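(* Let $n, m \in \mathbb{N}$ be distinct, with $n \geqslant 6$ and $m < \binom{n}{2}$, and let $\phi \colon \mathrm{Out}(F_n) \to \mathrm{Out}(F_m)$ be a group homomorphism. Then the image of $\phi$ is contained in a copy of $\mathbb{Z}_2$, the finite group of order two.
   Context: $F_k$ denotes the free group of rank $k$, and $\mathrm{Out}(F_k) = \mathrm{Aut}(F_k)/\mathrm{Inn}(F_k)$ its outer automorphism group. $\mathbb{Z}_2$ is the cyclic group of order $2$; "contained in a copy of $\mathbb{Z}_2$" means contained in a subgroup isomorphic to $\mathbb{Z}_2$ (or trivial), i.e. the image has at most two elements. *)

theory Defs
  imports "HOL-Algebra.Bij" "HOL-Algebra.Elementary_Groups"
begin

section \<open>Free groups of finite rank\<close>

text \<open>The letter \<open>(i, True)\<close> stands for the generator \<open>x\<^sub>i\<close> and \<open>(i, False)\<close> for its formal inverse.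
  The free group of rank \<open>k\<close> is realised on the reduced words in \<open>x\<^sub>0, \<dots>, x\<^sub>k\<^sub>-\<^sub>1\<close>.\<close>

type_synonym letter = "nat \<times> bool"
type_synonym word = "letter list"

definition letter_inv :: "letter \<Rightarrow> letter" where
  "letter_inv a = (fst a, \<not> snd a)"

definition reduced :: "word \<Rightarrow> bool" where
  "reduced = successively (\<lambda>a b. b \<noteq> letter_inv a)"

definition push :: "letter \<Rightarrow> word \<Rightarrow> word" where
  "push a w = (if w \<noteq> [] \<and> hd w = letter_inv a then tl w else a # w)"

text \<open>For reduced \<open>v\<close>, the word \<open>foldr push u v\<close> is the reduced form of the concatenation \<open>u @ v\<close>.\<close>

definition free_group :: "nat \<Rightarrow> word monoid" where
  "free_group k =
     \<lparr>carrier = {w. reduced w \<and> fst ` set w \<subseteq> {..<k}},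
      monoid.mult = foldr push,
      one = []\<rparr>"

lemma letter_inv_invol [simp]: "letter_inv (letter_inv a) = a"
  by (simp add: letter_inv_def)

lemma letter_inv_neq [simp]: "letter_inv a \<noteq> a" "a \<noteq> letter_inv a"
  by (simp_all add: letter_inv_def prod_eq_iff)

lemma fst_letter_inv [simp]: "fst (letter_inv a) = fst a"
  by (simp add: letter_inv_def)

lemma reduced_Nil [simp]: "reduced []"
  by (simp add: reduced_def)

lemma reduced_Cons: "reduced (a # w) \<longleftrightarrow> reduced w \<and> (w \<noteq> [] \<longrightarrow> hd w \<noteq> letter_inv a)"
  by (cases w) (auto simp: reduced_def)

lemma reduced_push: "reduced w \<Longrightarrow> reduced (push a w)"
  by (cases w) (auto simp: push_def reduced_Cons)

lemma set_push: "set (push a w) \<subseteq> insert a (set w)"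
  by (cases w) (auto simp: push_def)

lemma push_reduced: "reduced (a # w) \<Longrightarrow> push a w = a # w"
  by (auto simp: push_def reduced_Cons)

lemma push_cancel: "reduced w \<Longrightarrow> push a (push (letter_inv a) w) = w"
  by (cases w) (auto simp: push_def reduced_Cons)

lemma reduced_foldr_push: "reduced w \<Longrightarrow> reduced (foldr push u w)"
  by (induction u) (auto intro: reduced_push)

lemma set_foldr_push: "set (foldr push u w) \<subseteq> set u \<union> set w"
  using set_push by (induction u) fastforce+

lemma foldr_push_push: "reduced w \<Longrightarrow> foldr push (push a v) w = push a (foldr push v w)"
proof (cases "v \<noteq> [] \<and> hd v = letter_inv a")
  case True
  then obtain v' where "v = letter_inv a # v'" by (cases v) auto
  moreover assume "reduced w"
  ultimately show ?thesis by (simp add: push_cancel reduced_foldr_push push_def [of a "letter_inv a # v'"])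
next
  case False
  then have "push a v = a # v" by (auto simp: push_def)
  then show ?thesis by simp
qed

lemma foldr_push_assoc:
  "reduced w \<Longrightarrow> foldr push (foldr push u v) w = foldr push u (foldr push v w)"
  by (induction u) (simp_all add: foldr_push_push)

lemma foldr_push_Nil: "reduced u \<Longrightarrow> foldr push u [] = u"
  by (induction u) (auto simp: push_reduced reduced_Cons)

definition word_inv :: "word \<Rightarrow> word" where
  "word_inv u = foldr push (rev (map letter_inv u)) []"

lemma word_inv_left: "reduced u \<Longrightarrow> foldr push (word_inv u) u = []"
proof -
  have "foldr push (rev (map letter_inv u)) u = []"
    by (induction u) (simp_all add: push_def)
  then show "reduced u \<Longrightarrow> ?thesis"
    by (simp add: word_inv_def foldr_push_assoc)
qed

lemma group_free_group: "group (free_group k)"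
proof (rule groupI)
  fix x assume "x \<in> carrier (free_group k)"
  then have x: "reduced x" "fst ` set x \<subseteq> {..<k}" by (auto simp: free_group_def)
  have "set (word_inv x) \<subseteq> letter_inv ` set x"
    unfolding word_inv_def using set_foldr_push [of "rev (map letter_inv x)" "[]"] by simp
  then have "fst ` set (word_inv x) \<subseteq> {..<k}" using x by fastforce
  moreover have "reduced (word_inv x)" by (simp add: word_inv_def reduced_foldr_push)
  ultimately show "\<exists>y\<in>carrier (free_group k). y \<otimes>\<^bsub>free_group k\<^esub> x = \<one>\<^bsub>free_group k\<^esub>"
    using word_inv_left x by (intro bexI [of _ "word_inv x"]) (auto simp: free_group_def)
next
  fix x y assume "x \<in> carrier (free_group k)" "y \<in> carrier (free_group k)"
  then show "x \<otimes>\<^bsub>free_group k\<^esub> y \<in> carrier (free_group k)"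
    using set_foldr_push [of x y] by (fastforce simp: free_group_def reduced_foldr_push)
qed (auto simp: free_group_def foldr_push_assoc)

subsection \<open>Universal property\<close>

definition letter_val :: "('a, 'b) monoid_scheme \<Rightarrow> (nat \<Rightarrow> 'a) \<Rightarrow> letter \<Rightarrow> 'a" where
  "letter_val G f a = (if snd a then f (fst a) else inv\<^bsub>G\<^esub> (f (fst a)))"

definition word_val :: "('a, 'b) monoid_scheme \<Rightarrow> (nat \<Rightarrow> 'a) \<Rightarrow> word \<Rightarrow> 'a" where
  "word_val G f w = foldr (\<lambda>a x. letter_val G f a \<otimes>\<^bsub>G\<^esub> x) w \<one>\<^bsub>G\<^esub>"

theorem free_group_universal:
  fixes G (structure)
  assumes "group G" and f: "f \<in> {..<k} \<rightarrow> carrier G"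
  shows "\<exists>!h. h \<in> hom (free_group k) G \<inter> extensional (carrier (free_group k)) \<and>
               (\<forall>i<k. h [(i, True)] = f i)"
proof -
  interpret G: group G by fact
  interpret F: group "free_group k" by (rule group_free_group)
  let ?C = "carrier (free_group k)"
  have lc: "letter_val G f a \<in> carrier G" if "fst a < k" for a
    using f that by (auto simp: letter_val_def)
  have lc_inv: "letter_val G f a \<otimes> (letter_val G f (letter_inv a) \<otimes> x) = x"
    if "fst a < k" "x \<in> carrier G" for a x
  proof -
    have "f (fst a) \<in> carrier G" using f that by auto
    then show ?thesis using that
      by (simp add: letter_val_def letter_inv_def G.m_assoc [symmetric])
  qed
  have wc: "word_val G f w \<in> carrier G" if "fst ` set w \<subseteq> {..<k}" for w
    using that by (induction w) (auto simp: word_val_def lc)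
  have wp: "word_val G f (push a w) = letter_val G f a \<otimes> word_val G f w"
    if "fst a < k" "fst ` set w \<subseteq> {..<k}" for a w
  proof (cases "w \<noteq> [] \<and> hd w = letter_inv a")
    case True
    then obtain v where v: "w = letter_inv a # v" by (cases w) auto
    then show ?thesis using that lc_inv [OF that(1) wc [of v]]
      by (simp add: push_def word_val_def)
  qed (auto simp: push_def word_val_def)
  have wm: "word_val G f (foldr push u w) = word_val G f u \<otimes> word_val G f w"
    if "fst ` set u \<subseteq> {..<k}" "fst ` set w \<subseteq> {..<k}" for u w
    using that
  proof (induction u)
    case Nil
    then show ?case using wc by (simp add: word_val_def)
  next
    case (Cons a u)
    have "fst ` set (foldr push u w) \<subseteq> {..<k}"
      using set_foldr_push [of u w] Cons.prems by fastforce
    then show ?case using Cons wp [of a "foldr push u w"] lc [of a] wc [of u] wc [of w]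
      by (simp add: word_val_def G.m_assoc)
  qed
  let ?h = "restrict (word_val G f) ?C"
  have mem: "fst ` set w \<subseteq> {..<k}" if "w \<in> ?C" for w
    using that by (auto simp: free_group_def)
  have h_hom: "?h \<in> hom (free_group k) G"
  proof (rule homI)
    fix x y assume xy: "x \<in> ?C" "y \<in> ?C"
    have "x \<otimes>\<^bsub>free_group k\<^esub> y = foldr push x y" by (simp add: free_group_def)
    then show "?h (x \<otimes>\<^bsub>free_group k\<^esub> y) = ?h x \<otimes> ?h y"
      using wm [OF mem [OF xy(1)] mem [OF xy(2)]] xy F.m_closed [OF xy] by simp
  next
    fix x assume "x \<in> ?C"
    then show "?h x \<in> carrier G" using wc [OF mem] by simp
  qed
  have gen: "[(i, b)] \<in> ?C" if "i < k" for i b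
    using that by (simp add: free_group_def reduced_Cons)
  have h_gen: "?h [(i, True)] = f i" if "i < k" for i
  proof -
    have "f i \<in> carrier G" using f that by auto
    then show ?thesis using gen that by (simp add: word_val_def letter_val_def)
  qed
  have uniq: "g = ?h" if g: "g \<in> hom (free_group k) G" "g \<in> extensional ?C"
    and gf: "\<forall>i<k. g [(i, True)] = f i" for g
  proof (rule extensionalityI [OF g(2)])
    have g_letter: "g [a] = letter_val G f a" if "fst a < k" for a
    proof (cases "snd a")
      case True
      then show ?thesis using gf that by (cases a) (simp add: letter_val_def)
    next
      case False
      have "[(fst a, False)] \<otimes>\<^bsub>free_group k\<^esub> [(fst a, True)] = \<one>\<^bsub>free_group k\<^esub>"
        by (simp add: free_group_def push_def letter_inv_def)
      then have "inv\<^bsub>free_group k\<^esub> [(fst a, True)] = [(fst a, False)]"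
        using gen that by (intro F.inv_equality) auto
      moreover have "g (inv\<^bsub>free_group k\<^esub> [(fst a, True)]) = inv (g [(fst a, True)])"
        using group_hom.hom_inv [of "free_group k" G g] g gen that
        by (simp add: group_hom_def group_hom_axioms_def group_free_group assms(1))
      ultimately show ?thesis using gf that False
        by (cases a) (simp add: letter_val_def)
    qed
    fix w assume "w \<in> ?C"
    then show "g w = ?h w"
    proof (induction w)
      case Nil
      have "g \<one>\<^bsub>free_group k\<^esub> = \<one>"
        by (rule hom_one [OF g(1) group_free_group assms(1)])
      with Nil show ?case by (simp add: word_val_def) (simp add: free_group_def)
    next
      case (Cons a w)
      then have a: "fst a < k" and w: "w \<in> ?C" and r: "reduced (a # w)"
        by (auto simp: free_group_def reduced_Cons)
      have "a # w = [a] \<otimes>\<^bsub>free_group k\<^esub> w"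
        using r by (simp add: free_group_def push_reduced)
      then have "g (a # w) = g [a] \<otimes> g w"
        using hom_mult [OF g(1), of "[a]" w] gen [OF a, of "snd a"] w by (metis prod.collapse)
      then show ?case using Cons w a by (simp add: g_letter word_val_def)
    qed
  qed simp
  show ?thesis
  proof (rule ex1I [of _ ?h])
    show "?h \<in> hom (free_group k) G \<inter> extensional ?C \<and> (\<forall>i<k. ?h [(i, True)] = f i)"
      using h_hom h_gen by blast
  qed (use uniq in blast)
qed

section \<open>Outer automorphism groups\<close>

definition inner_aut :: "('a, 'b) monoid_scheme \<Rightarrow> 'a \<Rightarrow> 'a \<Rightarrow> 'a" where
  "inner_aut G g = (\<lambda>x\<in>carrier G. g \<otimes>\<^bsub>G\<^esub> x \<otimes>\<^bsub>G\<^esub> inv\<^bsub>G\<^esub> g)"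

definition Inn :: "('a, 'b) monoid_scheme \<Rightarrow> ('a \<Rightarrow> 'a) set" where
  "Inn G = inner_aut G ` carrier G"

definition Out :: "('a, 'b) monoid_scheme \<Rightarrow> ('a \<Rightarrow> 'a) set monoid" where
  "Out G = AutoGroup G Mod Inn G"

lemma (in group) inv_cancel_left:
  assumes "g \<in> carrier G" "x \<in> carrier G"
  shows "inv g \<otimes> (g \<otimes> x) = x" "g \<otimes> (inv g \<otimes> x) = x"
  using assms by (simp_all add: m_assoc [symmetric])

lemma (in group) inner_aut_auto:
  assumes g: "g \<in> carrier G"
  shows "inner_aut G g \<in> auto G"
proof -
  have "bij_betw (inner_aut G g) (carrier G) (carrier G)"
    by (rule bij_betw_byWitness [where f' = "inner_aut G (inv g)"])
       (use g in \<open>auto simp: inner_aut_def m_assoc inv_cancel_left\<close>)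
  moreover have "inner_aut G g \<in> hom G G"
    using g by (auto intro!: homI simp: inner_aut_def m_assoc inv_cancel_left)
  ultimately show ?thesis
    by (simp add: auto_def Bij_def inner_aut_def)
qed

lemma (in group) AutoGroup_mult:
  "\<lbrakk>f \<in> auto G; g \<in> auto G\<rbrakk> \<Longrightarrow> f \<otimes>\<^bsub>AutoGroup G\<^esub> g = compose (carrier G) f g"
  by (simp add: AutoGroup_def BijGroup_def auto_def)

lemma carrier_AutoGroup: "carrier (AutoGroup G) = auto G"
  by (simp add: AutoGroup_def)

lemma (in group) inner_aut_hom: "inner_aut G \<in> hom G (AutoGroup G)"
proof (rule homI)
  fix g h assume gh: "g \<in> carrier G" "h \<in> carrier G"
  then show "inner_aut G (g \<otimes> h) = inner_aut G g \<otimes>\<^bsub>AutoGroup G\<^esub> inner_aut G h"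
    unfolding AutoGroup_mult [OF inner_aut_auto [OF gh(1)] inner_aut_auto [OF gh(2)]]
    by (auto simp: compose_def inner_aut_def m_assoc inv_mult_group fun_eq_iff restrict_def)
qed (simp add: carrier_AutoGroup inner_aut_auto)

lemma (in group) Inn_normal: "Inn G \<lhd> AutoGroup G"
proof -
  interpret A: group "AutoGroup G" by (rule AutoGroup)
  have sub: "subgroup (Inn G) (AutoGroup G)"
    unfolding Inn_def
    by (rule group_hom.img_is_subgroup)
       (simp add: group_hom_def group_hom_axioms_def AutoGroup inner_aut_hom is_group)
  have conj: "f \<otimes>\<^bsub>AutoGroup G\<^esub> inner_aut G g = inner_aut G (f g) \<otimes>\<^bsub>AutoGroup G\<^esub> f"
    if f: "f \<in> auto G" and g: "g \<in> carrier G" for f g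
  proof -
    have h: "f \<in> hom G G" using f by (simp add: auto_def)
    interpret f: group_hom G G f
      using h by (simp add: group_hom_def group_hom_axioms_def is_group)
    have fg: "f g \<in> carrier G" using g by simp
    show ?thesis
      unfolding AutoGroup_mult [OF f inner_aut_auto [OF g]] AutoGroup_mult [OF inner_aut_auto [OF fg] f]
      using g by (auto simp: compose_def inner_aut_def fun_eq_iff restrict_def)
  qed
  show ?thesis
  proof (rule A.normal_invI [OF sub])
    fix f h assume f: "f \<in> carrier (AutoGroup G)" and "h \<in> Inn G"
    then obtain g where g: "g \<in> carrier G" "h = inner_aut G g" by (auto simp: Inn_def)
    have f': "f \<in> auto G" using f by (simp add: carrier_AutoGroup)
    have fg: "f g \<in> carrier G" using f' g by (auto simp: auto_def hom_def)
    have i: "inner_aut G (f g) \<in> carrier (AutoGroup G)"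
      using inner_aut_auto [OF fg] by (simp add: carrier_AutoGroup)
    have "f \<otimes>\<^bsub>AutoGroup G\<^esub> h \<otimes>\<^bsub>AutoGroup G\<^esub> inv\<^bsub>AutoGroup G\<^esub> f = inner_aut G (f g)"
      unfolding g(2) conj [OF f' g(1)] A.m_assoc [OF i f A.inv_closed [OF f]] A.r_inv [OF f]
      by (rule A.r_one [OF i])
    then show "f \<otimes>\<^bsub>AutoGroup G\<^esub> h \<otimes>\<^bsub>AutoGroup G\<^esub> inv\<^bsub>AutoGroup G\<^esub> f \<in> Inn G"
      using fg by (simp add: Inn_def)
  qed
qed

lemma (in group) group_Out: "group (Out G)"
  unfolding Out_def by (rule normal.factorgroup_is_group [OF Inn_normal])

end

theory Submission
  imports Defs Complex_Main "HOL-Algebra.Elementary_Groups" "HOL-Library.Function_Algebras" "HOL-Library.Numeral_Type"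
begin

text \<open>Let \<open>\<phi> : Out(F\<^sub>n) \<rightarrow> Out(F\<^sub>m)\<close> be a homomorphism and let \<open>V = Hom(F\<^sub>m, \<real>)\<close>, on which \<open>Out(F\<^sub>n)\<close> acts through \<open>\<phi>\<close>.
  Simultaneous eigenvectors of the inversions \<open>x\<^sub>i \<mapsto> x\<^sub>i\<^sup>-\<^sup>1\<close> with different patterns of signs are independent, and the
  permutations of the generators permute the patterns; as \<open>m\<close> is less than \<open>n choose 2\<close>, up to a central
  twist at most one sign is negative. Thus \<open>V\<close> is the sum of a part \<open>W0\<close> and of \<open>n\<close> isomorphic parts \<open>W i\<close>, and the relations
  between the transvections \<open>x\<^sub>i \<mapsto> x\<^sub>i x\<^sub>j\<close> show that they fix \<open>W0\<close> and act on the other parts almost as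
  elementary matrices.

  If the \<open>W i\<close> vanish, then the transvections act trivially on the abelianization of \<open>F\<^sub>m\<close>. Since each of them is a commutator of two
  others, the Magnus expansion shows inductively that their images are inner modulo every term of the lower
  central series, hence inner. By Nielsen's theorem \<open>\<phi>\<close> then factors through a group of order 2.

  Otherwise, take elements of order 4 and 3 of \<open>Out(F\<^sub>n)\<close> that commute, but do not lift to commuting elements of finite
  order of \<open>Aut(F\<^sub>n)\<close>. Powers \<open>d\<close> and \<open>s\<close> of a single lift of the image of their product are commuting
  automorphisms of \<open>F\<^sub>m\<close> for which \<open>s\<^sup>3\<close> is conjugation by some \<open>Z\<close>. Evaluating cochains of degree
  at most 3 with values in \<open>\<int>/9\<close> determines the class of \<open>Z\<close> in terms of the odd functionals; this is
  contradictory if the \<open>W i\<close> have rank at least 2 modulo 3, or if \<open>W0\<close> does not vanish modulo 3. So \<open>m = n\<close>.\<close>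

section \<open>Free groups as an additive type\<close>

text \<open>Linear algebra alone cannot exclude m > n: \<open>Out(F_n)\<close> does act on \<int>^m
  through its action on \<int>^n, with repetitions, duals and fixed vectors added. The obstruction
  must therefore come from below the abelianization of F_m. It is carried by the element
  \<open>Z\<close>, for which the third power of \<open>s\<close> is conjugation by
  \<open>Z\<close>. Every odd functional \<open>h\<close> vanishes at \<open>Z\<close>, but a
  suitably normalized cochain bounding a cup product with \<open>h\<close> takes there a value that
  is nonzero modulo 3 and the same for all \<open>h\<close> in question. As this cochain depends
  quadratically on \<open>h\<close>, two independent functionals contradict the parallelogram law.
  The prime 3 is the order of \<open>s\<close>; several identities can only be divided by 3 after
  multiplication by 3, so a residue modulo 3 survives only if the coefficients are taken modulo 9.
  The bound on m enters through two counts of sign patterns: there are at least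
  \<open>n choose 2\<close> patterns of a given size between 2 and n - 2, and 2^(n-2) - 1 nonempty
  patterns on n - 2 indices. The second count is the one for which n has to be at least 6.\<close>

typedef fg = "{w::word. reduced w}" morphisms fgw Fg
  by (rule exI [of _ "[]"]) simp

lemma reduced_fgw [simp]: "reduced (fgw g)"
  using fgw [of g] by simp

lemma fgw_Fg [simp]: "reduced w \<Longrightarrow> fgw (Fg w) = w"
  by (simp add: Fg_inverse)

lemma reduced_word_inv [simp]: "reduced (word_inv u)"
  by (simp add: word_inv_def reduced_foldr_push)

text \<open>A single group of countably infinite rank serves for all \<open>free_group k\<close>;
  the finite ranks are cut out later by the retractions \<open>pr k\<close>. Additive notation makes
  the simplifier's rules for noncommutative groups available.\<close>

instantiation fg :: group_add
begin
definition "0 = Fg []"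
definition "a + b = Fg (foldr push (fgw a) (fgw b))"
definition "- a = Fg (word_inv (fgw a))"
definition "(a::fg) - b = a + - b"
instance
proof
  fix a b c :: fg
  show "a + b + c = a + (b + c)"
    by (simp add: plus_fg_def reduced_foldr_push foldr_push_assoc)
  show "0 + a = a" "a + 0 = a"
    by (simp_all add: plus_fg_def zero_fg_def foldr_push_Nil fgw_inverse)
  show "- a + a = 0"
    by (simp add: plus_fg_def zero_fg_def uminus_fg_def word_inv_left)
  show "a + - b = a - b" by (simp add: minus_fg_def)
qed
end

lemma fgw_zero [simp]: "fgw 0 = []"
  by (simp add: zero_fg_def)

lemma fgw_plus: "fgw (a + b) = foldr push (fgw a) (fgw b)"
  by (simp add: plus_fg_def reduced_foldr_push)

definition gen :: "nat \<Rightarrow> fg" where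
  "gen i = Fg [(i, True)]"

definition lgen :: "letter \<Rightarrow> fg" where
  "lgen a = (if snd a then gen (fst a) else - gen (fst a))"

lemma fgw_gen: "fgw (gen i) = [(i, True)]"
  by (simp add: gen_def reduced_def)

lemma fgw_neg_gen: "fgw (- gen i) = [(i, False)]"
  by (simp add: uminus_fg_def fgw_gen word_inv_def push_def letter_inv_def reduced_def)

lemma fgw_lgen: "fgw (lgen a) = [a]"
  by (cases a) (auto simp: lgen_def fgw_gen fgw_neg_gen)

lemma Fg_Cons: "reduced (a # w) \<Longrightarrow> Fg (a # w) = lgen a + Fg w"
  by (simp add: plus_fg_def fgw_lgen reduced_Cons push_reduced)

lemma lgen_letter_inv [simp]: "lgen (letter_inv a) = - lgen a"
  by (simp add: lgen_def letter_inv_def)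

lemma fg_letter_induct [case_names zero step]:
  assumes "P 0" "\<And>a g. P g \<Longrightarrow> P (lgen a + g)"
  shows "P g"
proof -
  have "P (Fg w)" if "reduced w" for w
    using that
  proof (induction w)
    case Nil
    then show ?case using assms(1) by (simp add: zero_fg_def)
  next
    case (Cons a w)
    then show ?case using assms(2) by (simp add: Fg_Cons reduced_Cons)
  qed
  from this [of "fgw g"] show ?thesis by (simp add: fgw_inverse)
qed

text \<open>Rewriting to right-associated form with cancellation of adjacent inverses, which decides
  equations between explicit words. The rule \<open>add_uminus_conv_diff\<close> would reverse the
  first equation and is therefore removed wherever this set is used for such computations.\<close>

lemma group_norm:
  fixes a b c :: "'a::group_add"
  shows "a - b = a + - b" "a + b + c = a + (b + c)" "- (a + b) = - b + - a" "- a + (a + b) = b" "a + (- a + b) = b"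
  by (simp_all add: add.assoc minus_add flip: add.assoc)

definition additive_map :: "('a::group_add \<Rightarrow> 'b::group_add) \<Rightarrow> bool" where
  "additive_map f \<longleftrightarrow> (\<forall>a b. f (a + b) = f a + f b)"

lemma additive_map_add: "additive_map f \<Longrightarrow> f (a + b) = f a + f b"
  by (simp add: additive_map_def)

lemma additive_map_zero: "additive_map f \<Longrightarrow> f 0 = 0"
proof -
  assume "additive_map f"
  then have "f 0 + f 0 = f 0 + 0" by (simp flip: additive_map_add)
  then show ?thesis by (simp only: add_left_cancel)
qed

lemma additive_map_neg: "additive_map f \<Longrightarrow> f (- a) = - f a"
proof -
  assume f: "additive_map f"
  then have "f (- a) + f a = 0" by (simp flip: additive_map_add add: additive_map_zero)
  then show ?thesis by (simp add: eq_neg_iff_add_eq_0)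
qed

lemma additive_map_diff: "additive_map f \<Longrightarrow> f (a - b) = f a - f b"
  using additive_map_add [of f a "- b"] by (simp add: additive_map_neg)

lemmas additive_map_simps = additive_map_add additive_map_zero additive_map_neg additive_map_diff

lemma additive_map_comp: "additive_map f \<Longrightarrow> additive_map g \<Longrightarrow> additive_map (f \<circ> g)"
  by (simp add: additive_map_def)

lemma additive_map_conj: "additive_map f \<Longrightarrow> additive_map (\<lambda>x. h + f x - h)"
  by (simp add: additive_map_def group_norm del: add_uminus_conv_diff)

text \<open>The universal property in additive form. The target is an arbitrary group, so that the
  same construction yields endomorphisms and functionals.\<close>

definition ext :: "(nat \<Rightarrow> 'a::group_add) \<Rightarrow> fg \<Rightarrow> 'a" where
  "ext f g = foldr (\<lambda>a x. (if snd a then f (fst a) else - f (fst a)) + x) (fgw g) 0"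

lemma additive_ext: "additive_map (ext f)"
proof -
  let ?l = "\<lambda>a. if snd a then f (fst a) else - f (fst a)"
  let ?e = "\<lambda>w. foldr (\<lambda>a x. ?l a + x) w 0"
  have push: "?e (push a w) = ?l a + ?e w" for a w
  proof (cases "w \<noteq> [] \<and> hd w = letter_inv a")
    case True
    then obtain v where "w = letter_inv a # v" by (cases w) auto
    then show ?thesis by (auto simp: push_def letter_inv_def simp flip: add.assoc)
  qed (auto simp: push_def)
  have "?e (foldr push u w) = ?e u + ?e w" for u w
    by (induction u) (simp_all add: push add.assoc)
  then show ?thesis by (simp add: additive_map_def ext_def fgw_plus)
qed

lemma ext_gen [simp]: "ext f (gen i) = f i"
  by (simp add: ext_def fgw_gen)

lemmas ext_simps [simp] = additive_map_simps [OF additive_ext]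

lemma additive_map_eqI:
  fixes f g :: "fg \<Rightarrow> 'a::group_add"
  assumes "additive_map f" "additive_map g" "\<And>i. f (gen i) = g (gen i)"
  shows "f = g"
proof
  fix x show "f x = g x"
    by (induction x rule: fg_letter_induct)
       (auto simp: additive_map_simps [OF assms(1)] additive_map_simps [OF assms(2)] lgen_def assms(3))
qed

section \<open>Noncommutative power series\<close>

text \<open>A monomial in noncommuting variables is the list of its indices, and a series is its
  table of coefficients. The product at a monomial sums over the places where the list can be
  cut.\<close>

typedef ser = "UNIV :: (nat list \<Rightarrow> int) set" morphisms cf Ser ..

setup_lifting type_definition_ser

lemma ser_eqI: "(\<And>w. cf f w = cf g w) \<Longrightarrow> f = g"
  by (metis cf_inverse ext)

instantiation ser :: ring_1
begin
lift_definition zero_ser :: ser is "\<lambda>_. 0" .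
lift_definition one_ser :: ser is "\<lambda>w. if w = [] then 1 else 0" .
lift_definition plus_ser :: "ser \<Rightarrow> ser \<Rightarrow> ser" is "\<lambda>f g w. f w + g w" .
lift_definition uminus_ser :: "ser \<Rightarrow> ser" is "\<lambda>f w. - f w" .
lift_definition minus_ser :: "ser \<Rightarrow> ser \<Rightarrow> ser" is "\<lambda>f g w. f w - g w" .
lift_definition times_ser :: "ser \<Rightarrow> ser \<Rightarrow> ser"
  is "\<lambda>f g w. \<Sum>k\<le>length w. f (take k w) * g (drop k w)" .
instance
proof
  fix a b c :: ser
  show "a * b * c = a * (b * c)"
  proof (transfer, rule ext)
    fix f g h :: "nat list \<Rightarrow> int" and w
    have "(\<Sum>k\<le>length w. (\<Sum>j\<le>length (take k w). f (take j (take k w)) * g (drop j (take k w))) * h (drop k w))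
        = (\<Sum>k\<le>length w. \<Sum>j\<le>k. f (take j w) * g (drop j (take k w)) * h (drop k w))"
      by (intro sum.cong refl) (auto simp: sum_distrib_right min_def intro!: sum.cong)
    also have "\<dots> = (\<Sum>(k, j)\<in>(SIGMA k:{..length w}. {..k}). f (take j w) * g (drop j (take k w)) * h (drop k w))"
      by (simp add: sum.Sigma)
    \<comment> \<open>Both sides sum over the ways to cut \<open>w\<close> into three pieces; now
      \<open>k\<close> is the length of the middle piece instead of the position of the second
      cut.\<close>
    also have "\<dots> = (\<Sum>(j, k)\<in>(SIGMA j:{..length w}. {..length w - j}). f (take j w) * g (take k (drop j w)) * h (drop (k + j) w))"
      by (rule sum.reindex_bij_witness [of _ "\<lambda>(j, k). (j + k, j)" "\<lambda>(k, j). (j, k - j)"])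
         (auto simp: drop_take add.commute)
    also have "\<dots> = (\<Sum>j\<le>length w. \<Sum>k\<le>length w - j. f (take j w) * g (take k (drop j w)) * h (drop (k + j) w))"
      by (simp add: sum.Sigma)
    also have "\<dots> = (\<Sum>j\<le>length w. f (take j w) * (\<Sum>k\<le>length (drop j w). g (take k (drop j w)) * h (drop k (drop j w))))"
      by (simp add: sum_distrib_left mult.assoc)
    finally show "(\<Sum>k\<le>length w. (\<Sum>j\<le>length (take k w). f (take j (take k w)) * g (drop j (take k w))) * h (drop k w))
      = (\<Sum>j\<le>length w. f (take j w) * (\<Sum>k\<le>length (drop j w). g (take k (drop j w)) * h (drop k (drop j w))))" .
  qed
  show "1 * a = a"
  proof (transfer, rule ext)
    fix f :: "nat list \<Rightarrow> int" and w
    have "(\<Sum>k\<le>length w. (if take k w = [] then 1 else 0) * f (drop k w)) = (\<Sum>k\<le>length w. if k = 0 then f w else 0)"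
      by (intro sum.cong refl) (auto simp: take_eq_Nil)
    then show "(\<Sum>k\<le>length w. (if take k w = [] then 1 else 0) * f (drop k w)) = f w" by simp
  qed
  show "a * 1 = a"
  proof (transfer, rule ext)
    fix f :: "nat list \<Rightarrow> int" and w
    have "(\<Sum>k\<le>length w. f (take k w) * (if drop k w = [] then 1 else 0)) = (\<Sum>k\<le>length w. if k = length w then f w else 0)"
      by (intro sum.cong refl) auto
    then show "(\<Sum>k\<le>length w. f (take k w) * (if drop k w = [] then 1 else 0)) = f w" by simp
  qed
  show "(0::ser) \<noteq> 1"
    by transfer (auto simp: fun_eq_iff)
qed (transfer; simp add: fun_eq_iff sum.distrib algebra_simps)+
end

lemma cf_simps [simp]:
  "cf 0 w = 0" "cf (f + g) w = cf f w + cf g w" "cf (- f) w = - cf f w" "cf (f - g) w = cf f w - cf g w"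
  by (transfer; simp)+

lemma cf_one: "cf 1 w = (if w = [] then 1 else 0)"
  by transfer simp

lemma cf_mult: "cf (f * g) w = (\<Sum>k\<le>length w. cf f (take k w) * cf g (drop k w))"
  by transfer simp

section \<open>The Magnus expansion\<close>

lift_definition X :: "nat \<Rightarrow> ser" is "\<lambda>i w. if w = [i] then 1 else 0" .
text \<open>The geometric series that inverts \<open>1 + X i\<close>, the image of a generator; it
  is not an inverse of \<open>X i\<close>.\<close>

lift_definition Xinv :: "nat \<Rightarrow> ser" is "\<lambda>i w. if set w \<subseteq> {i} then (- 1) ^ length w else 0" .

lemma cf_X: "cf (X i) w = (if w = [i] then 1 else 0)"
  by transfer simp

lemma cf_mult_Nil [simp]: "cf (f * g) [] = cf f [] * cf g []"
  by (simp add: cf_mult)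

lemma cf_mult_Cons: "cf (f * g) (a # w) = cf f [] * cf g (a # w) + (\<Sum>k\<le>length w. cf f (a # take k w) * cf g (drop k w))"
  by (simp add: cf_mult sum.atMost_Suc_shift del: sum.atMost_Suc)

lemma cf_X_mult_Cons: "cf (X i * f) (a # w) = (if a = i then cf f w else 0)"
proof -
  have "(\<Sum>k\<le>length w. cf (X i) (a # take k w) * cf f (drop k w)) = (\<Sum>k\<le>length w. if k = 0 then (if a = i then cf f w else 0) else 0)"
    by (intro sum.cong refl) (auto simp: cf_X take_eq_Nil)
  then show ?thesis by (simp add: cf_mult_Cons cf_X)
qed

lemma cf_mult_X_snoc: "cf (f * X i) (w @ [a]) = (if a = i then cf f w else 0)"
proof -
  have "(\<Sum>k\<le>length (w @ [a]). cf f (take k (w @ [a])) * cf (X i) (drop k (w @ [a])))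
      = (\<Sum>k\<le>Suc (length w). if k = length w then (if a = i then cf f w else 0) else 0)"
  proof (intro sum.cong)
    fix k assume "k \<in> {..Suc (length w)}"
    then consider "k < length w" | "k = length w" | "k = Suc (length w)" by fastforce
    then show "cf f (take k (w @ [a])) * cf (X i) (drop k (w @ [a])) = (if k = length w then (if a = i then cf f w else 0) else 0)"
    proof cases
      case 1
      then have "length (drop k (w @ [a])) \<noteq> length [i]" by simp
      then have "drop k (w @ [a]) \<noteq> [i]" by metis
      with 1 show ?thesis by (simp add: cf_X)
    qed (auto simp: cf_X)
  qed simp
  then show ?thesis by (simp add: cf_mult)
qed

lemma cf_mult_X_Nil [simp]: "cf (f * X i) [] = 0" "cf (X i * f) [] = 0"
  by (simp_all add: cf_X)

lemma cf_Xinv_Cons: "cf (Xinv i) (a # w) = (if a = i then - cf (Xinv i) w else 0)"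
  by transfer auto

lemma cf_Xinv_snoc: "cf (Xinv i) (w @ [a]) = (if a = i then - cf (Xinv i) w else 0)"
  by transfer auto

lemma cf_Xinv_Nil: "cf (Xinv i) [] = 1"
  by transfer simp

lemma X_Xinv: "(1 + X i) * Xinv i = 1"
proof (rule ser_eqI)
  fix w show "cf ((1 + X i) * Xinv i) w = cf 1 w"
    by (cases w) (simp_all add: distrib_right cf_X_mult_Cons cf_Xinv_Cons cf_one cf_Xinv_Nil del: cf_mult_Nil)
qed

lemma Xinv_X: "Xinv i * (1 + X i) = 1"
proof (rule ser_eqI)
  fix w show "cf (Xinv i * (1 + X i)) w = cf 1 w"
    by (cases w rule: rev_cases) (simp_all add: distrib_left cf_mult_X_snoc cf_Xinv_snoc cf_one cf_Xinv_Nil del: cf_mult_Nil)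
qed

definition mu :: "fg \<Rightarrow> ser" where
  "mu g = foldr (\<lambda>a x. (if snd a then 1 + X (fst a) else Xinv (fst a)) * x) (fgw g) 1"

lemma mu_zero [simp]: "mu 0 = 1"
  by (simp add: mu_def)

lemma mu_gen: "mu (gen i) = 1 + X i"
  by (simp add: mu_def fgw_gen)

lemma mu_add: "mu (g + h) = mu g * mu h"
proof -
  let ?l = "\<lambda>a. if snd a then 1 + X (fst a) else Xinv (fst a)"
  let ?e = "\<lambda>w. foldr (\<lambda>a x. ?l a * x) w 1"
  have push: "?e (push a w) = ?l a * ?e w" for a w
  proof (cases "w \<noteq> [] \<and> hd w = letter_inv a")
    case True
    then obtain v where "w = letter_inv a # v" by (cases w) auto
    then show ?thesis by (auto simp: push_def letter_inv_def X_Xinv Xinv_X simp flip: mult.assoc)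
  qed (auto simp: push_def)
  have "?e (foldr push u w) = ?e u * ?e w" for u w
    by (induction u) (simp_all add: push mult.assoc)
  then show ?thesis by (simp add: mu_def fgw_plus)
qed

lemma mu_neg_left [simp]: "mu (- g) * mu g = 1"
  by (simp flip: mu_add)

lemma mu_neg_right [simp]: "mu g * mu (- g) = 1"
  by (simp flip: mu_add)

lemma mu_neg_gen: "mu (- gen i) = Xinv i"
  by (simp add: mu_def fgw_neg_gen)

lemma cf_mu_Nil [simp]: "cf (mu g) [] = 1"
  by (induction g rule: fg_letter_induct)
     (auto simp: mu_add lgen_def mu_gen mu_neg_gen cf_Xinv_Nil cf_one cf_X)

text \<open>The ideal of series without terms of degree below \<open>k\<close>. It contains
  \<open>mu g - 1\<close> if \<open>g\<close> lies in the \<open>k\<close>-th term of the lower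
  central series, which is how that series is tracked here.\<close>

definition deep :: "nat \<Rightarrow> ser \<Rightarrow> bool" where
  "deep k f \<longleftrightarrow> (\<forall>w. length w < k \<longrightarrow> cf f w = 0)"

lemma deep_zero [simp]: "deep k 0"
  by (simp add: deep_def)

lemma deep_0 [simp]: "deep 0 f"
  by (simp add: deep_def)

lemma deep_add: "deep k f \<Longrightarrow> deep k g \<Longrightarrow> deep k (f + g)"
  by (simp add: deep_def)

lemma deep_diff: "deep k f \<Longrightarrow> deep k g \<Longrightarrow> deep k (f - g)"
  by (simp add: deep_def)

lemma deep_mono: "deep k f \<Longrightarrow> j \<le> k \<Longrightarrow> deep j f"
  by (simp add: deep_def)

lemma deep_mult:
  assumes "deep j f" "deep k g"
  shows "deep (j + k) (f * g)"
  unfolding deep_def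
proof (intro allI impI)
  fix w :: "nat list" assume w: "length w < j + k"
  have "cf f (take i w) * cf g (drop i w) = 0" if "i \<le> length w" for i
  proof (cases "i < j")
    case True
    then show ?thesis using assms(1) that by (simp add: deep_def)
  next
    case False
    then have "length (drop i w) < k" using w that by simp
    then show ?thesis using assms(2) by (simp add: deep_def del: length_drop)
  qed
  then show "cf (f * g) w = 0" by (auto simp: cf_mult intro!: sum.neutral)
qed

lemma deep_mult_left: "deep k g \<Longrightarrow> deep k (f * g)"
  using deep_mult [of 0 f k g] by simp

lemma deep_mult_right: "deep k f \<Longrightarrow> deep k (f * g)"
  using deep_mult [of k f 0 g] by simp

lemma deep_mu: "deep 1 (mu g - 1)"
  by (auto simp: deep_def cf_one)

definition mon :: "(nat \<Rightarrow> ser) \<Rightarrow> nat list \<Rightarrow> ser" where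
  "mon Y w = foldr (\<lambda>i x. Y i * x) w 1"

lemma mon_simps [simp]: "mon Y [] = 1" "mon Y (a # w) = Y a * mon Y w"
  by (simp_all add: mon_def)

lemma mon_append: "mon Y (v @ w) = mon Y v * mon Y w"
  by (induction v) (simp_all add: mult.assoc)

lemma deep_mon: "(\<And>i. deep 1 (Y i)) \<Longrightarrow> deep (length w) (mon Y w)"
proof (induction w)
  case (Cons a w)
  then show ?case using deep_mult [of 1 "Y a" "length w" "mon Y w"] by simp
qed simp

definition Words :: "nat \<Rightarrow> nat \<Rightarrow> nat list set" where
  "Words m r = {w. set w \<subseteq> {..<m} \<and> length w \<le> r}"

lemma finite_Words [simp]: "finite (Words m r)"
  unfolding Words_def by (rule finite_lists_length_le) simp

text \<open>Substitution of \<open>Y i\<close> for the variables of index below \<open>m\<close>. As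
  the \<open>Y i\<close> will have no constant term, only words no longer than \<open>u\<close>
  contribute at \<open>u\<close>, and the bound on the letters leaves a finite sum.\<close>

definition Sub :: "nat \<Rightarrow> (nat \<Rightarrow> ser) \<Rightarrow> ser \<Rightarrow> ser" where
  "Sub m Y f = Ser (\<lambda>u. \<Sum>w\<in>Words m (length u). cf f w * cf (mon Y w) u)"

lemma cf_Sub:
  assumes "\<And>i. deep 1 (Y i)" "length u \<le> r"
  shows "cf (Sub m Y f) u = (\<Sum>w\<in>Words m r. cf f w * cf (mon Y w) u)"
proof -
  have "(\<Sum>w\<in>Words m r. cf f w * cf (mon Y w) u) = (\<Sum>w\<in>Words m (length u). cf f w * cf (mon Y w) u)"
  proof (rule sum.mono_neutral_right)
    show "\<forall>w\<in>Words m r - Words m (length u). cf f w * cf (mon Y w) u = 0"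
      using deep_mon [OF assms(1)] by (fastforce simp: Words_def deep_def)
    show "Words m (length u) \<subseteq> Words m r" using assms(2) by (auto simp: Words_def)
  qed simp
  then show ?thesis by (simp add: Sub_def Ser_inverse)
qed

lemma Sub_add: "Sub m Y (f + g) = Sub m Y f + Sub m Y g"
  by (rule ser_eqI) (simp add: Sub_def Ser_inverse distrib_right sum.distrib)

lemma Sub_diff: "Sub m Y (f - g) = Sub m Y f - Sub m Y g"
  by (rule ser_eqI) (simp add: Sub_def Ser_inverse left_diff_distrib sum_subtractf)

lemma Sub_one: "Sub m Y 1 = 1"
proof (rule ser_eqI)
  fix u
  have "(\<Sum>w\<in>Words m (length u). cf 1 w * cf (mon Y w) u) = (\<Sum>w\<in>{[]}. cf 1 w * cf (mon Y w) u)"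
  proof (rule sum.mono_neutral_right)
    show "{[]} \<subseteq> Words m (length u)" by (simp add: Words_def)
  qed (auto simp: cf_one)
  then show "cf (Sub m Y 1) u = cf 1 u"
    by (simp add: Sub_def Ser_inverse cf_one)
qed

lemma Sub_X:
  assumes "\<And>i. deep 1 (Y i)" "\<And>i. i \<ge> m \<Longrightarrow> Y i = 0"
  shows "Sub m Y (X i) = Y i"
proof (rule ser_eqI)
  fix u
  have "(\<Sum>w\<in>Words m (Suc (length u)). cf (X i) w * cf (mon Y w) u) = (\<Sum>w\<in>{[i]} \<inter> Words m (Suc (length u)). cf (X i) w * cf (mon Y w) u)"
    by (rule sum.mono_neutral_right) (auto simp: cf_X)
  also have "\<dots> = cf (Y i) u"
    using assms(2) [of i] by (cases "i < m") (auto simp: Words_def cf_X)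
  finally show "cf (Sub m Y (X i)) u = cf (Y i) u"
    using cf_Sub [OF assms(1), where r = "Suc (length u)" and m = m and f = "X i" and u = u] by simp
qed

text \<open>Pairs of words whose lengths together exceed that of \<open>u\<close> contribute nothing
  at \<open>u\<close>; the remaining pairs are exactly the cuts of a single word.\<close>

lemma Sub_mult:
  assumes Y: "\<And>i. deep 1 (Y i)"
  shows "Sub m Y (f * g) = Sub m Y f * Sub m Y g"
proof (rule ser_eqI)
  fix u :: "nat list"
  let ?r = "length u"
  let ?W = "Words m ?r"
  let ?t = "\<lambda>v w. cf f v * cf g w * cf (mon Y v * mon Y w) u"
  have "cf (Sub m Y f * Sub m Y g) u
    = (\<Sum>k\<le>?r. (\<Sum>v\<in>?W. cf f v * cf (mon Y v) (take k u)) * (\<Sum>w\<in>?W. cf g w * cf (mon Y w) (drop k u)))"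
    unfolding cf_mult by (intro sum.cong refl) (simp add: cf_Sub [OF Y, where r = ?r])
  also have "\<dots> = (\<Sum>k\<le>?r. \<Sum>v\<in>?W. \<Sum>w\<in>?W. cf f v * cf g w * (cf (mon Y v) (take k u) * cf (mon Y w) (drop k u)))"
    by (simp add: sum_product mult_ac)
  also have "\<dots> = (\<Sum>v\<in>?W. \<Sum>k\<le>?r. \<Sum>w\<in>?W. cf f v * cf g w * (cf (mon Y v) (take k u) * cf (mon Y w) (drop k u)))"
    by (rule sum.swap)
  also have "\<dots> = (\<Sum>v\<in>?W. \<Sum>w\<in>?W. \<Sum>k\<le>?r. cf f v * cf g w * (cf (mon Y v) (take k u) * cf (mon Y w) (drop k u)))"
    by (intro sum.cong refl sum.swap)
  also have "\<dots> = (\<Sum>v\<in>?W. \<Sum>w\<in>?W. ?t v w)"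
    by (simp add: cf_mult sum_distrib_left)
  also have "\<dots> = (\<Sum>(v, w)\<in>?W \<times> ?W. ?t v w)"
    by (simp add: sum.cartesian_product)
  also have "\<dots> = (\<Sum>(v, w)\<in>{(v, w). set v \<subseteq> {..<m} \<and> set w \<subseteq> {..<m} \<and> length v + length w \<le> ?r}. ?t v w)"
    (is "_ = sum _ ?P")
  proof (rule sum.mono_neutral_right)
    show "\<forall>p\<in>?W \<times> ?W - ?P. (case p of (v, w) \<Rightarrow> ?t v w) = 0"
    proof
      fix p assume p: "p \<in> ?W \<times> ?W - ?P"
      obtain v w where vw: "p = (v, w)" by (cases p)
      then have "?r < length v + length w" using p by (auto simp: Words_def)
      then have "cf (mon Y v * mon Y w) u = 0"
        using deep_mult [OF deep_mon [OF Y, of v] deep_mon [OF Y, of w]] by (simp add: deep_def)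
      then show "(case p of (v, w) \<Rightarrow> ?t v w) = 0" by (simp add: vw)
    qed
    show "?P \<subseteq> ?W \<times> ?W"
      by (auto simp: Words_def)
  qed simp
  also have "\<dots> = (\<Sum>(w, k)\<in>(SIGMA w:?W. {..length w}). ?t (take k w) (drop k w))"
    by (rule sum.reindex_bij_witness [of _ "\<lambda>(w, k). (take k w, drop k w)" "\<lambda>(v, w). (v @ w, length v)"])
       (auto simp: Words_def dest: in_set_takeD in_set_dropD)
  also have "\<dots> = (\<Sum>w\<in>?W. \<Sum>k\<le>length w. cf f (take k w) * cf g (drop k w) * cf (mon Y w) u)"
    by (simp add: sum.Sigma flip: mon_append)
  also have "\<dots> = cf (Sub m Y (f * g)) u"
    by (simp add: cf_Sub [OF Y, where r = ?r] cf_mult sum_distrib_right)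
  finally show "cf (Sub m Y (f * g)) u = cf (Sub m Y f * Sub m Y g) u" ..
qed

text \<open>An endomorphism of the free group thus acts on power series by substitution. Generators
  from \<open>m\<close> on must be killed because \<open>Sub m\<close> drops the corresponding
  variables. The value at an inverse generator is forced by multiplicativity.\<close>

lemma Sub_mu:
  assumes B: "additive_map b" and kill: "\<And>i. i \<ge> m \<Longrightarrow> b (gen i) = 0"
  shows "Sub m (\<lambda>i. mu (b (gen i)) - 1) (mu g) = mu (b g)"
proof -
  let ?Y = "\<lambda>i. mu (b (gen i)) - 1"
  have Y: "deep 1 (?Y i)" for i by (rule deep_mu)
  have Y0: "?Y i = 0" if "i \<ge> m" for i using kill [OF that] by simp
  have gen: "Sub m ?Y (mu (gen i)) = mu (b (gen i))" for i
    by (simp add: mu_gen Sub_add Sub_one Sub_X [where Y = ?Y, OF Y Y0])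
  have neg: "Sub m ?Y (mu (- gen i)) = mu (b (- gen i))" for i
  proof -
    have "Sub m ?Y (mu (- gen i)) * mu (b (gen i)) = 1"
      using Sub_mult [where Y = ?Y, OF Y, of m "mu (- gen i)" "mu (gen i)"] by (simp add: Sub_one gen)
    then have "Sub m ?Y (mu (- gen i)) * mu (b (gen i)) * mu (- b (gen i)) = mu (- b (gen i))" by simp
    then show ?thesis by (simp add: mult.assoc additive_map_neg [OF B])
  qed
  show ?thesis
  proof (induction g rule: fg_letter_induct)
    case (step a g)
    have "Sub m ?Y (mu (lgen a)) = mu (b (lgen a))" by (simp add: lgen_def gen neg)
    with step show ?case by (simp add: mu_add additive_map_add [OF B] Sub_mult [where Y = ?Y, OF Y])
  qed (simp add: Sub_one additive_map_zero [OF B])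
qed

section \<open>Automorphisms of the free group of rank k\<close>

text \<open>The retraction onto the free group of rank \<open>k\<close>; the equation
  \<open>pr k g = g\<close> is used throughout as membership in that subgroup.\<close>

definition pr :: "nat \<Rightarrow> fg \<Rightarrow> fg" where
  "pr k = ext (\<lambda>i. if i < k then gen i else 0)"

lemma additive_pr: "additive_map (pr k)"
  by (simp add: pr_def additive_ext)

lemma pr_gen [simp]: "pr k (gen i) = (if i < k then gen i else 0)"
  by (simp add: pr_def)

lemmas pr_simps [simp] = additive_map_simps [OF additive_pr]

lemma pr_pr [simp]: "pr k (pr k g) = pr k g"
proof -
  have "pr k \<circ> pr k = pr k"
    by (rule additive_map_eqI) (auto simp: additive_map_comp additive_pr)
  then show ?thesis by (metis comp_apply)
qed

lemma set_fgw_pr: "fst ` set (fgw (pr k g)) \<subseteq> {..<k}"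
proof (induction g rule: fg_letter_induct)
  case (step a g)
  have "set (fgw (pr k (lgen a + g))) \<subseteq> set (fgw (pr k (lgen a))) \<union> set (fgw (pr k g))"
    by (simp add: fgw_plus set_foldr_push)
  moreover have "fst ` set (fgw (pr k (lgen a))) \<subseteq> {..<k}"
    by (auto simp: lgen_def fgw_gen fgw_neg_gen)
  ultimately show ?case using step by fastforce
qed simp

lemma pr_fixed_iff: "pr k g = g \<longleftrightarrow> fst ` set (fgw g) \<subseteq> {..<k}"
proof
  assume "fst ` set (fgw g) \<subseteq> {..<k}"
  moreover have "pr k (Fg w) = Fg w" if "reduced w" "fst ` set w \<subseteq> {..<k}" for w
    using that
  proof (induction w)
    case Nil
    then show ?case by (simp flip: zero_fg_def)
  next
    case (Cons a w)
    then show ?case by (auto simp: Fg_Cons reduced_Cons lgen_def)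
  qed
  ultimately show "pr k g = g" by (metis fgw_inverse reduced_fgw)
qed (use set_fgw_pr in metis)

abbreviation F :: "nat \<Rightarrow> word monoid" where "F \<equiv> free_group"

lemma carrier_F: "carrier (F k) = {w. reduced w \<and> fst ` set w \<subseteq> {..<k}}"
  by (simp add: free_group_def)

lemma mult_F: "v \<otimes>\<^bsub>F k\<^esub> w = foldr push v w"
  by (simp add: free_group_def)

lemma one_F: "\<one>\<^bsub>F k\<^esub> = []"
  by (simp add: free_group_def)

lemma fgw_in_F: "fgw g \<in> carrier (F k) \<longleftrightarrow> pr k g = g"
  by (simp add: carrier_F pr_fixed_iff)

lemma F_cases:
  assumes "w \<in> carrier (F k)"
  obtains g where "w = fgw g" "pr k g = g"
  using assms that [of "Fg w"] by (auto simp: carrier_F pr_fixed_iff)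

lemma Fg_fgw [simp]: "Fg (fgw g) = g"
  by (rule fgw_inverse)

lemma mult_F_fgw: "fgw g \<otimes>\<^bsub>F k\<^esub> fgw h = fgw (g + h)"
  by (simp add: mult_F fgw_plus)

lemma inv_F_fgw: "pr k g = g \<Longrightarrow> inv\<^bsub>F k\<^esub> (fgw g) = fgw (- g)"
  by (rule group.inv_equality [OF group_free_group]) (simp_all add: mult_F_fgw one_F fgw_in_F)

text \<open>An endomorphism of the subgroup of rank \<open>k\<close>, extended by 0 to the other
  generators. With this normalization equality of functions is equality of endomorphisms, and
  \<open>pr k\<close> is the identity element.\<close>

definition endo :: "nat \<Rightarrow> (fg \<Rightarrow> fg) \<Rightarrow> bool" where
  "endo k f \<longleftrightarrow> additive_map f \<and> (\<forall>i\<ge>k. f (gen i) = 0) \<and> (\<forall>g. pr k (f g) = f g)"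

definition aut :: "nat \<Rightarrow> (fg \<Rightarrow> fg) \<Rightarrow> bool" where
  "aut k f \<longleftrightarrow> endo k f \<and> (\<exists>h. endo k h \<and> f \<circ> h = pr k \<and> h \<circ> f = pr k)"

lemma endo_additive: "endo k f \<Longrightarrow> additive_map f"
  by (simp add: endo_def)

lemma endo_eqI:
  assumes "endo k f" "endo k g" "\<And>i. i < k \<Longrightarrow> f (gen i) = g (gen i)"
  shows "f = g"
  using assms by (intro additive_map_eqI) (auto simp: endo_def not_le_imp_less le_less_linear, metis not_le)

lemma endo_comp: "endo k f \<Longrightarrow> endo k g \<Longrightarrow> endo k (f \<circ> g)"
  by (auto simp: endo_def additive_map_comp additive_map_zero)

lemma endo_pr_simps: "endo k f \<Longrightarrow> f \<circ> pr k = f" "endo k f \<Longrightarrow> pr k \<circ> f = f"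
proof -
  show "f \<circ> pr k = f" if "endo k f"
    using that by (intro additive_map_eqI additive_map_comp additive_pr) (auto simp: endo_def additive_map_zero)
qed (auto simp: endo_def)

lemma endo_pr: "endo k (pr k)"
  by (simp add: endo_def additive_pr)

lemma endo_ext: "(\<And>i. i < k \<Longrightarrow> pr k (f i) = f i) \<Longrightarrow> endo k (ext (\<lambda>i. if i < k then f i else 0))"
proof -
  assume a: "\<And>i. i < k \<Longrightarrow> pr k (f i) = f i"
  have "pr k \<circ> ext (\<lambda>i. if i < k then f i else 0) = ext (\<lambda>i. if i < k then f i else 0)"
    by (rule additive_map_eqI) (auto simp: additive_map_comp additive_pr additive_ext a)
  then show ?thesis by (auto simp: endo_def additive_ext fun_eq_iff)
qed

lemma aut_endo: "aut k f \<Longrightarrow> endo k f"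
  by (simp add: aut_def)

lemma aut_pr: "aut k (pr k)"
  by (auto simp: aut_def endo_pr fun_eq_iff intro!: exI [of _ "pr k"])

lemma aut_comp: assumes "aut k f" "aut k g" shows "aut k (f \<circ> g)"
proof -
  obtain f' g' where f': "endo k f'" "f \<circ> f' = pr k" "f' \<circ> f = pr k"
    and g': "endo k g'" "g \<circ> g' = pr k" "g' \<circ> g = pr k"
    using assms by (auto simp: aut_def)
  have "f \<circ> g \<circ> (g' \<circ> f') = f \<circ> (g \<circ> g') \<circ> f'" "g' \<circ> f' \<circ> (f \<circ> g) = g' \<circ> (f' \<circ> f) \<circ> g"
    by (simp_all add: comp_assoc)
  then show ?thesis
    using assms f' g' unfolding aut_def
    by (metis endo_comp endo_pr_simps)
qed

definition ainv :: "nat \<Rightarrow> (fg \<Rightarrow> fg) \<Rightarrow> fg \<Rightarrow> fg" where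
  "ainv k f = (SOME h. endo k h \<and> f \<circ> h = pr k \<and> h \<circ> f = pr k)"

lemma ainv: assumes "aut k f"
  shows "endo k (ainv k f)" "f \<circ> ainv k f = pr k" "ainv k f \<circ> f = pr k" "aut k (ainv k f)"
proof -
  have *: "endo k (ainv k f) \<and> f \<circ> ainv k f = pr k \<and> ainv k f \<circ> f = pr k"
    unfolding ainv_def by (rule someI_ex [OF conjunct2 [OF assms [unfolded aut_def]]])
  then show "endo k (ainv k f)" "f \<circ> ainv k f = pr k" "ainv k f \<circ> f = pr k" by auto
  show "aut k (ainv k f)" using * assms unfolding aut_def by blast
qed

lemma autI: "endo k f \<Longrightarrow> endo k h \<Longrightarrow> f \<circ> h = pr k \<Longrightarrow> h \<circ> f = pr k \<Longrightarrow> aut k f"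
  unfolding aut_def by blast

text \<open>Conjugation applied after an arbitrary map: \<open>inn h f\<close> runs through the
  coset of \<open>f\<close> modulo inner automorphisms, and the inner automorphisms are the maps
  \<open>inn h (pr k)\<close>.\<close>

definition inn :: "fg \<Rightarrow> (fg \<Rightarrow> fg) \<Rightarrow> fg \<Rightarrow> fg" where
  "inn h f x = h + f x - h"

lemma endo_inn: "pr k h = h \<Longrightarrow> endo k f \<Longrightarrow> endo k (inn h f)"
proof -
  assume "pr k h = h" "endo k f"
  moreover have "inn h f = (\<lambda>x. h + f x - h)" by (simp add: inn_def fun_eq_iff)
  ultimately show ?thesis by (simp add: endo_def additive_map_conj)
qed

lemma inn_comp_right: "inn h f \<circ> g = inn h (f \<circ> g)"
  by (simp add: inn_def fun_eq_iff)

lemma comp_inn: "additive_map f \<Longrightarrow> f \<circ> inn h g = inn (f h) (f \<circ> g)"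
  by (simp add: inn_def fun_eq_iff additive_map_simps)

lemma inn_inn: "inn h (inn h' f) = inn (h + h') f"
  by (simp add: inn_def fun_eq_iff group_norm del: add_uminus_conv_diff)

lemma inn_0 [simp]: "inn 0 f = f"
  by (simp add: inn_def fun_eq_iff)

lemma aut_inn: assumes h: "pr k h = h" and f: "aut k f" shows "aut k (inn h f)"
proof -
  have i: "aut k (inn h (pr k))"
  proof (rule autI [of k _ "inn (- h) (pr k)"])
    show "inn h (pr k) \<circ> inn (- h) (pr k) = pr k" "inn (- h) (pr k) \<circ> inn h (pr k) = pr k"
      by (simp_all add: inn_def fun_eq_iff h group_norm del: add_uminus_conv_diff)
  qed (simp_all add: endo_inn h endo_pr)
  have "inn h (pr k) \<circ> f = inn h f"
    by (simp add: inn_comp_right endo_pr_simps [OF aut_endo [OF f]])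
  then show ?thesis using aut_comp [OF i f] by simp
qed

section \<open>Comparison with the outer automorphism group\<close>

definition toA :: "nat \<Rightarrow> (fg \<Rightarrow> fg) \<Rightarrow> word \<Rightarrow> word" where
  "toA k f = (\<lambda>w\<in>carrier (F k). fgw (f (Fg w)))"

lemma toA_fgw: "pr k g = g \<Longrightarrow> toA k f (fgw g) = fgw (f g)"
  by (simp add: toA_def fgw_in_F)

lemma toA_eqI:
  assumes "\<And>g. pr k g = g \<Longrightarrow> a (fgw g) = fgw (f g)" "a \<in> extensional (carrier (F k))"
  shows "toA k f = a"
proof (rule extensionalityI [of _ "carrier (F k)"])
  show "toA k f \<in> extensional (carrier (F k))" by (simp add: toA_def)
next
  fix w assume "w \<in> carrier (F k)"
  then show "toA k f w = a w" by (elim F_cases) (simp add: toA_fgw assms)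
qed (rule assms)

lemma toA_auto:
  assumes "aut k f" shows "toA k f \<in> auto (F k)"
proof -
  obtain h where f: "endo k f" and h: "endo k h" "f \<circ> h = pr k" "h \<circ> f = pr k"
    using assms by (auto simp: aut_def)
  have cl: "w \<in> carrier (F k) \<Longrightarrow> toA k e w \<in> carrier (F k)" if "endo k e" for e w
    using that by (elim F_cases) (simp add: toA_fgw fgw_in_F endo_def)
  have inv: "w \<in> carrier (F k) \<Longrightarrow> toA k e (toA k e' w) = w" if "endo k e" "endo k e'" "e \<circ> e' = pr k" for e e' w
  proof (elim F_cases)
    fix g assume "w = fgw g" "pr k g = g"
    moreover have "e (e' g) = pr k g" using that(3) by (simp add: fun_eq_iff)
    ultimately show "toA k e (toA k e' w) = w"
      using that by (simp add: toA_fgw endo_def)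
  qed
  have "bij_betw (toA k f) (carrier (F k)) (carrier (F k))"
    by (rule bij_betw_byWitness [where f' = "toA k h"]) (auto simp: cl inv f h)
  moreover have "toA k f \<in> hom (F k) (F k)"
  proof (rule homI)
    fix v w assume "v \<in> carrier (F k)" "w \<in> carrier (F k)"
    then show "toA k f (v \<otimes>\<^bsub>F k\<^esub> w) = toA k f v \<otimes>\<^bsub>F k\<^esub> toA k f w"
      using f by (elim F_cases) (simp add: mult_F_fgw toA_fgw endo_def additive_map_add)
  qed (use cl f in auto)
  ultimately show ?thesis by (simp add: auto_def Bij_def toA_def)
qed

text \<open>An automorphism of the group of words is recovered from its values at the generators by
  \<open>fr\<close>; the same construction applied to the inverse function provides the
  inverse.\<close>

lemma toA_surj:
  assumes a: "a \<in> auto (F k)" shows "\<exists>f. aut k f \<and> toA k f = a"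
proof -
  interpret G: group "F k" by (rule group_free_group)
  define fr where "fr b = ext (\<lambda>i. if i < k then Fg (b [(i, True)]) else 0)" for b :: "word \<Rightarrow> word"
  have g1: "[(i, True)] = fgw (gen i)" for i by (simp add: fgw_gen)
  have endo: "endo k (fr b)" and val: "\<And>g. pr k g = g \<Longrightarrow> b (fgw g) = fgw (fr b g)" if b: "b \<in> hom (F k) (F k)" for b
  proof -
    interpret b: group_hom "F k" "F k" b
      using b by (simp add: group_hom_def group_hom_axioms_def group_free_group)
    have pb: "pr k (Fg (b (fgw (gen i)))) = Fg (b (fgw (gen i)))" if "i < k" for i
    proof -
      have "b (fgw (gen i)) \<in> carrier (F k)" using that by (simp add: fgw_in_F)
      then show ?thesis by (metis F_cases Fg_fgw)
    qed
    show e: "endo k (fr b)" unfolding fr_def g1 by (rule endo_ext) (rule pb)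
    show "b (fgw g) = fgw (fr b g)" if "pr k g = g" for g
    proof -
      have "pr k (Fg w) = Fg w \<Longrightarrow> reduced w \<Longrightarrow> b (fgw (Fg w)) = fgw (fr b (Fg w))" for w
      proof (induction w)
        case Nil
        then show ?case using b.hom_one by (simp add: one_F flip: zero_fg_def) (simp add: additive_map_zero [OF endo_additive [OF e]])
      next
        case (Cons a w)
        then have r: "reduced w" and l: "fst a < k" "pr k (Fg w) = Fg w"
          by (auto simp: reduced_Cons pr_fixed_iff)
        have la: "pr k (lgen a) = lgen a" using l by (simp add: lgen_def)
        have "b (fgw (lgen a)) = fgw (fr b (lgen a))"
        proof -
          have gg: "b (fgw (gen (fst a))) = fgw (fr b (gen (fst a)))"
          proof -
            have "b (fgw (gen (fst a))) \<in> carrier (F k)" using l by (simp add: fgw_in_F)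
            then show ?thesis using l by (simp add: fr_def g1 carrier_F)
          qed
          moreover have "b (fgw (- gen (fst a))) = fgw (- fr b (gen (fst a)))"
          proof -
            have "b (fgw (- gen (fst a))) = inv\<^bsub>F k\<^esub> (b (fgw (gen (fst a))))"
              using b.hom_inv [of "fgw (gen (fst a))"] l by (simp add: inv_F_fgw fgw_in_F)
            also have "\<dots> = fgw (- fr b (gen (fst a)))"
              unfolding gg using e by (intro inv_F_fgw) (simp add: endo_def)
            finally show ?thesis .
          qed
          ultimately show ?thesis by (auto simp: lgen_def additive_map_neg [OF endo_additive [OF e]])
        qed
        moreover have "b (fgw (lgen a + Fg w)) = b (fgw (lgen a)) \<otimes>\<^bsub>F k\<^esub> b (fgw (Fg w))"
          using b.hom_mult [of "fgw (lgen a)" "fgw (Fg w)"] la l by (simp only: mult_F_fgw fgw_in_F)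
        ultimately show ?case
          using Cons.IH [OF l(2) r] Cons.prems
          by (simp only: Fg_Cons mult_F_fgw additive_map_add [OF endo_additive [OF e]])
      qed
      from this [of "fgw g"] that show ?thesis by simp
    qed
  qed
  have hom: "a \<in> hom (F k) (F k)" and ex: "a \<in> extensional (carrier (F k))" and bij: "bij_betw a (carrier (F k)) (carrier (F k))"
    using a by (auto simp: auto_def Bij_def)
  let ?i = "inv_into (carrier (F k)) a"
  have ihom: "?i \<in> hom (F k) (F k)"
  proof -
    have "a \<in> iso (F k) (F k)" using hom bij by (simp add: iso_def)
    from G.iso_set_sym [OF this] show ?thesis by (simp add: iso_def)
  qed
  have inv1: "fr a (fr ?i g) = g" if "pr k g = g" for g
  proof -
    have "fgw (fr a (fr ?i g)) = a (?i (fgw g))"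
    proof -
      have "pr k (fr ?i g) = fr ?i g" using endo [OF ihom] by (simp add: endo_def)
      then show ?thesis using val [OF hom] val [OF ihom] that by simp
    qed
    also have "\<dots> = fgw g" using bij that by (simp add: bij_betw_def f_inv_into_f fgw_in_F)
    finally show ?thesis by (metis Fg_fgw)
  qed
  have inv2: "fr ?i (fr a g) = g" if "pr k g = g" for g
  proof -
    have "fgw (fr ?i (fr a g)) = ?i (a (fgw g))"
    proof -
      have "pr k (fr a g) = fr a g" using endo [OF hom] by (simp add: endo_def)
      then show ?thesis using val [OF hom] val [OF ihom] that by simp
    qed
    also have "\<dots> = fgw g" using bij that by (simp add: bij_betw_def inv_into_f_f fgw_in_F)
    finally show ?thesis by (metis Fg_fgw)
  qed
  have "aut k (fr a)"
  proof (rule autI [OF endo [OF hom] endo [OF ihom]])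
    have *: "fr b g = fr b (pr k g)" if "b \<in> hom (F k) (F k)" for b g
      using endo_pr_simps(1) [OF endo [OF that]] by (metis comp_apply)
    show "fr a \<circ> fr ?i = pr k" "fr ?i \<circ> fr a = pr k"
      using inv1 [of "pr k _"] inv2 [of "pr k _"] *[OF hom] *[OF ihom] by (simp_all add: fun_eq_iff)
  qed
  moreover have "toA k (fr a) = a" by (rule toA_eqI [OF val [OF hom] ex])
  ultimately show ?thesis by blast
qed

lemma toA_comp: assumes "aut k f" "aut k g"
  shows "toA k (f \<circ> g) = toA k f \<otimes>\<^bsub>AutoGroup (F k)\<^esub> toA k g"
proof (rule toA_eqI)
  have *: "toA k f \<otimes>\<^bsub>AutoGroup (F k)\<^esub> toA k g = compose (carrier (F k)) (toA k f) (toA k g)"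
    by (rule group.AutoGroup_mult [OF group_free_group toA_auto toA_auto]) (fact assms)+
  then show "toA k f \<otimes>\<^bsub>AutoGroup (F k)\<^esub> toA k g \<in> extensional (carrier (F k))"
    by (simp add: compose_def)
  fix x assume "pr k x = x"
  moreover have "pr k (g x) = g x" using assms by (simp add: aut_def endo_def)
  ultimately show "(toA k f \<otimes>\<^bsub>AutoGroup (F k)\<^esub> toA k g) (fgw x) = fgw ((f \<circ> g) x)"
    by (simp add: * compose_def toA_fgw fgw_in_F)
qed

lemma toA_inner: "pr k h = h \<Longrightarrow> toA k (inn h (pr k)) = inner_aut (F k) (fgw h)"
  by (rule toA_eqI) (simp_all add: inner_aut_def fgw_in_F mult_F_fgw inv_F_fgw inn_def flip: add_uminus_conv_diff)

lemma toA_inj: assumes "endo k f" "endo k g" "toA k f = toA k g" shows "f = g"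
proof (rule endo_eqI [OF assms(1,2)])
  fix i assume "i < k"
  then have "fgw (f (gen i)) = fgw (g (gen i))" using assms(3) toA_fgw [of k "gen i"] by (metis pr_gen)
  then show "f (gen i) = g (gen i)" by (metis Fg_fgw)
qed

definition cls :: "nat \<Rightarrow> (fg \<Rightarrow> fg) \<Rightarrow> (word \<Rightarrow> word) set" where
  "cls k f = Inn (F k) #>\<^bsub>AutoGroup (F k)\<^esub> toA k f"

lemma normal_Inn: "Inn (F k) \<lhd> AutoGroup (F k)"
  by (rule group.Inn_normal [OF group_free_group])

lemma cls_in_Out: "aut k f \<Longrightarrow> cls k f \<in> carrier (Out (F k))"
  by (auto simp: cls_def Out_def FactGroup_def RCOSETS_def carrier_AutoGroup intro: toA_auto)

lemma cls_surj: assumes "x \<in> carrier (Out (F k))" shows "\<exists>f. aut k f \<and> x = cls k f"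
proof -
  obtain a where "a \<in> auto (F k)" "x = Inn (F k) #>\<^bsub>AutoGroup (F k)\<^esub> a"
    using assms by (auto simp: Out_def FactGroup_def RCOSETS_def carrier_AutoGroup)
  then show ?thesis using toA_surj [of a k] by (auto simp: cls_def)
qed

lemma cls_mult: assumes "aut k f" "aut k g"
  shows "cls k (f \<circ> g) = cls k f \<otimes>\<^bsub>Out (F k)\<^esub> cls k g"
proof -
  interpret N: normal "Inn (F k)" "AutoGroup (F k)" by (rule normal_Inn)
  show ?thesis
    using N.rcos_sum [of "toA k f" "toA k g"] assms
    by (simp add: cls_def Out_def FactGroup_def carrier_AutoGroup toA_auto toA_comp)
qed

lemma cls_one: "cls k (pr k) = \<one>\<^bsub>Out (F k)\<^esub>"
proof -
  interpret G: group "Out (F k)" by (rule group.group_Out [OF group_free_group])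
  have "pr k \<circ> pr k = pr k" by (simp add: fun_eq_iff)
  then have "cls k (pr k) = cls k (pr k) \<otimes>\<^bsub>Out (F k)\<^esub> cls k (pr k)"
    using cls_mult [OF aut_pr aut_pr, of k] by simp
  then show ?thesis using cls_in_Out [OF aut_pr] by (metis G.l_cancel_one)
qed

text \<open>The bridge by which equations in \<open>Out\<close> are turned into explicit
  conjugations and back.\<close>

lemma cls_eq_iff: assumes f: "aut k f" and g: "aut k g"
  shows "cls k f = cls k g \<longleftrightarrow> (\<exists>h. pr k h = h \<and> g = inn h f)"
proof -
  interpret N: normal "Inn (F k)" "AutoGroup (F k)" by (rule normal_Inn)
  have fA: "toA k f \<in> carrier (AutoGroup (F k))" and gA: "toA k g \<in> carrier (AutoGroup (F k))"
    using f g by (simp_all add: carrier_AutoGroup toA_auto)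
  have "cls k f = cls k g \<longleftrightarrow> toA k g \<in> Inn (F k) #>\<^bsub>AutoGroup (F k)\<^esub> toA k f"
    unfolding cls_def using N.repr_independence [OF _ fA N.subgroup_axioms] N.rcos_self [OF gA N.subgroup_axioms] by metis
  also have "\<dots> \<longleftrightarrow> (\<exists>h. pr k h = h \<and> toA k g = toA k (inn h f))"
  proof -
    have e: "inner_aut (F k) (fgw h) \<otimes>\<^bsub>AutoGroup (F k)\<^esub> toA k f = toA k (inn h f)" if "pr k h = h" for h
      using toA_comp [OF aut_inn [OF that aut_pr] f] that
      by (simp add: toA_inner inn_comp_right endo_pr_simps [OF aut_endo [OF f]])
    show ?thesis
    proof
      assume "toA k g \<in> Inn (F k) #>\<^bsub>AutoGroup (F k)\<^esub> toA k f"
      then obtain w where "w \<in> carrier (F k)" "toA k g = inner_aut (F k) w \<otimes>\<^bsub>AutoGroup (F k)\<^esub> toA k f"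
        by (auto simp: r_coset_def Inn_def)
      then show "\<exists>h. pr k h = h \<and> toA k g = toA k (inn h f)" by (elim F_cases) (auto simp: e)
    next
      assume "\<exists>h. pr k h = h \<and> toA k g = toA k (inn h f)"
      then show "toA k g \<in> Inn (F k) #>\<^bsub>AutoGroup (F k)\<^esub> toA k f"
        by (auto simp: r_coset_def Inn_def fgw_in_F simp flip: e)
    qed
  qed
  also have "\<dots> \<longleftrightarrow> (\<exists>h. pr k h = h \<and> g = inn h f)"
    using toA_inj [OF aut_endo [OF g]] by (metis aut_endo aut_inn f)
  finally show ?thesis .
qed

section \<open>Elementary Nielsen automorphisms\<close>

lemma gen_eq_iff [simp]: "gen x = gen y \<longleftrightarrow> x = y"
  by (metis fgw_gen list.inject prod.inject)

lemma gen_neq_0 [simp]: "gen x \<noteq> 0"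
  by (metis fgw_gen fgw_zero list.distinct(1))

text \<open>Nielsen's generators are the maps \<open>rho\<close>, \<open>eps\<close> and
  \<open>swp\<close>. Left transvections and inverse transvections arise from \<open>rho\<close> by
  conjugation with \<open>eps\<close>.\<close>

definition rho :: "nat \<Rightarrow> nat \<Rightarrow> nat \<Rightarrow> fg \<Rightarrow> fg" where
  "rho n i j = ext (\<lambda>k. if k < n then (if k = i then gen i + gen j else gen k) else 0)"

definition eps :: "nat \<Rightarrow> nat \<Rightarrow> fg \<Rightarrow> fg" where
  "eps n i = ext (\<lambda>k. if k < n then (if k = i then - gen i else gen k) else 0)"

definition swp :: "nat \<Rightarrow> nat \<Rightarrow> nat \<Rightarrow> fg \<Rightarrow> fg" where
  "swp n i j = ext (\<lambda>k. if k < n then (if k = i then gen j else if k = j then gen i else gen k) else 0)"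

lemma endo_elementary [simp]:
  "j < n \<Longrightarrow> endo n (rho n i j)" "endo n (eps n i)" "i < n \<Longrightarrow> j < n \<Longrightarrow> endo n (swp n i j)"
  unfolding rho_def eps_def swp_def by (rule endo_ext; simp)+

lemma additive_elementary [simp]:
  "additive_map (rho n i j)" "additive_map (eps n i)" "additive_map (swp n i j)"
  by (simp_all add: rho_def eps_def swp_def additive_ext)

lemmas elementary_simps [simp] = additive_map_simps [OF additive_elementary(1)]
  additive_map_simps [OF additive_elementary(2)] additive_map_simps [OF additive_elementary(3)]

lemma elementary_gen [simp]:
  "rho n i j (gen k) = (if k < n then (if k = i then gen i + gen j else gen k) else 0)"
  "eps n i (gen k) = (if k < n then (if k = i then - gen i else gen k) else 0)"
  "swp n i j (gen k) = (if k < n then (if k = i then gen j else if k = j then gen i else gen k) else 0)"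
  by (simp_all add: rho_def eps_def swp_def)

lemma eps_eps: "eps n i \<circ> eps n i = pr n"
  by (rule additive_map_eqI) (auto simp: additive_map_comp additive_pr)

lemma swp_swp: "i < n \<Longrightarrow> j < n \<Longrightarrow> swp n i j \<circ> swp n i j = pr n"
  by (rule additive_map_eqI) (auto simp: additive_map_comp additive_pr)

lemma aut_eps [simp]: "aut n (eps n i)"
  by (rule autI [OF _ _ eps_eps eps_eps]) auto

lemma aut_swp [simp]: "i < n \<Longrightarrow> j < n \<Longrightarrow> aut n (swp n i j)"
  by (rule autI [OF _ _ swp_swp swp_swp]) auto

text \<open>Inverting x_j turns the transvection by x_j into its inverse, which makes
  \<open>rho\<close> invertible without a separate formula.\<close>

lemma rho_eps_rho_eps: "i \<noteq> j \<Longrightarrow> i < n \<Longrightarrow> j < n \<Longrightarrow> rho n i j \<circ> eps n j \<circ> rho n i j \<circ> eps n j = pr n"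
  by (rule additive_map_eqI) (auto simp: additive_map_comp additive_pr)

lemma eps_rho_eps_rho: "i \<noteq> j \<Longrightarrow> i < n \<Longrightarrow> j < n \<Longrightarrow> eps n j \<circ> rho n i j \<circ> eps n j \<circ> rho n i j = pr n"
  by (rule additive_map_eqI) (auto simp: additive_map_comp additive_pr add.assoc)

lemma aut_rho [simp]:
  assumes "i \<noteq> j" "i < n" "j < n" shows "aut n (rho n i j)"
proof (rule autI [of _ _ "eps n j \<circ> rho n i j \<circ> eps n j"])
  show "rho n i j \<circ> (eps n j \<circ> rho n i j \<circ> eps n j) = pr n"
    using rho_eps_rho_eps [OF assms] by (simp add: comp_assoc)
  show "eps n j \<circ> rho n i j \<circ> eps n j \<circ> rho n i j = pr n"
    using eps_rho_eps_rho [OF assms] by (simp add: comp_assoc)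
qed (use assms in \<open>simp_all add: endo_comp\<close>)

text \<open>Closed under right multiplication by the generators only; their inverses are again words
  in the generators, which the lemmas ending in \<open>_back\<close> exploit.\<close>

inductive_set Nie :: "nat \<Rightarrow> (fg \<Rightarrow> fg) set" for n where
  Nie_pr: "pr n \<in> Nie n"
| Nie_rho: "f \<in> Nie n \<Longrightarrow> i \<noteq> j \<Longrightarrow> i < n \<Longrightarrow> j < n \<Longrightarrow> f \<circ> rho n i j \<in> Nie n"
| Nie_eps: "f \<in> Nie n \<Longrightarrow> i < n \<Longrightarrow> f \<circ> eps n i \<in> Nie n"
| Nie_swp: "f \<in> Nie n \<Longrightarrow> i < n \<Longrightarrow> j < n \<Longrightarrow> f \<circ> swp n i j \<in> Nie n"

lemma Nie_eps_back:
  assumes "f \<circ> eps n i \<in> Nie n" "i < n" "endo n f" shows "f \<in> Nie n"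
proof -
  have "f \<circ> eps n i \<circ> eps n i = f"
    using endo_pr_simps(1) [OF assms(3)] eps_eps by (simp add: comp_assoc)
  then show ?thesis using Nie_eps [OF assms(1,2)] by simp
qed

lemma Nie_swp_back:
  assumes "f \<circ> swp n i j \<in> Nie n" "i < n" "j < n" "endo n f" shows "f \<in> Nie n"
proof -
  have "f \<circ> swp n i j \<circ> swp n i j = f"
    using endo_pr_simps(1) [OF assms(4)] swp_swp [OF assms(2,3)] by (simp add: comp_assoc)
  then show ?thesis using Nie_swp [OF assms(1,2,3)] by simp
qed

text \<open>Carries a negative letter to the positive generator, so that one formula covers
  transvections with all combinations of signs.\<close>

definition sgn_fix :: "nat \<Rightarrow> letter \<Rightarrow> fg \<Rightarrow> fg" where
  "sgn_fix n a = (if snd a then pr n else eps n (fst a))"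

text \<open>The transvection taking \<open>lgen a\<close> to \<open>lgen a + lgen c\<close>.\<close>

definition tr :: "nat \<Rightarrow> letter \<Rightarrow> letter \<Rightarrow> fg \<Rightarrow> fg" where
  "tr n a c = sgn_fix n a \<circ> sgn_fix n c \<circ> rho n (fst a) (fst c) \<circ> sgn_fix n c \<circ> sgn_fix n a"

lemma additive_sgn_fix: "additive_map (sgn_fix n a)"
  by (simp add: sgn_fix_def additive_pr)

lemma endo_sgn_fix: "endo n (sgn_fix n a)"
  by (simp add: sgn_fix_def endo_pr)

lemma Nie_sgn_fix: "f \<in> Nie n \<Longrightarrow> endo n f \<Longrightarrow> fst a < n \<Longrightarrow> f \<circ> sgn_fix n a \<in> Nie n"
  by (simp add: sgn_fix_def endo_pr_simps Nie_eps)

lemma endo_tr: "fst a < n \<Longrightarrow> fst c < n \<Longrightarrow> endo n (tr n a c)"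
  unfolding tr_def by (intro endo_comp endo_sgn_fix) simp_all

lemma Nie_tr:
  assumes "f \<in> Nie n" "endo n f" "fst a < n" "fst c < n" "fst a \<noteq> fst c"
  shows "f \<circ> tr n a c \<in> Nie n"
proof -
  have "f \<circ> sgn_fix n a \<circ> sgn_fix n c \<circ> rho n (fst a) (fst c) \<circ> sgn_fix n c \<circ> sgn_fix n a \<in> Nie n"
    using assms by (intro Nie_sgn_fix Nie_rho endo_comp endo_sgn_fix) auto
  then show ?thesis by (simp add: tr_def comp_assoc)
qed

lemma tr_lgen:
  assumes "fst a < n" "fst c < n" "fst a \<noteq> fst c"
  shows "tr n a c (lgen a) = lgen a + lgen c"
    "fst b < n \<Longrightarrow> fst b \<noteq> fst a \<Longrightarrow> tr n a c (lgen b) = lgen b"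
  using assms by (auto simp: tr_def sgn_fix_def lgen_def group_norm simp del: add_uminus_conv_diff)

lemma tr_tr:
  assumes "fst a < n" "fst c < n" "fst a \<noteq> fst c"
  shows "tr n a c \<circ> tr n a (letter_inv c) = pr n"
proof (rule additive_map_eqI)
  show "additive_map (tr n a c \<circ> tr n a (letter_inv c))"
    unfolding tr_def by (intro additive_map_comp additive_sgn_fix) simp_all
  fix i show "(tr n a c \<circ> tr n a (letter_inv c)) (gen i) = pr n (gen i)"
    using assms by (auto simp: tr_def sgn_fix_def letter_inv_def group_norm simp del: add_uminus_conv_diff)
qed (rule additive_pr)

lemma Nie_tr_back:
  assumes "f \<circ> tr n a c \<in> Nie n" "fst a < n" "fst c < n" "fst a \<noteq> fst c" "endo n f"
  shows "f \<in> Nie n"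
proof -
  have "f \<circ> tr n a c \<circ> tr n a (letter_inv c) \<in> Nie n"
    by (rule Nie_tr [OF assms(1)]) (use assms in \<open>auto intro: endo_comp endo_tr\<close>)
  moreover have "f \<circ> tr n a c \<circ> tr n a (letter_inv c) = f"
    using endo_pr_simps(1) [OF assms(5)] tr_tr [OF assms(2,3,4)] by (simp add: comp_assoc)
  ultimately show ?thesis by (simp only:)
qed

lemma aut_tr:
  assumes "fst a < n" "fst c < n" "fst a \<noteq> fst c"
  shows "aut n (tr n a c)"
proof (rule autI [of _ _ "tr n a (letter_inv c)"])
  show "tr n a (letter_inv c) \<circ> tr n a c = pr n"
    using tr_tr [of a n "letter_inv c"] assms by simp
qed (use assms in \<open>simp_all add: endo_tr tr_tr\<close>)

section \<open>Cancellation in reduced words\<close>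

text \<open>The formal inverse, without the reduction performed by \<open>word_inv\<close>; on
  reduced words the two agree by \<open>fgw_neg\<close>.\<close>

definition winv :: "word \<Rightarrow> word" where
  "winv w = rev (map letter_inv w)"

lemma winv_simps [simp]: "winv [] = []" "winv (v @ w) = winv w @ winv v" "winv (winv w) = w"
  "length (winv w) = length w" "winv (a # w) = winv w @ [letter_inv a]"
  by (simp_all add: winv_def rev_map o_def)

lemma reduced_append_iff:
  "reduced (v @ w) \<longleftrightarrow> reduced v \<and> reduced w \<and> (v \<noteq> [] \<longrightarrow> w \<noteq> [] \<longrightarrow> hd w \<noteq> letter_inv (last v))"
  by (auto simp: reduced_def successively_append_iff)

lemma reduced_winv: "reduced w \<Longrightarrow> reduced (winv w)"
proof (induction w)
  case (Cons a w)
  then show ?case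
    by (auto simp: reduced_append_iff reduced_Cons winv_def last_rev hd_map)
qed simp

lemma fgw_neg: "fgw (- g) = winv (fgw g)"
  by (simp add: uminus_fg_def word_inv_def foldr_push_Nil reduced_winv flip: winv_def)

text \<open>A letter pushed in front either prolongs \<open>p\<close> or, if \<open>p\<close> is
  empty, cancels against the first letter of \<open>q\<close> and joins \<open>c\<close>.\<close>

lemma push_cancellation:
  assumes "reduced u" "reduced v"
  shows "\<exists>p c q. u = p @ c \<and> v = winv c @ q \<and> foldr push u v = p @ q"
  using assms(1)
proof (induction u)
  case Nil
  then show ?case by (intro exI [of _ "[]"] exI [of _ v]) simp
next
  case (Cons a u)
  then obtain p c q where pcq: "u = p @ c" "v = winv c @ q" "foldr push u v = p @ q"
    unfolding reduced_Cons by blast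
  show ?case
  proof (cases "p = [] \<and> q \<noteq> [] \<and> hd q = letter_inv a")
    case True
    then obtain q' where "q = letter_inv a # q'" by (cases q) auto
    with True pcq show ?thesis
      by (intro exI [of _ "[]"] exI [of _ "a # c"] exI [of _ q']) (simp add: push_def [of a "letter_inv a # q'"])
  next
    case False
    then have "push a (p @ q) = a # p @ q"
      using Cons.prems pcq(1) by (cases p) (auto simp: push_def reduced_Cons)
    then show ?thesis
      using pcq by (intro exI [of _ "a # p"] exI [of _ c] exI [of _ q]) simp
  qed
qed

definition len :: "fg \<Rightarrow> nat" where
  "len g = length (fgw g)"

text \<open>The Gromov product: the number of letters that each factor loses in the product
  \<open>u + v\<close>.\<close>

definition kap :: "fg \<Rightarrow> fg \<Rightarrow> nat" where
  "kap u v = (len u + len v - len (u + v)) div 2"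

lemma len_neg [simp]: "len (- g) = len g"
  by (simp add: len_def fgw_neg)

lemma len_zero_iff [simp]: "len g = 0 \<longleftrightarrow> g = 0"
  by (metis len_def length_0_conv fgw_zero fgw_inverse)

lemma kap_props:
  shows "kap u v \<le> len u" "kap u v \<le> len v" "len (u + v) = len u + len v - 2 * kap u v"
    "fgw (u + v) = take (len u - kap u v) (fgw u) @ drop (kap u v) (fgw v)"
    "drop (len u - kap u v) (fgw u) = winv (take (kap u v) (fgw v))"
proof -
  obtain p c q where pcq: "fgw u = p @ c" "fgw v = winv c @ q" "fgw (u + v) = p @ q"
    using push_cancellation [of "fgw u" "fgw v"] by (auto simp: fgw_plus)
  then have "kap u v = length c" by (simp add: kap_def len_def)
  with pcq show "kap u v \<le> len u" "kap u v \<le> len v" "len (u + v) = len u + len v - 2 * kap u v"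
    "fgw (u + v) = take (len u - kap u v) (fgw u) @ drop (kap u v) (fgw v)"
    "drop (len u - kap u v) (fgw u) = winv (take (kap u v) (fgw v))"
    by (simp_all add: len_def)
qed

text \<open>If half of \<open>u\<close> cancelled in \<open>u + u\<close>, the middle of
  \<open>u\<close> would coincide with its own formal inverse: for odd length the middle letter
  would be its own inverse, for even length the two middle letters would be inverse to each
  other.\<close>

lemma kap_self:
  assumes "u \<noteq> 0" shows "2 * kap u u < len u"
proof (rule ccontr)
  assume "\<not> 2 * kap u u < len u"
  then have r: "len u \<le> 2 * kap u u" by simp
  let ?r = "kap u u" and ?n = "len u" and ?w = "fgw u"
  have n: "?n > 0" "?r \<le> ?n" using assms kap_props(1) len_zero_iff by (auto simp: neq0_conv [symmetric] simp del: neq0_conv)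
  have sym: "?w ! (?n - ?r + s) = letter_inv (?w ! (?r - 1 - s))" if "s < ?r" for s
  proof -
    have "?w ! (?n - ?r + s) = drop (?n - ?r) ?w ! s" using that n by (simp add: len_def)
    also have "\<dots> = winv (take ?r ?w) ! s" by (simp add: kap_props(5))
    also have "\<dots> = letter_inv (?w ! (?r - 1 - s))"
      using that n by (simp add: winv_def rev_nth len_def)
    finally show ?thesis .
  qed
  show False
  proof (cases "odd ?n")
    case True
    \<comment> \<open>The offset at which the symmetry \<open>sym\<close> pairs the middle letter
      with itself; in the even case below it pairs the two middle letters.\<close>
    define s where "s = (2 * ?r - 1 - ?n) div 2"
    have "2 * s + ?n = 2 * ?r - 1" using True r by (auto simp: s_def elim!: oddE) presburger
    then have "s < ?r" "?n - ?r + s = ?r - 1 - s" using n r by linarith+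
    with sym [of s] show False by simp
  next
    case False
    define s where "s = (2 * ?r - ?n) div 2"
    have s: "2 * s + ?n = 2 * ?r" using False r by (auto simp: s_def)
    then have "s < ?r" "?n - ?r + s = Suc (?r - 1 - s)" "Suc (?r - 1 - s) < ?n" using n r by linarith+
    with sym [of s] have "?w ! Suc (?r - 1 - s) = letter_inv (?w ! (?r - 1 - s))" "Suc (?r - 1 - s) < length ?w"
      by (simp_all add: len_def)
    moreover have "successively (\<lambda>a b. b \<noteq> letter_inv a) ?w" using reduced_fgw [of u] by (simp add: reduced_def)
    ultimately show False by (auto simp: successively_conv_nth)
  qed
qed

text \<open>The nonempty part \<open>m\<close>, which survives on both sides, keeps the cancellation
  away from \<open>p\<close>.\<close>

lemma fgw_add_reduced:
  assumes x: "fgw x = p @ m @ c" and y: "fgw y = winv c @ q" and m: "m \<noteq> []" and r: "reduced (m @ q)"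
  shows "fgw (x + y) = p @ m @ q"
proof -
  have rx: "reduced (p @ m @ c)" using reduced_fgw [of x] by (simp add: x)
  have ry: "reduced (winv c @ q)" using reduced_fgw [of y] by (simp add: y)
  have c: "foldr push c (winv c @ q) = q" using ry
  proof (induction c arbitrary: q)
    case (Cons a c)
    then have "foldr push c (winv c @ letter_inv a # q) = letter_inv a # q" by simp
    then show ?case by (simp add: push_def [of a "letter_inv a # q"])
  qed simp
  have "reduced (p @ m @ q)"
    using rx r m by (auto simp: reduced_append_iff)
  then have "foldr push (p @ m) q = p @ m @ q"
  proof -
    assume a: "reduced (p @ m @ q)"
    have "foldr push v q = v @ q" if "reduced (v @ q)" for v
      using that by (induction v) (auto simp: push_reduced reduced_Cons)
    from this [of "p @ m"] a show ?thesis by simp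
  qed
  then show ?thesis by (simp add: fgw_plus x y c)
qed

section \<open>Nielsen's theorem\<close>

text \<open>With this numbering, words of equal length are compared lexicographically by reading
  them as numbers in base 2n.\<close>

definition digit :: "letter \<Rightarrow> nat" where
  "digit a = 2 * fst a + (if snd a then 1 else 0)"

lemma digit_less: "fst a < n \<Longrightarrow> digit a < 2 * n"
  by (simp add: digit_def)

lemma digit_inj: "digit a = digit b \<Longrightarrow> a = b"
  by (auto simp: digit_def prod_eq_iff split: if_splits) presburger+

fun code :: "nat \<Rightarrow> word \<Rightarrow> nat" where
  "code B [] = 0"
| "code B (a # w) = digit a * B ^ length w + code B w"

lemma code_append: "code B (v @ w) = code B v * B ^ length w + code B w"
  by (induction v) (simp_all add: power_add algebra_simps)

lemma code_less: "fst ` set w \<subseteq> {..<n} \<Longrightarrow> code (2 * n) w < (2 * n) ^ length w"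
proof (induction w)
  case (Cons a w)
  then have "digit a + 1 \<le> 2 * n" "code (2 * n) w < (2 * n) ^ length w"
    using digit_less [of a n] by auto
  then have "digit a * (2 * n) ^ length w + code (2 * n) w < (digit a + 1) * (2 * n) ^ length w" by simp
  also have "\<dots> \<le> 2 * n * (2 * n) ^ length w" by (rule mult_right_mono) (use \<open>digit a + 1 \<le> 2 * n\<close> in auto)
  finally show ?case by simp
qed simp

lemma code_inj:
  assumes "length v = length w" "fst ` set v \<subseteq> {..<n}" "fst ` set w \<subseteq> {..<n}" "code (2 * n) v = code (2 * n) w"
  shows "v = w"
  using assms
proof (induction v w rule: list_induct2)
  case (Cons a v b w)
  let ?B = "2 * n"
  define P where "P = ?B ^ length v"
  have P: "(d * P + x) div P = d" if "x < P" for d x using that by simp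
  have l: "code ?B v < P" "code ?B w < P"
    using code_less [of v n] code_less [of w n] Cons by (auto simp: P_def)
  have e: "digit a * P + code ?B v = digit b * P + code ?B w"
    using Cons by (simp add: P_def)
  then have "digit a = digit b" using P [OF l(1), of "digit a"] P [OF l(2), of "digit b"] by simp
  with e have "code ?B v = code ?B w" by simp
  with Cons \<open>digit a = digit b\<close> show ?case by (simp add: digit_inj)
qed simp

text \<open>The initial half, including the middle letter of a word of odd length.\<close>

definition half :: "word \<Rightarrow> word" where
  "half w = take (Suc (length w) div 2) w"

definition nlen :: "nat \<Rightarrow> (fg \<Rightarrow> fg) \<Rightarrow> nat" where
  "nlen n f = (\<Sum>i<n. len (f (gen i)))"

text \<open>Nielsen's second measure, decisive when a transvection preserves the total length.
  Adding the codes for \<open>g\<close> and \<open>- g\<close> makes it insensitive to inversion, so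
  each image counts only up to sign.\<close>

definition hcode :: "nat \<Rightarrow> fg \<Rightarrow> nat" where
  "hcode n g = code (2 * n) (half (fgw g)) + code (2 * n) (half (fgw (- g)))"

definition ncode :: "nat \<Rightarrow> (fg \<Rightarrow> fg) \<Rightarrow> nat" where
  "ncode n f = (\<Sum>i<n. hcode n (f (gen i)))"

lemma hcode_neg: "hcode n (- g) = hcode n g"
  by (simp add: hcode_def)

lemma lgen_cases: "lgen a = gen (fst a) \<or> lgen a = - gen (fst a)"
  by (simp add: lgen_def)

lemma len_lgen: "additive_map f \<Longrightarrow> len (f (lgen a)) = len (f (gen (fst a)))"
  using lgen_cases [of a] by (auto simp: additive_map_neg)

lemma hcode_lgen: "additive_map f \<Longrightarrow> hcode n (f (lgen a)) = hcode n (f (gen (fst a)))"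
  using lgen_cases [of a] by (auto simp: additive_map_neg hcode_neg)

lemma sum_update_less:
  fixes f g :: "nat \<Rightarrow> nat"
  assumes "i < n" "\<And>k. k < n \<Longrightarrow> k \<noteq> i \<Longrightarrow> f k = g k" "f i < g i"
  shows "sum f {..<n} < sum g {..<n}"
proof (rule sum_strict_mono_ex1)
  show "\<forall>k\<in>{..<n}. f k \<le> g k" using assms by (metis lessThan_iff less_imp_le order_refl)
qed (use assms in auto)

lemma sum_update_eq:
  fixes f g :: "nat \<Rightarrow> nat"
  assumes "i < n" "\<And>k. k < n \<Longrightarrow> k \<noteq> i \<Longrightarrow> f k = g k" "f i = g i"
  shows "sum f {..<n} = sum g {..<n}"
  by (rule sum.cong) (use assms in auto)

lemma tr_gen_other:
  assumes "fst a < n" "fst c < n" "fst a \<noteq> fst c" "k < n" "k \<noteq> fst a"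
  shows "tr n a c (gen k) = gen k"
  using tr_lgen(2) [of a n c "(k, True)"] assms by (simp add: lgen_def)

lemma nlen_tr:
  assumes f: "additive_map f" and a: "fst a < n" "fst c < n" "fst a \<noteq> fst c"
  shows "len (f (lgen a) + f (lgen c)) < len (f (lgen a)) \<Longrightarrow> nlen n (f \<circ> tr n a c) < nlen n f"
    and "len (f (lgen a) + f (lgen c)) = len (f (lgen a)) \<Longrightarrow> nlen n (f \<circ> tr n a c) = nlen n f"
    and "hcode n (f (lgen a) + f (lgen c)) < hcode n (f (lgen a)) \<Longrightarrow> ncode n (f \<circ> tr n a c) < ncode n f"
proof -
  have ft: "additive_map (f \<circ> tr n a c)"
    using f endo_tr [OF a(1,2)] by (intro additive_map_comp) (auto simp: endo_def)
  have *: "(f \<circ> tr n a c) (lgen a) = f (lgen a) + f (lgen c)"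
    by (simp add: tr_lgen a additive_map_add [OF f])
  have o: "(f \<circ> tr n a c) (gen k) = f (gen k)" if "k < n" "k \<noteq> fst a" for k
    using that a by (simp add: tr_gen_other)
  have l: "len ((f \<circ> tr n a c) (gen (fst a))) = len (f (lgen a) + f (lgen c))"
    "hcode n ((f \<circ> tr n a c) (gen (fst a))) = hcode n (f (lgen a) + f (lgen c))"
    by (simp_all only: * flip: len_lgen [OF ft] hcode_lgen [OF ft])
  show "nlen n (f \<circ> tr n a c) < nlen n f" if "len (f (lgen a) + f (lgen c)) < len (f (lgen a))"
    unfolding nlen_def by (rule sum_update_less [OF a(1)]) (use that in \<open>simp_all only: o l not_False_eq_True len_lgen [OF f]\<close>)
  show "nlen n (f \<circ> tr n a c) = nlen n f" if "len (f (lgen a) + f (lgen c)) = len (f (lgen a))"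
    unfolding nlen_def by (rule sum_update_eq [OF a(1)]) (use that in \<open>simp_all only: o l not_False_eq_True len_lgen [OF f]\<close>)
  show "ncode n (f \<circ> tr n a c) < ncode n f" if "hcode n (f (lgen a) + f (lgen c)) < hcode n (f (lgen a))"
    unfolding ncode_def by (rule sum_update_less [OF a(1)]) (use that in \<open>simp_all only: o l not_False_eq_True hcode_lgen [OF f]\<close>)
qed

text \<open>In \<open>v + w\<close> the initial segment \<open>winv d\<close> of \<open>w\<close> is
  replaced by the smaller word \<open>p\<close> of the same length. Since the segment fills at most
  half of \<open>w\<close>, the half read from the other end does not change.\<close>

lemma half_code_less:
  assumes w: "fgw w = winv d @ z" and v: "fgw v = p @ d" and pd: "length p = length d"
    and vw: "fgw (v + w) = p @ z" and lw: "2 * length d \<le> len w"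
    and less: "code (2 * n) p < code (2 * n) (winv d)" and n: "n > 0"
  shows "hcode n (v + w) < hcode n w"
proof -
  let ?h = "Suc (length d + length z) div 2"
  have z: "length d \<le> length z" using lw w by (simp add: len_def)
  then have h: "length d \<le> ?h" "?h \<le> length z \<or> ?h - length z = 0" by auto
  have "half (fgw w) = winv d @ take (?h - length d) z" "half (fgw (v + w)) = p @ take (?h - length d) z"
    using h by (simp_all add: half_def w vw pd)
  then have "code (2 * n) (half (fgw (v + w))) < code (2 * n) (half (fgw w))"
    using less n by (simp add: code_append)
  moreover have "half (fgw (- (v + w))) = half (fgw (- w))"
  proof -
    have "fgw (- (v + w)) = winv z @ winv p" "fgw (- w) = winv z @ d"
      by (simp_all only: fgw_neg vw w winv_simps)
    moreover have "?h \<le> length z" using z by linarith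
    ultimately show ?thesis by (simp add: half_def pd add.commute)
  qed
  ultimately show ?thesis by (simp add: hcode_def)
qed

text \<open>No transvection shortens an image, so at most half of each of two adjacent images
  cancels. Hence the image of \<open>b\<close> could be consumed completely only if exactly half of
  it cancelled on each side. Writing it as \<open>p @ d\<close>, one neighbour could then exchange
  \<open>winv d\<close> for \<open>p\<close> and the other \<open>p\<close> for
  \<open>winv d\<close> at no cost in length; whichever of the two words has the smaller code yields
  a decreasing move.\<close>

lemma Nielsen_minimal:
  assumes f: "aut n f" and n: "n > 0"
    and min: "\<And>a c. fst a < n \<Longrightarrow> fst c < n \<Longrightarrow> fst a \<noteq> fst c \<Longrightarrow>
      \<not> (nlen n (f \<circ> tr n a c) < nlen n f \<or> nlen n (f \<circ> tr n a c) = nlen n f \<and> ncode n (f \<circ> tr n a c) < ncode n f)"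
    and a: "fst a < n" and b: "fst b < n" and c: "fst c < n"
    and ab: "b \<noteq> letter_inv a" and bc: "c \<noteq> letter_inv b"
  shows "kap (f (lgen a)) (f (lgen b)) + kap (f (lgen b)) (f (lgen c)) < len (f (lgen b))"
proof -
  have add: "additive_map f" using f by (simp add: aut_def endo_def)
  let ?f = "\<lambda>a. f (lgen a)"
  have inj: "f x = 0 \<Longrightarrow> pr n x = 0" for x
    using ainv(3) [OF f] additive_map_zero [OF endo_additive [OF ainv(1) [OF f]]] by (metis comp_apply)
  have nz: "?f x \<noteq> 0" if "fst x < n" for x
  proof
    assume "?f x = 0"
    then have "pr n (lgen x) = 0" by (rule inj)
    then have "lgen x = 0" using that by (auto simp: lgen_def split: if_splits)
    then show False using fgw_lgen [of x] by simp
  qed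
  have neg: "?f (letter_inv x) = - ?f x" for x by (simp add: additive_map_neg [OF add])
  have N1: "len (?f x) \<le> len (?f x + ?f y)" "len (?f y) \<le> len (?f x + ?f y)"
    if "fst x < n" "fst y < n" "fst x \<noteq> fst y" for x y
  proof -
    show "len (?f x) \<le> len (?f x + ?f y)"
      using min [OF that] nlen_tr(1) [OF add that] by force
    have "len (- ?f y) \<le> len (- ?f y + - ?f x)"
      using min [of "letter_inv y" "letter_inv x"] nlen_tr(1) [OF add, of "letter_inv y" n "letter_inv x"] that neg
      by (metis fst_letter_inv not_le)
    then show "len (?f y) \<le> len (?f x + ?f y)"
      by (simp only: len_neg flip: minus_add)
  qed
  have le: "2 * kap (?f x) (?f y) \<le> len (?f x)" "2 * kap (?f x) (?f y) \<le> len (?f y)"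
    if "fst x < n" "fst y < n" "fst x \<noteq> fst y" for x y
    using N1 [OF that] kap_props(1,2,3) [of "?f x" "?f y"] by linarith+
  have eq: "2 * kap (?f x) (?f y) < len (?f y)" if "fst x < n" "fst x = fst y" "y \<noteq> letter_inv x" for x y
  proof -
    have "x = y" using that by (auto simp: letter_inv_def prod_eq_iff)
    then show ?thesis using kap_self [OF nz [OF that(1)]] by simp
  qed
  show ?thesis
  proof (rule ccontr)
    assume ge: "\<not> ?thesis"
    have "fst a \<noteq> fst b"
    proof
      assume "fst a = fst b"
      then have "2 * kap (?f a) (?f b) < len (?f b)" using eq a ab by auto
      moreover have "2 * kap (?f b) (?f c) \<le> len (?f b)"
        using le(1) [of b c] eq [of b c] b c bc by (cases "fst b = fst c") (auto simp: len_lgen [OF add])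
      ultimately show False using ge by linarith
    qed
    moreover have "fst b \<noteq> fst c"
    proof
      assume "fst b = fst c"
      then have "2 * kap (?f b) (?f c) < len (?f b)" using eq b bc by (auto simp: len_lgen [OF add])
      moreover have "2 * kap (?f a) (?f b) \<le> len (?f b)"
        using le(2) [of a b] \<open>fst a \<noteq> fst b\<close> a b by auto
      ultimately show False using ge by linarith
    qed
    ultimately have abc: "fst a \<noteq> fst b" "fst b \<noteq> fst c" by auto
    define u v w where "u = ?f a" and "v = ?f b" and "w = ?f c"
    note uvw = u_def [symmetric] v_def [symmetric] w_def [symmetric]
    define h where "h = kap u v"
    have hs: "2 * kap u v = len v" "kap v w = h" "len v = 2 * h"
      using le(2) [OF a b abc(1), folded u_def v_def] le(1) [OF b c abc(2), folded v_def w_def] ge [folded u_def v_def w_def]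
      unfolding h_def by linarith+
    have lu: "2 * h \<le> len u"
      unfolding h_def u_def v_def by (rule le(1) [OF a b abc(1)])
    have lw: "2 * h \<le> len w"
      using le(2) [OF b c abc(2), folded v_def w_def] by (simp only: hs(2))
    define p d where "p = take h (fgw v)" and "d = drop h (fgw v)"
    have pd: "fgw v = p @ d" "length p = h" "length d = h" using hs by (simp_all add: p_def d_def len_def)
    have d: "d = winv (take h (fgw w))" using kap_props(5) [of v w] hs by (simp add: d_def)
    then have w': "fgw w = winv d @ drop h (fgw w)" by simp
    have vw': "fgw (v + w) = p @ drop h (fgw w)" using kap_props(4) [of v w] hs by (simp add: p_def)
    have "drop (len u - h) (fgw u) = winv p" using kap_props(5) [of u v] by (simp add: h_def p_def)
    then have u': "fgw u = take (len u - h) (fgw u) @ winv p" by (metis append_take_drop_id)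
    have uv': "fgw (u + v) = take (len u - h) (fgw u) @ d" using kap_props(4) [of u v] by (simp add: h_def d_def)
    have "v \<noteq> 0" using nz [OF b] by (simp add: v_def)
    then have "h > 0" using hs by (metis len_zero_iff mult_is_0 neq0_conv)
    have "p \<noteq> winv d"
    proof
      assume "p = winv d"
      then have "reduced (winv d @ d)" using reduced_fgw [of v] by (simp add: pd)
      moreover have "d \<noteq> []" using pd \<open>h > 0\<close> by auto
      ultimately show False by (cases d) (auto simp: reduced_append_iff reduced_Cons)
    qed
    have vF: "fst ` set (fgw v) \<subseteq> {..<n}"
      using f by (simp add: v_def aut_def endo_def flip: pr_fixed_iff)
    have "code (2 * n) p \<noteq> code (2 * n) (winv d)"
    proof
      assume "code (2 * n) p = code (2 * n) (winv d)"
      moreover have "fst ` set p \<subseteq> {..<n}" "fst ` set (winv d) \<subseteq> {..<n}"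
        using vF by (auto simp: pd winv_def)
      ultimately show False using code_inj [of p "winv d" n] pd \<open>p \<noteq> winv d\<close> by auto
    qed
    then consider "code (2 * n) p < code (2 * n) (winv d)" | "code (2 * n) (winv d) < code (2 * n) p" by linarith
    then show False
    proof cases
      case 1
      have "hcode n (v + w) < hcode n w"
        by (rule half_code_less [OF w' pd(1) _ vw' _ 1 n]) (use pd lw in auto)
      moreover have "len (v + w) = len w" using kap_props(3) [of v w] hs by simp
      \<comment> \<open>Transvections multiply on the right, so the product \<open>v + w\<close> is
        reached through the inverse letters.\<close>
      moreover have "- w + - v = - (v + w)" by (simp only: minus_add)
      ultimately have "len (?f (letter_inv c) + ?f (letter_inv b)) = len (?f (letter_inv c))"
        "hcode n (?f (letter_inv c) + ?f (letter_inv b)) < hcode n (?f (letter_inv c))"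
        by (simp_all only: neg uvw len_neg hcode_neg)
      then show False
        using min [of "letter_inv c" "letter_inv b"] nlen_tr(2,3) [OF add, of "letter_inv c" n "letter_inv b"] b c abc
        by simp
    next
      case 2
      have nuv: "- v + - u = - (u + v)" by (simp only: minus_add)
      have nu: "fgw (- u) = p @ winv (take (len u - h) (fgw u))"
        by (subst fgw_neg, subst u') simp
      have nv: "fgw (- v) = winv d @ winv p" by (simp add: fgw_neg pd)
      have nuv': "fgw (- v + - u) = winv d @ winv (take (len u - h) (fgw u))"
        by (simp only: nuv fgw_neg uv' winv_simps)
      have "hcode n (- v + - u) < hcode n (- u)"
        by (rule half_code_less [OF _ nv _ nuv']) (use nu pd lu 2 n in auto)
      then have "hcode n (u + v) < hcode n u" by (simp only: nuv hcode_neg)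
      moreover have "len (u + v) = len u" using kap_props(3) [of u v] hs(1) by linarith
      ultimately show False
        using min [of a b] nlen_tr(2,3) [OF add, of a n b] a b abc by (simp add: uvw)
    qed
  qed
qed

text \<open>By \<open>K\<close> a nonempty middle part of the image of every letter survives both
  neighbours. The induction adds letters on the right and keeps the uncancelled tail of the last
  image, whose loss depends only on the letter before it.\<close>

lemma length_le_len:
  assumes f: "additive_map f"
    and K: "\<And>a b c. fst a < n \<Longrightarrow> fst b < n \<Longrightarrow> fst c < n \<Longrightarrow> b \<noteq> letter_inv a \<Longrightarrow> c \<noteq> letter_inv b \<Longrightarrow>
      kap (f (lgen a)) (f (lgen b)) + kap (f (lgen b)) (f (lgen c)) < len (f (lgen b))"
    and ls: "reduced ls" "fst ` set ls \<subseteq> {..<n}"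
  shows "length ls \<le> len (f (Fg ls))"
proof (cases ls rule: rev_cases)
  case (snoc l z)
  let ?W = "\<lambda>a. f (lgen a)"
  have "reduced (l @ [z]) \<Longrightarrow> fst ` set (l @ [z]) \<subseteq> {..<n} \<Longrightarrow>
    \<exists>Q r. fgw (f (Fg (l @ [z]))) = Q @ drop r (fgw (?W z)) \<and> length l \<le> length Q \<and>
      (r = 0 \<or> (\<exists>y. fst y < n \<and> z \<noteq> letter_inv y \<and> r = kap (?W y) (?W z)))" for l z
  proof (induction l arbitrary: z rule: rev_induct)
    case Nil
    then show ?case by (intro exI [of _ "[]"] exI [of _ 0]) (simp add: Fg_Cons flip: zero_fg_def)
  next
    case (snoc a l)
    have red: "reduced (l @ [a])" and az: "z \<noteq> letter_inv a" "fst z < n" "fst a < n"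
      using snoc.prems by (auto simp: reduced_append_iff reduced_Cons)
    obtain Q r where Q: "fgw (f (Fg (l @ [a]))) = Q @ drop r (fgw (?W a))" "length l \<le> length Q"
      and r: "r = 0 \<or> (\<exists>y. fst y < n \<and> a \<noteq> letter_inv y \<and> r = kap (?W y) (?W a))"
      using snoc.IH [of a] red snoc.prems by auto
    let ?s = "kap (?W a) (?W z)" and ?n = "len (?W a)"
    have rs: "r + ?s < ?n"
      using r
    proof
      assume "r = 0"
      moreover have "kap (?W a) (?W a) + ?s < ?n" by (rule K) (use az in \<open>auto\<close>)
      ultimately show ?thesis by linarith
    next
      assume "\<exists>y. fst y < n \<and> a \<noteq> letter_inv y \<and> r = kap (?W y) (?W a)"
      then show ?thesis using K az by blast
    qed
    \<comment> \<open>The part of the image of \<open>a\<close> that is lost neither to the left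
      neighbour (\<open>r\<close> letters) nor to the right one.\<close>
    define m where "m = take (?n - ?s - r) (drop r (fgw (?W a)))"
    have m: "m \<noteq> []" using rs by (simp add: m_def len_def)
    have split: "drop r (fgw (?W a)) = m @ drop (?n - ?s) (fgw (?W a))"
      using rs append_take_drop_id [of "?n - ?s - r" "drop r (fgw (?W a))"] by (simp add: m_def)
    have c: "drop (?n - ?s) (fgw (?W a)) = winv (take ?s (fgw (?W z)))" by (rule kap_props(5))
    have "take (?n - ?s) (fgw (?W a)) = take r (fgw (?W a)) @ m"
      using rs by (simp add: m_def take_add [symmetric] flip: take_add)
    then have "fgw (?W a + ?W z) = take r (fgw (?W a)) @ m @ drop ?s (fgw (?W z))"
      using kap_props(4) [of "?W a" "?W z"] by simp
    then have "reduced (m @ drop ?s (fgw (?W z)))"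
      using reduced_fgw [of "?W a + ?W z"] by (simp add: reduced_append_iff)
    then have "fgw (f (Fg (l @ [a])) + ?W z) = Q @ m @ drop ?s (fgw (?W z))"
      using m by (intro fgw_add_reduced [where c = "winv (take ?s (fgw (?W z)))"]) (simp_all add: Q split c)
    moreover have "Fg ((l @ [a]) @ [z]) = Fg (l @ [a]) + lgen z"
    proof -
      have "foldr push (l @ [a]) [z] = (l @ [a]) @ [z]"
        using fgw_add_reduced [of "Fg (l @ [a])" l "[a]" "[]" "lgen z" "[z]"] snoc.prems red
        by (simp add: fgw_plus fgw_lgen reduced_append_iff)
      then show ?thesis by (simp add: plus_fg_def fgw_lgen red)
    qed
    ultimately have "fgw (f (Fg ((l @ [a]) @ [z]))) = (Q @ m) @ drop ?s (fgw (?W z))"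
      by (simp only: additive_map_add [OF f] append_assoc)
    moreover have "length (l @ [a]) \<le> length (Q @ m)"
      using Q(2) m by (cases m) auto
    ultimately show ?case using az by blast
  qed
  then obtain Q r where Q: "fgw (f (Fg ls)) = Q @ drop r (fgw (?W z))" "length l \<le> length Q"
      and r: "r = 0 \<or> (\<exists>y. fst y < n \<and> z \<noteq> letter_inv y \<and> r = kap (?W y) (?W z))"
    using ls snoc by blast
  have z: "fst z < n" using ls snoc by auto
  have "r < len (?W z)"
    using r
  proof
    assume "r = 0"
    then show ?thesis using K [of z z z] z by auto
  next
    assume "\<exists>y. fst y < n \<and> z \<noteq> letter_inv y \<and> r = kap (?W y) (?W z)"
    then obtain y where "fst y < n" "z \<noteq> letter_inv y" "r = kap (?W y) (?W z)" by blast
    then show ?thesis using K [of y z z] z by auto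
  qed
  then show ?thesis using Q snoc by (simp add: len_def)
qed simp

text \<open>Sorting: inversions remove the negative signs one at a time, then each transposition
  increases the number of fixed generators.\<close>

lemma signed_perm_in_Nie:
  assumes f: "aut n f" and sp: "\<And>i. i < n \<Longrightarrow> \<exists>a. f (gen i) = lgen a"
  shows "f \<in> Nie n"
proof -
  have pos: "f \<in> Nie n" if "aut n f" "\<And>i. i < n \<Longrightarrow> \<exists>j. f (gen i) = gen j" for f
    using that
  proof (induction "card {i. i < n \<and> f (gen i) \<noteq> gen i}" arbitrary: f rule: less_induct)
    case less
    show ?case
    proof (cases "\<exists>i<n. f (gen i) \<noteq> gen i")
      case False
      then have "f = pr n" using less.prems by (intro endo_eqI [of n]) (auto simp: aut_def endo_pr)
      then show ?thesis by (simp add: Nie_pr)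
    next
      case True
      then obtain j where j: "j < n" "f (gen j) \<noteq> gen j" by blast
      obtain i where fj: "f (gen j) = gen i" using less.prems j by blast
      have pp: "pr n (f x) = f x" for x using less.prems(1) by (simp add: aut_def endo_def)
      have i: "i < n" using pp [of "gen j"] unfolding fj by (metis pr_gen fgw_zero fgw_gen list.distinct(1))
      have inj: "x = y" if "x < n" "y < n" "f (gen x) = f (gen y)" for x y
      proof -
        have "pr n (gen x) = pr n (gen y)" using ainv(3) [OF less.prems(1)] that by (metis comp_apply)
        then show ?thesis using that by simp
      qed
      have ij: "i \<noteq> j" using fj j by auto
      have fi: "f (gen i) \<noteq> gen i" using inj [OF i j(1)] fj ij by auto
      have add: "additive_map f" using less.prems(1) by (simp add: aut_def endo_def)
      let ?g = "f \<circ> swp n i j"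
      have "{k. k < n \<and> ?g (gen k) \<noteq> gen k} \<subset> {k. k < n \<and> f (gen k) \<noteq> gen k}"
        using i j fj fi ij by (auto simp: additive_map_zero [OF add] split: if_splits)
      then have "card {k. k < n \<and> ?g (gen k) \<noteq> gen k} < card {k. k < n \<and> f (gen k) \<noteq> gen k}"
        by (intro psubset_card_mono) auto
      then have "?g \<in> Nie n"
        by (rule less.hyps [OF _ aut_comp [OF less.prems(1) aut_swp [OF i j(1)]]])
           (use less.prems i j in \<open>auto\<close>)
      then show ?thesis by (rule Nie_swp_back [OF _ i j(1) aut_endo [OF less.prems(1)]])
    qed
  qed
  show ?thesis
    using assms
  proof (induction "card {i. i < n \<and> (\<forall>j. f (gen i) \<noteq> gen j)}" arbitrary: f rule: less_induct)
    case less
    show ?case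
    proof (cases "\<exists>i<n. \<forall>j. f (gen i) \<noteq> gen j")
      case False
      then show ?thesis using pos less.prems by blast
    next
      case True
      then obtain i where i: "i < n" "\<And>j. f (gen i) \<noteq> gen j" by blast
      then obtain j where j: "f (gen i) = - gen j"
        using less.prems(2) [of i] by (metis lgen_def)
      have add: "additive_map f" using less.prems(1) by (simp add: aut_def endo_def)
      let ?g = "f \<circ> eps n i"
      have "{k. k < n \<and> (\<forall>j. ?g (gen k) \<noteq> gen j)} \<subset> {k. k < n \<and> (\<forall>j. f (gen k) \<noteq> gen j)}"
        using i j by (auto simp: additive_map_neg [OF add])
      then have "card {k. k < n \<and> (\<forall>j. ?g (gen k) \<noteq> gen j)} < card {k. k < n \<and> (\<forall>j. f (gen k) \<noteq> gen j)}"
        by (intro psubset_card_mono) auto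
      moreover have "\<exists>a. ?g (gen k) = lgen a" if "k < n" for k
        using less.prems(2) [OF that] that i j
        by (auto simp: additive_map_neg [OF add] lgen_def intro: exI [of _ "(j, True)"])
      ultimately have "?g \<in> Nie n"
        by (rule less.hyps [OF _ aut_comp [OF less.prems(1) aut_eps]])
      then show ?thesis by (rule Nie_eps_back [OF _ i(1) aut_endo [OF less.prems(1)]])
    qed
  qed
qed

text \<open>Descent on total length and then on codes. At a minimal \<open>f\<close> every word is
  at most as long as its image, so the preimage of a generator is a single letter; then
  \<open>f\<close> permutes the generators up to sign.\<close>

theorem Nielsen:
  assumes "aut n f" shows "f \<in> Nie n"
  using assms
proof (induction f rule: wf_induct [where r = "measures [nlen n, ncode n]"])
  case 1
  show ?case by simp
next
  case (2 f)
  have endo: "endo n f" using 2(2) by (rule aut_endo)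
  show ?case
  proof (cases "n > 0 \<and> (\<forall>a c. fst a < n \<longrightarrow> fst c < n \<longrightarrow> fst a \<noteq> fst c \<longrightarrow>
      \<not> (nlen n (f \<circ> tr n a c) < nlen n f \<or> nlen n (f \<circ> tr n a c) = nlen n f \<and> ncode n (f \<circ> tr n a c) < ncode n f))")
    case False
    show ?thesis
    proof (cases "n = 0")
      case True
      then have "f = pr n" using endo by (intro endo_eqI [of n]) (auto simp: endo_pr)
      then show ?thesis by (simp add: Nie_pr)
    next
      case False
      then obtain a c where ac: "fst a < n" "fst c < n" "fst a \<noteq> fst c"
        and "nlen n (f \<circ> tr n a c) < nlen n f \<or> nlen n (f \<circ> tr n a c) = nlen n f \<and> ncode n (f \<circ> tr n a c) < ncode n f"
        using \<open>\<not> (n > 0 \<and> _)\<close> by blast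
      then have "(f \<circ> tr n a c, f) \<in> measures [nlen n, ncode n]" by auto
      moreover have "aut n (f \<circ> tr n a c)" by (rule aut_comp [OF 2(2) aut_tr [OF ac]])
      ultimately have "f \<circ> tr n a c \<in> Nie n" using 2(1) by blast
      then show ?thesis using ac endo by (rule Nie_tr_back)
    qed
  next
    case True
    then have n: "n > 0" and min: "\<And>a c. fst a < n \<Longrightarrow> fst c < n \<Longrightarrow> fst a \<noteq> fst c \<Longrightarrow>
      \<not> (nlen n (f \<circ> tr n a c) < nlen n f \<or> nlen n (f \<circ> tr n a c) = nlen n f \<and> ncode n (f \<circ> tr n a c) < ncode n f)"
      by auto
    have add: "additive_map f" using endo by (simp add: endo_def)
    have "\<exists>a. ainv n f (gen j) = lgen a" if j: "j < n" for j
    proof -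
      let ?g = "ainv n f (gen j)"
      have "f ?g = gen j" using ainv(2) [OF 2(2)] j by (metis comp_apply pr_gen)
      moreover have "fst ` set (fgw ?g) \<subseteq> {..<n}"
        using ainv(1) [OF 2(2)] by (simp add: endo_def flip: pr_fixed_iff)
      then have "length (fgw ?g) \<le> len (f (Fg (fgw ?g)))"
        by (intro length_le_len [where n = n] add Nielsen_minimal [OF 2(2) n min]) auto
      ultimately have "length (fgw ?g) \<le> 1" by (simp add: len_def fgw_gen)
      moreover have "fgw ?g \<noteq> []"
      proof
        assume "fgw ?g = []"
        then have "?g = 0" by (metis fgw_zero fgw_inverse)
        then show False using \<open>f ?g = gen j\<close> by (metis additive_map_zero [OF add] fgw_zero fgw_gen list.distinct(1))
      qed
      ultimately obtain a where "fgw ?g = [a]" by (cases "fgw ?g") auto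
      then have "?g = lgen a" by (metis fgw_inverse fgw_lgen)
      then show ?thesis by blast
    qed
    then have perm: "\<exists>a. f (gen i) = lgen a" if "i < n" for i
    proof -
      have "\<exists>s. \<forall>j<n. ainv n f (gen j) = lgen (s j)" using \<open>\<And>j. j < n \<Longrightarrow> \<exists>a. ainv n f (gen j) = lgen a\<close> by metis
      then obtain s where s: "\<And>j. j < n \<Longrightarrow> ainv n f (gen j) = lgen (s j)" by blast
      have fs: "f (lgen (s j)) = gen j" if "j < n" for j
        using ainv(2) [OF 2(2)] that s by (metis comp_apply pr_gen)
      have sl: "fst (s j) < n" if "j < n" for j
      proof -
        have "pr n (lgen (s j)) = lgen (s j)" using ainv(1) [OF 2(2)] s [OF that] by (metis endo_def)
        then show ?thesis by (simp add: pr_fixed_iff fgw_lgen)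
      qed
      have fsign: "f (gen (fst (s j))) = lgen (j, snd (s j))" if "j < n" for j
      proof (cases "snd (s j)")
        case True
        then show ?thesis using fs [OF that] by (simp add: lgen_def)
      next
        case False
        then have "- f (gen (fst (s j))) = gen j" using fs [OF that] by (simp add: lgen_def additive_map_neg [OF add])
        then have "f (gen (fst (s j))) = - gen j" by (metis minus_minus)
        then show ?thesis using False by (simp add: lgen_def)
      qed
      have "inj_on (fst \<circ> s) {..<n}"
      proof (rule inj_onI)
        fix x y assume xy: "x \<in> {..<n}" "y \<in> {..<n}" "(fst \<circ> s) x = (fst \<circ> s) y"
        then have "lgen (x, snd (s x)) = lgen (y, snd (s y))" using fsign [of x] fsign [of y] by simp
        then show "x = y" by (metis fgw_lgen list.inject prod.inject)
      qed
      then have "(fst \<circ> s) ` {..<n} = {..<n}"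
        using sl by (intro endo_inj_surj) auto
      then obtain j where "j < n" "fst (s j) = i" using \<open>i < n\<close> by (metis comp_apply imageE lessThan_iff)
      then show ?thesis using fsign by blast
    qed
    show ?thesis by (rule signed_perm_in_Nie [OF 2(2) perm])
  qed
qed

section \<open>Injectivity of the Magnus expansion\<close>

text \<open>The generators of the syllables, that is of the maximal powers of one generator in a
  reduced word. The Magnus coefficient at this list is the product of the exponents of the syllables
  and hence nonzero.\<close>

definition syl :: "word \<Rightarrow> nat list" where
  "syl w = remdups_adj (map fst w)"

lemma mu_lgen_mult:
  "snd a \<Longrightarrow> cf (mu (lgen a) * f) (b # v) = cf f (b # v) + (if b = fst a then cf f v else 0)"
  "\<not> snd a \<Longrightarrow> cf (mu (lgen a) * f) (b # v) = cf f (b # v) - (if b = fst a then cf (mu (lgen a) * f) v else 0)"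
proof -
  show "snd a \<Longrightarrow> cf (mu (lgen a) * f) (b # v) = cf f (b # v) + (if b = fst a then cf f v else 0)"
    by (simp add: lgen_def mu_gen distrib_right cf_X_mult_Cons)
  assume "\<not> snd a"
  then have "(1 + X (fst a)) * (mu (lgen a) * f) = f"
    by (simp add: lgen_def mu_neg_gen X_Xinv flip: mult.assoc)
  then have "cf f (b # v) = cf ((1 + X (fst a)) * (mu (lgen a) * f)) (b # v)" by simp
  also have "\<dots> = cf (mu (lgen a) * f) (b # v) + (if b = fst a then cf (mu (lgen a) * f) v else 0)"
    by (simp add: distrib_right cf_X_mult_Cons)
  finally show "cf (mu (lgen a) * f) (b # v) = cf f (b # v) - (if b = fst a then cf (mu (lgen a) * f) v else 0)"
    by simp
qed

lemma cf_mult_lgen_other: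
  assumes "v = [] \<or> hd v \<noteq> fst a" shows "cf (mu (lgen a) * f) v = cf f v"
  using assms by (cases v; cases "snd a") (auto simp: mu_lgen_mult)

lemma cf_mult_lgen_same:
  assumes "v = [] \<or> hd v \<noteq> fst a"
  shows "cf (mu (lgen a) * f) (fst a # v) = cf f (fst a # v) + (if snd a then 1 else -1) * cf f v"
  using cf_mult_lgen_other [OF assms] by (cases "snd a") (auto simp: mu_lgen_mult)

text \<open>Here \<open>e\<close> is the exponent of the first syllable and \<open>c\<close> the
  product of the later ones. At a list without equal neighbours each syllable can contribute at most
  one letter, so a list of the right length other than the list of syllables has coefficient
  0.\<close>

lemma mu_syl:
  assumes "reduced (a # w)"
  shows "\<exists>c e. c \<noteq> 0 \<and> e \<noteq> 0 \<and> (e > 0 \<longleftrightarrow> snd a) \<and>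
    (\<forall>v. distinct_adj v \<longrightarrow> v = [] \<or> hd v \<noteq> fst a \<longrightarrow> length (syl (a # w)) \<le> Suc (length v) \<longrightarrow>
      cf (mu (Fg (a # w))) v = (if v = tl (syl (a # w)) then c else 0) \<and>
      cf (mu (Fg (a # w))) (fst a # v) = (if v = tl (syl (a # w)) then e * c else 0))"
  using assms
proof (induction w arbitrary: a)
  case Nil
  have m: "mu (Fg [a]) = mu (lgen a) * 1" using Nil by (simp add: Fg_Cons flip: zero_fg_def)
  show ?case
    by (rule exI [of _ 1], rule exI [of _ "if snd a then 1 else -1"])
       (auto simp: m cf_mult_lgen_other cf_mult_lgen_same cf_one syl_def simp del: mult_1_right)
next
  case (Cons b w)
  have rb: "reduced (b # w)" and ab: "b \<noteq> letter_inv a" using Cons.prems by (simp_all add: reduced_Cons)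
  obtain c e where ce: "c \<noteq> 0" "e \<noteq> 0" "e > 0 \<longleftrightarrow> snd b"
    and val: "\<And>v. distinct_adj v \<Longrightarrow> v = [] \<or> hd v \<noteq> fst b \<Longrightarrow> length (syl (b # w)) \<le> Suc (length v) \<Longrightarrow>
      cf (mu (Fg (b # w))) v = (if v = tl (syl (b # w)) then c else 0) \<and>
      cf (mu (Fg (b # w))) (fst b # v) = (if v = tl (syl (b # w)) then e * c else 0)"
    using Cons.IH [OF rb] by blast
  have m: "mu (Fg (a # b # w)) = mu (lgen a) * mu (Fg (b # w))"
    using Cons.prems by (simp add: Fg_Cons [of a] mu_add)
  have syl_Cons: "syl (b # w) = fst b # tl (syl (b # w))"
    by (simp add: syl_def)
  show ?case
  proof (cases "fst a = fst b")
    case True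
    then have s: "snd a = snd b" using ab by (auto simp: letter_inv_def prod_eq_iff)
    have sy: "syl (a # b # w) = syl (b # w)" using True by (simp add: syl_def)
    \<comment> \<open>The same letter is repeated in a reduced word, so the exponent moves away from
      0.\<close>
    define d where "d = e + (if snd a then 1 else -1)"
    have "cf (mu (Fg (a # b # w))) v = (if v = tl (syl (b # w)) then c else 0) \<and>
      cf (mu (Fg (a # b # w))) (fst a # v) = (if v = tl (syl (b # w)) then d * c else 0)"
      if "distinct_adj v" "v = [] \<or> hd v \<noteq> fst a" "length (syl (b # w)) \<le> Suc (length v)" for v
      unfolding m cf_mult_lgen_other [OF that(2)] cf_mult_lgen_same [OF that(2)]
      using val [of v] that True by (auto simp: algebra_simps d_def)
    moreover have "d \<noteq> 0" "d > 0 \<longleftrightarrow> snd a" using ce s by (auto simp: d_def)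
    ultimately show ?thesis using ce(1) unfolding sy by blast
  next
    case False
    have sy: "syl (a # b # w) = fst a # syl (b # w)" using False by (simp add: syl_def)
    have v0: "cf (mu (Fg (b # w))) (fst a # v) = 0" if "distinct_adj v" "v = [] \<or> hd v \<noteq> fst a" "length (syl (b # w)) \<le> length v" for v
    proof -
      have "fst a # v \<noteq> tl (syl (b # w))"
      proof
        assume "fst a # v = tl (syl (b # w))"
        then have "Suc (length v) = length (tl (syl (b # w)))" by (metis length_Cons)
        then show False using that(3) by simp
      qed
      then show ?thesis using val [of "fst a # v"] that False by (cases v) (auto simp: distinct_adj_Cons)
    qed
    have v1: "cf (mu (Fg (b # w))) v = (if v = syl (b # w) then e * c else 0)"
      if "distinct_adj v" "length (syl (b # w)) \<le> length v" for v
    proof -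
      have "v \<noteq> []" using that(2) syl_Cons by auto
      then obtain d u where v: "v = d # u" by (cases v) auto
      show ?thesis
      proof (cases "d = fst b")
        case True
        then have "u = [] \<or> hd u \<noteq> fst b" using that(1) by (auto simp: v distinct_adj_Cons)
        moreover have "v = syl (b # w) \<longleftrightarrow> u = tl (syl (b # w))" using syl_Cons True v by (metis list.inject)
        ultimately show ?thesis using val [of u] that True by (auto simp: v distinct_adj_Cons)
      next
        case False
        have "v \<noteq> tl (syl (b # w))" "v \<noteq> syl (b # w)" using that(2) syl_Cons v False
          by (metis impossible_Cons, metis list.inject)
        then show ?thesis using val [of v] that False v by auto
      qed
    qed
    show ?thesis
      by (rule exI [of _ "e * c"], rule exI [of _ "if snd a then 1 else -1"])
         (use ce v0 v1 in \<open>auto simp: m sy cf_mult_lgen_other cf_mult_lgen_same\<close>)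
  qed
qed

lemma syl_Cons: "syl (a # w) = fst a # tl (syl (a # w))"
  by (simp add: syl_def)

lemma distinct_adj_syl: "distinct_adj (syl w)"
  by (simp add: syl_def)

lemma mu_syl_coeff:
  assumes "fgw g \<noteq> []"
  shows "cf (mu g) (syl (fgw g)) \<noteq> 0"
    and "\<And>v. distinct_adj v \<Longrightarrow> length v = length (syl (fgw g)) \<Longrightarrow> v \<noteq> syl (fgw g) \<Longrightarrow> cf (mu g) v = 0"
proof -
  obtain a w where aw: "fgw g = a # w" using assms by (cases "fgw g") auto
  then have r: "reduced (a # w)" using reduced_fgw [of g] by simp
  have g: "mu g = mu (Fg (a # w))" by (simp flip: aw)
  have d: "distinct_adj (fst a # tl (syl (a # w)))" using distinct_adj_syl [of "a # w"] syl_Cons [of a w] by simp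
  obtain c e where ce: "c \<noteq> 0" "e \<noteq> 0"
    and val: "\<And>v. distinct_adj v \<Longrightarrow> v = [] \<or> hd v \<noteq> fst a \<Longrightarrow> length (syl (a # w)) \<le> Suc (length v) \<Longrightarrow>
      cf (mu g) v = (if v = tl (syl (a # w)) then c else 0) \<and>
      cf (mu g) (fst a # v) = (if v = tl (syl (a # w)) then e * c else 0)"
    unfolding g using mu_syl [OF r] by blast
  have "cf (mu g) (fst a # tl (syl (a # w))) = e * c"
    using val [of "tl (syl (a # w))"] d by (auto simp: distinct_adj_Cons)
  then show "cf (mu g) (syl (fgw g)) \<noteq> 0" using ce syl_Cons [of a w] by (simp add: aw)
  fix v assume v: "distinct_adj v" "length v = length (syl (fgw g))" "v \<noteq> syl (fgw g)"
  have "v \<noteq> []" using v(2) syl_Cons [of a w] by (auto simp: aw)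
  then obtain b u where bu: "v = b # u" by (cases v) auto
  show "cf (mu g) v = 0"
  proof (cases "b = fst a")
    case True
    then have "u \<noteq> tl (syl (a # w))" using v(3) syl_Cons [of a w] by (auto simp: aw bu)
    then show ?thesis using val [of u] v True by (auto simp: bu aw distinct_adj_Cons)
  next
    case False
    have "v \<noteq> tl (syl (a # w))" using v(2) syl_Cons [of a w] by (metis aw length_Cons n_not_Suc_n)
    then show ?thesis using val [of v] v False by (auto simp: bu aw)
  qed
qed

lemma mu_eq_1: assumes "mu g = 1" shows "g = 0"
proof (rule ccontr)
  assume "g \<noteq> 0"
  then have "fgw g \<noteq> []" by (metis fgw_zero fgw_inverse)
  then have "cf 1 (syl (fgw g)) \<noteq> 0" using mu_syl_coeff(1) [of g] assms by simp
  moreover have "syl (fgw g) \<noteq> []" using \<open>fgw g \<noteq> []\<close> by (simp add: syl_def)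
  ultimately show False by (simp add: cf_one)
qed

lemma mu_inj: assumes "mu g = mu h" shows "g = h"
proof -
  have "mu (g - h) = 1" using assms by (simp add: diff_conv_add_uminus mu_add del: add_uminus_conv_diff)
  then show ?thesis using mu_eq_1 [of "g - h"] by simp
qed

section \<open>Automorphisms close to the identity\<close>

definition asub :: "nat \<Rightarrow> (fg \<Rightarrow> fg) \<Rightarrow> ser \<Rightarrow> ser" where
  "asub m f = Sub m (\<lambda>i. mu (f (gen i)) - 1)"

lemma asub_mu: "endo m f \<Longrightarrow> asub m f (mu g) = mu (f g)"
  by (simp add: asub_def endo_def Sub_mu)

lemma deep_mu_Suc [simp]: "deep (Suc 0) (mu g - 1)"
  using deep_mu [of g] by simp

lemma asub_ring: "asub m f 1 = 1" "asub m f (s + t) = asub m f s + asub m f t" "asub m f (s - t) = asub m f s - asub m f t"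
    "asub m f (s * t) = asub m f s * asub m f t"
  unfolding asub_def by (simp_all only: Sub_one Sub_add Sub_diff Sub_mult [OF deep_mu])

lemma cf_asub: "cf (asub m f s) u = (\<Sum>w\<in>Words m (length u). cf s w * cf (mon (\<lambda>i. mu (f (gen i)) - 1) w) u)"
  unfolding asub_def by (rule cf_Sub [OF deep_mu order_refl])

lemma deep_asub: assumes "deep j s" shows "deep j (asub m f s)"
  unfolding deep_def
proof (intro allI impI)
  fix u :: "nat list" assume u: "length u < j"
  have "cf s w * cf (mon (\<lambda>i. mu (f (gen i)) - 1) w) u = 0" if "w \<in> Words m (length u)" for w
    using that u assms by (auto simp: Words_def deep_def)
  then show "cf (asub m f s) u = 0"
    unfolding cf_asub by (intro sum.neutral) auto
qed

text \<open>The Johnson filtration: \<open>f\<close> induces the identity modulo the term k + 1 of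
  the lower central series. For \<open>k = 1\<close> this is triviality on the
  abelianization.\<close>

definition near :: "nat \<Rightarrow> nat \<Rightarrow> (fg \<Rightarrow> fg) \<Rightarrow> bool" where
  "near m k f \<longleftrightarrow> (\<forall>i<m. deep (Suc k) (mu (f (gen i)) - mu (gen i)))"

text \<open>The difference of the two substitutions raises degrees by \<open>k\<close>, seen by
  exchanging the factors of a monomial one at a time. The comparison is with \<open>pr m\<close>
  instead of the identity because substitutions drop the variables from \<open>m\<close> on.\<close>

lemma near_asub:
  assumes f: "endo m f" and near: "near m k f" and s: "deep j s"
  shows "deep (j + k) (asub m f s - asub m (pr m) s)"
proof -
  let ?Y = "\<lambda>i. mu (f (gen i)) - 1" and ?Z = "\<lambda>i. mu (pr m (gen i)) - 1"
  have YZ: "deep (Suc k) (?Y i - ?Z i)" for i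
    using near f by (cases "i < m") (auto simp: near_def endo_def)
  have mon: "deep (length w + k) (mon ?Y w - mon ?Z w)" for w
  proof (induction w)
    case (Cons a w)
    have "mon ?Y (a # w) - mon ?Z (a # w) = (?Y a - ?Z a) * mon ?Y w + ?Z a * (mon ?Y w - mon ?Z w)"
      by (simp add: algebra_simps)
    moreover have "deep (Suc k + length w) ((?Y a - ?Z a) * mon ?Y w)"
      by (intro deep_mult YZ deep_mon deep_mu)
    moreover have "deep (1 + (length w + k)) (?Z a * (mon ?Y w - mon ?Z w))"
      by (intro deep_mult Cons deep_mu)
    ultimately show ?case by (simp add: deep_add add.commute)
  qed simp
  show ?thesis
    unfolding deep_def
  proof (intro allI impI)
    fix u :: "nat list" assume u: "length u < j + k"
    have *: "cf s w * cf (mon ?Y w) u = cf s w * cf (mon ?Z w) u" for w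
    proof (cases "length w < j")
      case True
      then show ?thesis using s by (simp add: deep_def)
    next
      case False
      then have "cf (mon ?Y w - mon ?Z w) u = 0" using mon [of w] u unfolding deep_def by simp
      then show ?thesis by simp
    qed
    show "cf (asub m f s - asub m (pr m) s) u = 0"
      using * by (simp only: cf_asub cf_simps)
  qed
qed

lemma near_inverse:
  assumes f: "endo m f" and h: "endo m h" "h \<circ> f = pr m" and near: "near m k f"
  shows "near m k h"
  unfolding near_def
proof (intro allI impI)
  fix i assume i: "i < m"
  have "deep (Suc k) (asub m h (mu (f (gen i)) - mu (gen i)))"
    using near i by (intro deep_asub) (simp add: near_def)
  also have "asub m h (mu (f (gen i)) - mu (gen i)) = mu (gen i) - mu (h (gen i))"
    using h i by (simp add: asub_ring asub_mu fun_eq_iff)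
  finally show "deep (Suc k) (mu (h (gen i)) - mu (gen i))" by (simp add: deep_def)
qed

text \<open>If \<open>f\<close> and \<open>g\<close> act as A and B, then AB - BA is the commutator
  of A - 1 and B - 1, which raises degrees by 2k. Applying the inverse of BA turns AB - BA into the
  commutator minus the identity, and 2k is at least k + 1.\<close>

lemma near_commutator:
  assumes k: "k \<ge> 1" and f: "endo m f" "near m k f" and g: "endo m g" "near m k g"
    and f': "endo m f'" "f' \<circ> f = pr m" and g': "endo m g'" "g' \<circ> g = pr m"
  shows "near m (Suc k) (f' \<circ> g' \<circ> f \<circ> g)"
  unfolding near_def
proof (intro allI impI)
  fix i assume i: "i < m"
  define s where "s = mu (gen i) - 1"
  let ?P = "asub m (pr m)" and ?A = "asub m f" and ?B = "asub m g"
  have s: "deep 1 s" by (simp add: s_def deep_mu)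
  have AB: "?A (?B s) = mu (f (g (gen i))) - 1" "?B (?A s) = mu (g (f (gen i))) - 1"
    "?P (?B s) = ?B s" "?P (?A s) = ?A s" "?P s = s"
    using f(1) g(1) i
    by (simp_all add: s_def asub_ring asub_mu [OF f(1)] asub_mu [OF g(1)] asub_mu [OF endo_pr] endo_def)
  have 1: "deep (1 + k + k) (?A (?B s - s) - ?P (?B s - s))"
    using near_asub [OF f, of "1 + k" "?B s - s"] near_asub [OF g s] AB by simp
  have 2: "deep (1 + k + k) (?B (?A s - s) - ?P (?A s - s))"
    using near_asub [OF g, of "1 + k" "?A s - s"] near_asub [OF f s] AB by simp
  have "mu (f (g (gen i))) - mu (g (f (gen i))) = (?A (?B s - s) - ?P (?B s - s)) - (?B (?A s - s) - ?P (?A s - s))"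
    by (simp add: asub_ring AB)
  then have d: "deep (1 + k + k) (mu (f (g (gen i))) - mu (g (f (gen i))))"
    using deep_diff [OF 1 2] by simp
  have "deep (1 + k + k) (asub m (f' \<circ> g') (mu (f (g (gen i))) - mu (g (f (gen i)))))"
    by (rule deep_asub [OF d])
  also have "asub m (f' \<circ> g') (mu (f (g (gen i))) - mu (g (f (gen i)))) = mu ((f' \<circ> g' \<circ> f \<circ> g) (gen i)) - mu (gen i)"
  proof -
    have "f' (g' (g (f (gen i)))) = gen i"
      using f g f' g' i by (metis comp_apply endo_def pr_gen)
    then show ?thesis by (simp add: asub_ring asub_mu endo_comp f' g')
  qed
  finally show "deep (Suc (Suc k)) (mu ((f' \<circ> g' \<circ> f \<circ> g) (gen i)) - mu (gen i))"
    by (rule deep_mono) (use k in simp)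
qed

section \<open>Automorphisms that are inner to every order\<close>

text \<open>The sum of the coefficients over the rotations of \<open>w\<close>: a trace on the
  algebra of series, hence constant on conjugacy classes.\<close>

definition cyc :: "nat list \<Rightarrow> ser \<Rightarrow> int" where
  "cyc w f = (\<Sum>j<length w. cf f (rotate j w))"

lemma cyc_mult_commute: "cyc w (f * g) = cyc w (g * f)"
proof -
  let ?L = "length w"
  have rot: "take (?L - k) (rotate (j + k) w) = drop k (rotate j w)" "drop (?L - k) (rotate (j + k) w) = take k (rotate j w)"
    if "k \<le> ?L" for j k
  proof -
    have "rotate (j + k) w = rotate k (rotate j w)" by (simp add: rotate_rotate add.commute)
    also have "\<dots> = drop k (rotate j w) @ take k (rotate j w)"
      using that by (metis append_take_drop_id length_rotate length_take min.absorb2 rotate_append)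
    finally show "take (?L - k) (rotate (j + k) w) = drop k (rotate j w)" "drop (?L - k) (rotate (j + k) w) = take k (rotate j w)"
      by simp_all
  qed
  have "cyc w (f * g) = (\<Sum>j<?L. \<Sum>k\<le>?L. cf f (take k (rotate j w)) * cf g (drop k (rotate j w)))"
    by (simp add: cyc_def cf_mult)
  also have "\<dots> = (\<Sum>(j, k)\<in>{..<?L} \<times> {..?L}. cf f (take k (rotate j w)) * cf g (drop k (rotate j w)))"
    by (simp add: sum.cartesian_product)
  also have "\<dots> = (\<Sum>(j, k)\<in>{..<?L} \<times> {..?L}. cf g (take k (rotate j w)) * cf f (drop k (rotate j w)))"
  \<comment> \<open>Rotating by \<open>k\<close> further moves the prefix of length \<open>k\<close>
    to the end, so the two factors of the cut change places.\<close>
  proof (rule sum.reindex_bij_witness [of _ "\<lambda>(j, k). ((j + k) mod ?L, ?L - k)" "\<lambda>(j, k). ((j + k) mod ?L, ?L - k)"])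
    fix p assume p: "p \<in> {..<?L} \<times> {..?L}"
    obtain j k where jk: "p = (j, k)" by (cases p)
    have j: "j < ?L" "k \<le> ?L" using p jk by auto
    have L: "(j + k) mod ?L < ?L" by (rule mod_less_divisor) (use j in linarith)
    have "((j + k) mod ?L + (?L - k)) mod ?L = (j + k + (?L - k)) mod ?L" by (simp add: mod_add_left_eq)
    then have m: "((j + k) mod ?L + (?L - k)) mod ?L = j" using j by simp
    show "(case case p of (j, k) \<Rightarrow> ((j + k) mod ?L, ?L - k) of (j, k) \<Rightarrow> ((j + k) mod ?L, ?L - k)) = p"
      "(case case p of (j, k) \<Rightarrow> ((j + k) mod ?L, ?L - k) of (j, k) \<Rightarrow> ((j + k) mod ?L, ?L - k)) = p"
      using m j by (simp_all add: jk)
    show "(case p of (j, k) \<Rightarrow> ((j + k) mod ?L, ?L - k)) \<in> {..<?L} \<times> {..?L}"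
      "(case p of (j, k) \<Rightarrow> ((j + k) mod ?L, ?L - k)) \<in> {..<?L} \<times> {..?L}" using j jk L by auto
    show "(case case p of (j, k) \<Rightarrow> ((j + k) mod ?L, ?L - k) of (j, k) \<Rightarrow> cf g (take k (rotate j w)) * cf f (drop k (rotate j w)))
      = (case p of (j, k) \<Rightarrow> cf f (take k (rotate j w)) * cf g (drop k (rotate j w)))"
      using rot [OF j(2), of j] rotate_conv_mod [of "j + k" w] by (simp add: jk mult.commute)
  qed
  also have "\<dots> = cyc w (g * f)" by (simp add: cyc_def cf_mult sum.cartesian_product)
  finally show ?thesis .
qed

lemma cyc_conj: "cyc w (mu (u + x - u)) = cyc w (mu x)"
proof -
  have "mu (u + x - u) = mu u * (mu x * mu (- u))"
    by (simp add: diff_conv_add_uminus mu_add mult.assoc del: add_uminus_conv_diff)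
  then have "cyc w (mu (u + x - u)) = cyc w ((mu x * mu (- u)) * mu u)" by (metis cyc_mult_commute)
  then show ?thesis by (simp add: mult.assoc)
qed

lemma cyc_deep: "deep k (f - g) \<Longrightarrow> length w < k \<Longrightarrow> cyc w f = cyc w g"
  unfolding cyc_def by (intro sum.cong refl) (auto simp: deep_def)

lemma cf_mu_singleton_add: "cf (mu (g + h)) [i] = cf (mu g) [i] + cf (mu h) [i]"
  by (simp add: mu_add cf_mult)

lemma Fg_append: "reduced (v @ w) \<Longrightarrow> Fg (v @ w) = Fg v + Fg w"
proof (induction v)
  case (Cons a v)
  have "reduced (a # (v @ w))" using Cons.prems by simp
  moreover have "reduced (a # v)" using Cons.prems reduced_append_iff [of "a # v" w] by simp
  moreover have "reduced (v @ w)" using Cons.prems by (simp add: reduced_Cons)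
  ultimately show ?case using Cons.IH by (simp only: append_Cons Fg_Cons add.assoc)
qed (simp flip: zero_fg_def)

lemma fgw_eq_Nil_iff: "fgw g = [] \<longleftrightarrow> g = 0"
  by (metis fgw_zero fgw_inverse)

lemma reduced_of_len_add: "len (u + v) \<ge> len u + len v \<Longrightarrow> fgw (u + v) = fgw u @ fgw v"
  using kap_props(1-4) [of u v] len_zero_iff by (cases "kap u v = 0") (auto simp: len_def)

text \<open>If the first and the last of at least two syllables belong to the same generator, the
  last one is moved to the front by conjugation. Either letters cancel or the two syllables merge,
  so the length or the number of syllables decreases.\<close>

lemma conj_cyclically_reduced:
  "\<exists>v y0. y = v + y0 - v \<and> (length (syl (fgw y0)) \<ge> 2 \<longrightarrow> hd (syl (fgw y0)) \<noteq> last (syl (fgw y0)))"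
proof (induction y rule: wf_induct [where r = "measures [len, \<lambda>g. length (syl (fgw g))]"])
  case 1
  show ?case by simp
next
  case (2 y)
  show ?case
  proof (cases "length (syl (fgw y)) \<ge> 2 \<and> hd (syl (fgw y)) = last (syl (fgw y))")
    case False
    then show ?thesis by (intro exI [of _ 0] exI [of _ y]) auto
  next
    case True
    define w where "w = fgw y"
    define x where "x = fst (last w)"
    define s where "s = rev (takeWhile (\<lambda>a. fst a = x) (rev w))"
    define w1 where "w1 = rev (dropWhile (\<lambda>a. fst a = x) (rev w))"
    have w: "w = w1 @ s" by (metis rev_append s_def takeWhile_dropWhile_id w1_def rev_rev_ident)
    have wn: "w \<noteq> []" using True by (auto simp: w_def syl_def)
    have sx: "a \<in> set s \<Longrightarrow> fst a = x" for a by (auto simp: s_def dest: set_takeWhileD)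
    have ms: "map fst s = replicate (length s) x" using sx by (auto simp: list_eq_iff_nth_eq)
    have sn: "s \<noteq> []" using wn by (cases "rev w") (auto simp: s_def x_def simp flip: hd_rev)
    have syls: "syl s = [x]" using sn by (simp add: syl_def ms remdups_adj_replicate)
    have w1n: "w1 \<noteq> []"
    proof
      assume "w1 = []"
      then have "syl w = [x]" using w syls by simp
      then show False using True by (simp flip: w_def)
    qed
    have lw1: "fst (last w1) \<noteq> x"
      using w1n hd_dropWhile [of "\<lambda>a. fst a = x" "rev w"] by (simp add: w1_def last_rev)
    have hw1: "fst (hd w1) = x"
    proof -
      have "hd (syl w) = fst (hd w)" "last (syl w) = fst (last w)"
        using wn by (simp_all add: syl_def hd_map last_map)
      then have "fst (hd w) = x" using True by (simp add: x_def flip: w_def)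
      then show ?thesis using w w1n by simp
    qed
    have l1: "length (syl w) = Suc (length (syl w1))"
      using lw1 w1n sn syls remdups_adj_append' [of "map fst w1" "map fst s"]
      by (simp add: w syl_def last_map ms)
    have l2: "length (syl (s @ w1)) = length (syl w1)"
    proof -
      have "syl (s @ w1) = remdups_adj (replicate (length s) x @ map fst w1)" by (simp add: syl_def ms)
      also have "\<dots> = remdups_adj (map fst w1)"
        using sn w1n hw1
      proof (induction s)
        case (Cons b s)
        then show ?case by (cases s; cases w1) (auto)
      qed simp
      finally show ?thesis by (simp add: syl_def)
    qed
    have red: "reduced (w1 @ s)" using reduced_fgw [of y] by (simp add: w flip: w_def)
    then have red12: "reduced w1" "reduced s" by (simp_all add: reduced_append_iff)
    define y' where "y' = Fg s + Fg w1"
    have y: "y = - Fg s + y' - (- Fg s)"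
      using Fg_append [OF red] by (simp add: y'_def w_def flip: w add.assoc)
    have "(y', y) \<in> measures [len, \<lambda>g. length (syl (fgw g))]"
    proof (cases "len y' < len y")
      case False
      have "len y = length w1 + length s" using w by (simp add: len_def w_def)
      then have "fgw y' = s @ w1" "len y' = len y"
        using False reduced_of_len_add [of "Fg s" "Fg w1"] red12 by (simp_all add: y'_def len_def)
      then show ?thesis using l1 l2 by (simp add: w_def)
    qed simp
    then obtain v y0 where v: "y' = v + y0 - v" "length (syl (fgw y0)) \<ge> 2 \<longrightarrow> hd (syl (fgw y0)) \<noteq> last (syl (fgw y0))"
      using 2 by blast
    have "y = (- Fg s + v) + y0 - (- Fg s + v)"
      by (subst y) (simp add: v(1) group_norm del: add_uminus_conv_diff)
    then show ?thesis using v(2) by blast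
  qed
qed

lemma distinct_adj_rotate1:
  assumes "distinct_adj w" "length w \<ge> 2 \<Longrightarrow> hd w \<noteq> last w"
  shows "distinct_adj (rotate1 w)" "length w \<ge> 2 \<Longrightarrow> hd (rotate1 w) \<noteq> last (rotate1 w)"
proof -
  have "distinct_adj (rotate1 w) \<and> (length w \<ge> 2 \<longrightarrow> hd (rotate1 w) \<noteq> last (rotate1 w))"
  proof (cases w)
    case (Cons a u)
    show ?thesis
    proof (cases "u = []")
      case False
      then have "length w \<ge> 2" using Cons by (cases u) auto
      then have "a \<noteq> last u" using assms(2) Cons False by simp
      moreover have "distinct_adj (u @ [a])"
        using assms(1) Cons False \<open>a \<noteq> last u\<close> by (auto simp: distinct_adj_append_iff distinct_adj_Cons)
      moreover have "hd u \<noteq> a" using assms(1) Cons False by (auto simp: distinct_adj_Cons)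
      ultimately show ?thesis using Cons False by simp
    qed (simp add: Cons)
  qed simp
  then show "distinct_adj (rotate1 w)" "length w \<ge> 2 \<Longrightarrow> hd (rotate1 w) \<noteq> last (rotate1 w)" by blast+
qed

lemma distinct_adj_rotate:
  assumes "distinct_adj w" "length w \<ge> 2 \<longrightarrow> hd w \<noteq> last w" shows "distinct_adj (rotate j w)"
proof -
  have "distinct_adj (rotate j w) \<and> (length w \<ge> 2 \<longrightarrow> hd (rotate j w) \<noteq> last (rotate j w))"
  proof (induction j)
    case (Suc j)
    then show ?case using distinct_adj_rotate1 [of "rotate j w"] by simp
  qed (use assms in simp)
  then show ?thesis by simp
qed

text \<open>For a cyclically reduced element with several syllables, a rotation of the list of
  syllables has a nonzero coefficient only if it equals the list itself. The trace at this list is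
  then nonzero, unlike that of a generator. With a single syllable, the coefficients of degree 1
  determine generator and exponent.\<close>

lemma conj_gen_of_cyc:
  assumes "\<And>w. w \<noteq> [] \<Longrightarrow> cyc w (mu y) = cyc w (mu (gen i))"
  shows "\<exists>v. y = v + gen i - v"
proof -
  obtain v y0 where y: "y = v + y0 - v" and red: "length (syl (fgw y0)) \<ge> 2 \<longrightarrow> hd (syl (fgw y0)) \<noteq> last (syl (fgw y0))"
    using conj_cyclically_reduced by blast
  have c: "cyc w (mu y0) = cyc w (mu (gen i))" if "w \<noteq> []" for w
    using assms [OF that] by (simp add: y cyc_conj)
  have c1: "cf (mu y0) [k] = (if k = i then 1 else 0)" for k
    using c [of "[k]"] by (simp add: cyc_def mu_gen cf_one cf_X eq_commute)
  have "y0 \<noteq> 0" using c1 [of i] by (auto simp: cf_one)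
  then have n: "fgw y0 \<noteq> []" by (simp add: fgw_eq_Nil_iff)
  let ?w = "syl (fgw y0)"
  have "length ?w = 1"
  proof (rule ccontr)
    assume "length ?w \<noteq> 1"
    moreover have "?w \<noteq> []" using n by (simp add: syl_def)
    ultimately have l: "length ?w \<ge> 2" by (cases ?w rule: list.exhaust [case_product list.exhaust]) (auto simp: neq_Nil_conv Suc_le_eq)
    have z: "cf (mu y0) (rotate j ?w) = (if rotate j ?w = ?w then cf (mu y0) ?w else 0)" for j
      using mu_syl_coeff(2) [OF n, of "rotate j ?w"] distinct_adj_rotate [OF distinct_adj_syl red, of j] by auto
    have "cyc ?w (mu y0) = (\<Sum>j<length ?w. if rotate j ?w = ?w then cf (mu y0) ?w else 0)"
      unfolding cyc_def z ..
    also have "\<dots> = int (card {j. j < length ?w \<and> rotate j ?w = ?w}) * cf (mu y0) ?w"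
      by (simp add: sum.If_cases lessThan_def Int_def)
    moreover have "cyc ?w (mu (gen i)) = 0"
      unfolding cyc_def
    proof (intro sum.neutral ballI)
      fix j
      have "length (rotate j ?w) \<noteq> length [i]" "length (rotate j ?w) \<noteq> length []" using l by auto
      then have "rotate j ?w \<noteq> [i]" "rotate j ?w \<noteq> []" by metis+
      then show "cf (mu (gen i)) (rotate j ?w) = 0" by (simp add: mu_gen cf_one cf_X)
    qed
    ultimately have "card {j. j < length ?w \<and> rotate j ?w = ?w} = 0"
      using c [of ?w] \<open>?w \<noteq> []\<close> mu_syl_coeff(1) [OF n] by simp
    moreover have "0 \<in> {j. j < length ?w \<and> rotate j ?w = ?w}" using l by auto
    moreover have "finite {j. j < length ?w \<and> rotate j ?w = ?w}" by simp
    ultimately show False by (metis card_0_eq empty_iff)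
  qed
  then have rep: "map fst (fgw y0) = replicate (length (fgw y0)) (hd (map fst (fgw y0)))"
    using remdups_adj_singleton_iff [of "map fst (fgw y0)"] by (simp add: syl_def)
  define x where "x = hd (map fst (fgw y0))"
  have fx: "\<forall>a\<in>set (fgw y0). fst a = x" using rep unfolding x_def [symmetric] by (metis in_set_conv_nth length_map nth_map nth_replicate)
  have signs: "\<exists>b. w = replicate (length w) (x, b)" if "reduced w" "\<forall>a\<in>set w. fst a = x" for w
    using that
  proof (induction w)
    case (Cons a w)
    then obtain b where b: "w = replicate (length w) (x, b)" by (auto simp: reduced_Cons)
    show ?case
    proof (cases w)
      case Nil
      then show ?thesis using Cons.prems by (intro exI [of _ "snd a"]) (auto simp: prod_eq_iff)
    next
      case (Cons c w')
      then have "c = (x, b)" using b by (metis hd_replicate list.sel(1) list.size(3) replicate_0 list.distinct(1))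
      moreover have "c \<noteq> letter_inv a" "fst a = x" using Cons.prems \<open>w = c # w'\<close> by (auto simp: reduced_Cons)
      ultimately have "a = (x, b)" by (auto simp: letter_inv_def prod_eq_iff)
      then show ?thesis using b by (intro exI [of _ b]) (metis length_Cons replicate_Suc)
    qed
  qed simp
  obtain b where b: "fgw y0 = replicate (length (fgw y0)) (x, b)" using signs [OF reduced_fgw fx] by blast
  have val: "reduced (replicate k (x, b)) \<and> cf (mu (Fg (replicate k (x, b)))) [x] = (if b then int k else - int k)" for k
  proof (induction k)
    case (Suc k)
    then have "reduced (replicate (Suc k) (x, b))" by (cases k) (auto simp: reduced_Cons letter_inv_def)
    then show ?case using Suc
      by (simp add: Fg_Cons cf_mu_singleton_add) (auto simp: lgen_def mu_gen mu_neg_gen cf_one cf_X cf_Xinv_Cons cf_Xinv_Nil)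
  qed (simp flip: zero_fg_def add: cf_one)
  have "cf (mu y0) [x] = (if b then int (length (fgw y0)) else - int (length (fgw y0)))"
    using val [of "length (fgw y0)"] by (simp flip: b)
  then have "x = i" "b" "length (fgw y0) = 1" using c1 [of x] n by (auto split: if_splits)
  then have "fgw y0 = fgw (gen i)" using b by (simp add: fgw_gen)
  then have "y0 = gen i" by (metis fgw_inverse)
  then show ?thesis using y by blast
qed

text \<open>The powers of \<open>gen 0\<close> form its centralizer, which is what remains
  undetermined once an automorphism is normalized to fix \<open>gen 0\<close>.\<close>

fun pwn :: "nat \<Rightarrow> fg" where
  "pwn 0 = 0"
| "pwn (Suc k) = gen 0 + pwn k"

definition pw :: "int \<Rightarrow> fg" where
  "pw e = (if e \<ge> 0 then pwn (nat e) else - pwn (nat (- e)))"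

lemma pwn_commute: "gen 0 + pwn k = pwn k + gen 0"
proof (induction k)
  case (Suc k)
  then show ?case by (metis pwn.simps(2) add.assoc)
qed simp

lemma pw_step: "gen 0 + pw e = pw (e + 1)" "- gen 0 + pw e = pw (e - 1)"
proof -
  have up: "gen 0 + pw e = pw (e + 1)" for e
  proof (cases "e \<ge> 0")
    case True
    then have "nat (e + 1) = Suc (nat e)" by simp
    then show ?thesis using True by (simp add: pw_def)
  next
    case False
    then have "nat (- e) = Suc (nat (- (e + 1)))" by simp
    then have "pw e = - (pwn (nat (- (e + 1))) + gen 0)" using False
      by (simp only: pw_def pwn.simps pwn_commute if_False)
    then have "pw e = - gen 0 - pwn (nat (- (e + 1)))" by (simp add: minus_add)
    moreover have "pw (e + 1) = - pwn (nat (- (e + 1)))"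
      using False by (cases "e = - 1") (auto simp: pw_def)
    ultimately show ?thesis by (simp only: diff_conv_add_uminus add_minus_cancel)
  qed
  show "gen 0 + pw e = pw (e + 1)" by (rule up)
  have "pw e = gen 0 + pw (e - 1)" using up [of "e - 1"] by simp
  then show "- gen 0 + pw e = pw (e - 1)" by simp
qed

lemma pw_commute: "gen 0 + pw e = pw e + gen 0"
proof -
  have "gen 0 - pwn k = - pwn k + gen 0" for k
    using pwn_commute [of k] by (metis add.assoc add_diff_cancel diff_conv_add_uminus minus_add_cancel)
  then show ?thesis by (simp add: pw_def pwn_commute)
qed

lemma pr_1: "\<exists>e. pr 1 g = pw e"
proof (induction g rule: fg_letter_induct)
  case zero
  then show ?case by (intro exI [of _ 0]) (simp add: pw_def)
next
  case (step a g)
  then obtain e where "pr 1 g = pw e" by blast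
  then show ?case by (auto simp: lgen_def pw_step)
qed

lemma cf_mu_neg_singleton: "cf (mu (- g)) [i] = - cf (mu g) [i]"
  using cf_mu_singleton_add [of "- g" g i] by (simp add: cf_one)

lemma cf_mu_pw: "cf (mu (pw e)) [0] = e"
proof -
  have "cf (mu (pwn k)) [0] = int k" for k
    by (induction k) (simp_all add: cf_mu_singleton_add mu_gen cf_one cf_X)
  then show ?thesis by (simp add: pw_def cf_mu_neg_singleton)
qed

lemma cf_mu_pr_1: "cf (mu (pr 1 g)) (replicate j 0) = cf (mu g) (replicate j 0)"
proof (induction g arbitrary: j rule: fg_letter_induct)
  case (step a g)
  have "cf (mu (pr 1 (lgen a))) (replicate j 0) = cf (mu (lgen a)) (replicate j 0)" for j
    by (cases j) (auto simp: lgen_def mu_gen mu_neg_gen cf_one cf_X cf_Xinv_Cons)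
  then show ?case using step by (simp add: mu_add cf_mult min_def)
qed simp

lemma mu_conj: "mu (u + x - u) = mu u * mu x * mu (- u)"
  by (simp add: diff_conv_add_uminus mu_add mult.assoc del: add_uminus_conv_diff)

text \<open>An approximate form of the fact that the centralizer of \<open>gen 0\<close> consists of
  its powers. Commutation with \<open>X 0\<close> in low degrees kills coefficients at words not
  starting with 0 and moves a leading 0 to the end, so only powers of \<open>X 0\<close> can
  survive. Those are removed by the correction with \<open>pw e\<close>, where \<open>pw e\<close>
  is the projection of \<open>u\<close> to rank 1.\<close>

lemma commute_gen_0:
  assumes d: "deep (Suc k) (mu (gen 0) - mu (u + gen 0 - u))"
  shows "\<exists>e. deep k (mu (u - pw e) - 1)"
proof -
  obtain e where e: "pr 1 u = pw e" using pr_1 by blast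
  define u' where "u' = u - pw e"
  have comm': "cf (mu u') (b # w) = (if b = 0 then cf (mu u') (w @ [0]) else 0)" if "length w + 1 < k" for b w
  proof -
    have "u' + gen 0 = u' + (gen 0 + pw e) - pw e" by (simp add: group_norm del: add_uminus_conv_diff)
    also have "\<dots> = u - pw e + pw e + gen 0 - pw e" by (simp only: pw_commute u'_def add.assoc)
    finally have "u' + gen 0 = u - pw e + pw e + gen 0 - pw e" .
    then have "u' + gen 0 - u' = u + gen 0 - u"
      by (simp add: u'_def group_norm del: add_uminus_conv_diff)
    then have "deep (Suc k) (mu (gen 0) - mu (u' + gen 0 - u'))" using d by simp
    moreover have "(mu (gen 0) - mu (u' + gen 0 - u')) * mu u' = X 0 * mu u' - mu u' * X 0"
      by (simp add: mu_conj mult.assoc left_diff_distrib mu_gen distrib_left distrib_right)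
    ultimately have "deep (Suc k) (X 0 * mu u' - mu u' * X 0)"
      using deep_mult_right [of "Suc k" _ "mu u'"] by metis
    then have "cf (X 0 * mu u') ((b # w) @ [0]) = cf (mu u' * X 0) ((b # w) @ [0])"
      using that unfolding deep_def by simp
    then show ?thesis unfolding cf_mult_X_snoc by (simp add: cf_X_mult_Cons)
  qed
  have rep: "cf (mu u') (replicate j 0) = (if j = 0 then 1 else 0)" for j
  proof -
    have "pr 1 (pw e) = pw e" using e by (metis pr_pr)
    then have "pr 1 u' = 0" using e by (simp add: u'_def)
    then show ?thesis using cf_mu_pr_1 [of u' j] by (simp add: cf_one)
  qed
  have vanish: "cf (mu u') w = 0" if "w \<noteq> []" "length w < k" for w
  proof -
    have "cf (mu u') (x @ replicate j 0) = 0" if "x @ replicate j 0 \<noteq> []" "length x + j < k" for x j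
      using that
    proof (induction x arbitrary: j)
      case Nil
      then show ?case by (simp add: rep)
    next
      case (Cons b x)
      have "cf (mu u') (b # x @ replicate j 0) = (if b = 0 then cf (mu u') (x @ replicate (Suc j) 0) else 0)"
        using comm' [of "x @ replicate j 0" b] Cons.prems by (simp add: replicate_append_same)
      then show ?case using Cons.IH [of "Suc j"] Cons.prems by auto
    qed
    from this [of w 0] that show ?thesis by simp
  qed
  have "deep k (mu u' - 1)"
    unfolding deep_def using vanish by (auto simp: cf_one)
  then show ?thesis by (auto simp: u'_def)
qed

text \<open>The conjugators for different \<open>k\<close> need not fit together a priori. The
  traces \<open>cyc\<close> show that \<open>a\<close> maps \<open>gen 0\<close> to a conjugate of
  it, and after normalization each conjugator is a power of \<open>gen 0\<close> up to high degree.
  Its exponent is a coefficient of degree 2 of the image of \<open>gen 1\<close>, hence the same for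
  every \<open>k\<close>, and injectivity of \<open>mu\<close> concludes.\<close>

theorem inner_of_near:
  assumes a: "aut m a"
    and near: "\<And>k. \<exists>u. \<forall>i<m. deep (Suc k) (mu (a (gen i)) - mu (u + gen i - u))"
  shows "\<exists>h. pr m h = h \<and> a = inn h (pr m)"
proof (cases "m = 0")
  case True
  then have "a = pr m" using a by (intro endo_eqI [of m]) (auto simp: aut_def endo_pr)
  then show ?thesis by (intro exI [of _ 0]) simp
next
  case False
  have "cyc w (mu (a (gen 0))) = cyc w (mu (gen 0))" if "w \<noteq> []" for w
  proof -
    obtain u where "deep (Suc (length w)) (mu (a (gen 0)) - mu (u + gen 0 - u))"
      using near [of "length w"] False by auto
    then show ?thesis using cyc_deep [of "Suc (length w)" _ _ w] cyc_conj by (metis lessI)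
  qed
  then obtain v where v: "a (gen 0) = v + gen 0 - v" using conj_gen_of_cyc by blast
  have pa: "pr m (a x) = a x" for x using a by (simp add: aut_def endo_def)
  have v': "a (gen 0) = pr m v + gen 0 - pr m v"
    using pa [of "gen 0"] False unfolding v by simp
  define a' where "a' = inn (- pr m v) a"
  have a': "aut m a'" unfolding a'_def by (rule aut_inn [OF _ a]) simp
  have a'0: "a' (gen 0) = gen 0" by (simp add: a'_def inn_def v' group_norm del: add_uminus_conv_diff)
  have near': "\<exists>e. \<forall>i<m. deep k (mu (a' (gen i)) - mu (pw e + gen i - pw e))" for k
  proof -
    obtain u where u: "\<forall>i<m. deep (Suc k) (mu (a (gen i)) - mu (u + gen i - u))" using near by blast
    define u' where "u' = - pr m v + u"
    have d: "deep (Suc k) (mu (a' (gen i)) - mu (u' + gen i - u'))" if "i < m" for i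
    proof -
      have "mu (a' (gen i)) - mu (u' + gen i - u') = mu (- pr m v) * (mu (a (gen i)) - mu (u + gen i - u)) * mu (pr m v)"
        by (simp add: a'_def u'_def inn_def mu_add group_norm algebra_simps del: add_uminus_conv_diff)
      then show ?thesis using u that by (simp add: deep_mult_left deep_mult_right)
    qed
    obtain e where e: "deep k (mu (u' - pw e) - 1)"
      using commute_gen_0 [of k u'] d [of 0] False a'0 by auto
    define s where "s = u' - pw e"
    have "deep k (mu (a' (gen i)) - mu (pw e + gen i - pw e))" if "i < m" for i
    proof -
      let ?z = "mu (pw e + gen i - pw e)"
      have "mu (u' + gen i - u') = mu s * ?z * mu (- s)"
      proof -
        have "u' + gen i - u' = s + (pw e + gen i - pw e) - s"
          by (simp add: s_def group_norm del: add_uminus_conv_diff)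
        then show ?thesis by (simp add: mu_conj)
      qed
      moreover have "mu s * ?z * mu (- s) - ?z = ((mu s - 1) * ?z - ?z * (mu s - 1)) * mu (- s)"
        by (simp add: algebra_simps)
      moreover have "deep k (((mu s - 1) * ?z - ?z * (mu s - 1)) * mu (- s))"
        by (rule deep_mult_right [OF deep_diff [OF deep_mult_right [OF e [folded s_def]] deep_mult_left [OF e [folded s_def]]]])
      ultimately have "deep k (mu (u' + gen i - u') - ?z)" by simp
      moreover have "deep k (mu (a' (gen i)) - mu (u' + gen i - u'))" by (rule deep_mono [OF d [OF that]]) simp
      ultimately show ?thesis using deep_add by fastforce
    qed
    then show ?thesis by blast
  qed
  have "\<exists>h. pr m h = h \<and> a' = inn h (pr m)"
  proof (cases "m = 1")
    case True
    then have "a' = pr m" using a' a'0 by (intro endo_eqI [of m]) (auto simp: aut_def endo_pr)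
    then show ?thesis by (intro exI [of _ 0]) simp
  next
    case m1: False
    define E where "E = cf (mu (a' (gen 1))) [0, 1]"
    have E: "deep k (mu (a' (gen i)) - mu (pw E + gen i - pw E))" if "i < m" for i k
    proof -
      \<comment> \<open>Depth \<open>k + 3\<close> covers the coefficient of degree 2 at
        \<open>[0, 1]\<close>, from which the exponent is read off.\<close>
      obtain e where e: "\<forall>i<m. deep (k + 3) (mu (a' (gen i)) - mu (pw e + gen i - pw e))" using near' by blast
      have "cf (mu (a' (gen 1)) - mu (pw e + gen 1 - pw e)) [0, 1] = 0"
        using e m1 False unfolding deep_def by (metis One_nat_def Suc_lessI add_gr_0 length_Cons list.size(3) nat_neq_iff less_one not_less_eq numeral_3_eq_3 trans_less_add2 lessI)
      moreover have "cf (mu (pw e + gen 1 - pw e)) [0, 1] = e"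
      proof -
        have "mu (pw e + gen 1 - pw e) = 1 + mu (pw e) * X 1 * mu (- pw e)"
          by (simp add: mu_conj mu_gen algebra_simps)
        moreover have "cf (mu (pw e) * X 1 * mu (- pw e)) [0, 1] = e"
          by (simp add: cf_mult cf_X numeral_2_eq_2 cf_mu_pw)
        ultimately show ?thesis by (simp add: cf_one)
      qed
      ultimately have "e = E" by (simp add: E_def)
      then show ?thesis using e that deep_mono [of "k + 3" _ k] by simp
    qed
    have "a' (gen i) = pw E + gen i - pw E" if "i < m" for i
    proof (rule mu_inj, rule ser_eqI)
      fix w show "cf (mu (a' (gen i))) w = cf (mu (pw E + gen i - pw E)) w"
        using E [OF that, of "Suc (length w)"] by (simp add: deep_def)
    qed
    moreover have "pr m (pw E) = pw E"
    proof -
      have "pr m (pwn k) = pwn k" for k using False by (induction k) simp_all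
      then show ?thesis by (simp add: pw_def)
    qed
    ultimately have "a' = inn (pw E) (pr m)"
      using a' by (intro endo_eqI [of m] endo_inn) (auto simp: aut_def endo_pr inn_def)
    then show ?thesis using \<open>pr m (pw E) = pw E\<close> by blast
  qed
  then obtain h where h: "pr m h = h" "a' = inn h (pr m)" by blast
  have "a = inn (pr m v) a'" by (simp add: a'_def inn_inn)
  then have "a = inn (pr m v + h) (pr m)" by (simp add: h(2) inn_inn)
  then show ?thesis using h(1) by (intro exI [of _ "pr m v + h"]) simp
qed

section \<open>Cochains on free groups\<close>

text \<open>The second cohomology of a free group vanishes.\<close>

lemma exists_cochain:
  fixes f :: "fg \<Rightarrow> fg \<Rightarrow> 'a::ab_group_add"
  assumes f0: "\<And>y. f 0 y = 0" "\<And>x. f x 0 = 0"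
    and f: "\<And>x y z. f y z + f x (y + z) = f (x + y) z + f x y"
  shows "\<exists>w. \<forall>x y. w (x + y) = w x + w y + f x y"
proof -
  \<comment> \<open>Generators receive the value 0; the value at an inverse generator is then
    forced, since the cochain must vanish at 0.\<close>
  define l where "l a = (if snd a then 0 else - f (lgen a) (- lgen a))" for a :: letter
  define wf where "wf = rec_list 0 (\<lambda>a v r. l a + r + f (lgen a) (Fg v))"
  have wf: "wf [] = 0" "wf (a # v) = l a + wf v + f (lgen a) (Fg v)" for a v
    by (simp_all add: wf_def)
  define w where "w g = wf (fgw g)" for g
  have sym: "f x (- x) = f (- x) x" for x
    using f [of "- x" x x] by (simp add: f0)
  have ll: "l a + l (letter_inv a) = - f (lgen a) (- lgen a)" for a
    using sym [of "lgen a"] by (auto simp: l_def letter_inv_def lgen_def)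
  have wstep: "w (lgen a + g) = l a + w g + f (lgen a) g" for a g
  proof (cases "fgw g \<noteq> [] \<and> hd (fgw g) = letter_inv a")
    case True
    then obtain v where v: "fgw g = letter_inv a # v" by (cases "fgw g") auto
    then have r: "reduced v" using reduced_fgw [of g] by (simp add: reduced_Cons)
    have ag: "lgen a + g = Fg v"
      using v by (metis Fg_fgw fgw_plus fgw_lgen foldr.simps id_apply comp_apply push_def list.sel list.distinct(1))
    then have g: "g = - lgen a + Fg v" by (metis minus_add_cancel)
    have "w g = l (letter_inv a) + w (Fg v) + f (- lgen a) (Fg v)"
      using r by (simp add: w_def v wf)
    moreover have "f (- lgen a) (Fg v) + f (lgen a) g = f (lgen a) (- lgen a)"
      using f [of "- lgen a" "Fg v" "lgen a"] by (simp add: f0 flip: g)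
    ultimately show ?thesis using ll [of a] by (simp add: ag algebra_simps eq_neg_iff_add_eq_0)
  next
    case False
    then have "fgw (lgen a + g) = a # fgw g" by (auto simp: fgw_plus fgw_lgen push_def)
    then show ?thesis by (simp add: w_def wf)
  qed
  have "w (x + y) = w x + w y + f x y" for x y
  proof (induction x rule: fg_letter_induct)
    case zero
    then show ?case by (simp add: f0 w_def wf)
  next
    case (step a g)
    then show ?case using f [of g y "lgen a"] by (simp add: add.assoc wstep algebra_simps)
  qed
  then show ?thesis by blast
qed

section \<open>Functionals and cochains that bound cup products\<close>

definition fn :: "nat \<Rightarrow> (fg \<Rightarrow> 'a::ab_group_add) \<Rightarrow> bool" where
  "fn m h \<longleftrightarrow> additive_map h \<and> (\<forall>x. h (pr m x) = h x)"

text \<open>The coboundary of \<open>c\<close> is, up to sign, the cup product of \<open>a\<close>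
  and \<open>b\<close>.\<close>

definition coc :: "nat \<Rightarrow> (fg \<Rightarrow> 'a::comm_ring_1) \<Rightarrow> (fg \<Rightarrow> 'a) \<Rightarrow> (fg \<Rightarrow> 'a) \<Rightarrow> bool" where
  "coc m a b c \<longleftrightarrow> (\<forall>x y. c (x + y) = c x + c y + a x * b y) \<and> (\<forall>x. c (pr m x) = c x)"

lemma fn_add: "fn m h \<Longrightarrow> h (x + y) = h x + h y"
  and fn_neg: "fn m h \<Longrightarrow> h (- x) = - h x"
  and fn_diff: "fn m h \<Longrightarrow> h (x - y) = h x - h y"
  and fn_zero: "fn m h \<Longrightarrow> h 0 = 0"
  and fn_pr: "fn m h \<Longrightarrow> h (pr m x) = h x"
  by (simp_all add: fn_def additive_map_simps)

lemmas fn_simps = fn_add fn_neg fn_diff fn_zero fn_pr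

lemma fn_comp: "fn m h \<Longrightarrow> endo m f \<Longrightarrow> fn m (\<lambda>x. h (f x))"
  using endo_pr_simps(1) [of m f] by (auto simp: fn_def endo_def additive_map_def fun_eq_iff)

lemma coc_add: "coc m a b c \<Longrightarrow> c (x + y) = c x + c y + a x * b y"
  by (simp add: coc_def)

lemma exists_pr_cochain:
  fixes f :: "fg \<Rightarrow> fg \<Rightarrow> 'a::ab_group_add"
  assumes f0: "\<And>y. f 0 y = 0" "\<And>x. f x 0 = 0"
    and f: "\<And>x y z. f y z + f x (y + z) = f (x + y) z + f x y"
    and p: "\<And>x y. f (pr m x) (pr m y) = f x y"
  shows "\<exists>w. (\<forall>x y. w (x + y) = w x + w y + f x y) \<and> (\<forall>x. w (pr m x) = w x)"
proof -
  obtain w where "\<forall>x y. w (x + y) = w x + w y + f x y"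
    using exists_cochain [of f] assms by blast
  then show ?thesis using p by (intro exI [of _ "\<lambda>x. w (pr m x)"]) simp
qed

lemma exists_coc: assumes "fn m a" "fn m b" shows "\<exists>c. coc m a b c"
  unfolding coc_def
  by (rule exists_pr_cochain) (simp_all add: fn_simps [OF assms(1)] fn_simps [OF assms(2)] algebra_simps)

lemma coc_props:
  assumes c: "coc m a b c" and a: "fn m a" and b: "fn m b"
  shows "c 0 = 0" "c (- x) = - c x + a x * b x"
    "c (x - y) = c x - c y + a y * b y - a x * b y" "c (u + x - u) = c x + a u * b x - a x * b u"
proof -
  show z: "c 0 = 0" using coc_add [OF c, of 0 0] by (simp add: fn_simps [OF a])
  have neg: "c (- x) = - c x + a x * b x" for x
    using coc_add [OF c, of x "- x"] by (simp add: z fn_simps [OF b] algebra_simps eq_neg_iff_add_eq_0)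
  then show "c (- x) = - c x + a x * b x" .
  have diff: "c (x - y) = c x - c y + a y * b y - a x * b y" for x y
    using coc_add [OF c, of x "- y"] by (simp add: neg fn_simps [OF b] algebra_simps)
  then show "c (x - y) = c x - c y + a y * b y - a x * b y" .
  show "c (u + x - u) = c x + a u * b x - a x * b u"
    by (simp only: diff coc_add [OF c] fn_simps [OF a]) (simp add: algebra_simps)
qed

text \<open>The data needed from the lifts of the two commuting elements. Since \<open>s\<close> and
  \<open>d\<close> will be powers of one automorphism that fixes \<open>Z\<close>, they commute and
  \<open>d\<close> fixes \<open>Z\<close>. The assumption \<open>odd\<close> says that
  \<open>1 + s + s^2\<close> kills the functionals negated by \<open>d\<close>; \<open>even\<close>
  says that, up to 3-torsion, a functional fixed by \<open>d\<close> and killed by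
  \<open>1 + s + s^2\<close> is a coboundary for \<open>s\<close>.\<close>

locale commuting_lift =
  fixes m :: nat and s d :: "fg \<Rightarrow> fg" and Z Z' :: fg and ty :: "'a::comm_ring_1 itself"
  assumes nine: "(9::'a) = 0" and three: "\<And>x::'a. 3 * x = 0 \<Longrightarrow> \<exists>y. x = 3 * y"
    and endo: "endo m s" "endo m d" and sd: "\<And>x. s (d x) = d (s x)"
    and s3: "\<And>x. s (s (s x)) = Z + pr m x - Z" and d4: "\<And>x. d (d (d (d x))) = Z' + pr m x - Z'"
    and dZ: "d Z = Z" and Z': "\<And>h::fg \<Rightarrow> 'a. fn m h \<Longrightarrow> h Z' = 0"
    and odd: "\<And>(h::fg \<Rightarrow> 'a) x. fn m h \<Longrightarrow> (\<And>x. h (d x) = - h x) \<Longrightarrow> h x + h (s x) + h (s (s x)) = 0"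
    and even: "\<And>h::fg \<Rightarrow> 'a. fn m h \<Longrightarrow> (\<And>x. h (d x) = h x) \<Longrightarrow> (\<And>x. h x + h (s x) + h (s (s x)) = 0)
      \<Longrightarrow> \<exists>\<nu>. fn m \<nu> \<and> (\<forall>x. 3 * h x = 3 * (\<nu> (s x) - \<nu> x))"
begin

lemma nine_mult: "9 * (x::'a) = 0"
  by (simp add: nine)

text \<open>Modulo 9 the inverse of 2 is 5, a constant that recurs below.\<close>

lemma double_zero: assumes "2 * (x::'a) = 0" shows "x = 0"
proof -
  have "x = 5 * (2 * x) - 9 * x" by (simp add: algebra_simps)
  then show ?thesis by (simp add: assms nine)
qed

lemma sadd: "s (x + y) = s x + s y" "s (x - y) = s x - s y" "s (- x) = - s x" "pr m (s x) = s x" "s (pr m x) = s x"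
  and dadd: "d (x + y) = d x + d y" "d (x - y) = d x - d y" "d (- x) = - d x" "pr m (d x) = d x" "d (pr m x) = d x"
  using endo endo_pr_simps(1) [OF endo(1)] endo_pr_simps(1) [OF endo(2)]
  by (simp_all add: endo_def additive_map_simps fun_eq_iff)

definition is_odd :: "(fg \<Rightarrow> 'a) \<Rightarrow> bool" where
  "is_odd h \<longleftrightarrow> fn m h \<and> (\<forall>x. h (d x) = - h x)"

text \<open>On odd functionals one has \<open>dif h (s x) = dif h x - 3 * h (s x)\<close>, so that
  \<open>dif h\<close> is invariant under \<open>s\<close> modulo 3.\<close>

definition dif :: "(fg \<Rightarrow> 'a) \<Rightarrow> fg \<Rightarrow> 'a" where
  "dif h x = h (s x) - h x"

lemma odd_facts:
  assumes "is_odd h"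
  shows "fn m h" "h (d x) = - h x" "h (s (s x)) = - h x - h (s x)" "h Z = 0" "fn m (dif h)" "dif h (d x) = - dif h x"
    "dif h (s x) = - h x - 2 * h (s x)" "dif h Z = 0" "is_odd (\<lambda>x. h (s x))"
proof -
  show h: "fn m h" and hd: "h (d x) = - h x" for x using assms by (simp_all add: is_odd_def)
  show "is_odd (\<lambda>x. h (s x))" using fn_comp [OF h endo(1)] by (simp add: is_odd_def sd hd)
  show ss: "h (s (s x)) = - h x - h (s x)" for x
    using odd [OF h hd, of x] by (simp add: algebra_simps eq_neg_iff_add_eq_0)
  have z: "h y = 0" if "d y = y" for y using hd [of y] double_zero [of "h y"] that by (simp add: eq_neg_iff_add_eq_0)
  then show "h Z = 0" using dZ by blast
  show "fn m (dif h)"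
    using fn_comp [OF h endo(1)] h by (simp add: fn_def dif_def additive_map_def sadd)
  show "dif h (d x) = - dif h x" by (simp add: dif_def sd hd)
  show "dif h (s x) = - h x - 2 * h (s x)" by (simp add: dif_def ss)
  show "dif h Z = 0" using z [of "s Z"] z [OF dZ] dZ by (simp add: dif_def flip: sd)
qed

text \<open>Modulo 3, applying \<open>s\<close> adds to the product of \<open>dif h\<close> and
  \<open>h\<close> the product of \<open>dif h\<close> with itself, which half the square of
  \<open>dif h\<close> bounds, and 5 is 1/2 modulo 9. Hence the expression multiplied by 3 here is
  additive modulo 3 for any \<open>c\<close> bounding the product, and the normalization asks it to
  vanish.\<close>

definition normal_coc :: "(fg \<Rightarrow> 'a) \<Rightarrow> (fg \<Rightarrow> 'a) \<Rightarrow> bool" where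
  "normal_coc h c \<longleftrightarrow> coc m (dif h) h c \<and> (\<forall>x. 3 * (c (s x) - c x - 5 * dif h x ^ 2) = 0)"

text \<open>In \<open>\<int>/9\<close> one has \<open>1/4 = 7\<close>, so this is an average over the powers of \<open>d\<close>.\<close>

lemma average_coc:
  assumes a: "fn m a" "\<And>x. a (d x) = e * a x" and b: "fn m b" "\<And>x. b (d x) = e' * b x"
    and e: "e * e = 1" "e' * e' = (1::'a)"
  shows "\<exists>c. coc m a b c \<and> (\<forall>x. c (d x) = e * e' * c x)"
proof -
  obtain c where c: "coc m a b c" using exists_coc [OF a(1) b(1)] by blast
  let ?e = "e * e'"
  define c1 where "c1 x = 7 * (c x + ?e * c (d x) + c (d (d x)) + ?e * c (d (d (d x))))" for x
  have ee: "e * (e * x) = x" "e' * (e' * x) = x" for x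
    using e by (simp_all flip: mult.assoc)
  have 28: "28 * x = (x::'a)" for x using nine_mult [of "3 * x"] by (simp add: algebra_simps)
  have "coc m a b c1"
    unfolding coc_def
  proof safe
    fix x y
    have "c1 (x + y) = c1 x + c1 y + 28 * (a x * b y)"
      by (simp add: c1_def dadd coc_add [OF c] a b algebra_simps ee)
    then show "c1 (x + y) = c1 x + c1 y + a x * b y" by (simp only: 28)
    show "c1 (pr m x) = c1 x" using c by (simp add: c1_def dadd coc_def)
  qed
  moreover have "c (d (d (d (d x)))) = c x" for x
    using c by (simp add: d4 coc_props(4) [OF c a(1) b(1)] Z' a(1) b(1)) (simp add: coc_def)
  then have "c1 (d x) = ?e * c1 x" for x
    by (simp add: c1_def algebra_simps ee)
  ultimately show ?thesis by blast
qed

text \<open>With \<open>c\<close> averaged over \<open>d\<close>, the defect \<open>M\<close> of the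
  normalization is a functional fixed by \<open>d\<close>. Its sum over the powers of
  \<open>s\<close> vanishes because conjugation by \<open>Z\<close> does not change
  \<open>c\<close>. The assumption \<open>even\<close> then provides the functional to
  subtract.\<close>

lemma normal_coc_exists: assumes h: "is_odd h" shows "\<exists>c. normal_coc h c"
proof -
  note o = odd_facts [OF h]
  let ?x = "dif h"
  have minus: "- y = - 1 * (y::'a)" for y by simp
  obtain c where c: "coc m ?x h c" and cd: "\<And>x. c (d x) = c x"
    using average_coc [of "?x" "- 1" h "- 1"] o by auto
  \<comment> \<open>The first three terms fail to be additive by
    \<open>- 3 * h (s x) * h (s y)\<close>. The last term repairs this exactly: 15 is 3/2 modulo
    9.\<close>
  define M where "M x = c (s x) - c x - 5 * ?x x ^ 2 + 15 * h (s x) ^ 2" for x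
  have M: "fn m M"
    unfolding fn_def additive_map_def
  proof safe
    fix x y
    have "M (x + y) = M x + M y + 9 * (h x * h (s y) + 2 * h (s x) * h (s y) + h (s x) * h y - h x * h y)"
      by (simp add: M_def sadd coc_add [OF c] fn_simps [OF o(1)] o(3) dif_def power2_eq_square algebra_simps)
    then show "M (x + y) = M x + M y" by (simp add: nine)
    show "M (pr m x) = M x" using c fn_pr [OF o(5)] by (simp add: M_def sadd coc_def)
  qed
  have Md: "M (d x) = M x" for x by (simp add: M_def cd o sd)
  have M0: "M x + M (s x) + M (s (s x)) = 0" for x
  proof -
    have "c (s (s (s x))) = c x"
      using c by (simp add: s3 coc_props(4) [OF c o(5) o(1)] o) (simp add: coc_def)
    then have "M x + M (s x) + M (s (s x)) = - 5 * (?x x ^ 2 + ?x (s x) ^ 2 + ?x (s (s x)) ^ 2) + 15 * (h (s x) ^ 2 + h (s (s x)) ^ 2 + h (s (s (s x))) ^ 2)"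
      by (simp add: M_def algebra_simps)
    then show ?thesis
      by (simp add: dif_def o(3) power2_eq_square algebra_simps)
  qed
  obtain \<nu> where v: "fn m \<nu>" "\<And>x. 3 * M x = 3 * (\<nu> (s x) - \<nu> x)" using even [OF M Md M0] by blast
  define c' where "c' x = c x - \<nu> x" for x
  have "coc m ?x h c'" using c v(1) by (simp add: coc_def c'_def fn_simps)
  moreover have "3 * (c' (s x) - c' x - 5 * ?x x ^ 2) = 0" for x
  proof -
    have "3 * (c' (s x) - c' x - 5 * ?x x ^ 2) = 3 * M x - 3 * (\<nu> (s x) - \<nu> x) - 9 * (5 * h (s x) ^ 2)"
      by (simp add: c'_def M_def algebra_simps)
    then show ?thesis by (simp add: v(2) nine)
  qed
  ultimately show ?thesis unfolding normal_coc_def by blast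
qed

text \<open>A Massey product of \<open>dif h\<close>, \<open>dif h\<close> and \<open>h\<close>: the
  cochain \<open>w\<close> bounds its defining cocycle. Comparing \<open>w\<close> at a
  homologically trivial word and at its image under \<open>s\<close> brings in
  \<open>s (s (s x))\<close>, which is \<open>x\<close> conjugated by \<open>Z\<close>, and so the
  value \<open>c Z\<close>.\<close>

lemma normal_coc_value:
  assumes h: "is_odd h" and c: "normal_coc h c"
    and x: "\<And>g::fg \<Rightarrow> 'a. fn m g \<Longrightarrow> g x + g (s x) + g (s (s x)) = 0" "pr m x = x"
  shows "3 * (dif h x * c Z) = 3 * dif h x ^ 3"
proof -
  note o = odd_facts [OF h]
  let ?x = "dif h"
  have cc: "coc m ?x h c" and cs: "\<And>x. 3 * (c (s x) - c x - 5 * ?x x ^ 2) = 0" using c by (auto simp: normal_coc_def)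
  have "\<exists>w. (\<forall>x y. w (x + y) = w x + w y + (5 * ?x x ^ 2 * h y + ?x x * c y)) \<and> (\<forall>x. w (pr m x) = w x)"
  proof (rule exists_pr_cochain)
    fix x y z
    have "5 * ?x y ^ 2 * h z + ?x y * c z + (5 * ?x x ^ 2 * h (y + z) + ?x x * c (y + z))
      = 5 * ?x (x + y) ^ 2 * h z + ?x (x + y) * c z + (5 * ?x x ^ 2 * h y + ?x x * c y) - 9 * (?x x * ?x y * h z)"
      by (simp add: fn_simps [OF o(1)] fn_simps [OF o(5)] coc_add [OF cc] power2_eq_square algebra_simps)
    then show "5 * ?x y ^ 2 * h z + ?x y * c z + (5 * ?x x ^ 2 * h (y + z) + ?x x * c (y + z))
      = 5 * ?x (x + y) ^ 2 * h z + ?x (x + y) * c z + (5 * ?x x ^ 2 * h y + ?x x * c y)" by (simp add: nine)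
  qed (use cc in \<open>simp_all add: fn_simps [OF o(1)] fn_simps [OF o(5)] coc_props(1) [OF cc o(5) o(1)] coc_def\<close>)
  then obtain w where w: "\<And>x y. w (x + y) = w x + w y + (5 * ?x x ^ 2 * h y + ?x x * c y)" "\<And>x. w (pr m x) = w x" by blast
  have xs: "?x (s x) = ?x x - 3 * h (s x)" for x by (simp add: dif_def o(3))
  have hs: "h (s x) = h x + ?x x" for x by (simp add: dif_def)
  \<comment> \<open>Up to multiples of 3, \<open>s\<close> changes the cocycle bounded by
    \<open>w\<close> by \<open>5 * a ^ 2 * b + 5 * a * b ^ 2\<close>, where \<open>a\<close> and
    \<open>b\<close> are the values of \<open>dif h\<close>. This is bounded by 5/3 of the cube;
    multiplication by 3 makes sense of the denominator.\<close>
  define G where "G x = 3 * (w (s x) - w x) - 5 * ?x x ^ 3" for x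
  have G: "fn m G"
    unfolding fn_def additive_map_def
  proof safe
    fix x y
    have c3: "3 * c (s y) = 3 * c y + 15 * ?x y ^ 2" using cs [of y] by (simp add: algebra_simps)
    have x3: "3 * ?x (s x) = 3 * ?x x" using nine_mult [of "h (s x)"] by (simp add: xs algebra_simps)
    have "3 * (5 * ?x (s x) ^ 2 * h (s y) + ?x (s x) * c (s y)) = 5 * (3 * ?x (s x)) * ?x (s x) * h (s y) + (3 * ?x (s x)) * c (s y)"
      by (simp add: power2_eq_square algebra_simps)
    also have "\<dots> = 5 * (3 * ?x x) * ?x (s x) * h (s y) + (3 * ?x x) * c (s y)"
      by (simp only: x3)
    also have "\<dots> = 5 * ?x x * (3 * ?x (s x)) * h (s y) + ?x x * (3 * c (s y))"
      by (simp add: algebra_simps)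
    also have "\<dots> = 5 * ?x x * (3 * ?x x) * (h y + ?x y) + ?x x * (3 * c y + 15 * ?x y ^ 2)"
      by (simp only: x3 c3 hs)
    finally show "G (x + y) = G x + G y"
      by (simp add: G_def sadd w(1) fn_simps [OF o(5)] power2_eq_square power3_eq_cube algebra_simps)
    show "G (pr m x) = G x" using fn_pr [OF o(5)] by (simp add: G_def sadd w(2))
  qed
  define y where "y = s x"
  define z where "z = s y"
  \<comment> \<open>In this palindrome the unknown values \<open>c x\<close>, \<open>c y\<close>,
    \<open>c z\<close> enter \<open>w p\<close> and \<open>w (s p)\<close> with equal coefficients;
    they would not for \<open>x + y + z\<close>.\<close>
  define p where "p = x + y + z + z + y + x"
  have x': "s z = Z + x - Z" using s3 [of x] x(2) by (simp add: y_def z_def)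
  have sp: "s p = y + z + s z + s z + z + y" by (simp add: p_def sadd y_def z_def)
  have hz: "h z = - h x - h y" by (simp add: z_def y_def o(3))
  have xx: "?x x = h y - h x" "?x y = - h x - 2 * h y" "?x z = 2 * h x + h y"
    using o(3) [of x] o(3) [of y] hz by (simp_all add: dif_def y_def z_def)
  have "G p = 2 * (G x + G (s x) + G (s (s x)))"
    by (simp add: p_def fn_simps [OF G] y_def z_def)
  then have Gp: "G p = 0" using x(1) [OF G] by simp
  have "?x p = 2 * (?x x + ?x (s x) + ?x (s (s x)))"
    by (simp add: p_def fn_simps [OF o(5)] y_def z_def)
  then have "?x p = 0" using x(1) [OF o(5)] by simp
  then have eq: "3 * w (s p) = 3 * w p" using Gp by (simp add: G_def algebra_simps)
  have cneg: "c (- Z) = - c Z" using coc_props(2) [OF cc o(5) o(1)] o by simp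
  have wneg: "w (- Z) = - w Z"
  proof -
    have "w 0 = 0" using w(1) [of 0 0] by (simp add: fn_simps [OF o(5)])
    then show ?thesis using w(1) [of Z "- Z"] by (simp add: o fn_simps [OF o(1)] eq_neg_iff_add_eq_0 add.commute)
  qed
  have wx': "w (s z) = w x - ?x x * c Z"
    unfolding x' diff_conv_add_uminus w(1) by (simp add: wneg cneg o fn_simps [OF o(1)] fn_simps [OF o(5)])
  have cx': "c (s z) = c x" using coc_props(4) [OF cc o(5) o(1)] o by (simp add: x')
  have hx': "h (s z) = h x" "?x (s z) = ?x x" using o by (simp_all add: x' fn_simps [OF o(1)] fn_simps [OF o(5)])
  have wp: "w p = 2 * (w x + w y + w z) + 5 * (?x x ^ 2 * h y + (?x x + ?x y) ^ 2 * h z + (?x x + ?x y + ?x z) ^ 2 * h z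
     + (?x x + ?x y + 2 * ?x z) ^ 2 * h y + (?x x + 2 * ?x y + 2 * ?x z) ^ 2 * h x)
     + (?x x * c y + (?x x + ?x y) * c z + (?x x + ?x y + ?x z) * c z
     + (?x x + ?x y + 2 * ?x z) * c y + (?x x + 2 * ?x y + 2 * ?x z) * c x)"
    unfolding p_def w(1) fn_simps [OF o(5)] by (simp add: algebra_simps)
  have wsp: "w (s p) = 2 * (w x + w y + w z) - 2 * (?x x * c Z) + 5 * (?x y ^ 2 * h z + (?x y + ?x z) ^ 2 * h x + (?x x + ?x y + ?x z) ^ 2 * h x
     + (2 * ?x x + ?x y + ?x z) ^ 2 * h z + (2 * ?x x + ?x y + 2 * ?x z) ^ 2 * h y)
     + (?x y * c z + (?x y + ?x z) * c x + (?x x + ?x y + ?x z) * c x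
     + (2 * ?x x + ?x y + ?x z) * c z + (2 * ?x x + ?x y + 2 * ?x z) * c y)"
    unfolding sp w(1) wx' cx' hx' fn_simps [OF o(5)] by (simp add: algebra_simps)
  have "3 * w (s p) - 3 * w p = 6 * (?x x ^ 3 - ?x x * c Z) + 9 * (?x x ^ 3 - 5 * h x * (h x + h y) * ?x x - 5 * h y * ?x x ^ 2)"
    unfolding wp wsp xx hz by (simp add: power2_eq_square power3_eq_cube algebra_simps)
  then have "6 * (?x x ^ 3 - ?x x * c Z) = 0" by (simp add: eq nine)
  then have "2 * (3 * (?x x ^ 3 - ?x x * c Z)) = 0" by (simp add: algebra_simps)
  then have "3 * (?x x ^ 3 - ?x x * c Z) = 0" by (rule double_zero)
  then show ?thesis by (simp add: algebra_simps)
qed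

text \<open>The alternating sum of \<open>y\<close> over the powers of \<open>d\<close> evaluates
  every functional through an odd one, so \<open>odd\<close> supplies the assumption of
  \<open>normal_coc_value\<close>. It multiplies \<open>dif h y\<close> by 4, whose square is 1
  modulo 3, and the unit \<open>dif h x\<close> can be cancelled.\<close>

lemma normal_coc_unit_value:
  assumes h: "is_odd h" and c: "normal_coc h c" and y: "3 * dif h y ^ 2 = 3"
  shows "3 * c Z = 3"
proof -
  note o = odd_facts [OF h]
  define x where "x = pr m y - d y + d (d y) - d (d (d y))"
  have "g x + g (s x) + g (s (s x)) = 0" if g: "fn m g" for g :: "fg \<Rightarrow> 'a"
  proof -
    define k where "k v = g v - g (d v) + g (d (d v)) - g (d (d (d v)))" for v
    have k: "fn m k"
      using g by (simp add: fn_def additive_map_def k_def dadd)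
    have "k (d v) = - k v" for v
      using g by (simp add: k_def d4 fn_simps [OF g] Z')
    then have "k y + k (s y) + k (s (s y)) = 0" by (rule odd [OF k])
    then show ?thesis by (simp add: x_def k_def sadd sd fn_simps [OF g])
  qed
  moreover have "pr m x = x" by (simp add: x_def dadd)
  ultimately have v: "3 * (dif h x * c Z) = 3 * dif h x ^ 3" by (rule normal_coc_value [OF h c])
  have xy: "dif h x = 4 * dif h y" by (simp add: x_def fn_simps [OF o(5)] o)
  have "3 * dif h x ^ 2 = 3 * dif h y ^ 2 + 9 * (5 * dif h y ^ 2)" by (simp add: xy power2_eq_square algebra_simps)
  then have x2: "3 * dif h x ^ 2 = 3" by (simp add: y nine)
  have "3 * c Z = 3 * dif h x ^ 2 * c Z" by (simp add: x2)
  also have "\<dots> = dif h x * (3 * (dif h x * c Z))" by (simp add: power2_eq_square algebra_simps)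
  also have "\<dots> = (3 * dif h x ^ 2) * dif h x ^ 2" unfolding v by (simp add: power2_eq_square power3_eq_cube algebra_simps)
  also have "\<dots> = 3" by (simp only: x2)
  finally show ?thesis .
qed

lemma is_odd_add: "is_odd h \<Longrightarrow> is_odd h' \<Longrightarrow> is_odd (\<lambda>x. h x + h' x)"
  and is_odd_diff: "is_odd h \<Longrightarrow> is_odd h' \<Longrightarrow> is_odd (\<lambda>x. h x - h' x)"
  by (simp_all add: is_odd_def fn_def additive_map_def)

text \<open>The parallelogram law: \<open>2 * c + 2 * c' - cp\<close> is a normalized cochain for
  \<open>h - h'\<close>. As all four values at \<open>Z\<close> are 1 modulo 3, it would follow that
  1 = 2 + 2 - 1 modulo 3.\<close>

lemma odd_rank_le_1:
  assumes h: "is_odd h" "is_odd h'"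
    and unit: "\<exists>x. 3 * dif h x ^ 2 = 3" "\<exists>x. 3 * dif h' x ^ 2 = 3"
      "\<exists>x. 3 * dif (\<lambda>x. h x + h' x) x ^ 2 = 3" "\<exists>x. 3 * dif (\<lambda>x. h x - h' x) x ^ 2 = 3"
  shows "(3::'a) = 0"
proof -
  let ?p = "\<lambda>x. h x + h' x" and ?m = "\<lambda>x. h x - h' x"
  obtain c c' cp where c: "normal_coc h c" "normal_coc h' c'" "normal_coc ?p cp"
    using normal_coc_exists h is_odd_add by metis
  have dif: "dif ?p x = dif h x + dif h' x" "dif ?m x = dif h x - dif h' x" for x
    by (simp_all add: dif_def)
  have m: "normal_coc ?m (\<lambda>x. 2 * c x + 2 * c' x - cp x)"
    unfolding normal_coc_def
  proof safe
    show "coc m (dif ?m) ?m (\<lambda>x. 2 * c x + 2 * c' x - cp x)"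
      using c by (simp add: normal_coc_def coc_def dif algebra_simps)
    fix x
    have "3 * (c (s x) - c x - 5 * dif h x ^ 2) = 0" "3 * (c' (s x) - c' x - 5 * dif h' x ^ 2) = 0"
      "3 * (cp (s x) - cp x - 5 * (dif h x + dif h' x) ^ 2) = 0"
      using c by (simp_all add: normal_coc_def dif)
    moreover have "3 * (2 * c (s x) + 2 * c' (s x) - cp (s x) - (2 * c x + 2 * c' x - cp x) - 5 * dif ?m x ^ 2)
      = 2 * (3 * (c (s x) - c x - 5 * dif h x ^ 2)) + 2 * (3 * (c' (s x) - c' x - 5 * dif h' x ^ 2))
       - 3 * (cp (s x) - cp x - 5 * (dif h x + dif h' x) ^ 2)"
      by (simp add: dif power2_eq_square algebra_simps)
    ultimately show "3 * (2 * c (s x) + 2 * c' (s x) - cp (s x) - (2 * c x + 2 * c' x - cp x) - 5 * dif ?m x ^ 2) = 0"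
      by simp
  qed
  have "3 * c Z = 3" "3 * c' Z = 3" "3 * cp Z = 3" "3 * (2 * c Z + 2 * c' Z - cp Z) = 3"
    using unit normal_coc_unit_value [OF h(1) c(1)] normal_coc_unit_value [OF h(2) c(2)]
      normal_coc_unit_value [OF is_odd_add [OF h] c(3)] normal_coc_unit_value [OF is_odd_diff [OF h] m] by blast+
  moreover have "3 * (2 * c Z + 2 * c' Z - cp Z) = 2 * (3 * c Z) + 2 * (3 * c' Z) - 3 * cp Z" by (simp add: algebra_simps)
  ultimately have "(9::'a) = 3" by simp
  then show ?thesis by (simp add: nine)
qed

text \<open>A Massey product formed with the invariant functional \<theta>. The word
  \<open>- t + s t\<close> is invisible to functionals, and its orbit under \<open>s\<close> adds up
  to the commutator of \<open>- t\<close> and \<open>Z\<close>. There the cochain \<open>A\<close>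
  takes the value \<open>\<theta> Z * dd t - \<theta> t * dd Z\<close>, which forces
  \<open>3 * dd Z = 0\<close>, while \<open>dd Z\<close> is twice the value \<open>c Z\<close>
  computed before.\<close>

lemma no_fixed_part:
  fixes \<theta> :: "fg \<Rightarrow> 'a"
  assumes h: "is_odd h" and unit: "3 * dif h y ^ 2 = 3"
    and \<theta>: "fn m \<theta>" "\<And>x. \<theta> (d x) = \<theta> x" "\<And>x. \<theta> (s x) = \<theta> x"
    and t: "pr m t = t" "\<theta> t = 1" "\<And>g::fg \<Rightarrow> 'a. fn m g \<Longrightarrow> g (s t) = g t" "\<And>g::fg \<Rightarrow> 'a. fn m g \<Longrightarrow> g (d t) = g t"
  shows "(3::'a) = 0"
proof -
  note o = odd_facts [OF h]
  let ?x = "dif h"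
  obtain c where c: "normal_coc h c" using normal_coc_exists [OF h] by blast
  have cc: "coc m ?x h c" and cs: "\<And>x. 3 * (c (s x) - c x - 5 * ?x x ^ 2) = 0" using c by (auto simp: normal_coc_def)
  have cZ: "3 * c Z = 3" by (rule normal_coc_unit_value [OF h c unit])
  have hs: "h (s x) = h x + ?x x" "?x (s x) = - 3 * h x - 2 * ?x x" for x by (simp_all add: dif_def o(3))
  obtain u where u: "coc m \<theta> h u" and ud: "\<And>x. u (d x) = - u x"
    using average_coc [of \<theta> 1 h "- 1"] o \<theta> by auto
  \<comment> \<open>This sum would be invariant under \<open>s\<close> if the third power of
    \<open>s\<close> were the identity; conjugation by \<open>Z\<close> leaves the term
    \<open>\<theta> Z * h\<close>. As \<open>al\<close> is odd this gives
    \<open>3 * \<theta> Z = 0\<close>.\<close>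
  define al where "al x = u x + u (s x) + u (s (s x))" for x
  have uZ: "u (Z + x - Z) = u x + \<theta> Z * h x" for x using coc_props(4) [OF u \<theta>(1) o(1)] o by simp
  have upr: "u (pr m x) = u x" for x using u by (simp add: coc_def)
  have al: "fn m al"
    using u by (simp add: fn_def additive_map_def coc_def al_def sadd \<theta>(3) o(3) algebra_simps)
  have "al (d x) = - al x" for x by (simp add: al_def sd ud)
  then have alo: "is_odd al" using al by (simp add: is_odd_def)
  have als: "al (s x) = al x + \<theta> Z * h x" for x by (simp add: al_def s3 uZ upr fn_pr [OF o(1)])
  have al3: "3 * al x = - \<theta> Z * (3 * h x + ?x x)" for x
  proof -
    have "al x + al (s x) + al (s (s x)) = 3 * al x + \<theta> Z * (3 * h x + ?x x)"
      by (simp add: als hs) (simp add: algebra_simps)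
    then show ?thesis using odd_facts(3) [OF alo, of x] by (simp add: algebra_simps eq_neg_iff_add_eq_0)
  qed
  have tZ: "3 * \<theta> Z = 0"
  proof -
    have "3 * (\<theta> Z * ?x x) = 0" for x
    proof -
      have "3 * (3 * al x) = - (9 * (\<theta> Z * h x)) - 3 * (\<theta> Z * ?x x)" unfolding al3 by (simp add: algebra_simps)
      then show ?thesis by (simp add: nine flip: mult.assoc)
    qed
    then have "3 * (\<theta> Z * ?x y) * ?x y = 0" by simp
    then have "\<theta> Z * (3 * ?x y ^ 2) = 0" by (simp add: power2_eq_square algebra_simps)
    then show ?thesis by (simp add: unit mult.commute)
  qed
  then obtain t0 where t0: "\<theta> Z = 3 * t0" using three by blast
  define v where "v x = u (s x) - u x" for x
  \<comment> \<open>The coboundary of \<open>dd\<close> is the antisymmetric product of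
    \<open>dif h\<close> and \<open>h\<close>, as required by the products of \<theta> with
    \<open>dif h\<close> and \<open>h\<close>, which \<open>v\<close> and \<open>u\<close>
    bound.\<close>
  define dd where "dd x = 2 * c x - ?x x * h x" for x
  have "\<exists>A. (\<forall>x y. A (x + y) = A x + A y + (v x * h y - u x * ?x y + \<theta> x * dd y)) \<and> (\<forall>x. A (pr m x) = A x)"
  proof (rule exists_pr_cochain)
    fix x y z
    show "v y * h z - u y * ?x z + \<theta> y * dd z + (v x * h (y + z) - u x * ?x (y + z) + \<theta> x * dd (y + z)) =
       v (x + y) * h z - u (x + y) * ?x z + \<theta> (x + y) * dd z + (v x * h y - u x * ?x y + \<theta> x * dd y)"
      by (simp add: fn_simps [OF o(1)] fn_simps [OF o(5)] fn_simps [OF \<theta>(1)] coc_add [OF cc] coc_add [OF u] v_def dd_def sadd hs \<theta>(3)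
          algebra_simps)
  qed (use cc u in \<open>simp_all add: fn_simps [OF o(1)] fn_simps [OF o(5)] fn_simps [OF \<theta>(1)] v_def dd_def sadd
     coc_props(1) [OF cc o(5) o(1)] coc_props(1) [OF u \<theta>(1) o(1)] coc_def additive_map_zero [OF endo_additive [OF endo(1)]]\<close>)
  then obtain A where A: "\<And>x y. A (x + y) = A x + A y + (v x * h y - u x * ?x y + \<theta> x * dd y)" "\<And>x. A (pr m x) = A x" by blast
  \<comment> \<open>The additional term compensates for the \<open>\<theta> Z\<close> that
    \<open>al\<close> introduces when \<open>s\<close> is applied.\<close>
  define G where "G x = 3 * (A (s x) - A x) + \<theta> Z * (c x + 5 * ?x x ^ 2)" for x
  have G: "fn m G"
    unfolding fn_def additive_map_def
  proof safe
    fix x y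
    have dds: "3 * dd (s y) = 3 * dd y"
    proof -
      have "3 * dd (s y) = 2 * (3 * (c (s y) - c y - 5 * ?x y ^ 2)) + 3 * dd y + 9 * (h y ^ 2 + 2 * ?x y * h y + 4 * ?x y ^ 2)"
        by (simp add: dd_def hs power2_eq_square algebra_simps)
      then show ?thesis by (simp only: cs nine mult_zero_left mult_zero_right add_0 add_0_right)
    qed
    have vs: "v (s x) = al x - u x - 2 * u (s x)" by (simp add: v_def al_def)
    have "3 * (v (s x) * h (s y) - u (s x) * ?x (s y) + \<theta> (s x) * dd (s y)) =
      3 * (v x * h y - u x * ?x y) + \<theta> x * (3 * dd (s y)) + (3 * al x) * (h y + ?x y)"
      unfolding vs by (simp add: v_def hs \<theta>(3) algebra_simps)
    also have "\<dots> = 3 * (v x * h y - u x * ?x y + \<theta> x * dd y) - \<theta> Z * (?x x * (h y + ?x y)) - 9 * (t0 * h x * (h y + ?x y))"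
      unfolding dds al3 by (simp add: t0 algebra_simps)
    finally have *: "3 * (v (s x) * h (s y) - u (s x) * ?x (s y) + \<theta> (s x) * dd (s y)) =
      3 * (v x * h y - u x * ?x y + \<theta> x * dd y) - \<theta> Z * (?x x * (h y + ?x y))" by (simp add: nine)
    have "G (x + y) = G x + G y + 3 * (v (s x) * h (s y) - u (s x) * ?x (s y) + \<theta> (s x) * dd (s y))
      - 3 * (v x * h y - u x * ?x y + \<theta> x * dd y) + \<theta> Z * (?x x * h y + 10 * (?x x * ?x y))"
      by (simp add: G_def sadd A(1) coc_add [OF cc] fn_simps [OF o(5)] power2_eq_square algebra_simps)
    also have "\<dots> = G x + G y + 9 * (\<theta> Z * ?x x * ?x y)" unfolding * by (simp add: algebra_simps)
    finally show "G (x + y) = G x + G y" by (simp add: nine)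
    show "G (pr m x) = G x" using cc fn_pr [OF o(5)] by (simp add: G_def sadd A(2) coc_def)
  qed
  have gs: "g (s t) = g t" "g (s (s t)) = g t" "g (s (s (s t))) = g t" if "fn m g" for g :: "fg \<Rightarrow> 'a"
    using t(3) [OF that] t(3) [OF fn_comp [OF that endo(1)]] t(3) [OF fn_comp [OF fn_comp [OF that endo(1)] endo(1)]] by simp_all
  have ht: "h t = 0" using t(4) [OF o(1)] double_zero [of "h t"] o(2) [of t] by (simp add: eq_neg_iff_add_eq_0)
  have xt: "?x t = 0" by (simp add: dif_def gs o(1) ht)
  \<comment> \<open>A word killed by all functionals, whose translates under \<open>s\<close>
    telescope to \<open>- t + (Z + t - Z)\<close>.\<close>
  define e where "e = - t + s t"
  have ge: "g e = 0" "g (s e) = 0" if "fn m g" for g :: "fg \<Rightarrow> 'a" using gs [OF that] by (simp_all add: e_def sadd fn_simps [OF that])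
  have cse: "\<theta> Z * c (s x) = \<theta> Z * c x" if "?x x = 0" for x
  proof -
    have "\<theta> Z * c (s x) - \<theta> Z * c x = t0 * (3 * (c (s x) - c x - 5 * ?x x ^ 2))" by (simp add: t0 that algebra_simps)
    then show ?thesis by (simp only: cs mult_zero_right eq_iff_diff_eq_0 [of "\<theta> Z * c (s x)"])
  qed
  have ce: "\<theta> Z * c e = 0"
  proof -
    have ce1: "c e = c (s t) - c t"
      by (simp add: e_def coc_add [OF cc] coc_props(2) [OF cc o(5) o(1)] xt ht fn_simps [OF o(5)])
    show ?thesis unfolding ce1 right_diff_distrib cse [OF xt] by simp
  qed
  have "3 * A (s e) = 3 * A e" "3 * A (s (s e)) = 3 * A (s e)"
    using ge [OF G] ge [OF o(5)] ce cse [of e] by (simp_all add: G_def distrib_left algebra_simps)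
  then have "3 * (A e + A (s e) + A (s (s e))) = 9 * A e" by (simp add: algebra_simps)
  then have A3: "3 * A (e + s e + s (s e)) = 0"
    using ge [OF o(1)] ge [OF o(5)] ge [OF \<theta>(1)] hs [of "s e"] hs [of e]
    by (simp add: A(1) fn_simps [OF \<theta>(1)] fn_simps [OF o(1)] fn_simps [OF o(5)] nine)
  have ee: "e + s e + s (s e) = - t + (Z + t - Z)"
    by (simp add: e_def sadd s3 t(1) group_norm del: add_uminus_conv_diff)
  have AA: "A (- t + (Z + t - Z)) = \<theta> Z * dd t - \<theta> t * dd Z"
  proof -
    have A0: "A 0 = 0" using A(1) [of 0 0] coc_props(1) [OF cc o(5) o(1)]
      by (simp add: fn_simps [OF o(1)] fn_simps [OF o(5)] fn_simps [OF \<theta>(1)])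
    have An: "A (- x) = - A x + \<theta> x * dd x" if "h x = 0" "?x x = 0" for x
    proof -
      have dn: "dd (- x) = - dd x" using that coc_props(2) [OF cc o(5) o(1)] by (simp add: dd_def fn_simps [OF o(1)])
      have "A x + A (- x) + \<theta> x * dd (- x) = 0"
        using A(1) [of x "- x"] that A0 by (simp add: fn_simps [OF o(1)] fn_simps [OF o(5)])
      then show ?thesis unfolding dn by (simp add: algebra_simps)
    qed
    have ddn: "dd (- Z) = - dd Z" "dd (Z + t - Z) = dd t"
      using o ht xt coc_props(2,4) [OF cc o(5) o(1)] by (simp_all add: dd_def fn_simps [OF o(1)] fn_simps [OF o(5)])
    have 1: "A (Z + t - Z) = A t + \<theta> Z * dd t - \<theta> t * dd Z"
      unfolding diff_conv_add_uminus A(1)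
      by (simp add: An o ddn ht xt fn_simps [OF o(1)] fn_simps [OF o(5)] fn_simps [OF \<theta>(1)] algebra_simps)
    show ?thesis
      unfolding A(1) [of "- t"]
      by (simp add: An 1 ddn ht xt o fn_simps [OF o(1)] fn_simps [OF o(5)] fn_simps [OF \<theta>(1)] algebra_simps)
  qed
  have "3 * (\<theta> Z * dd t) - 3 * dd Z = 0" using A3 unfolding ee AA by (simp add: t(2) right_diff_distrib)
  moreover have "3 * (\<theta> Z * dd t) = 0" using tZ by (simp flip: mult.assoc)
  moreover have "3 * dd Z = 2 * (3 * c Z)" by (simp add: dd_def o)
  ultimately have "2 * (3::'a) = 0" using cZ by simp
  then show ?thesis by (rule double_zero)
qed

end

section \<open>Linear representations by transvections\<close>

text \<open>The operators \<open>E i\<close> and \<open>R i j\<close> stand for inversions, up to a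
  central sign, and transvections. The dimension enters only through \<open>E_rank\<close>, which
  says that no eigenvector is negated by two of the \<open>E i\<close>, and through
  \<open>no_signs\<close>. In \<open>L_comm\<close> a left transvection occurs as a conjugate of a
  right one; \<open>T\<close> is a signed transposition. The relation \<open>outer\<close> is the
  one that holds in \<open>Out\<close> but not in \<open>Aut\<close>.\<close>

locale transvections =
  fixes n :: nat and E :: "nat \<Rightarrow> 'v::real_vector \<Rightarrow> 'v" and R :: "nat \<Rightarrow> nat \<Rightarrow> 'v \<Rightarrow> 'v"
  assumes n: "n \<ge> 6"
    and linE: "i < n \<Longrightarrow> linear (E i)"
    and linR: "i < n \<Longrightarrow> j < n \<Longrightarrow> i \<noteq> j \<Longrightarrow> linear (R i j)"
    and E_E: "i < n \<Longrightarrow> E i (E i v) = v"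
    and E_rank: "i < n \<Longrightarrow> j < n \<Longrightarrow> i \<noteq> j \<Longrightarrow> E i (E j v) = E i v + E j v - v"
    and E_R: "i < n \<Longrightarrow> j < n \<Longrightarrow> k < n \<Longrightarrow> i \<noteq> j \<Longrightarrow> k \<noteq> i \<Longrightarrow> k \<noteq> j \<Longrightarrow> E k (R i j v) = R i j (E k v)"
    and R_inv: "i < n \<Longrightarrow> j < n \<Longrightarrow> i \<noteq> j \<Longrightarrow> E j (R i j (E j (R i j v))) = v"
    and R_R: "i < n \<Longrightarrow> j < n \<Longrightarrow> k < n \<Longrightarrow> i \<noteq> j \<Longrightarrow> i \<noteq> k \<Longrightarrow> j \<noteq> k \<Longrightarrow> R j k (R i j v) = R i j (R j k (R i k v))"
    and R_comm: "i < n \<Longrightarrow> j < n \<Longrightarrow> k < n \<Longrightarrow> l < n \<Longrightarrow> i \<noteq> j \<Longrightarrow> k \<noteq> l \<Longrightarrow> i \<noteq> k \<Longrightarrow> j \<noteq> k \<Longrightarrow> i \<noteq> l \<Longrightarrow>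
      R i j (R k l v) = R k l (R i j v)"
    and L_comm: "i < n \<Longrightarrow> j < n \<Longrightarrow> k < n \<Longrightarrow> i \<noteq> j \<Longrightarrow> i \<noteq> k \<Longrightarrow> j \<noteq> k \<Longrightarrow>
      E i (E k (R i k (E k (E i (R i j v))))) = R i j (E i (E k (R i k (E k (E i v)))))"
    and T_E: "i < n \<Longrightarrow> j < n \<Longrightarrow> i \<noteq> j \<Longrightarrow>
      T = (\<lambda>v. E i (E j (R i j (E j (E i (E j (R j i (E j (R i j v))))))))) \<Longrightarrow> T (E i v) = E j (T v)"
      "i < n \<Longrightarrow> j < n \<Longrightarrow> i \<noteq> j \<Longrightarrow>
      T = (\<lambda>v. E i (E j (R i j (E j (E i (E j (R j i (E j (R i j v))))))))) \<Longrightarrow> T (E j v) = E i (T v)"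
    and outer: "k < n \<Longrightarrow> foldr E [0..<n] (foldr (\<lambda>j. R j k) (filter (\<lambda>j. j \<noteq> k) [0..<n]) v)
      = foldr (\<lambda>j. R j k) (filter (\<lambda>j. j \<noteq> k) [0..<n]) (foldr E [0..<n] v)"
    and no_signs: "i < n \<Longrightarrow> k < n \<Longrightarrow> i \<noteq> k \<Longrightarrow> U u \<Longrightarrow> j < n \<Longrightarrow> j \<noteq> i \<Longrightarrow> j \<noteq> k \<Longrightarrow>
      (\<And>u j. U u \<Longrightarrow> j < n \<Longrightarrow> j \<noteq> i \<Longrightarrow> j \<noteq> k \<Longrightarrow> U (R i j u) \<and> R i j (R i j u) = u) \<Longrightarrow>
      (\<And>u j l. U u \<Longrightarrow> j < n \<Longrightarrow> j \<noteq> i \<Longrightarrow> j \<noteq> k \<Longrightarrow> l < n \<Longrightarrow> l \<noteq> i \<Longrightarrow> l \<noteq> k \<Longrightarrow> R i j (R i l u) = R i l (R i j u)) \<Longrightarrow>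
      (\<And>u v. U u \<Longrightarrow> U v \<Longrightarrow> U (u + v) \<and> U (u - v)) \<Longrightarrow> R i j u = u"
begin

lemma E_lin: "i < n \<Longrightarrow> E i (u + v) = E i u + E i v" "i < n \<Longrightarrow> E i (u - v) = E i u - E i v" "i < n \<Longrightarrow> E i (- v) = - E i v"
    "i < n \<Longrightarrow> E i (a *\<^sub>R v) = a *\<^sub>R E i v" "i < n \<Longrightarrow> E i 0 = 0" "i < n \<Longrightarrow> E i (sum f A) = (\<Sum>x\<in>A. E i (f x))"
  by (simp_all add: linear_add [OF linE] linear_diff [OF linE] linear_neg [OF linE] linear_scale [OF linE] linear_0 [OF linE] linear_sum [OF linE])

lemma R_lin: assumes "i < n" "j < n" "i \<noteq> j"
  shows "R i j (u + v) = R i j u + R i j v" "R i j (u - v) = R i j u - R i j v" "R i j (- v) = - R i j v" "R i j (a *\<^sub>R v) = a *\<^sub>R R i j v" "R i j 0 = 0"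
  using linR [OF assms] by (rule linear_add linear_diff linear_neg linear_scale linear_0)+

lemma E_comm: "i < n \<Longrightarrow> j < n \<Longrightarrow> E i (E j v) = E j (E i v)"
  by (cases "i = j") (simp_all add: E_rank)

lemma R_inj: "i < n \<Longrightarrow> j < n \<Longrightarrow> i \<noteq> j \<Longrightarrow> R i j u = R i j v \<Longrightarrow> u = v"
  by (metis R_inv)

lemma eq_neg_self: assumes "u = - u" shows "u = (0::'v)"
proof -
  have "u + u = 0" using assms by (simp only: eq_neg_iff_add_eq_0)
  then have "(2::real) *\<^sub>R u = 0" by (simp only: scaleR_2)
  then show ?thesis by simp
qed

section \<open>The decomposition into eigenspaces of the inversions\<close>

definition W0 :: "'v \<Rightarrow> bool" where "W0 v \<longleftrightarrow> (\<forall>i<n. E i v = v)"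
definition W :: "nat \<Rightarrow> 'v \<Rightarrow> bool" where "W i v \<longleftrightarrow> E i v = - v"
definition p :: "nat \<Rightarrow> 'v \<Rightarrow> 'v" where "p i v = (1/2) *\<^sub>R (v - E i v)"

lemma W_other: assumes "W i v" "i < n" "j < n" "i \<noteq> j" shows "E j v = v"
proof -
  have "E i (E j v) = E j v - v - v" using assms E_rank [of i j v] by (simp add: W_def)
  moreover have "E i (E j v) = - E j v" using assms E_comm [of i j v] by (simp add: W_def E_lin)
  ultimately have "E j v - v = - (E j v - v)" by (simp add: algebra_simps)
  then have "E j v - v = 0" by (rule eq_neg_self)
  then show ?thesis by simp
qed

lemma W0_E: "W0 v \<Longrightarrow> i < n \<Longrightarrow> E i v = v"
  and W_E: "W i v \<Longrightarrow> E i v = - v"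
  by (simp_all add: W0_def W_def)

lemma double_p: "2 *\<^sub>R p i v = v - E i v"
  by (simp add: p_def)

lemma E_p: "E i v = v - p i v - p i v"
  using double_p [of i v] by (simp only: scaleR_2) (simp add: diff_diff_add)

lemma p_W: "i < n \<Longrightarrow> W i (p i v)"
  by (simp add: W_def p_def E_lin E_E algebra_simps)

lemma p_lin: "i < n \<Longrightarrow> p i (u + v) = p i u + p i v" "i < n \<Longrightarrow> p i (u - v) = p i u - p i v" "i < n \<Longrightarrow> p i (- v) = - p i v" "i < n \<Longrightarrow> p i 0 = 0"
  by (simp_all add: p_def E_lin algebra_simps)

lemma p_on: "W i v \<Longrightarrow> p i v = v" "E i v = v \<Longrightarrow> p i v = 0"
  by (simp_all add: p_def W_def)

lemma p_simps: "W0 v \<Longrightarrow> i < n \<Longrightarrow> p i v = 0" "W j v \<Longrightarrow> i < n \<Longrightarrow> j < n \<Longrightarrow> i \<noteq> j \<Longrightarrow> p i v = 0"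
  by (simp_all add: p_on(2) W0_E W_other)

lemma p_eq_0: "p i v = 0 \<Longrightarrow> E i v = v"
  by (simp add: p_def)

lemma W_closed: "i < n \<Longrightarrow> W i u \<Longrightarrow> W i v \<Longrightarrow> W i (u + v)" "i < n \<Longrightarrow> W i u \<Longrightarrow> W i v \<Longrightarrow> W i (u - v)" "i < n \<Longrightarrow> W i v \<Longrightarrow> W i (- v)" "i < n \<Longrightarrow> W i 0"
  by (simp_all add: W_def E_lin)

lemma W0_closed: "W0 u \<Longrightarrow> W0 v \<Longrightarrow> W0 (u + v)" "W0 u \<Longrightarrow> W0 v \<Longrightarrow> W0 (u - v)" "W0 v \<Longrightarrow> W0 (- v)" "W0 0"
  by (simp_all add: W0_def E_lin)

lemma W0_rest: "W0 (v - (\<Sum>i<n. p i v))"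
  unfolding W0_def
proof safe
  fix j assume j: "j < n"
  have "E j (\<Sum>i<n. p i v) = (\<Sum>i<n. if i = j then - p j v else p i v)"
    unfolding E_lin(6) [OF j] using j W_E [OF p_W] W_other [OF p_W] by (intro sum.cong refl) simp
  also have "\<dots> = (\<Sum>i<n. p i v - (if i = j then 2 *\<^sub>R p j v else 0))"
    by (intro sum.cong refl) (simp add: scaleR_2)
  also have "\<dots> = (\<Sum>i<n. p i v) - 2 *\<^sub>R p j v"
    using j by (simp add: sum_subtractf)
  finally have "E j (\<Sum>i<n. p i v) = (\<Sum>i<n. p i v) - (v - E j v)"
    by (simp only: double_p)
  then show "E j (v - (\<Sum>i<n. p i v)) = v - (\<Sum>i<n. p i v)"
    by (simp only: E_lin(2) [OF j]) (simp only: algebra_simps)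
qed

text \<open>The direct sum decomposition as an induction rule: identities between additive operators
  are checked on \<open>W0\<close> and on each \<open>W i\<close>.\<close>

lemma W_induct [case_names W0 W add]:
  assumes "\<And>v. W0 v \<Longrightarrow> P v" "\<And>i v. i < n \<Longrightarrow> W i v \<Longrightarrow> P v" "\<And>u v. P u \<Longrightarrow> P v \<Longrightarrow> P (u + v)"
  shows "P v"
proof -
  have "P ((v - (\<Sum>i<n. p i v)) + (\<Sum>i<k. p i v))" if "k \<le> n" for k
    using that
  proof (induction k)
    case 0
    have "v - (\<Sum>i<n. p i v) + (\<Sum>i<0. p i v) = v - (\<Sum>i<n. p i v)" by simp
    then show ?case by (simp only: assms(1) [OF W0_rest])
  next
    case (Suc k)
    have "v - (\<Sum>i<n. p i v) + (\<Sum>i<Suc k. p i v) = (v - (\<Sum>i<n. p i v) + (\<Sum>i<k. p i v)) + p k v"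
      by (simp add: add.assoc)
    moreover have "P (p k v)" using assms(2) [OF _ p_W] Suc.prems by simp
    ultimately show ?case using assms(3) Suc by (simp only: Suc_leD)
  qed
  from this [OF order_refl] show ?thesis by (simp only: diff_add_cancel)
qed

lemma R_W: "i < n \<Longrightarrow> j < n \<Longrightarrow> k < n \<Longrightarrow> i \<noteq> j \<Longrightarrow> k \<noteq> i \<Longrightarrow> k \<noteq> j \<Longrightarrow> W k v \<Longrightarrow> W k (R i j v)"
  by (simp add: W_def E_R R_lin)

text \<open>On \<open>W k\<close> the operator \<open>E j\<close> is the identity, so
  \<open>R_inv\<close> makes \<open>R i j\<close> an involution. These involutions commute for
  varying \<open>j\<close>, and \<open>no_signs\<close> makes them trivial.\<close>

lemma R_fix:
  assumes "i < n" "j < n" "k < n" "i \<noteq> j" "k \<noteq> i" "k \<noteq> j" "W k v" shows "R i j v = v"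
proof (rule no_signs [of i k "W k"])
  have inv: "R i j (R i j u) = u" if "W k u" "i < n" "j < n" "i \<noteq> j" "k \<noteq> i" "k \<noteq> j" for u i j
    using R_inv [of i j u] that assms(3) R_W [of i j k u] R_W [of i j k "R i j u"] W_other [of k "R i j u" j]
      W_other [of k "R i j (R i j u)" j] by simp
  fix u assume u: "W k u"
  show "W k (R i j u) \<and> R i j (R i j u) = u" if "j < n" "j \<noteq> i" "j \<noteq> k" for j
    using u that assms inv R_W by simp
  show "R i j (R i l u) = R i l (R i j u)" if j: "j < n" "j \<noteq> i" "j \<noteq> k" and l: "l < n" "l \<noteq> i" "l \<noteq> k" for j l
  proof (cases "j = l")
    case False
    have W: "W k (R i j x)" "W k (R i l x)" "W k (R j l x)" if "W k x" for x
      using that assms j l False R_W by simp_all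
    \<comment> \<open>Thus \<open>R j l\<close> conjugates \<open>R i j\<close> to the product of
      \<open>R i j\<close> and \<open>R i l\<close>. That product is an involution as well, and two
      involutions whose product is an involution commute.\<close>
    have rr: "R j l (R i j x) = R i j (R i l (R j l x))" for x
      using R_R [of i j l x] R_comm [of j l i l x] assms j l False by simp
    have AB: "R i j (R i l (R i j (R i l (R j l x)))) = R j l x" if x: "W k x" for x
    proof -
      have "R i j (R i l (R i j (R i l (R j l x)))) = R i j (R i l (R j l (R i j x)))" by (simp add: rr)
      also have "\<dots> = R j l (R i j (R i j x))" by (simp add: rr)
      finally show ?thesis using inv [of x i j] x assms j l by simp
    qed
    have "R i j (R i l (R i j (R i l u))) = u" using AB [of "R j l u"] W u inv [of u j l] assms j l False by simp
    moreover have "R i j (R i j (R i l (R i j (R i l u)))) = R i l (R i j (R i l u))"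
      "R i l (R i l (R i j (R i l u))) = R i j (R i l u)"
      by (rule inv; use W u assms j l in simp)+
    ultimately show ?thesis by metis
  qed simp
qed (use assms in \<open>auto intro: W_closed\<close>)

text \<open>\<open>D\<close> is 1 on \<open>W0\<close> and -1 on all \<open>W i\<close>. It commutes
  with \<open>S k\<close> by \<open>outer\<close>, which separates \<open>W0\<close> from the other
  components.\<close>

definition D :: "'v \<Rightarrow> 'v" where "D = foldr E [0..<n]"
definition S :: "nat \<Rightarrow> 'v \<Rightarrow> 'v" where "S k = foldr (\<lambda>j. R j k) (filter (\<lambda>j. j \<noteq> k) [0..<n])"

lemma D_on: "W0 v \<Longrightarrow> D v = v" "i < n \<Longrightarrow> W i v \<Longrightarrow> D v = - v"
proof -
  have *: "foldr E [0..<k] v = v" if "W0 v" "k \<le> n" for k v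
    using that by (induction k arbitrary: v) (auto simp: W0_E)
  then show "W0 v \<Longrightarrow> D v = v" by (simp add: D_def)
  have **: "foldr E [0..<k] v = (if i < k then - v else v)" if "W i v" "k \<le> n" "i < n" for k v
    using that
  proof (induction k arbitrary: v)
    case (Suc k)
    then show ?case
      using Suc.IH [of v] Suc.IH [of "- v"] W_closed(3) [of i v] W_other [of i v k]
      by (cases "i = k") (auto simp: W_E)
  qed simp
  show "i < n \<Longrightarrow> W i v \<Longrightarrow> D v = - v" using **[of v n] by (simp add: D_def)
qed

lemma D_lin: "D (u + v) = D u + D v" "D (u - v) = D u - D v" "D (- v) = - D v" "i < n \<Longrightarrow> E i (D v) = D (E i v)"
proof -
  have "foldr E [0..<k] (u + v) = foldr E [0..<k] u + foldr E [0..<k] v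
     \<and> foldr E [0..<k] (u - v) = foldr E [0..<k] u - foldr E [0..<k] v
     \<and> foldr E [0..<k] (- v) = - foldr E [0..<k] v \<and> (i < n \<longrightarrow> E i (foldr E [0..<k] v) = foldr E [0..<k] (E i v))" if "k \<le> n" for k
    using that by (induction k arbitrary: u v) (auto simp: E_lin E_comm)
  from this [of n] show "D (u + v) = D u + D v" "D (u - v) = D u - D v" "D (- v) = - D v" "i < n \<Longrightarrow> E i (D v) = D (E i v)"
    by (auto simp: D_def)
qed

lemma D_S: "k < n \<Longrightarrow> D (S k v) = S k (D v)"
  using outer by (simp add: D_def S_def)

lemma D_fixed: assumes "D u = u" "i < n" shows "E i u = u"
proof -
  have "W i (u - E i u)" using assms(2) by (simp add: W_def E_lin E_E)
  then have "D (u - E i u) = - (u - E i u)" using D_on(2) assms(2) by blast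
  moreover have "D (u - E i u) = u - E i u" using assms D_lin(4) [of i u] by (simp add: D_lin)
  ultimately have "u - E i u = - (u - E i u)" by (simp only:)
  then have "u - E i u = 0" by (rule eq_neg_self)
  then show ?thesis by simp
qed

text \<open>Here \<open>Q\<close> is the product of the factors \<open>R j k\<close> with
  \<open>j\<close> different from \<open>i\<close>. As it commutes with \<open>E i\<close> and is
  injective, commutation of \<open>D\<close> with \<open>S k\<close> gives information on the single
  factor \<open>R i k\<close>.\<close>

lemma S_split:
  assumes "i < n" "k < n" "i \<noteq> k"
  shows "\<exists>Q. (\<forall>v. S k v = Q (R i k v)) \<and> (\<forall>v. E i (Q v) = Q (E i v)) \<and> inj Q \<and> (\<forall>v. W i v \<longrightarrow> S k v = R i k v)"
proof -
  have gen: "\<exists>Q. (\<forall>v. foldr (\<lambda>j. R j k) l v = Q (if i \<in> set l then R i k v else v)) \<and> (\<forall>v. E i (Q v) = Q (E i v)) \<and> inj Q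
      \<and> (\<forall>v. W i v \<longrightarrow> foldr (\<lambda>j. R j k) l v = (if i \<in> set l then R i k v else v))"
    if "distinct l" "set l \<subseteq> {..<n} - {k}" for l
    using that
  proof (induction l)
    case Nil
    then show ?case by (intro exI [of _ id]) simp
  next
    case (Cons j l)
    then obtain Q where Q: "\<And>v. foldr (\<lambda>j. R j k) l v = Q (if i \<in> set l then R i k v else v)"
      "\<And>v. E i (Q v) = Q (E i v)" "inj Q" "\<And>v. W i v \<Longrightarrow> foldr (\<lambda>j. R j k) l v = (if i \<in> set l then R i k v else v)" by auto
    show ?case
    proof (cases "j = i")
      case True
      have fold: "foldr (\<lambda>j. R j k) l (R i k v) = R i k (foldr (\<lambda>j. R j k) l v)" for v
        using Cons.prems True
        by (induction l arbitrary: v) (auto intro!: arg_cong [where f = "R _ k"] simp: R_comm assms)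
      have QR: "R i k (Q v) = Q (R i k v)" for v
        using fold [of v] Q(1) [of v] Q(1) [of "R i k v"] Cons.prems True by simp
      show ?thesis
        using Q Cons.prems True by (intro exI [of _ Q]) (auto simp: QR)
    next
      case False
      have j: "j < n" "j \<noteq> k" using Cons.prems by auto
      have "inj (\<lambda>v. R j k (Q v))"
        using injD [OF Q(3)] R_inj [OF j(1) assms(2) j(2)] by (intro injI) blast
      moreover have "R j k (R i k v) = R i k v" if "W i v" for v
        using R_comm [of j k i k v] R_fix [of j k i v] that j assms False by simp
      moreover have "E i (R j k (Q v)) = R j k (Q (E i v))" for v
        using E_R [of j k i] Q(2) j assms False by simp
      moreover have "foldr (\<lambda>j. R j k) (j # l) v = R j k (Q (if i \<in> set (j # l) then R i k v else v))" for v
        using Q(1) False by simp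
      moreover have "foldr (\<lambda>j. R j k) (j # l) v = (if i \<in> set (j # l) then R i k v else v)" if "W i v" for v
        using Q(4) [OF that] False R_fix [of j k i v] that j assms \<open>\<And>v. W i v \<Longrightarrow> R j k (R i k v) = R i k v\<close> by simp
      ultimately show ?thesis
        by (intro exI [of _ "\<lambda>v. R j k (Q v)"] conjI allI impI)
    qed
  qed
  have m: "i \<in> set (filter (\<lambda>j. j \<noteq> k) [0..<n])" using assms by simp
  have "distinct (filter (\<lambda>j. j \<noteq> k) [0..<n])" "set (filter (\<lambda>j. j \<noteq> k) [0..<n]) \<subseteq> {..<n} - {k}" by auto
  from gen [OF this] show ?thesis unfolding S_def if_P [OF m] .
qed

text \<open>On \<open>W i\<close> the operators \<open>S k\<close> and \<open>R i k\<close> agree,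
  so \<open>D\<close> negates the image of \<open>v\<close>, which therefore has no component in
  \<open>W0\<close>. The other inversions fix it, so it lies in the sum of \<open>W i\<close> and
  \<open>W k\<close>.\<close>

lemma R_W_two: assumes "i < n" "k < n" "i \<noteq> k" "W i v" shows "E i (R i k v) = - E k (R i k v)"
proof -
  define u where "u = R i k v"
  have "\<forall>x. W i x \<longrightarrow> S k x = R i k x" using S_split [OF assms(1-3)] by (elim exE conjE)
  then have S: "S k x = R i k x" if "W i x" for x using that by blast
  have Du: "D u = - u"
    using D_S [OF assms(2), of v] S [OF assms(4)] S [OF W_closed(3) [OF assms(1,4)]]
    by (simp add: D_on(2) [OF assms(1,4)] u_def R_lin assms)
  have u': "E j u = u" if "j < n" "j \<noteq> i" "j \<noteq> k" for j
    using E_R [of i k j v] that assms W_other [of i v j] by (simp add: u_def)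
  have "W0 (u - p i u - p k u)"
    unfolding W0_def
  proof safe
    fix j assume j: "j < n"
    consider "j = i" | "j = k" | "j \<noteq> i" "j \<noteq> k" by blast
    then show "E j (u - p i u - p k u) = u - p i u - p k u"
    proof cases
      case 3
      then show ?thesis using j assms u' W_other [OF p_W] by (simp add: E_lin)
    next
      case 1
      then show ?thesis using j assms W_other [OF p_W, of k i u] by (simp add: E_lin W_E [OF p_W]) (simp add: E_p)
    next
      case 2
      then show ?thesis using j assms W_other [OF p_W, of i k u] by (simp add: E_lin W_E [OF p_W]) (simp add: E_p)
    qed
  qed
  then have "D (u - p i u - p k u) = u - p i u - p k u" by (rule D_on)
  moreover have "D (u - p i u - p k u) = - (u - p i u - p k u)"
    using D_on(2) [OF _ p_W] assms by (simp add: D_lin Du)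
  ultimately have "u - p i u - p k u = - (u - p i u - p k u)" by (simp only:)
  then have z: "u - p i u - p k u = 0" by (rule eq_neg_self)
  have "E i u + E k u = 2 *\<^sub>R (u - p i u - p k u)"
    by (simp only: scaleR_right_diff_distrib double_p) (simp add: scaleR_2)
  then have "E i u + E k u = 0" by (simp only: z scaleR_zero_right)
  then show ?thesis by (simp only: u_def eq_neg_iff_add_eq_0)
qed

text \<open>\<open>D\<close> fixes \<open>S k v\<close>, hence so does \<open>E i\<close>, and
  \<open>E i\<close> can be moved past \<open>Q\<close>.\<close>

lemma R_W0_i: assumes "i < n" "k < n" "i \<noteq> k" "W0 v" shows "E i (R i k v) = R i k v"
proof -
  obtain Q where Q: "\<And>v. S k v = Q (R i k v)" "\<And>v. E i (Q v) = Q (E i v)" "inj Q"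
    using S_split [OF assms(1-3)] by (elim exE conjE) (rule that, erule spec, erule spec, assumption)
  have "D (S k v) = S k v" using D_S [OF assms(2), of v] D_on(1) [OF assms(4)] by simp
  then have "E i (S k v) = S k v" using D_fixed assms(1) by blast
  then have "Q (E i (R i k v)) = Q (R i k v)" by (simp only: Q(1,2))
  then show ?thesis by (rule injD [OF Q(3)])
qed

section \<open>Matrix entries of the transvections on the parts \<open>W i\<close>\<close>

definition ix :: "nat list \<Rightarrow> bool" where "ix l \<longleftrightarrow> distinct l \<and> set l \<subseteq> {..<n}"

lemma ix_simps [simp]: "ix [] \<longleftrightarrow> True" "ix (a # l) \<longleftrightarrow> a < n \<and> a \<notin> set l \<and> ix l"
  by (auto simp: ix_def)

lemma third: "\<exists>k. k < n \<and> k \<noteq> i \<and> k \<noteq> j"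
proof -
  have "card {i, j} < card {..<n}" using n by (simp add: card_insert_if)
  then have "{..<n} - {i, j} \<noteq> {}" by (metis card_mono finite.emptyI finite.insertI Diff_eq_empty_iff not_le)
  then show ?thesis by auto
qed

lemma third_ix: "ix [i, j] \<Longrightarrow> \<exists>k. ix [i, j, k]"
  using third [of i j] by (elim exE) (auto intro: exI)

lemma p_R: assumes "ix [i, j, k]" shows "p k (R i j x) = p k x"
proof -
  have "p k (R i j x) = R i j (p k x)" using assms by (simp add: p_def E_R R_lin)
  also have "\<dots> = p k x" using assms p_W by (intro R_fix [of i j k]) auto
  finally show ?thesis .
qed

lemma col_sum: assumes "ix [i, j]" "W i v" shows "R i j v = p i (R i j v) + p j (R i j v)"
proof -
  let ?u = "R i j v"
  have "E i ?u = - E j ?u" by (rule R_W_two) (use assms in auto)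
  then have "2 *\<^sub>R (p i ?u + p j ?u) = 2 *\<^sub>R ?u"
    by (simp only: scaleR_right_distrib double_p) (simp add: scaleR_2)
  then show ?thesis by simp
qed

lemma col_fix: assumes "ix [i, j, k]" "W i v"
  shows "R k j (R i j v) = R i j v" "R k j (p j (R i j v)) = p j (R i j v)"
proof -
  have "R k j (R i j v) = R i j (R k j v)" using assms(1) by (intro R_comm) auto
  then show 1: "R k j (R i j v) = R i j v" using R_fix [of k j i v] assms by simp
  have 2: "R k j (p i (R i j v)) = p i (R i j v)" using assms(1) p_W by (intro R_fix [of k j i]) auto
  have s: "R i j v = p i (R i j v) + p j (R i j v)" by (rule col_sum) (use assms in auto)
  have "R k j (p i (R i j v) + p j (R i j v)) = p i (R i j v) + p j (R i j v)" using 1 by (simp only: flip: s)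
  then show "R k j (p j (R i j v)) = p j (R i j v)" using assms(1) by (simp add: R_lin 2)
qed

text \<open>The relation \<open>R_R\<close> applied to a vector of \<open>W i\<close>, compared in
  the components \<open>W i\<close> and \<open>W j\<close>.\<close>

lemma col_main: assumes "ix [i, j, k]" "W i v"
  shows "p i (R i k v) = p i (R i k (p i (R i j v)))" "p j (R k j (p k (R i k v))) = p j (R i j v)"
proof -
  have ij: "ix [i, j]" and ik: "ix [i, k]" and kj: "ix [k, j]" using assms(1) by auto
  define a b a' b' where "a = p i (R i j v)" and "b = p j (R i j v)" and "a' = p i (R i k v)" and "b' = p k (R i k v)"
  have W: "W i a" "W j b" "W i a'" "W k b'" using assms(1) p_W by (auto simp: a_def b_def a'_def b'_def)
  have ab: "R i j v = a + b" "R i k v = a' + b'"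
    unfolding a_def b_def a'_def b'_def by (rule col_sum; use assms in auto)+
  have "R k j (R i k v) = R i k (R k j (R i j v))" using assms(1) by (intro R_R) auto
  also have "R k j (R i j v) = R i j v" by (rule col_fix(1) [OF assms])
  finally have eq: "R k j (a' + b') = R i k (a + b)" by (simp only: ab)
  have "R k j (a' + b') = a' + R k j b'" using assms(1) R_fix [of k j i a'] W by (simp add: R_lin)
  moreover have "R i k (a + b) = R i k a + b" using assms(1) R_fix [of i k j b] W by (simp add: R_lin)
  ultimately have eq: "a' + R k j b' = R i k a + b" using eq by (simp only:)
  have "p i (R k j b') = 0" "p i b = 0" "p i a' = a'"
    using p_R [of k j i b'] assms(1) W p_simps(2) p_on(1) by auto
  then show "p i (R i k v) = p i (R i k (p i (R i j v)))"
    using arg_cong [OF eq, of "p i"] assms(1) by (simp add: p_lin flip: a_def a'_def)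
  have "p j (R i k a) = 0" "p j b = b" "p j a' = 0"
    using p_R [of i k j a] assms(1) W p_simps(2) p_on(1) by auto
  then show "p j (R k j (p k (R i k v))) = p j (R i j v)"
    using arg_cong [OF eq, of "p j"] assms(1) by (simp add: p_lin flip: b_def b'_def)
qed

text \<open>On \<open>W i\<close> this is the entry of \<open>R i j\<close> from \<open>W i\<close>
  to \<open>W j\<close>, because the diagonal entry turns out to be 1.\<close>

definition c :: "nat \<Rightarrow> nat \<Rightarrow> 'v \<Rightarrow> 'v" where "c i j v = R i j v - v"

lemma R_c: "R i j v = v + c i j v"
  by (simp add: c_def)

text \<open>By \<open>R_inv\<close> the diagonal entry of \<open>R i j\<close> is an involution, and
  \<open>col_main\<close> says that the entry for \<open>k\<close> absorbs the one for
  \<open>j\<close>; hence the latter is 1.\<close>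

lemma col_p: assumes "ix [i, j]" "W i v" shows "p i (R i j v) = v" "p j (R i j v) = c i j v" "R i j (c i j v) = c i j v"
proof -
  have fixed: "R i j (p j (R i j v)) = p j (R i j v)" and aa: "p i (R i j (p i (R i j v))) = v"
    if "ix [i, j]" "W i v" for i j v
  proof -
    from third_ix [OF that(1)] obtain k where k: "ix [i, j, k]" by blast
    have Wk: "W k (p k (R i k v))" using k p_W by auto
    have "R i j (p j (R k j (p k (R i k v)))) = p j (R k j (p k (R i k v)))"
      by (rule col_fix(2) [of k j i, OF _ Wk]) (use k in auto)
    then show fixed: "R i j (p j (R i j v)) = p j (R i j v)" using col_main(2) [OF k that(2)] by (simp only:)
    define a b where "a = p i (R i j v)" and "b = p j (R i j v)"
    have W: "W i a" "W j b" using that(1) p_W by (auto simp: a_def b_def)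
    have ab: "R i j v = a + b" unfolding a_def b_def by (rule col_sum [OF that])
    have Eab: "E j (a + b) = a - b" using that(1) W W_other [of i a j] by (simp add: E_lin W_E)
    have "E j (R i j (a - b)) = v" using R_inv [of i j v] that(1) by (simp add: ab Eab)
    moreover have "R i j (a - b) = R i j a - b" using that(1) fixed by (simp add: R_lin b_def)
    ultimately have e: "E j (R i j a) + b = v" using that(1) by (simp add: E_lin W_E [OF W(2)])
    have e': "p i (E j (R i j a)) = p i (R i j a)"
    proof -
      have s: "R i j a = p i (R i j a) + p j (R i j a)" by (rule col_sum [OF that(1) W(1)])
      have "E j (R i j a) = p i (R i j a) - p j (R i j a)"
        using that(1) W_E [OF p_W, of j "R i j a"] W_other [OF p_W, of i j "R i j a"]
        by (subst s) (simp add: E_lin)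
      then have "p i (E j (R i j a)) = p i (p i (R i j a)) - p i (p j (R i j a))" using that(1) by (simp add: p_lin)
      then show ?thesis using that(1) p_on(1) [OF p_W] p_simps(2) [OF p_W, of j i] by simp
    qed
    have "p i b = 0" "p i v = v" using that W p_simps(2) [of j b i] p_on(1) [of i v] by auto
    then have "p i (R i j a) = v"
      using that(1) arg_cong [OF e, of "p i"] by (simp add: p_lin e')
    then show "p i (R i j (p i (R i j v))) = v" by (simp only: a_def)
  qed
  obtain k where k: "ix [i, j, k]" using third_ix [OF assms(1)] by blast
  have ik: "ix [i, k]" using k by auto
  have Wa: "W i (p i (R i j v))" using assms(1) p_W by auto
  have "p i (R i k (p i (R i k v))) = p i (R i k (p i (R i k (p i (R i j v)))))"
    using col_main(1) [OF k assms(2)] by (simp only:)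
  then have "v = p i (R i j v)" using aa [OF ik assms(2)] aa [OF ik Wa] by (simp only:)
  then show 1: "p i (R i j v) = v" by (simp only:)
  define x where "x = p j (R i j v)"
  have "R i j v = v + x" using col_sum [OF assms] by (simp only: 1 x_def)
  then have "x = c i j v" by (simp add: c_def)
  then show 2: "p j (R i j v) = c i j v" by (simp only: x_def)
  show "R i j (c i j v) = c i j v" using fixed [OF assms] by (simp only: 2)
qed

lemma c_W: "ix [i, j] \<Longrightarrow> W i v \<Longrightarrow> W j (c i j v)"
  using p_W [of j "R i j v"] col_p(2) [of i j v] by simp

lemma R_of_c: "ix [i, j] \<Longrightarrow> k < n \<Longrightarrow> k \<noteq> j \<Longrightarrow> W i v \<Longrightarrow> R k j (c i j v) = c i j v"
  using col_p(2,3) [of i j v] col_fix(2) [of i j k v] by (cases "k = i") auto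

lemma c_c: assumes "ix [i, j, k]" "W i v" shows "c j k (c i j v) = c i k v"
proof -
  have ij: "ix [i, j]" and ik: "ix [i, k]" and jk: "ix [j, k]" and ikj: "ix [i, k, j]" using assms(1) by auto
  have "p k (R j k (c i j v)) = c j k (c i j v)" by (rule col_p(2) [OF jk c_W [OF ij assms(2)]])
  then show ?thesis using col_main(2) [OF ikj assms(2)] col_p(2) [OF ij assms(2)] col_p(2) [OF ik assms(2)] by simp
qed

lemma c_lin: assumes "ix [i, j]" shows "c i j (u + v) = c i j u + c i j v" "c i j (u - v) = c i j u - c i j v" "c i j (- v) = - c i j v" "c i j 0 = 0"
  using assms by (simp_all add: c_def R_lin)

text \<open>On \<open>W j\<close> the entry in the opposite direction, from \<open>W j\<close> to
  \<open>W i\<close>. Both directions can occur, since the representation may contain the standard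
  one as well as its dual. By \<open>c_d\<close>, \<open>d_c\<close> and \<open>theta_W\<close> the
  two kinds are complementary.\<close>

definition d :: "nat \<Rightarrow> nat \<Rightarrow> 'v \<Rightarrow> 'v" where "d i j v = p i (R i j v)"

lemma d_lin: assumes "ix [i, j]" shows "d i j (u + v) = d i j u + d i j v" "d i j (u - v) = d i j u - d i j v" "d i j (- v) = - d i j v" "d i j 0 = 0"
  using assms by (simp_all add: d_def R_lin p_lin)

lemma d_W: "ix [i, j] \<Longrightarrow> W i (d i j v)"
  by (simp add: d_def p_W)

lemma row: assumes "ix [i, j]" shows "p i (R i j u) = p i u + d i j (p j u)"
proof (induction u rule: W_induct)
  case (W0 v)
  then show ?case using assms R_W0_i [of i j v] p_on(2) [of i "R i j v"] by (simp add: p_simps(1) d_lin)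
next
  case (W l v)
  consider "l = i" | "l = j" | "l \<noteq> i" "l \<noteq> j" by blast
  then show ?case
  proof cases
    case 1
    then show ?thesis using W assms col_p(1) [of i j v] p_on(1) [of i v] p_simps(2) [of i v j] by (simp add: d_lin)
  next
    case 2
    then show ?thesis using W assms p_on(1) [of j v] p_simps(2) [of j v i] by (simp add: d_def)
  next
    case 3
    then show ?thesis using W assms R_fix [of i j l v] p_simps(2) [of l v] by (simp add: d_lin)
  qed
next
  case (add u v)
  then show ?case using assms by (simp add: R_lin p_lin d_lin)
qed

lemma row_fix: assumes "ix [i, j, k]" shows "d i j (p j (R k j u)) = d i j (p j u)"
proof -
  have ij: "ix [i, j]" and kji: "ix [k, j, i]" using assms by auto
  have "R i j (R k j u) = R k j (R i j u)" using assms by (intro R_comm) auto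
  then have "p i (R i j (R k j u)) = p i (R i j u)" using p_R [OF kji] by simp
  then show ?thesis by (simp add: row [OF ij] p_R [OF kji])
qed

lemma row_main: assumes "ix [i, j, k]" shows "d i k (d k j (p j u)) = - d i j (p j u)"
proof -
  have ij: "ix [i, j]" and ik: "ix [i, k]" and kj: "ix [k, j]" and kji: "ix [k, j, i]" and ijk: "ix [i, j, k]" using assms by auto
  have "R k j (R i k u) = R i k (R k j (R i j u))" using assms by (intro R_R) auto
  then have "p i (R i k u) = p i (R i k (R k j (R i j u)))" using p_R [OF kji, of "R i k u"] by simp
  also have "\<dots> = p i u + d i j (p j u) + (d i k (p k u) + d i k (d k j (p j u)))"
    by (simp only: row [OF ik] p_R [OF kji] row [OF ij] row [OF kj] p_R [OF ijk] row_fix [OF kji] d_lin [OF ik])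
  finally have "d i j (p j u) + d i k (d k j (p j u)) = 0" by (simp add: row [OF ik])
  then show ?thesis by (simp add: eq_neg_iff_add_eq_0 add.commute)
qed

lemma d_d: "ix [i, j, k] \<Longrightarrow> W j v \<Longrightarrow> d i k (d k j v) = - d i j v"
  using row_main [of i j k v] p_on(1) [of j v] by simp

lemma row_fix': assumes "ix [i, j]" "k < n" "k \<noteq> j" shows "d i j (p j (R k j u)) = d i j (p j u)"
proof (cases "k = i")
  case True
  \<comment> \<open>For \<open>k = i\<close> the entry is factored through a third index by
    \<open>row_main\<close>, where \<open>row_fix\<close> applies.\<close>
  obtain l where l: "ix [i, j, l]" using third_ix [OF assms(1)] by blast
  then have "ix [l, j, i]" by auto
  then have "d l j (p j (R i j u)) = d l j (p j u)" by (rule row_fix)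
  then show ?thesis using row_main [OF l, of u] row_main [OF l, of "R i j u"] True by simp
qed (use row_fix [of i j k u] assms in auto)

lemma d_c: "ix [i, j] \<Longrightarrow> W i v \<Longrightarrow> d i j (c i j v) = 0"
  using row_fix' [of i j i v] col_p(2) [of i j v] p_simps(2) [of i v j] by (simp add: d_lin)

section \<open>Transvections act trivially on \<open>W0\<close>\<close>

lemma double_eq_0: "u + u = 0 \<Longrightarrow> u = (0::'v)"
  by (rule eq_neg_self) (simp only: eq_neg_iff_add_eq_0)

lemma W0_W_eq: assumes "j < n" "W0 a" "W j b" "a + b = 0" shows "a = 0" "b = 0"
proof -
  have "p j (a + b) = b" using assms(1-3) p_on(1) [of j b] by (simp add: p_lin p_simps(1))
  then show "b = 0" by (simp only: assms(4) p_lin(4) [OF assms(1)])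
  then show "a = 0" using assms by simp
qed

lemma W0_one: assumes "j < n" "\<And>l. l < n \<Longrightarrow> l \<noteq> j \<Longrightarrow> E l y = y" shows "W0 (y - p j y)"
  unfolding W0_def
proof safe
  fix l assume l: "l < n"
  show "E l (y - p j y) = y - p j y"
  proof (cases "l = j")
    case True
    then show ?thesis using l by (simp add: E_lin W_E [OF p_W]) (simp add: E_p)
  next
    case False
    then show ?thesis using l assms W_other [OF p_W, of j l y] by (simp add: E_lin)
  qed
qed

lemma W0_two: assumes "ix [i, j]" "\<And>l. ix [i, j, l] \<Longrightarrow> E l y = y" shows "W0 (y - p i y - p j y)"
proof -
  have "W0 (y - p i y - p j (y - p i y))"
  proof (rule W0_one)
    fix l assume l: "l < n" "l \<noteq> j"
    show "E l (y - p i y) = y - p i y"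
    proof (cases "l = i")
      case True
      then show ?thesis using l by (simp add: E_lin W_E [OF p_W]) (simp add: E_p)
    next
      case False
      then show ?thesis using l assms W_other [OF p_W, of i l y] by (simp add: E_lin)
    qed
  qed (use assms(1) in auto)
  moreover have "p j (y - p i y) = p j y" using assms(1) p_simps(2) [OF p_W [of i y], of j] by (simp add: p_lin)
  ultimately show ?thesis by simp
qed

text \<open>Entries of \<open>R i j\<close> on \<open>W0\<close>: there is no component in
  \<open>W i\<close> by \<open>R_W0_i\<close>, so the image is \<open>P i j w\<close> in
  \<open>W0\<close> plus \<open>C i j w\<close> in \<open>W j\<close>. The aim is to show that
  \<open>P i j\<close> is the identity there and \<open>C i j\<close> vanishes.\<close>

definition C :: "nat \<Rightarrow> nat \<Rightarrow> 'v \<Rightarrow> 'v" where "C i j w = p j (R i j w)"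
definition P :: "nat \<Rightarrow> nat \<Rightarrow> 'v \<Rightarrow> 'v" where "P i j w = R i j w - C i j w"

lemma R_PC: "R i j w = P i j w + C i j w"
  by (simp add: P_def)

lemma PC_lin: assumes "ix [i, j]"
  shows "C i j (u + v) = C i j u + C i j v" "C i j (u - v) = C i j u - C i j v" "C i j 0 = 0"
    "P i j (u + v) = P i j u + P i j v" "P i j (u - v) = P i j u - P i j v"
  using assms by (simp_all add: C_def P_def R_lin p_lin)

lemma C_W: "ix [i, j] \<Longrightarrow> W j (C i j w)"
  by (simp add: C_def p_W)

lemma P_W0: assumes "ix [i, j]" "W0 w" shows "W0 (P i j w)"
  unfolding P_def C_def
proof (rule W0_one)
  fix l assume l: "l < n" "l \<noteq> j"
  show "E l (R i j w) = R i j w"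
    using l assms R_W0_i [of i j w] E_R [of i j l w] W0_E [of w l] by (cases "l = i") auto
qed (use assms in auto)

lemma W0_inv: assumes "ix [i, j]" "W0 w" shows "R i j (C i j w) = P i j (P i j w) - w + C i j (P i j w)"
proof -
  let ?P = "P i j" and ?C = "C i j"
  have W: "W0 (?P w)" "W0 (?P (?P w))" "W j (?C w)" "W j (?C (?P w))" using assms P_W0 C_W by blast+
  define y where "y = R i j (?C w)"
  have dC: "p i y = 0"
    using row [OF assms(1), of "?C w"] row_fix' [OF assms(1), of i w] assms W p_simps(2) [of j "?C w" i]
    by (simp add: y_def C_def p_on(1) [OF p_W] p_simps(1) d_lin)
  have "E l y = y" if "l < n" "l \<noteq> j" for l
    using that assms E_R [of i j l] W_other [OF W(3), of l] p_eq_0 [OF dC] by (cases "l = i") (auto simp: y_def)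
  then have y0: "W0 (y - p j y)" using assms(1) by (intro W0_one) auto
  have jn: "j < n" using assms(1) by simp
  have y: "y = (y - p j y) + p j y" by simp
  have Ey: "E j y = (y - p j y) - p j y" by (simp add: E_p)
  have "E j (R i j w) = ?P w - ?C w" using jn by (simp add: R_PC E_lin W0_E [OF W(1)] W_E [OF W(3)])
  then have "E j (R i j (?P w - ?C w)) = w" using R_inv [of i j w] assms(1) by simp
  then have "E j (?P (?P w) + ?C (?P w) - y) = w" using assms(1) by (simp add: R_lin R_PC [of i j "?P w"] y_def)
  then have "?P (?P w) - ?C (?P w) - ((y - p j y) - p j y) = w"
    using jn by (simp only: E_lin Ey W0_E [OF W(2)] W_E [OF W(4)]) simp
  then have "(?P (?P w) - (y - p j y) - w) + (p j y - ?C (?P w)) = 0" by (simp add: algebra_simps)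
  moreover have "W0 (?P (?P w) - (y - p j y) - w)" by (intro W0_closed(2) W y0 assms(2))
  moreover have "W j (p j y - ?C (?P w))" using W p_W jn by (intro W_closed)
  ultimately have "?P (?P w) - (y - p j y) - w = 0" "p j y - ?C (?P w) = 0" using W0_W_eq jn by blast+
  then show ?thesis by (simp add: y_def algebra_simps)
qed

text \<open>The right transvection by x_j commutes with the left transvection by x_k. The
  conjugating inversions change the sign of the \<open>C\<close> terms, so the components of the two
  sides can be separated.\<close>

lemma L_W0: assumes "ix [i, j, k]" "W0 w"
  shows "C i j (P i k w) = C i j w" "P i j (P i k w) = P i k (P i j w)"
proof -
  have ij: "ix [i, j]" and ik: "ix [i, k]" using assms(1) by auto
  have W: "W0 (P i j w)" "W0 (P i k w)" "W0 (P i j (P i k w))" "W0 (P i k (P i j w))"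
    using assms(2) P_W0 ij ik by blast+
  note Ws = W0_E [OF W(1)] W0_E [OF W(2)] W0_E [OF W(3)] W0_E [OF W(4)] W_E [OF C_W [OF ij]] W_E [OF C_W [OF ik]] W0_E [OF assms(2)]
    W_other [OF C_W [OF ij]] W_other [OF C_W [OF ik]]
  have "R i k (C i j x) = C i j x" "R i j (C i k x) = C i k x" for x
    using assms(1) C_W [OF ij] C_W [OF ik] R_fix [of i k j] R_fix [of i j k] by auto
  then have "P i k (P i j w) - C i k (P i j w) + C i j w = P i j (P i k w) + C i j (P i k w) - C i k w"
    using L_comm [of i j k w] assms(1)
    by (simp add: R_PC [of i j w] R_PC [of i k w] E_lin Ws R_lin R_PC [of i k "P i j w"] R_PC [of i j "P i k w"])
  then have eq: "P i k (P i j w) + C i j w + C i k w = P i j (P i k w) + C i j (P i k w) + C i k (P i j w)"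
    by (simp add: algebra_simps)
  have pp: "p j (C i j x) = C i j x" "p j (C i k x) = 0" "p k (C i k x) = C i k x" "p k (C i j x) = 0" for x
    using assms(1) p_on(1) [OF C_W [OF ij]] p_on(1) [OF C_W [OF ik]] p_simps(2) [OF C_W [OF ij], of k] p_simps(2) [OF C_W [OF ik], of j] by auto
  show 1: "C i j (P i k w) = C i j w"
    using arg_cong [OF eq, of "p j"] assms(1) by (simp add: p_lin pp p_simps(1) [OF W(3)] p_simps(1) [OF W(4)])
  have 2: "C i k (P i j w) = C i k w"
    using arg_cong [OF eq, of "p k"] assms(1) by (simp add: p_lin pp p_simps(1) [OF W(3)] p_simps(1) [OF W(4)])
  show "P i j (P i k w) = P i k (P i j w)" using eq by (simp add: 1 2)
qed

text \<open>Where all \<open>C i l\<close> vanish, the operators \<open>R i l\<close> are commuting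
  involutions, and \<open>no_signs\<close> applies.\<close>

lemma P_id_of_C: assumes ij: "ix [i, j]" and u: "W0 u" "\<And>l. ix [i, l] \<Longrightarrow> C i l u = 0" shows "P i j u = u"
proof -
  let ?U = "\<lambda>u. W0 u \<and> (\<forall>l. ix [i, l] \<longrightarrow> C i l u = 0)"
  have RP: "R i l u = P i l u" if "?U u" "ix [i, l]" for u l using that by (simp add: R_PC)
  have inv: "P i l (P i l u) = u \<and> C i l (P i l u) = 0" if U: "?U u" "ix [i, l]" for u l
  proof -
    have C0: "C i l u = 0" using U by blast
    have W: "W0 (P i l u)" "W0 (P i l (P i l u))" using U P_W0 by blast+
    have ln: "l < n" using U(2) by simp
    have "(P i l (P i l u) - u) + C i l (P i l u) = 0" using W0_inv [OF U(2), of u] U R_lin(5) [of i l] by (simp add: C0)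
    moreover have "W0 (P i l (P i l u) - u)" using W U by (intro W0_closed) auto
    ultimately have "P i l (P i l u) - u = 0" "C i l (P i l u) = 0" using W0_W_eq [OF ln] C_W [OF U(2)] by blast+
    then show ?thesis by simp
  qed
  have U: "?U (P i l u)" if "?U u" "ix [i, l]" for u l
  proof -
    have "C i l' (P i l u) = 0" if l': "ix [i, l']" for l'
    proof (cases "l' = l")
      case True
      then show ?thesis using inv \<open>?U u\<close> \<open>ix [i, l]\<close> by blast
    next
      case False
      then have "ix [i, l', l]" using l' \<open>ix [i, l]\<close> by auto
      then show ?thesis using L_W0(1) [of i l' l u] \<open>?U u\<close> l' by auto
    qed
    then show ?thesis using that P_W0 by blast
  qed
  from third_ix [OF ij] obtain k where k: "ix [i, j, k]" by blast
  have "R i j u = u"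
  proof (rule no_signs [of i k ?U])
    show "?U u" using u by blast
    fix u assume u: "?U u"
    show "?U (R i j u) \<and> R i j (R i j u) = u" if "j < n" "j \<noteq> i" "j \<noteq> k" for j
    proof -
      have "ix [i, j]" using k that by auto
      then show ?thesis using u U [of u j] RP [of u j] RP [of "P i j u" j] inv [of u j] by simp
    qed
    show "R i j (R i l u) = R i l (R i j u)" if jl: "j < n" "j \<noteq> i" "j \<noteq> k" "l < n" "l \<noteq> i" "l \<noteq> k" for j l
    proof (cases "j = l")
      case False
      then have "ix [i, j, l]" "ix [i, j]" "ix [i, l]" using k jl by auto
      then show ?thesis using u U [of u j] U [of u l] RP [of u j] RP [of u l] RP [of "P i j u" l] RP [of "P i l u" j] L_W0(2) [of i j l u] by simp
    qed simp
    fix v assume v: "?U v"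
    show "?U (u + v) \<and> ?U (u - v)" using u v W0_closed by (simp add: PC_lin)
  qed (use k in auto)
  then show ?thesis using RP [of u j] u ij by simp
qed

text \<open>The vector \<open>z\<close>, obtained from \<open>w\<close> by \<open>P i j - 1\<close>
  and \<open>P i k - 1\<close>, is killed by all \<open>C i l\<close>, hence fixed by
  \<open>P i j\<close>. But \<open>P i j\<close> is an involution on \<open>P i k w - w\<close>, so
  it also negates \<open>z\<close>.\<close>

lemma P_P: assumes "ix [i, j, k]" "W0 w" shows "P i j (P i k w - w) = P i k w - w"
proof -
  have ij: "ix [i, j]" and ik: "ix [i, k]" and ikj: "ix [i, k, j]" using assms(1) by auto
  define x where "x = P i k w - w"
  define y where "y = P i j w - w"
  define z where "z = P i j x - x"
  have W: "W0 x" "W0 y" "W0 z" using assms(2) P_W0 ij ik W0_closed by (simp_all add: x_def y_def z_def)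
  have z': "z = P i k y - y" by (simp add: z_def x_def y_def PC_lin [OF ij] PC_lin [OF ik] L_W0(2) [OF assms])
  have "C i l z = 0" if l: "ix [i, l]" for l
  proof (cases "l = j")
    case True
    then show ?thesis using L_W0(1) [of i j k y] W assms(1) unfolding z' by (simp add: PC_lin)
  next
    case False
    then have "ix [i, l, j]" using l ij by auto
    then show ?thesis using L_W0(1) [of i l j x] W l unfolding z_def by (simp add: PC_lin)
  qed
  then have "P i j z = z" by (intro P_id_of_C ij W)
  moreover have "P i j z = - z"
  proof -
    have C0: "C i j x = 0" using L_W0(1) [OF assms] by (simp add: x_def PC_lin [OF ij])
    have jn: "j < n" using ij by simp
    have "(P i j (P i j x) - x) + C i j (P i j x) = 0" using W0_inv [OF ij W(1)] R_lin(5) [of i j] ij by (simp add: C0)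
    moreover have "W0 (P i j (P i j x) - x)" using W ij by (intro W0_closed P_W0)
    ultimately have "P i j (P i j x) - x = 0" using W0_W_eq(1) [OF jn] C_W [OF ij] by blast
    then show ?thesis by (simp add: z_def PC_lin [OF ij])
  qed
  ultimately have "z = - z" by (simp only:)
  then have "z = 0" by (rule eq_neg_self)
  then show ?thesis by (simp add: z_def x_def)
qed

text \<open>By \<open>P_P\<close> the product of \<open>R i k - 1\<close> and
  \<open>R i j - 1\<close> kills \<open>R j k w\<close>. The relation \<open>R_R\<close> rewrites
  this in terms of \<open>y\<close>, and cancelling the injective \<open>R j k\<close> leaves an
  equation whose components give \<open>2 * P i k w = 2 * w\<close>.\<close>

lemma P_id: assumes "ix [i, k]" "W0 w" shows "P i k w = w"
proof -
  from third_ix [OF assms(1)] obtain j where "ix [i, k, j]" by blast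
  then have ijk: "ix [i, j, k]" and ikj: "ix [i, k, j]" and ij: "ix [i, j]" and jk: "ix [j, k]" by auto
  note ik = assms(1)
  \<comment> \<open>The inverse image of \<open>w\<close> under \<open>R i k\<close>.\<close>
  define y where "y = P i k w - C i k w"
  have Ry: "R i k y = w"
  proof -
    have "E k (R i k (E k w)) = y"
      using ik W0_E [OF P_W0 [OF ik assms(2)]] W_E [OF C_W [OF ik]] W0_E [OF assms(2)] by (simp add: R_PC E_lin y_def)
    then have "E k (R i k (E k (R i k (E k w)))) = E k (R i k y)" by (simp only:)
    then have "E k w = E k (R i k y)" using R_inv [of i k "E k w"] ik by simp
    then have "E k (E k w) = E k (E k (R i k y))" by (simp only:)
    then show ?thesis using ik by (simp add: E_E)
  qed
  define z where "z = R j k w"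
  have z: "R i k (R i j z) - R i j z = R i k z - z"
  proof -
    define g h where "g = P j k w" and "h = C j k w"
    have gh: "z = g + h" "W0 g" "W k h" using P_W0 [OF jk assms(2)] C_W [OF jk] R_PC by (simp_all add: z_def g_def h_def)
    have "R i j z - z = (P i j g - g) + C i j g"
      using R_fix [of i j k h] gh ijk by (simp add: R_lin R_PC [of i j g])
    moreover have "R i k (P i j g - g) = P i j g - g"
      using P_P [OF ikj gh(2)] L_W0(1) [OF ikj gh(2)] by (simp add: R_PC [of i k] PC_lin [OF ik])
    moreover have "R i k (C i j g) = C i j g" using R_fix [of i k j] C_W [OF ij] ijk by simp
    ultimately have "R i k (R i j z - z) = R i j z - z" using ik by (simp add: R_lin)
    then show ?thesis using ik by (simp add: R_lin algebra_simps)
  qed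
  have zy: "R i j z = R j k (R i j y)"
    using R_R [of i j k y] ijk Ry by (simp add: z_def)
  have comm: "R i k (R j k x) = R j k (R i k x)" for x using R_comm [of i k j k x] ijk by simp
  have "R j k (R i k (R i j y) - R i j y) = R j k (R i k w - w)"
    using z jk unfolding zy by (simp add: z_def comm R_lin)
  then have "R i k (R i j y) - R i j y = R i k w - w" using R_inj [of j k] jk by simp
  moreover have Rijy: "R i j y = P i j (P i k w) + C i j w - C i k w"
    using R_fix [of i j k "C i k w"] C_W [OF ik] ijk L_W0(1) [OF ijk assms(2)] by (simp add: y_def R_lin R_PC [of i j "P i k w"])
  moreover have PP: "P i j (P i k w) = P i k w - w + P i j w"
    using P_P [OF ijk assms(2)] by (simp add: PC_lin [OF ij] algebra_simps)
  moreover have "R i k (R i j y) = P i j w + C i j w"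
  proof -
    have Cj: "R i k (C i j w) = C i j w" using R_fix [of i k j] C_W [OF ij] ijk by simp
    have "R i k (P i j (P i k w)) = P i k (P i k w) + C i k (P i k w) - (P i k w + C i k w) + (P i k (P i j w) + C i k w)"
      using ik L_W0(1) [OF ikj assms(2)] unfolding PP by (simp add: R_lin) (simp add: R_PC)
    then have "R i k (R i j y) = - P i k w + P i k (P i j w) + C i j w + w"
      unfolding Rijy using ik by (simp add: R_lin Cj W0_inv [OF ik assms(2)])
    moreover have "P i k (P i j w) = P i k w - w + P i j w" using L_W0(2) [OF ijk assms(2)] PP by simp
    ultimately show ?thesis by simp
  qed
  ultimately have "P i j w + C i j w - (P i k w - w + P i j w + C i j w - C i k w) = P i k w + C i k w - w"
    by (simp only: R_PC [of i k w])
  then have "2 *\<^sub>R P i k w = 2 *\<^sub>R w" by (simp only: scaleR_2) (simp add: algebra_simps)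
  then show ?thesis by simp
qed

lemma R_W0_C: "ix [i, j] \<Longrightarrow> W0 w \<Longrightarrow> R i j w = w + C i j w"
  by (simp add: R_PC P_id)

lemma R_C: assumes "ix [i, j]" "W0 w" shows "R i j (C i j w) = C i j w"
  using W0_inv [OF assms] P_id [OF assms] by simp

text \<open>The signed transposition \<open>T\<close> exchanges \<open>E i\<close> and
  \<open>E j\<close>, which both fix \<open>w\<close>, so they fix \<open>T w\<close>. Computing
  \<open>T w\<close> from its factors leaves a component \<open>v\<close> in \<open>W i\<close> that
  must vanish.\<close>

lemma C_theta: assumes "ix [i, j]" "W0 w" shows "C j i w = c j i (C i j w)"
proof -
  have ij: "i < n" "j < n" "i \<noteq> j" and ji: "ix [j, i]" using assms(1) by auto
  define T where "T = (\<lambda>v. E i (E j (R i j (E j (E i (E j (R j i (E j (R i j v)))))))))"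
  define u where "u = C i j w"
  define v where "v = C j i w - c j i u"
  have W: "W j u" "W i (C j i w)" "W i (c j i u)" "W i v" "W j (c i j v)"
    unfolding u_def v_def using C_W [OF assms(1)] C_W [OF ji] c_W [OF ji] c_W [OF assms(1)] W_closed(2) [of i] ij by auto
  note Es = W_E [OF W(1)] W_E [OF W(4)] W_E [OF W(5)] W0_E [OF assms(2)] W_other [OF W(1)] W_other [OF W(4)] W_other [OF W(5)]
  have 1: "E j (R i j w) = w - u" using ij by (simp add: R_W0_C [OF assms] E_lin Es flip: u_def)
  have "R j i (w - u) = w - u + v" using ij by (simp add: R_lin R_W0_C [OF ji assms(2)] R_c [of j i u] v_def)
  then have 2: "E i (E j (R j i (w - u))) = w + u - v" using ij by (simp add: E_lin Es)
  have 3: "R i j (w - u - v) = w - v - c i j v"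
    using ij R_C [OF assms] by (simp add: R_lin R_W0_C [OF assms] R_c [of i j v] flip: u_def)
  have Tw: "T w = w + v + c i j v"
    using ij by (simp add: T_def 1 2) (simp add: E_lin Es 3)
  have "T (E i w) = E j (T w)" "T (E j w) = E i (T w)" using T_E [OF ij T_def] by blast+
  then have "w + v + c i j v = w + v - c i j v" "w + v + c i j v = w - v + c i j v"
    using ij by (simp_all add: Tw E_lin Es)
  then have "v + v = 0" by (simp add: algebra_simps)
  then have "v = 0" by (rule double_eq_0)
  then show ?thesis by (simp add: v_def u_def)
qed

lemma R_of_C: assumes "ix [i, j]" "k < n" "k \<noteq> j" "W0 w" shows "R k j (C i j w) = C i j w"
proof -
  have ji: "ix [j, i]" using assms(1) by auto
  show ?thesis
    unfolding C_theta [OF ji assms(4)] by (rule R_of_c [OF assms(1-3) C_W [OF ji]])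
qed

lemma C_C: assumes "ix [i, j, k]" "W0 w" shows "c k j (C i k w) = C i j w"
proof -
  have ij: "ix [i, j]" and ik: "ix [i, k]" and kj: "ix [k, j]" using assms(1) by auto
  have kn: "k < n" "k \<noteq> j" "i < n" "i \<noteq> j" "i \<noteq> k" using assms(1) by auto
  have "R k j (R i k w) = R i k (R k j (R i j w))" using assms(1) by (intro R_R) auto
  moreover have "R k j (C i j w) = C i j w" by (rule R_of_C) (use assms kn in auto)
  moreover have "R i k (C i j w) = C i j w" "R i k (C k j w) = C k j w"
    using R_fix [of i k j] C_W [OF ij] C_W [OF kj] assms(1) by auto
  ultimately have "w + C k j w + (C i k w + c k j (C i k w)) = w + C i k w + C k j w + C i j w"
    using ij ik kj by (simp add: R_W0_C assms(2) R_lin R_c [of k j "C i k w"])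
  then show ?thesis by (simp add: algebra_simps)
qed

lemma C_indep: assumes "ix [i, j, k]" "W0 w" shows "C j i w = C k i w"
proof -
  have ij: "ix [i, j]" and ik: "ix [i, k]" and kji: "ix [k, j, i]" using assms(1) by auto
  have "C j i w = c j i (c k j (C i k w))" by (simp only: C_theta [OF ij assms(2)] C_C [OF assms])
  also have "\<dots> = C k i w" unfolding C_theta [OF ik assms(2)] by (rule c_c [OF kji C_W [OF ik]])
  finally show ?thesis .
qed

lemma length_others: "k < n \<Longrightarrow> length (filter (\<lambda>j. j \<noteq> k) [0..<n]) = n - 1"
proof -
  assume k: "k < n"
  have "length (filter (\<lambda>j. j \<noteq> k) [0..<n]) = card (set (filter (\<lambda>j. j \<noteq> k) [0..<n]))"
    by (intro distinct_card [symmetric]) simp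
  also have "set (filter (\<lambda>j. j \<noteq> k) [0..<n]) = {..<n} - {k}" by auto
  finally show ?thesis using k by simp
qed

text \<open>The vector \<open>x\<close> does not depend on \<open>i\<close>, so all factors of
  \<open>S k\<close> contribute the same and \<open>S k w = w + (n - 1) x\<close> with
  \<open>x\<close> in \<open>W k\<close>. But \<open>D\<close> fixes \<open>S k w\<close> and
  negates \<open>x\<close>.\<close>

lemma R_W0: assumes "ix [i, k]" "W0 w" shows "R i k w = w"
proof -
  define x where "x = C i k w"
  have kn: "k < n" "i < n" "i \<noteq> k" using assms(1) by auto
  have Cx: "C j k w = x" if "j < n" "j \<noteq> k" for j
    using C_indep [of k j i w] assms that by (cases "j = i") (auto simp: x_def)
  have Rx: "R j k x = x" if "j < n" "j \<noteq> k" for j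
    unfolding x_def by (rule R_of_C [OF assms(1) that assms(2)])
  have "foldr (\<lambda>j. R j k) l w = w + real (length l) *\<^sub>R x" if "set l \<subseteq> {..<n} - {k}" for l
    using that
  proof (induction l)
    case (Cons a l)
    then have a: "a < n" "a \<noteq> k" and IH: "foldr (\<lambda>j. R j k) l w = w + real (length l) *\<^sub>R x" by auto
    then have "R a k w = w + x" using R_W0_C [of a k w] Cx [OF a] assms(2) kn by simp
    then show ?case using a kn Rx [OF a] by (simp add: IH R_lin) (simp add: algebra_simps)
  qed simp
  moreover have "set (filter (\<lambda>j. j \<noteq> k) [0..<n]) \<subseteq> {..<n} - {k}" by auto
  ultimately have S: "S k w = w + real (n - 1) *\<^sub>R x" using length_others [OF kn(1)] by (simp add: S_def)
  have "D (S k w) = S k w" using D_S [OF kn(1), of w] D_on(1) [OF assms(2)] by simp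
  then have "E k (S k w) = S k w" using D_fixed kn(1) by blast
  moreover have "W k x" using C_W [OF assms(1)] by (simp add: x_def)
  ultimately have "w - real (n - 1) *\<^sub>R x = w + real (n - 1) *\<^sub>R x"
    unfolding S using kn(1) by (simp add: E_lin W0_E [OF assms(2)] W_E)
  then have "real (n - 1) *\<^sub>R x + real (n - 1) *\<^sub>R x = 0" by (simp add: algebra_simps)
  then have "real (n - 1) *\<^sub>R x = 0" by (rule double_eq_0)
  then have "x = 0" using n by simp
  then show ?thesis using R_W0_C [OF assms] by (simp add: x_def)
qed

section \<open>The remaining entries of the transvections on \<open>W j\<close>\<close>

definition e :: "nat \<Rightarrow> nat \<Rightarrow> 'v \<Rightarrow> 'v" where "e i j u = p j (R i j u)"
text \<open>For \<open>u\<close> in \<open>W j\<close>, the entries of \<open>R i j\<close> into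
  \<open>W j\<close>, \<open>W i\<close> and \<open>W0\<close> are \<open>e\<close>,
  \<open>d\<close> and \<open>g\<close>. The aim is that \<open>e\<close> is the identity and
  \<open>g\<close> vanishes.\<close>

definition g :: "nat \<Rightarrow> nat \<Rightarrow> 'v \<Rightarrow> 'v" where "g i j u = R i j u - d i j u - e i j u"

lemma R_gde: "R i j u = g i j u + d i j u + e i j u"
  by (simp add: g_def)

lemma e_lin: assumes "ix [i, j]" shows "e i j (u - v) = e i j u - e i j v" "e i j 0 = 0"
  using assms by (simp_all add: e_def R_lin p_lin)

lemma e_W: "ix [i, j] \<Longrightarrow> W j (e i j u)"
  by (simp add: e_def p_W)

lemma g_W0: assumes "ix [i, j]" "W j u" shows "W0 (g i j u)"
  unfolding g_def d_def e_def
proof (rule W0_two [OF assms(1)])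
  fix l assume "ix [i, j, l]"
  then show "E l (R i j u) = R i j u" using assms E_R [of i j l u] W_other [of j u l] by auto
qed

lemma W0_W_W_eq: assumes "ix [i, j]" "W0 a" "W i b" "W j x" "a + b + x = 0" shows "a = 0" "b = 0" "x = 0"
proof -
  have ij: "i < n" "j < n" "i \<noteq> j" using assms(1) by auto
  have "p j (a + b + x) = x" using ij p_on(1) [OF assms(4)] p_simps(2) [OF assms(3), of j] by (simp add: p_lin p_simps(1) [OF assms(2)])
  then show "x = 0" by (simp only: assms(5) p_lin(4) [OF ij(2)])
  then have "a + b = 0" using assms(5) by simp
  then show "a = 0" "b = 0" using W0_W_eq [OF ij(1) assms(2,3)] by blast+
qed

lemma e_e: assumes "ix [i, j, k]" "W j u" shows "e k j (e i j u) = e k j u"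
proof -
  have ij: "ix [i, j]" and kj: "ix [k, j]" and ikj: "ix [i, k, j]" and kji: "ix [k, j, i]" using assms(1) by auto
  have "R k j (R i k u) = R i k (R k j (R i j u))" using assms(1) by (intro R_R) auto
  moreover have "R i k u = u" using R_fix [of i k j u] assms by auto
  ultimately have "e k j u = p j (R k j (R i j u))" using p_R [OF ikj] by (simp add: e_def)
  also have "R k j (R i j u) = g i j u + d i j u + R k j (e i j u)"
    using kj R_fix [of k j i "d i j u"] d_W [OF ij, of u] ij assms(1) R_W0 [OF kj g_W0 [OF ij assms(2)]]
    by (subst R_gde) (simp add: R_lin)
  also have "p j \<dots> = e k j (e i j u)"
    using ij p_simps(1) [OF g_W0 [OF ij assms(2)]] p_simps(2) [OF d_W [OF ij], of j u] by (simp add: p_lin e_def)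
  finally show ?thesis by simp
qed

lemma e_inv: assumes ij: "ix [i, j]" and u: "W j u" shows "e i j (e i j u) = u + c i j (d i j u)"
proof -
  let ?g = "g i j" and ?d = "d i j" and ?e = "e i j" and ?c = "c i j"
  have n: "i < n" "j < n" "i \<noteq> j" using ij by auto
  have W: "W0 (?g u)" "W i (?d u)" "W j (?e u)" "W0 (?g (?e u))" "W i (?d (?e u))" "W j (?e (?e u))" "W j (?c (?d u))"
    using g_W0 [OF ij] d_W [OF ij] e_W [OF ij] c_W [OF ij] u by blast+
  have "E j (R i j u) = ?g u + ?d u - ?e u"
    unfolding R_gde [of i j u] using n W_other [OF W(2)] by (simp add: E_lin W0_E [OF W(1)] W_E [OF W(3)])
  then have "E j (R i j (?g u + ?d u - ?e u)) = u" using R_inv [of i j u] n by simp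
  moreover have "R i j (?g u + ?d u - ?e u) = ?g u + (?d u + ?c (?d u)) - (?g (?e u) + ?d (?e u) + ?e (?e u))"
    by (simp only: R_lin [OF n] R_W0 [OF ij W(1)] R_c [of i j "?d u"] R_gde [of i j "?e u"])
  ultimately have "?g u + (?d u - ?c (?d u)) - (?g (?e u) + ?d (?e u) - ?e (?e u)) = u"
    using n W_other [OF W(2), of j] W_other [OF W(5), of j]
    by (simp add: E_lin W0_E [OF W(1)] W0_E [OF W(4)] W_E [OF W(7)] W_E [OF W(6)])
  then have "(?g u - ?g (?e u)) + (?d u - ?d (?e u)) + (?e (?e u) - ?c (?d u) - u) = 0" by (simp add: algebra_simps)
  then have "?e (?e u) - ?c (?d u) - u = 0"
    by (rule W0_W_W_eq(3) [OF ij W0_closed(2) [OF W(1,4)] W_closed(2) [OF n(1) W(2,5)] W_closed(2) [OF n(2) W_closed(2) [OF n(2) W(6,7)] u]])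
  then show ?thesis by (simp add: algebra_simps)
qed

lemma c_d_nil: assumes "ix [i, j]" "W j u" shows "d i j (c i j (d i j u)) = 0"
  by (rule d_c [OF assms(1) d_W [OF assms(1)]])

text \<open>By \<open>e_e\<close>, the entry \<open>e k j\<close> kills
  \<open>z = e i j u - u\<close>. Then \<open>e_inv\<close> gives
  \<open>c k j (d k j z) = - z\<close>; applying \<open>d k j\<close>, which kills the image of
  \<open>c k j\<close>, shows first \<open>d k j z = 0\<close> and then
  \<open>z = 0\<close>.\<close>

lemma e_id: assumes ij: "ix [i, j]" and u: "W j u" shows "e i j u = u"
proof -
  from third_ix [OF ij] obtain k where k: "ix [i, j, k]" by blast
  then have kj: "ix [k, j]" and jn: "j < n" by auto
  define z where "z = e i j u - u"
  have z: "W j z" using e_W [OF ij] u jn W_closed(2) by (simp add: z_def)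
  have "e k j z = 0" using e_e [OF k u] by (simp add: z_def e_lin [OF kj])
  then have 1: "z + c k j (d k j z) = 0" using e_inv [OF kj z] e_lin(2) [OF kj] by simp
  then have "c k j (d k j z) = - z" by (simp add: eq_neg_iff_add_eq_0 add.commute)
  then have "d k j (- z) = 0" using c_d_nil [OF kj z] by simp
  then have "d k j z = 0" by (simp add: d_lin [OF kj])
  then have "z = 0" using 1 by (simp add: c_lin [OF kj])
  then show ?thesis by (simp add: z_def)
qed

lemma c_d: assumes "ix [i, j]" "W j u" shows "c i j (d i j u) = 0"
  using e_inv [OF assms] e_id [OF assms] by simp

lemma R_gd: "ix [i, j] \<Longrightarrow> W j u \<Longrightarrow> R i j u = u + d i j u + g i j u"
  by (simp add: R_gde [of i j u] e_id)

lemma g_lin: assumes "ix [i, j]" shows "g i j (u + v) = g i j u + g i j v" "g i j (u - v) = g i j u - g i j v" "g i j (- v) = - g i j v"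
  using assms by (simp_all add: g_def e_def d_def R_lin p_lin)

lemma g_c: assumes ij: "ix [i, j]" and v: "W i v" shows "g i j (c i j v) = 0"
  using R_gd [OF ij c_W [OF ij v]] col_p(3) [OF ij v] d_c [OF ij v] by simp

text \<open>As \<open>T\<close> exchanges \<open>E i\<close> and \<open>E j\<close>, it maps
  \<open>W i\<close> into \<open>W j\<close>. Hence the components of \<open>T v\<close> in
  \<open>W i\<close> and in \<open>W0\<close> vanish, which are the first two equations, and the
  component in \<open>W j\<close> is the third.\<close>

lemma theta_W: assumes ij: "ix [i, j]" and v: "W i v"
  shows "c j i (c i j v) + d i j (d j i v) = v" "g j i v = - g i j (d j i v)"
    "E i (E j (R i j (E j (E i (E j (R j i (E j (R i j v)))))))) = c i j v - d j i v"
proof -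
  have n: "i < n" "j < n" "i \<noteq> j" and ji: "ix [j, i]" using ij by auto
  define T where "T = (\<lambda>v. E i (E j (R i j (E j (E i (E j (R j i (E j (R i j v)))))))))"
  define x where "x = c i j v"
  define v' where "v' = v - c j i x"
  define u' where "u' = x - d j i v"
  have W: "W j x" "W j (d j i v)" "W0 (g j i v)" "W i (c j i x)" "W i v'" "W j u'" "W0 (g i j u')" "W i (d i j u')" "W j (c i j v')"
  proof -
    show 1: "W j x" "W j (d j i v)" "W0 (g j i v)" "W i (c j i x)"
      unfolding x_def using c_W [OF ij v] d_W [OF ji] g_W0 [OF ji v] c_W [OF ji] by blast+
    show 2: "W i v'" "W j u'" unfolding v'_def u'_def using 1 v n by (intro W_closed(2); simp)+
    show "W0 (g i j u')" "W i (d i j u')" "W j (c i j v')" using g_W0 [OF ij 2(2)] d_W [OF ij] c_W [OF ij 2(1)] by blast+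
  qed
  note Es = W_E [OF v] W_E [OF W(1)] W_E [OF W(5)] W_E [OF W(6)] W0_E [OF W(3)] W0_E [OF W(7)] W_E [OF W(8)] W_E [OF W(9)]
    W_other [OF v] W_other [OF W(1)] W_other [OF W(5)] W_other [OF W(6)] W_other [OF W(8)] W_other [OF W(9)]
  have 1: "E j (R i j v) = v - x" using n by (simp add: R_c [of i j v] E_lin Es flip: x_def)
  have "R j i (v - x) = v' - u' + g j i v"
    using n by (simp add: R_lin R_gd [OF ji v] R_c [of j i x] v'_def u'_def)
  then have 2: "E i (E j (R j i (v - x))) = u' - v' + g j i v" using n by (simp add: E_lin Es)
  have 3: "E j (u' - v' + g j i v) = g j i v - u' - v'" using n by (simp add: E_lin Es)
  have 4: "R i j (g j i v - u' - v') = g j i v - (u' + d i j u' + g i j u') - (v' + c i j v')"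
    by (simp only: R_lin [OF n] R_gd [OF ij W(6)] R_c [of i j v'] R_W0 [OF ij W(3)])
  have Tv: "T v = (v' + d i j u') + (u' + c i j v') + (g j i v - g i j u')"
    using n by (simp add: T_def 1 2 3 4) (simp add: E_lin Es)
  have Tneg: "T (- x) = - T x" for x using n by (simp add: T_def E_lin R_lin)
  have TT: "T (E i v) = E j (T v)" "T (E j v) = E i (T v)" using T_E [OF n T_def] by blast+
  have "T v = E i (T v)" using TT(2) n W_other [OF v, of j] by simp
  moreover have "E i ((v' + d i j u') + (u' + c i j v') + (g j i v - g i j u')) = - (v' + d i j u') + (u' + c i j v') + (g j i v - g i j u')"
    using n by (simp add: E_lin Es)
  ultimately have "(v' + d i j u') + (u' + c i j v') + (g j i v - g i j u') = - (v' + d i j u') + (u' + c i j v') + (g j i v - g i j u')"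
    by (simp only: Tv)
  then have "v' + d i j u' = - (v' + d i j u')" by (simp only: add_right_cancel)
  then have A: "v' + d i j u' = 0" by (rule eq_neg_self)
  have "- T v = E j (T v)" using TT(1) n by (simp add: Es Tneg)
  then have "(g j i v - g i j u') + (g j i v - g i j u') = 0" unfolding Tv A using n by (simp add: E_lin Es algebra_simps)
  then have B: "g j i v - g i j u' = 0" by (rule double_eq_0)
  have du': "d i j u' = - d i j (d j i v)" by (simp add: u'_def d_lin [OF ij] x_def d_c [OF ij v])
  show C: "c j i (c i j v) + d i j (d j i v) = v"
    using A unfolding du' by (simp add: v'_def x_def algebra_simps)
  show "g j i v = - g i j (d j i v)" using B by (simp add: u'_def g_lin [OF ij] x_def g_c [OF ij v] eq_neg_iff_add_eq_0)
  have "c i j v' = 0"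
  proof -
    have "v' = d i j (d j i v)" using A unfolding du' by simp
    then show ?thesis using c_d [OF ij d_W [OF ji]] by simp
  qed
  then have "T v = u'" unfolding Tv A B by simp
  then show "E i (E j (R i j (E j (E i (E j (R j i (E j (R i j v)))))))) = c i j v - d j i v" by (simp add: T_def u'_def x_def)
qed

lemma g_rel: assumes "ix [i, j, k]" and u: "W j u" shows "g i j u = - g i k (d k j u)" "c i k (d i j u) = 0"
proof -
  have ij: "ix [i, j]" and ik: "ix [i, k]" and kj: "ix [k, j]" and n: "i < n" "j < n" "k < n" "i \<noteq> j" "i \<noteq> k" "j \<noteq> k"
    using assms(1) by auto
  have W: "W k (d k j u)" "W i (d i j u)" "W0 (g i j u)" "W0 (g k j u)" "W0 (g i k (d k j u))" "W k (c i k (d i j u))"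
    using d_W [OF kj] d_W [OF ij] g_W0 [OF ij u] g_W0 [OF kj u] g_W0 [OF ik d_W [OF kj]] c_W [OF ik d_W [OF ij]] by blast+
  have "R k j (R i k u) = R i k (R k j (R i j u))" using n by (intro R_R) auto
  moreover have iku: "R i k u = u" using R_fix [of i k j u] u n by simp
  moreover have "R k j (R i j u) = (u + d k j u + g k j u) + d i j u + g i j u"
    using n R_fix [of k j i "d i j u"] W(2) by (simp add: R_gd [OF ij u] R_lin R_gd [OF kj u] R_W0 [OF kj W(3)])
  moreover have "R i k ((u + d k j u + g k j u) + d i j u + g i j u)
      = u + (d k j u + d i k (d k j u) + g i k (d k j u)) + g k j u + (d i j u + c i k (d i j u)) + g i j u"
    using n by (simp add: R_lin iku R_gd [OF ik W(1)] R_W0 [OF ik W(3)] R_W0 [OF ik W(4)] R_c [of i k "d i j u"])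
  ultimately have "(g i k (d k j u) + g i j u) + c i k (d i j u) = 0"
    by (simp add: R_gd [OF kj u] d_d [OF assms]) (simp add: algebra_simps)
  then have "g i k (d k j u) + g i j u = 0" "c i k (d i j u) = 0" by (rule W0_W_eq [OF n(3) W0_closed(1) [OF W(5,3)] W(6)])+
  then show "g i j u = - g i k (d k j u)" "c i k (d i j u) = 0" by (simp_all add: eq_neg_iff_add_eq_0 add.commute)
qed

lemma g_indep: assumes "ix [i, j, k]" "W i v" shows "g j i v = g k i v"
proof -
  have ij: "ix [i, j]" and ik: "ix [i, k]" and ji: "ix [j, i]" and kij: "ix [k, i, j]" using assms(1) by auto
  have "g j i v = g i k (d k j (d j i v))"
    using theta_W(2) [OF ij assms(2)] g_rel(1) [OF assms(1) d_W [OF ji]] by simp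
  also have "\<dots> = g k i v" using theta_W(2) [OF ik assms(2)] d_d [OF kij assms(2)] by (simp add: g_lin [OF ik])
  finally show ?thesis .
qed

text \<open>The counterpart of \<open>R_W0\<close>: all factors of \<open>S k\<close> contribute the
  same vector \<open>x\<close> of \<open>W0\<close>. Since \<open>D\<close> negates
  \<open>u\<close>, it negates \<open>S k u\<close>, but it fixes the multiple of \<open>x\<close>
  contained in it.\<close>

lemma g_zero: assumes "ix [i, k]" "W k u" shows "g i k u = 0"
proof -
  define x where "x = g i k u"
  have kn: "k < n" "i < n" "i \<noteq> k" using assms(1) by auto
  have x0: "W0 x" using g_W0 [OF assms] by (simp add: x_def)
  have gx: "g j k u = x" if "j < n" "j \<noteq> k" for j
    using g_indep [of k j i u] assms that by (cases "j = i") (auto simp: x_def)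
  \<comment> \<open>\<open>y\<close> collects the components \<open>d a k u\<close> in the parts
    \<open>W a\<close>; they are negated by \<open>D\<close> and fixed by the factors still to be
    applied.\<close>
  have "\<exists>y. foldr (\<lambda>j. R j k) l u = u + y + real (length l) *\<^sub>R x \<and> D y = - y \<and> (\<forall>a. a < n \<and> a \<noteq> k \<and> a \<notin> set l \<longrightarrow> R a k y = y)"
    if "set l \<subseteq> {..<n} - {k}" "distinct l" for l
    using that
  proof (induction l)
    case Nil
    then show ?case using D_lin(2) [of 0 0] kn by (intro exI [of _ 0]) (simp add: R_lin)
  next
    case (Cons a l)
    then have a: "a < n" "a \<noteq> k" "a \<notin> set l" by auto
    then have ak: "ix [a, k]" using kn by auto
    from Cons obtain y where y: "foldr (\<lambda>j. R j k) l u = u + y + real (length l) *\<^sub>R x" "D y = - y"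
      "\<And>a. a < n \<Longrightarrow> a \<noteq> k \<Longrightarrow> a \<notin> set l \<Longrightarrow> R a k y = y" by auto
    have Wd: "W a (d a k u)" by (rule d_W [OF ak])
    have "foldr (\<lambda>j. R j k) (a # l) u = u + (y + d a k u) + real (length (a # l)) *\<^sub>R x"
      using a kn y(3) [OF a] R_W0 [OF ak x0] by (simp add: y(1) R_lin R_gd [OF ak assms(2)] gx) (simp add: algebra_simps)
    moreover have "D (y + d a k u) = - (y + d a k u)" by (simp add: D_lin y(2) D_on(2) [OF a(1) Wd])
    moreover have "R b k (y + d a k u) = y + d a k u" if "b < n" "b \<noteq> k" "b \<notin> set (a # l)" for b
      using that y(3) [of b] R_fix [of b k a "d a k u"] Wd kn a by (simp add: R_lin)
    ultimately show ?case by blast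
  qed
  note ex = this
  have fl: "set (filter (\<lambda>j. j \<noteq> k) [0..<n]) \<subseteq> {..<n} - {k}" "distinct (filter (\<lambda>j. j \<noteq> k) [0..<n])" by auto
  obtain y where S: "S k u = u + y + real (n - 1) *\<^sub>R x" and y: "D y = - y"
    using ex [OF fl] unfolding S_def length_others [OF kn(1)] by (elim exE conjE)
  define r where "r = real (n - 1) *\<^sub>R x"
  have r: "W0 r" using x0 by (simp add: W0_def E_lin r_def)
  have "foldr (\<lambda>j. R j k) l (- u) = - foldr (\<lambda>j. R j k) l u" if "set l \<subseteq> {..<n} - {k}" for l
    using that kn by (induction l) (auto simp: R_lin)
  then have "S k (- u) = - S k u" unfolding S_def by (simp only: fl)
  then have "D (u + y + r) = - (u + y + r)" using D_S [OF kn(1), of u] D_on(2) [OF kn(1) assms(2)] S by (simp add: r_def)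
  then have "- u - y + r = - u - y - r" by (simp add: D_lin y D_on(2) [OF kn(1) assms(2)] D_on(1) [OF r])
  then have "r + r = 0" by (simp add: algebra_simps)
  then have "real (n - 1) *\<^sub>R x = 0" unfolding r_def [symmetric] by (rule double_eq_0)
  then show ?thesis using n by (simp add: x_def)
qed

lemma R_Wj: "ix [i, j] \<Longrightarrow> W j u \<Longrightarrow> R i j u = u + d i j u"
  by (simp add: R_gd g_zero)

lemma theta_Wj: assumes ij: "ix [i, j]" and u: "W j u"
  shows "E i (E j (R i j (E j (E i (E j (R j i (E j (R i j u)))))))) = d i j u - c j i u"
proof -
  have n: "i < n" "j < n" "i \<noteq> j" and ji: "ix [j, i]" using ij by auto
  define v where "v = d i j u"
  define v' where "v' = v - c j i u"
  define u' where "u' = u - d j i v"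
  have W: "W i v" "W j (d j i v)" "W i (c j i u)" "W i v'" "W j u'" "W i (d i j u')" "W j (c i j v')"
  proof -
    show 1: "W i v" "W j (d j i v)" "W i (c j i u)"
      unfolding v_def using d_W [OF ij] d_W [OF ji] c_W [OF ji u] by blast+
    show 2: "W i v'" "W j u'" unfolding v'_def u'_def using 1 u n by (intro W_closed(2); simp)+
    show "W i (d i j u')" "W j (c i j v')" using d_W [OF ij] c_W [OF ij 2(1)] by blast+
  qed
  note Es = W_E [OF u] W_E [OF W(1)] W_E [OF W(4)] W_E [OF W(5)] W_E [OF W(6)] W_E [OF W(7)]
    W_other [OF u] W_other [OF W(1)] W_other [OF W(4)] W_other [OF W(5)] W_other [OF W(6)] W_other [OF W(7)]
  have 1: "E j (R i j u) = v - u" using n by (simp add: R_Wj [OF ij u] E_lin Es flip: v_def)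
  have "R j i (v - u) = v' - u'"
    using n by (simp add: R_lin R_Wj [OF ji W(1)] R_c [of j i u] v'_def u'_def)
  then have 2: "E j (E i (E j (R j i (v - u)))) = - u' - v'" using n by (simp add: E_lin Es)
  have minus_u: "- u' - v' = - (u' + v')" by simp
  have 3: "R i j (- u' - v') = - (u' + d i j u') - (v' + c i j v')"
    by (simp only: R_lin [OF n] minus_u R_Wj [OF ij W(5)] R_c [of i j v']) simp
  have "E i (E j (R i j (E j (E i (E j (R j i (E j (R i j u)))))))) = (v' + d i j u') + (u' + c i j v')"
    unfolding 1 2 3 using n by (simp add: E_lin Es)
  moreover have "u' + c i j v' = 0"
  proof -
    have "u' + c i j v' = u - (c i j (c j i u) + d j i (d i j u))"
      unfolding u'_def v'_def v_def c_lin [OF ij] c_d [OF ij u] by simp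
    then show ?thesis by (simp only: theta_W(1) [OF ji u] diff_self)
  qed
  moreover have "v' + d i j u' = d i j u - c j i u"
  proof -
    have "d i j (c i j (c j i u) + d j i v) = d i j u" unfolding v_def by (simp only: theta_W(1) [OF ji u])
    then have "d i j (d j i v) = d i j u" using d_c [OF ij c_W [OF ji u]] by (simp only: d_lin [OF ij] add_0)
    then show ?thesis unfolding u'_def v'_def d_lin [OF ij] by (simp add: v_def)
  qed
  ultimately show ?thesis by simp
qed

end

section \<open>The action on the abelianization\<close>

text \<open>Functionals on F_m are represented by coordinate functions on all natural numbers.
  Finite dimension then means vanishing from \<open>m\<close> on, and no type depending on
  \<open>m\<close> is required.\<close>

instantiation "fun" :: (type, real_vector) real_vector
begin
definition "scaleR r f = (\<lambda>x. r *\<^sub>R f x)"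
instance
  by standard (simp_all add: scaleR_fun_def plus_fun_def fun_eq_iff algebra_simps)
end

lemma fun_simps [simp]: "(f + g) x = f x + g x" "(f - g) x = f x - g x" "(- f) x = - f x" "(0::'b \<Rightarrow> 'c::ab_group_add) x = 0"
  "(r *\<^sub>R h) x = r *\<^sub>R h x"
  by (simp_all add: plus_fun_def fun_diff_def fun_Compl_def zero_fun_def scaleR_fun_def)

lemma sum_fun_apply: "(\<Sum>i\<in>A. f i) x = (\<Sum>i\<in>A. f i x)"
  by (induction A rule: infinite_finite_induct) simp_all

text \<open>In a linear relation, an operator that distinguishes two of the sign patterns removes
  one of the vectors. The coordinates from \<open>m\<close> on vanish, so the vectors lie in a space
  of dimension \<open>m\<close>.\<close>

lemma sign_independent:
  fixes v :: "'i \<Rightarrow> nat \<Rightarrow> real" and L :: "'x \<Rightarrow> (nat \<Rightarrow> real) \<Rightarrow> nat \<Rightarrow> real"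
  assumes "finite I" and L: "\<And>x. x \<in> A \<Longrightarrow> linear (L x)"
    and v: "\<And>t. t \<in> I \<Longrightarrow> v t \<noteq> 0" "\<And>t k. t \<in> I \<Longrightarrow> k \<ge> m \<Longrightarrow> v t k = 0"
    and sgn: "\<And>t x. t \<in> I \<Longrightarrow> x \<in> A \<Longrightarrow> L x (v t) = (if \<chi> t x then - v t else v t)"
    and distinct: "\<And>s t. s \<in> I \<Longrightarrow> t \<in> I \<Longrightarrow> s \<noteq> t \<Longrightarrow> \<exists>x\<in>A. \<chi> s x \<noteq> \<chi> t x"
  shows "card I \<le> m"
proof -
  have lin: "a t = 0" if "finite J" "J \<subseteq> I" "(\<Sum>t\<in>J. a t *\<^sub>R v t) = 0" "t \<in> J" for J a t
    using that
  proof (induction J arbitrary: a t rule: finite_induct)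
    case (insert s J)
    have zero: "a t = 0" if t: "t \<in> J" for t
    proof -
      have "s \<noteq> t" using insert t by blast
      then obtain x where x: "x \<in> A" "\<chi> s x \<noteq> \<chi> t x" using distinct [of s t] insert.prems t by blast
      let ?e = "\<lambda>r. if \<chi> r x then - 1 else 1::real"
      have eL: "L x (v r) = ?e r *\<^sub>R v r" if "r \<in> insert s J" for r
        using sgn [of r x] x that insert.prems by auto
      have "0 = L x (\<Sum>r\<in>insert s J. a r *\<^sub>R v r)" using insert.prems L [OF x(1)] by (simp only: linear_0)
      also have "\<dots> = (\<Sum>r\<in>insert s J. (a r * ?e r) *\<^sub>R v r)"
        using L [OF x(1)] eL by (simp only: linear_sum linear_scale) (intro sum.cong refl, simp)
      finally have "(\<Sum>r\<in>insert s J. (a r * ?e r) *\<^sub>R v r) - ?e s *\<^sub>R (\<Sum>r\<in>insert s J. a r *\<^sub>R v r) = 0"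
        by (simp only: insert.prems(2) scaleR_zero_right diff_self)
      then have "(\<Sum>r\<in>insert s J. (a r * ?e r - ?e s * a r) *\<^sub>R v r) = 0"
        by (simp only: scaleR_sum_right scaleR_scaleR scaleR_left_diff_distrib sum_subtractf)
      then have "(\<Sum>r\<in>J. (a r * ?e r - ?e s * a r) *\<^sub>R v r) = 0"
        unfolding sum.insert [OF insert.hyps] by simp
      then have "a t * ?e t - ?e s * a t = 0" using insert.IH [of "\<lambda>r. a r * ?e r - ?e s * a r" t] insert.prems t by blast
      then show ?thesis using x by (auto split: if_splits)
    qed
    then have "(\<Sum>r\<in>J. a r *\<^sub>R v r) = 0" by (intro sum.neutral ballI) (simp only: scaleR_zero_left)
    then have "a s *\<^sub>R v s = 0" using insert.prems(2) unfolding sum.insert [OF insert.hyps] by (simp only: add_0_right)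
    then have "a s = 0" using v(1) [of s] insert.prems(1) unfolding scaleR_eq_0_iff by blast
    then show ?case using zero insert.prems by blast
  qed simp
  have inj: "inj_on v I"
  proof (rule inj_onI, rule ccontr)
    fix s t assume st: "s \<in> I" "t \<in> I" "v s = v t" "s \<noteq> t"
    have "(\<Sum>r\<in>{s, t}. (if r = s then 1 else - 1) *\<^sub>R v r) = 0" using st by simp
    from lin [OF _ _ this, of s] st show False by simp
  qed
  define B where "B = (\<lambda>i k. if k = i then 1 else 0::real) ` {..<m}"
  have "independent (v ` I)"
  proof -
    have "\<not> dependent (v ` I)"
    proof
      assume "dependent (v ` I)"
      then obtain u w where u: "(\<Sum>w\<in>v ` I. u w *\<^sub>R w) = 0" and w: "w \<in> v ` I" "u w \<noteq> 0"
        unfolding dependent_finite [OF finite_imageI [OF assms(1)]] by blast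
      have u': "(\<Sum>t\<in>I. u (v t) *\<^sub>R v t) = 0" using u by (simp only: sum.reindex [OF inj] o_def)
      obtain t where t: "t \<in> I" "w = v t" using w(1) by blast
      show False using lin [OF assms(1) order_refl u' t(1)] w(2) t(2) by blast
    qed
    then show ?thesis .
  qed
  moreover have "v ` I \<subseteq> span B"
  proof safe
    fix t assume t: "t \<in> I"
    have "v t = (\<Sum>i<m. v t i *\<^sub>R (\<lambda>k. if k = i then 1 else 0))"
    proof
      fix k
      have "(\<Sum>i<m. v t i *\<^sub>R (\<lambda>k. if k = i then 1 else 0)) k = (\<Sum>i<m. if i = k then v t k else 0)"
        unfolding sum_fun_apply by (intro sum.cong refl) auto
      also have "\<dots> = v t k" using v(2) [OF t, of k] by auto
      finally show "v t k = (\<Sum>i<m. v t i *\<^sub>R (\<lambda>k. if k = i then 1 else 0)) k" by simp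
    qed
    moreover have "\<dots> \<in> span B" by (intro span_sum span_scale span_base) (auto simp: B_def)
    ultimately show "v t \<in> span B" by simp
  qed
  moreover have "finite B" by (simp add: B_def)
  ultimately have "card (v ` I) \<le> card B" using independent_span_bound by blast
  also have "\<dots> \<le> m" unfolding B_def using card_image_le [of "{..<m}"] by auto
  finally show ?thesis by (simp add: card_image [OF inj])
qed

section \<open>The action of the outer automorphism group on functionals\<close>

locale out_hom =
  fixes n m :: nat and \<phi> :: "(word \<Rightarrow> word) set \<Rightarrow> (word \<Rightarrow> word) set"
  assumes n6: "n \<ge> 6" and m: "m < n choose 2" and hom: "\<phi> \<in> hom (Out (F n)) (Out (F m))"
begin

sublocale G: group "Out (F n)" by (rule group.group_Out [OF group_free_group])
sublocale M: group "Out (F m)" by (rule group.group_Out [OF group_free_group])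
sublocale h: group_hom "Out (F n)" "Out (F m)" \<phi>
  using hom by unfold_locales

text \<open>The inverse makes \<open>lift\<close> reverse products, so that \<open>act\<close> below is a left action on functionals.\<close>

definition lift :: "(fg \<Rightarrow> fg) \<Rightarrow> fg \<Rightarrow> fg" where
  "lift f = (SOME g. aut m g \<and> cls m g = inv\<^bsub>Out (F m)\<^esub> \<phi> (cls n f))"

lemma lift: assumes "aut n f" shows "aut m (lift f)" "cls m (lift f) = inv\<^bsub>Out (F m)\<^esub> \<phi> (cls n f)"
proof -
  have "inv\<^bsub>Out (F m)\<^esub> \<phi> (cls n f) \<in> carrier (Out (F m))" using assms cls_in_Out by simp
  then have "\<exists>g. aut m g \<and> cls m g = inv\<^bsub>Out (F m)\<^esub> \<phi> (cls n f)" using cls_surj by metis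
  then have "aut m (lift f) \<and> cls m (lift f) = inv\<^bsub>Out (F m)\<^esub> \<phi> (cls n f)"
    unfolding lift_def by (rule someI_ex)
  then show "aut m (lift f)" "cls m (lift f) = inv\<^bsub>Out (F m)\<^esub> \<phi> (cls n f)" by auto
qed

lemma lift_cls: "cls n f = cls n g \<Longrightarrow> lift f = lift g"
  by (simp add: lift_def)

lemma lift_inn: "aut n f \<Longrightarrow> pr n h = h \<Longrightarrow> lift (inn h f) = lift f"
  by (rule lift_cls [symmetric]) (auto simp: cls_eq_iff aut_inn)

lemma lift_comp: assumes "aut n f" "aut n g" shows "\<exists>h. pr m h = h \<and> lift (f \<circ> g) = inn h (lift g \<circ> lift f)"
proof -
  have "cls m (lift g \<circ> lift f) = cls m (lift (f \<circ> g))"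
    using assms by (simp add: cls_mult lift aut_comp cls_in_Out M.inv_mult_group)
  then show ?thesis
    using cls_eq_iff [of m "lift g \<circ> lift f" "lift (f \<circ> g)"] assms by (simp only: lift(1) aut_comp)
qed

lemma lift_pr: "\<exists>h. pr m h = h \<and> lift (pr n) = inn h (pr m)"
proof -
  have "cls m (pr m) = cls m (lift (pr n))" using aut_pr by (simp add: lift cls_one)
  then show ?thesis using cls_eq_iff [of m "pr m" "lift (pr n)"] by (simp only: lift(1) aut_pr)
qed

text \<open>Values in an arbitrary abelian group make one action available over the reals, the
  integers and the integers modulo 9. Coordinates from \<open>m\<close> on are left alone.\<close>

definition act :: "(fg \<Rightarrow> fg) \<Rightarrow> (nat \<Rightarrow> 'r::ab_group_add) \<Rightarrow> nat \<Rightarrow> 'r" where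
  "act f v = (\<lambda>i. if i < m then ext v (lift f (gen i)) else v i)"

lemma ext_act: assumes "aut n f" "pr m x = x" shows "ext (act f v) x = ext v (lift f x)"
proof -
  have "ext (act f v) \<circ> pr m = ext v \<circ> (lift f \<circ> pr m)"
  proof (rule additive_map_eqI)
    show "additive_map (ext v \<circ> (lift f \<circ> pr m))"
      by (intro additive_map_comp additive_ext additive_pr endo_additive [OF aut_endo [OF lift(1) [OF assms(1)]]])
    fix i show "(ext (act f v) \<circ> pr m) (gen i) = (ext v \<circ> (lift f \<circ> pr m)) (gen i)"
      using additive_map_zero [OF endo_additive [OF aut_endo [OF lift(1) [OF assms(1)]]]] by (simp add: act_def)
  qed (intro additive_map_comp additive_ext additive_pr)
  then show ?thesis using assms(2) by (metis comp_apply)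
qed

lemma act_comp: assumes "aut n f" "aut n g" shows "act (f \<circ> g) v = act f (act g v)"
proof
  fix i
  obtain h where h: "lift (f \<circ> g) = inn h (lift g \<circ> lift f)" using lift_comp [OF assms] by blast
  have "pr m (lift f (gen i)) = lift f (gen i)" using lift(1) [OF assms(1)] by (simp add: aut_def endo_def)
  then have "ext (act g v) (lift f (gen i)) = ext v (lift g (lift f (gen i)))" by (rule ext_act [OF assms(2)])
  then show "act (f \<circ> g) v i = act f (act g v) i"
    by (simp add: act_def [of f] act_def [of "f \<circ> g"] h inn_def) (simp add: act_def)
qed

lemma act_pr: "act (pr n) v = v"
proof -
  obtain h where "lift (pr n) = inn h (pr m)" using lift_pr by blast
  then show ?thesis by (simp add: act_def inn_def fun_eq_iff)
qed

lemma act_inn: "aut n f \<Longrightarrow> pr n h = h \<Longrightarrow> act (inn h f) = act f"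
  by (rule HOL.ext) (simp only: act_def lift_inn)

lemma ext_lin: "ext (u + v) x = ext u x + (ext v x :: 'r::ab_group_add)" "ext (u - v) x = ext u x - ext v x" "ext (- v) x = - ext v x"
    "ext 0 x = (0 :: 'r::ab_group_add)"
  by (induction x rule: fg_letter_induct) (auto simp: lgen_def algebra_simps)

lemma act_lin: "act f (u + v) = act f u + act f v" "act f (u - v) = act f u - act f v" "act f (- v) = - act f v" "act f 0 = 0"
  by (auto simp: act_def fun_eq_iff ext_lin)

lemma ext_scale: "ext (r *\<^sub>R v) x = r *\<^sub>R (ext v x :: real)"
  by (induction x rule: fg_letter_induct) (auto simp: lgen_def algebra_simps)

lemma linear_act: "linear (act f :: (nat \<Rightarrow> real) \<Rightarrow> _)"
  by (rule linearI, rule act_lin) (auto simp: act_def fun_eq_iff ext_scale)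

abbreviation eval :: "(fg \<Rightarrow> fg) list \<Rightarrow> fg \<Rightarrow> fg" where "eval \<equiv> foldr (\<lambda>f x. f x)"

text \<open>Reduces every relation between the operators to a computation on generators of F_n. The
  element \<open>h\<close> admits relations that hold only up to conjugation.\<close>

lemma act_words:
  assumes a: "\<And>f. f \<in> set fs \<union> set gs \<Longrightarrow> aut n f" and h: "pr n h = h"
    and eq: "\<And>i. i < n \<Longrightarrow> eval gs (gen i) = h + eval fs (gen i) - h"
  shows "foldr act fs v = foldr act gs v"
proof -
  define cm where "cm fs = foldr (\<circ>) fs (pr n)" for fs
  have cm: "cm [] = pr n" "cm (f # fs) = f \<circ> cm fs" for f fs by (simp_all add: cm_def)
  have comp: "foldr act fs v = act (cm fs) v \<and> aut n (cm fs) \<and> (\<forall>i<n. cm fs (gen i) = eval fs (gen i))"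
    if "\<And>f. f \<in> set fs \<Longrightarrow> aut n f" for fs
    using that
  proof (induction fs)
    case Nil
    then show ?case by (simp add: act_pr aut_pr cm)
  next
    case (Cons f fs)
    then have f: "aut n f" and IH: "foldr act fs v = act (cm fs) v" "aut n (cm fs)" "\<forall>i<n. cm fs (gen i) = eval fs (gen i)" by auto
    have "foldr act (f # fs) v = act f (foldr act fs v)" by simp
    then have "foldr act (f # fs) v = act (cm (f # fs)) v" by (simp only: cm IH(1) act_comp [OF f IH(2)])
    moreover have "aut n (cm (f # fs))" by (simp only: cm aut_comp [OF f IH(2)])
    moreover have "\<forall>i<n. cm (f # fs) (gen i) = eval (f # fs) (gen i)" using IH(3) by (simp add: cm)
    ultimately show ?case by (intro conjI)
  qed
  let ?f = "cm fs" and ?g = "cm gs"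
  have f: "foldr act fs v = act ?f v" "aut n ?f" "\<And>i. i < n \<Longrightarrow> ?f (gen i) = eval fs (gen i)" using comp [of fs] a by auto
  have g: "foldr act gs v = act ?g v" "aut n ?g" "\<And>i. i < n \<Longrightarrow> ?g (gen i) = eval gs (gen i)" using comp [of gs] a by auto
  have "?g = inn h ?f"
    by (rule endo_eqI [OF aut_endo [OF g(2)] endo_inn [OF h aut_endo [OF f(2)]]]) (simp only: g(3) f(3) eq inn_def)
  then show ?thesis by (simp only: f(1) g(1) act_inn [OF f(2) h])
qed

lemma act_words':
  assumes "\<And>f. f \<in> set fs \<union> set gs \<Longrightarrow> aut n f" "\<And>i. i < n \<Longrightarrow> eval gs (gen i) = eval fs (gen i)"
  shows "foldr act fs v = foldr act gs v"
  by (rule act_words [where h = 0]) (use assms in auto)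

definition e :: "nat \<Rightarrow> (nat \<Rightarrow> real) \<Rightarrow> nat \<Rightarrow> real" where "e i = act (eps n i)"
definition rr :: "nat \<Rightarrow> nat \<Rightarrow> (nat \<Rightarrow> real) \<Rightarrow> nat \<Rightarrow> real" where "rr i j = act (rho n i j)"

lemma e_lin: "e i (u + v) = e i u + e i v" "e i (u - v) = e i u - e i v" "e i (- v) = - e i v" "e i (r *\<^sub>R v) = r *\<^sub>R e i v" "e i 0 = 0"
  unfolding e_def by (simp_all only: linear_add [OF linear_act] linear_diff [OF linear_act] linear_neg [OF linear_act] linear_scale [OF linear_act] linear_0 [OF linear_act])

lemma rr_lin: "rr i j (u + v) = rr i j u + rr i j v" "rr i j (u - v) = rr i j u - rr i j v" "rr i j (- v) = - rr i j v" "rr i j (r *\<^sub>R v) = r *\<^sub>R rr i j v" "rr i j 0 = 0"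
  unfolding rr_def by (simp_all only: linear_add [OF linear_act] linear_diff [OF linear_act] linear_neg [OF linear_act] linear_scale [OF linear_act] linear_0 [OF linear_act])

lemma e_e:
  assumes "i < n"
  shows "e i (e i v) = v"
proof -
  have "foldr act [eps n i, eps n i] v = foldr act [] v"
    by (rule act_words') (use assms in \<open>auto simp: group_norm simp del: add_uminus_conv_diff\<close>)
  then show ?thesis by (simp add: e_def rr_def)
qed

lemma e_comm:
  assumes "i < n" "j < n"
  shows "e i (e j v) = e j (e i v)"
proof -
  have "foldr act [eps n i, eps n j] v = foldr act [eps n j, eps n i] v"
    by (rule act_words') (use assms in \<open>auto simp: group_norm simp del: add_uminus_conv_diff\<close>)
  then show ?thesis by (simp add: e_def rr_def)
qed

lemma e_rr:
  assumes "i < n" "j < n" "k < n" "i \<noteq> j" "k \<noteq> i" "k \<noteq> j"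
  shows "e k (rr i j v) = rr i j (e k v)"
proof -
  have "foldr act [eps n k, rho n i j] v = foldr act [rho n i j, eps n k] v"
    by (rule act_words') (use assms in \<open>auto simp: group_norm simp del: add_uminus_conv_diff\<close>)
  then show ?thesis by (simp add: e_def rr_def)
qed

lemma rr_inv:
  assumes "i < n" "j < n" "i \<noteq> j"
  shows "e j (rr i j (e j (rr i j v))) = v"
proof -
  have "foldr act [eps n j, rho n i j, eps n j, rho n i j] v = foldr act [] v"
    by (rule act_words') (use assms in \<open>auto simp: group_norm simp del: add_uminus_conv_diff\<close>)
  then show ?thesis by (simp add: e_def rr_def)
qed

lemma rr_rr:
  assumes "i < n" "j < n" "k < n" "i \<noteq> j" "i \<noteq> k" "j \<noteq> k"
  shows "rr j k (rr i j v) = rr i j (rr j k (rr i k v))"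
proof -
  have "foldr act [rho n j k, rho n i j] v = foldr act [rho n i j, rho n j k, rho n i k] v"
    by (rule act_words') (use assms in \<open>auto simp: group_norm simp del: add_uminus_conv_diff\<close>)
  then show ?thesis by (simp add: e_def rr_def)
qed

lemma rr_comm:
  assumes "i < n" "j < n" "k < n" "l < n" "i \<noteq> j" "k \<noteq> l" "i \<noteq> k" "j \<noteq> k" "i \<noteq> l"
  shows "rr i j (rr k l v) = rr k l (rr i j v)"
proof -
  have "foldr act [rho n i j, rho n k l] v = foldr act [rho n k l, rho n i j] v"
    by (rule act_words') (use assms in \<open>auto simp: group_norm simp del: add_uminus_conv_diff\<close>)
  then show ?thesis by (simp add: e_def rr_def)
qed

lemma ll_comm:
  assumes "i < n" "j < n" "k < n" "i \<noteq> j" "i \<noteq> k" "j \<noteq> k"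
  shows "e i (e k (rr i k (e k (e i (rr i j v))))) = rr i j (e i (e k (rr i k (e k (e i v)))))"
proof -
  have "foldr act [eps n i, eps n k, rho n i k, eps n k, eps n i, rho n i j] v = foldr act [rho n i j, eps n i, eps n k, rho n i k, eps n k, eps n i] v"
    by (rule act_words') (use assms in \<open>auto simp: group_norm simp del: add_uminus_conv_diff\<close>)
  then show ?thesis by (simp add: e_def rr_def)
qed

lemma tt_e_i:
  assumes "i < n" "j < n" "i \<noteq> j"
  shows "e i (e j (rr i j (e j (e i (e j (rr j i (e j (rr i j (e i v))))))))) = e j (e i (e j (rr i j (e j (e i (e j (rr j i (e j (rr i j v)))))))))"
proof -
  have "foldr act [eps n i, eps n j, rho n i j, eps n j, eps n i, eps n j, rho n j i, eps n j, rho n i j, eps n i] v = foldr act [eps n j, eps n i, eps n j, rho n i j, eps n j, eps n i, eps n j, rho n j i, eps n j, rho n i j] v"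
    by (rule act_words') (use assms in \<open>auto simp: group_norm simp del: add_uminus_conv_diff\<close>)
  then show ?thesis by (simp add: e_def rr_def)
qed

lemma tt_e_j:
  assumes "i < n" "j < n" "i \<noteq> j"
  shows "e i (e j (rr i j (e j (e i (e j (rr j i (e j (rr i j (e j v))))))))) = e i (e i (e j (rr i j (e j (e i (e j (rr j i (e j (rr i j v)))))))))"
proof -
  have "foldr act [eps n i, eps n j, rho n i j, eps n j, eps n i, eps n j, rho n j i, eps n j, rho n i j, eps n j] v = foldr act [eps n i, eps n i, eps n j, rho n i j, eps n j, eps n i, eps n j, rho n j i, eps n j, rho n i j] v"
    by (rule act_words') (use assms in \<open>auto simp: group_norm simp del: add_uminus_conv_diff\<close>)
  then show ?thesis by (simp add: e_def rr_def)
qed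

text \<open>Conjugation by the product of all inversions turns x_j \<mapsto> x_j x_k into x_j
  \<mapsto> x_k x_j for all j different from k at once, and these two maps differ by conjugation by
  x_k.\<close>

lemma outer_rel:
  assumes k: "k < n"
  shows "foldr e [0..<n] (foldr (\<lambda>j. rr j k) (filter (\<lambda>j. j \<noteq> k) [0..<n]) v)
      = foldr (\<lambda>j. rr j k) (filter (\<lambda>j. j \<noteq> k) [0..<n]) (foldr e [0..<n] v)"
proof -
  let ?l = "filter (\<lambda>j. j \<noteq> k) [0..<n]"
  let ?e = "map (eps n) [0..<n]" and ?r = "map (\<lambda>j. rho n j k) ?l"
  have 1: "foldr e l v = foldr act (map (eps n) l) v" "foldr (\<lambda>j. rr j k) l v = foldr act (map (\<lambda>j. rho n j k) l) v" for l v
    by (induction l) (auto simp: e_def rr_def)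
  have e: "eval (map (eps n) l) (gen i) = (if i \<in> set l then - gen i else gen i)" if "distinct l" "i < n" for l i
    using that by (induction l) auto
  have aux: "additive_map (eval (map (\<lambda>j. f j) l))" if "\<And>j. j \<in> set l \<Longrightarrow> additive_map (f j)" for f :: "nat \<Rightarrow> fg \<Rightarrow> fg" and l
    using that by (induction l) (auto simp: additive_map_def)
  have r: "eval (map (\<lambda>j. rho n j k) l) (gen i) = (if i \<in> set l then gen i + gen k else gen i)" if "distinct l" "k \<notin> set l" "i < n" for l i
    using that k by (induction l) auto
  have add: "additive_map (eval ?e)" "additive_map (eval ?r)" by (rule aux; simp)+
  have "foldr act (?e @ ?r) v = foldr act (?r @ ?e) v"
  proof (rule act_words)
    show "f \<in> set (?e @ ?r) \<union> set (?r @ ?e) \<Longrightarrow> aut n f" for f using k by auto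
    show "pr n (- gen k) = - gen k" using k by simp
    show "eval (?r @ ?e) (gen i) = - gen k + eval (?e @ ?r) (gen i) - - gen k" if i: "i < n" for i
      using i k by (simp add: e r additive_map_simps [OF add(1)] additive_map_simps [OF add(2)] group_norm del: add_uminus_conv_diff)
  qed
  then show ?thesis by (simp add: 1)
qed

end

text \<open>Induction rules may eta-expand functions; pointwise simplification would then destroy the algebraic structure.\<close>

declare fun_simps [simp del] plus_fun_apply [simp del] zero_fun_apply [simp del] minus_apply [simp del] uminus_apply [simp del]

context out_hom begin

section \<open>Sign patterns of the inversions\<close>

lemma e_rr_outside: "k \<ge> m \<Longrightarrow> e i v k = v k" "k \<ge> m \<Longrightarrow> rr i j v k = v k"
  by (simp_all add: e_def rr_def act_def)

lemma eq_neg_zero: "u = - u \<Longrightarrow> u = (0 :: nat \<Rightarrow> real)"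
  by (metis add.inverse_neutral add_eq_0_iff double_zero_sym scaleR_2 real_vector_eq_affinity scale_eq_0_iff zero_neq_numeral)

definition VS :: "nat set \<Rightarrow> (nat \<Rightarrow> real) \<Rightarrow> bool" where
  "VS S v \<longleftrightarrow> (\<forall>i<n. e i v = (if i \<in> S then - v else v))"

text \<open>Simultaneous diagonalization of the commuting involutions \<open>e i\<close>, splitting
  a vector by one index at a time.\<close>

lemma sign_induct:
  assumes base: "\<And>S v. VS S v \<Longrightarrow> Q v" and add: "\<And>u v. Q u \<Longrightarrow> Q v \<Longrightarrow> Q (u + v)"
  shows "Q v"
proof -
  have "\<forall>S v. (\<forall>i<k. e i v = (if i \<in> S then - v else v)) \<longrightarrow> Q v" if "k \<le> n" for k
    using that
  proof (induction k rule: inc_induct)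
    case base
    show ?case
    proof (intro allI impI)
      fix S v assume "\<forall>i<n. e i v = (if i \<in> S then - v else v)"
      then have "VS S v" by (simp only: VS_def)
      then show "Q v" by (rule assms(1))
    qed
  next
    case (step k)
    note k = \<open>k < n\<close> and IH = step.IH
    show ?case
    proof (intro allI impI)
      fix S v assume S: "\<forall>i<k. e i v = (if i \<in> S then - v else v)"
      define a b where "a = (1/2) *\<^sub>R (v + e k v)" and "b = (1/2) *\<^sub>R (v - e k v)"
      have sgn: "e i a = (if i \<in> S then - a else a)" "e i b = (if i \<in> S then - b else b)" if "i < k" for i
        using S that k e_comm [of i k v] by (auto simp: a_def b_def e_lin algebra_simps)
      have "e k a = a" "e k b = - b" using k by (simp_all add: a_def b_def e_lin e_e algebra_simps)
      then have "\<forall>i<Suc k. e i a = (if i \<in> S - {k} then - a else a)" "\<forall>i<Suc k. e i b = (if i \<in> insert k S then - b else b)"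
        using sgn by (auto simp: less_Suc_eq)
      then have "Q a" "Q b" using IH by blast+
      then have "Q (a + b)" by (rule add)
      moreover have "a + b = v" by (simp add: a_def b_def fun_eq_iff fun_simps field_simps)
      ultimately show "Q v" by simp
    qed
  qed
  from this [of 0] show ?thesis by simp
qed

lemma VS_swap:
  assumes "VS S v" "a \<in> S" "b \<notin> S" "a < n" "b < n"
  shows "VS (insert b (S - {a})) (act (swp n a b) v)" "act (swp n a b) (act (swp n a b) v) = v"
proof -
  have "foldr act [swp n a b, swp n a b] v = foldr act [] v" by (rule act_words') (use assms in auto)
  then show "act (swp n a b) (act (swp n a b) v) = v" by simp
  have lin: "act (swp n a b) (- v) = - act (swp n a b) v" by (rule act_lin)
  show "VS (insert b (S - {a})) (act (swp n a b) v)"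
    unfolding VS_def
  proof (intro allI impI)
    fix i assume i: "i < n"
    define i' where "i' = (if i = a then b else if i = b then a else i)"
    have "foldr act [eps n i, swp n a b] v = foldr act [swp n a b, eps n i'] v"
      by (rule act_words') (use assms i in \<open>auto simp: i'_def\<close>)
    then have "e i (act (swp n a b) v) = act (swp n a b) (e i' v)" by (simp add: e_def)
    then show "e i (act (swp n a b) v) = (if i \<in> insert b (S - {a}) then - act (swp n a b) v else act (swp n a b) v)"
      using assms i lin by (auto simp: i'_def VS_def)
  qed
qed

lemma binomial_ge: "2 \<le> s \<Longrightarrow> s \<le> n - 2 \<Longrightarrow> n choose 2 \<le> n choose s"
proof -
  assume s: "2 \<le> s" "s \<le> n - 2"
  show ?thesis
  proof (cases "2 * s \<le> n")
    case False
    then have "n choose (n - 2) \<le> n choose s" using s n6 by (intro binomial_antimono) auto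
    then show ?thesis using n6 binomial_symmetric [of 2 n] by simp
  qed (use s in \<open>intro binomial_mono; simp\<close>)
qed

text \<open>Transpositions of generators carry a nonzero vector of pattern \<open>S\<close> to every
  pattern of the same size. There are at least \<open>n choose 2\<close> of these, and eigenvectors
  of different patterns are independent.\<close>

lemma VS_zero:
  assumes v: "VS S v" and S: "S \<subseteq> {..<n}" "2 \<le> card S" "card S \<le> n - 2"
  shows "v = 0"
proof (rule ccontr)
  assume v0: "v \<noteq> 0"
  have fin: "finite T" if "T \<subseteq> {..<n}" for T :: "nat set" using that finite_subset by blast
  have all: "\<exists>w. w \<noteq> 0 \<and> VS T w" if "T \<subseteq> {..<n}" "card T = card S'" "S' \<subseteq> {..<n}" "w \<noteq> 0" "VS S' w" "card (T - S') = k" for T S' w k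
    using that
  proof (induction k arbitrary: S' w)
    case 0
    then have "T \<subseteq> S'" using fin [OF 0(1)] by simp
    then have "T = S'" using card_subset_eq [OF fin [OF 0(3)]] 0(2) by simp
    then show ?case using 0 by blast
  next
    case (Suc k)
    note f = fin [OF Suc.prems(1)] fin [OF Suc.prems(3)]
    obtain b where b: "b \<in> T" "b \<notin> S'" using Suc.prems(6) by (metis Diff_iff card.empty ex_in_conv nat.distinct(1))
    have "card (S' - T) = card (T - S')"
      using Suc.prems(2) card_Diff_subset_Int [of S' T] card_Diff_subset_Int [of T S'] f by (simp add: Int_commute)
    then obtain a where a: "a \<in> S'" "a \<notin> T" using Suc.prems(6) by (metis Diff_iff card.empty ex_in_conv nat.distinct(1))
    have ab: "a < n" "b < n" using a b Suc.prems by auto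
    let ?S = "insert b (S' - {a})" and ?w = "act (swp n a b) w"
    have w: "VS ?S ?w" "act (swp n a b) ?w = w" using VS_swap [OF Suc.prems(5) a(1) b(2) ab] by auto
    have "?w \<noteq> 0" using w(2) Suc.prems(4) act_lin(4) by metis
    moreover have "card ?S = card S'" using card_Suc_Diff1 [OF f(2) a(1)] card_insert_disjoint [of "S' - {a}" b] b(2) f by simp
    moreover have "T - ?S = (T - S') - {b}" using a by auto
    then have "card (T - ?S) = k" using b Suc.prems(6) f by simp
    ultimately show ?case using Suc.IH [of ?S ?w] Suc.prems(1,2,3) w(1) ab by auto
  qed
  define I where "I = {T. T \<subseteq> {..<n} \<and> card T = card S}"
  have "\<forall>T\<in>I. \<exists>w. w \<noteq> 0 \<and> VS T w" using all [OF _ _ S(1) v0 v] by (auto simp: I_def)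
  then obtain w where w: "\<And>T. T \<in> I \<Longrightarrow> w T \<noteq> 0" "\<And>T. T \<in> I \<Longrightarrow> VS T (w T)" by metis
  have "card I \<le> m"
  proof (rule sign_independent [where A = "{..<n}" and L = e and \<chi> = "\<lambda>T x. x \<in> T" and v = w])
    show "finite I" unfolding I_def by (rule finite_subset [of _ "Pow {..<n}"]) auto
    show "linear (e x)" for x by (simp add: e_def linear_act)
    \<comment> \<open>An inversion with negative sign fixes the coordinates from \<open>m\<close> on
      and negates them, so they vanish.\<close>
    show "w T k = 0" if T: "T \<in> I" "k \<ge> m" for T k
    proof -
      have "T \<noteq> {}" using T S(2) by (auto simp: I_def)
      then obtain i where i: "i \<in> T" "i < n" using T by (auto simp: I_def)
      then have "e i (w T) = - w T" using w(2) [OF T(1)] by (simp add: VS_def)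
      then have "e i (w T) k = - w T k" by (simp add: fun_simps)
      then show ?thesis using e_rr_outside(1) [OF T(2)] by (simp add: fun_simps)
    qed
    show "\<exists>x\<in>{..<n}. (x \<in> T) \<noteq> (x \<in> T')" if "T \<in> I" "T' \<in> I" "T \<noteq> T'" for T T' using that by (auto simp: I_def)
  qed (use w in \<open>auto simp: VS_def\<close>)
  moreover have "card I = n choose card S" unfolding I_def using n_subsets [of "{..<n}" "card S"] by simp
  ultimately show False using binomial_ge [OF S(2,3)] m by simp
qed

lemma VS_cases:
  assumes "VS S v" "v \<noteq> 0"
  obtains "\<And>a b. a < n \<Longrightarrow> b < n \<Longrightarrow> a \<noteq> b \<Longrightarrow> \<not> (a \<in> S \<and> b \<in> S)"
  | "\<And>a b. a < n \<Longrightarrow> b < n \<Longrightarrow> a \<noteq> b \<Longrightarrow> a \<in> S \<or> b \<in> S"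
proof -
  let ?S = "S \<inter> {..<n}"
  have "VS ?S v" using assms(1) by (auto simp: VS_def)
  then have "\<not> (2 \<le> card ?S \<and> card ?S \<le> n - 2)" using VS_zero [of ?S v] assms(2) by auto
  then consider "card ?S < 2" | "card ?S > n - 2" by linarith
  then show ?thesis
  proof cases
    case 1
    have "\<not> (a \<in> S \<and> b \<in> S)" if "a < n" "b < n" "a \<noteq> b" for a b
    proof
      assume "a \<in> S \<and> b \<in> S"
      then have "card {a, b} \<le> card ?S" using that by (intro card_mono) auto
      then show False using 1 that by simp
    qed
    then show ?thesis by (rule that(1))
  next
    case 2
    have big: "a \<in> S \<or> b \<in> S" if "a < n" "b < n" "a \<noteq> b" for a b
    proof (rule ccontr)
      assume "\<not> (a \<in> S \<or> b \<in> S)"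
      then have "card ?S \<le> card ({..<n} - {a, b})" by (intro card_mono) auto
      also have "\<dots> = n - 2" using that by (simp add: card_Diff_subset)
      finally show False using 2 by simp
    qed
    then show ?thesis by (rule that(2))
  qed
qed

text \<open>For commuting signs a, b, c the expression (a + b + c - abc)/2 is their
  majority.\<close>

definition om3 :: "nat \<Rightarrow> nat \<Rightarrow> nat \<Rightarrow> (nat \<Rightarrow> real) \<Rightarrow> nat \<Rightarrow> real" where
  "om3 a b c v = (1/2) *\<^sub>R (e a v + e b v + e c v - e a (e b (e c v)))"

text \<open>On every simultaneous eigenspace at most one sign differs from the others; \<open>om\<close> is the common sign.\<close>

definition om :: "(nat \<Rightarrow> real) \<Rightarrow> nat \<Rightarrow> real" where "om = om3 0 1 2"

text \<open>The inversion multiplied by the common sign. Each simultaneous eigenvector is negated by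
  at most one of these, and the relations survive since \<open>om\<close> is an involution commuting
  with all operators concerned.\<close>

definition ee :: "nat \<Rightarrow> (nat \<Rightarrow> real) \<Rightarrow> nat \<Rightarrow> real" where "ee i v = om (e i v)"

lemma om3_lin: "om3 a b c (u + v) = om3 a b c u + om3 a b c v" "om3 a b c (u - v) = om3 a b c u - om3 a b c v"
    "om3 a b c (- v) = - om3 a b c v" "om3 a b c (r *\<^sub>R v) = r *\<^sub>R om3 a b c v" "om3 a b c 0 = 0"
  by (simp_all add: om3_def e_lin algebra_simps)

lemmas om_lin = om3_lin [of 0 1 2, folded om_def]

lemma om3_VS:
  assumes "VS S v"
  shows "(\<forall>a b c. a < n \<and> b < n \<and> c < n \<and> a \<noteq> b \<and> a \<noteq> c \<and> b \<noteq> c \<longrightarrow> om3 a b c v = v) \<and> (\<forall>a b. a < n \<and> b < n \<and> a \<noteq> b \<longrightarrow> \<not> (a \<in> S \<and> b \<in> S))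
    \<or> (\<forall>a b c. a < n \<and> b < n \<and> c < n \<and> a \<noteq> b \<and> a \<noteq> c \<and> b \<noteq> c \<longrightarrow> om3 a b c v = - v) \<and> (\<forall>a b. a < n \<and> b < n \<and> a \<noteq> b \<longrightarrow> a \<in> S \<or> b \<in> S) \<or> v = 0"
proof (cases "v = 0")
  case False
  have val: "e a v = (if a \<in> S then - v else v)" if "a < n" for a using assms that by (simp add: VS_def)
  have half: "(1/2) *\<^sub>R (v + v) = v" "(1/2) *\<^sub>R (- v - v) = - v" by (simp_all add: fun_eq_iff fun_simps)
  from assms False show ?thesis
  proof (cases rule: VS_cases)
    case 1
    have "om3 a b c v = v" if "a < n" "b < n" "c < n" "a \<noteq> b" "a \<noteq> c" "b \<noteq> c" for a b c
    proof -
      have "\<not> (a \<in> S \<and> b \<in> S)" "\<not> (a \<in> S \<and> c \<in> S)" "\<not> (b \<in> S \<and> c \<in> S)" using 1 that by blast+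
      then show ?thesis using that val half by (auto simp: om3_def e_lin)
    qed
    then show ?thesis using 1 by blast
  next
    case 2
    have "om3 a b c v = - v" if "a < n" "b < n" "c < n" "a \<noteq> b" "a \<noteq> c" "b \<noteq> c" for a b c
    proof -
      have "a \<in> S \<or> b \<in> S" "a \<in> S \<or> c \<in> S" "b \<in> S \<or> c \<in> S" using 2 that by blast+
      then show ?thesis using that val half by (auto simp: om3_def e_lin)
    qed
    then show ?thesis using 2 by blast
  qed
qed simp

lemma om_indep: assumes "a < n" "b < n" "c < n" "a \<noteq> b" "a \<noteq> c" "b \<noteq> c" shows "om3 a b c v = om v"
proof (induction v rule: sign_induct)
  case (1 S v)
  have "0 < n" "1 < n" "2 < n" "(0::nat) \<noteq> 1" "(0::nat) \<noteq> 2" "(1::nat) \<noteq> 2" using n6 by auto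
  then have "v = 0 \<or> om3 a b c v = om3 0 1 2 v" using om3_VS [OF 1] assms by metis
  then show ?case by (auto simp: om_def om3_lin)
qed (simp add: om3_lin om_lin)

lemma om_om: "om (om v) = v"
proof (induction v rule: sign_induct)
  case (1 S v)
  have "0 < n" "1 < n" "2 < n" "(0::nat) \<noteq> 1" "(0::nat) \<noteq> 2" "(1::nat) \<noteq> 2" using n6 by auto
  then have "v = 0 \<or> om v = v \<or> om v = - v" using om3_VS [OF 1] unfolding om_def by metis
  then show ?case by (auto simp: om_lin)
qed (simp add: om_lin)

lemma e_om: "i < n \<Longrightarrow> e i (om v) = om (e i v)"
  using n6 by (simp add: om_def om3_def e_lin e_comm [of i])

text \<open>The majority can be computed from three indices different from \<open>i\<close> and
  \<open>j\<close>, whose inversions commute with \<open>rr i j\<close>.\<close>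

lemma rr_om: assumes "i < n" "j < n" "i \<noteq> j" shows "rr i j (om v) = om (rr i j v)"
proof -
  have "card ({..<6::nat} - {i, j}) \<ge> 4" using diff_card_le_card_Diff [of "{i, j}" "{..<6::nat}"] assms(3) by simp
  then have "3 \<le> card ({..<6::nat} - {i, j})" by linarith
  then obtain T where T: "T \<subseteq> {..<6} - {i, j}" "card T = 3" by (rule obtain_subset_with_card_n) auto
  obtain a b c where "T = {a, b, c}" "a \<noteq> b" "a \<noteq> c" "b \<noteq> c" using T(2) unfolding card_3_iff by blast
  then have abc: "a < n" "b < n" "c < n" "a \<noteq> b" "a \<noteq> c" "b \<noteq> c" "a \<noteq> i" "b \<noteq> i" "c \<noteq> i" "a \<noteq> j" "b \<noteq> j" "c \<noteq> j"
    using T n6 by auto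
  have "rr i j (om3 a b c v) = om3 a b c (rr i j v)"
    using abc assms by (simp add: om3_def rr_lin e_rr)
  then show ?thesis using om_indep [OF abc(1-6)] by simp
qed

lemma ee_rank: assumes "i < n" "j < n" "i \<noteq> j" shows "ee i (ee j v) = ee i v + ee j v - v"
proof -
  have VS: "ee i (ee j v) = ee i v + ee j v - v" if S: "VS S v" for S v
  proof -
    have n012: "0 < n" "1 < n" "2 < n" "(0::nat) \<noteq> 1" "(0::nat) \<noteq> 2" "(1::nat) \<noteq> 2" using n6 by auto
    have val: "e a v = (if a \<in> S then - v else v)" if "a < n" for a using S that by (simp add: VS_def)
    have "v = 0 \<or> (om v = v \<and> \<not> (i \<in> S \<and> j \<in> S)) \<or> (om v = - v \<and> (i \<in> S \<or> j \<in> S))"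
      using om3_VS [OF S] n012 assms unfolding om_def by metis
    then show ?thesis
    proof (elim disjE conjE)
      assume "v = 0"
      then show ?thesis by (simp add: ee_def om_lin e_lin)
    qed (use assms val in \<open>auto simp: ee_def om_lin e_lin\<close>)
  qed
  show ?thesis
  proof (induction v rule: sign_induct)
    case (1 S v)
    then show ?case by (rule VS)
  next
    case (2 u v)
    then have "ee i (ee j (u + v)) = ee i (u + v) + ee j (u + v) - (u + v)" by (simp add: ee_def om_lin e_lin)
    then show ?case .
  qed
qed

section \<open>Sign patterns of commuting transvections\<close>

lemma rr_inj: "i < n \<Longrightarrow> j < n \<Longrightarrow> i \<noteq> j \<Longrightarrow> rr i j v = 0 \<Longrightarrow> v = 0"
  using rr_inv [of i j v] by (simp add: e_lin rr_lin)

text \<open>The inequality starts at 6, where it reads 15 < 16; at 5 it would read 10 < 8.\<close>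

lemma card_patterns: "6 \<le> N \<Longrightarrow> N choose 2 < (2::nat) ^ (N - 2)"
proof (induction N rule: dec_induct)
  case base
  then show ?case by (simp add: choose_two)
next
  case (step N)
  have 1: "N - Suc 0 = Suc (N - 2)" if "6 \<le> N" for N :: nat using that by simp
  have "N + 1 \<le> 2 ^ (N - 2)" using step.hyps(1)
  proof (induction N rule: dec_induct)
    case (step N)
    then show ?case by (simp add: 1)
  qed simp
  moreover have "Suc N choose 2 = N + (N choose 2)" by (simp add: numeral_2_eq_2)
  ultimately show ?case using step.IH 1 [OF step.hyps(1)] by simp
qed

definition RS :: "nat \<Rightarrow> nat \<Rightarrow> nat set \<Rightarrow> (nat \<Rightarrow> real) \<Rightarrow> bool" where
  "RS i k T v \<longleftrightarrow> v \<noteq> 0 \<and> (\<forall>j<n. j \<noteq> i \<and> j \<noteq> k \<longrightarrow> rr i j v = (if j \<in> T then - v else v))"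

text \<open>The relation \<open>rr_rr\<close> shows that \<open>rr a b\<close> carries
  \<open>rr i a\<close> to its product with \<open>rr i b\<close>, up to order. On a vector negated
  by \<open>rr i b\<close> this reverses the sign at \<open>a\<close> and leaves the other
  signs.\<close>

lemma RS_toggle:
  assumes ik: "i < n" "k < n" "i \<noteq> k" and a: "a < n" "a \<noteq> i" "a \<noteq> k" and b: "b < n" "b \<noteq> i" "b \<noteq> k" "b \<noteq> a"
    and T: "RS i k T v" "b \<in> T"
  shows "RS i k (if a \<in> T then T - {a} else insert a T) (rr a b v)"
  unfolding RS_def
proof (intro conjI allI impI)
  have v: "v \<noteq> 0" and sgn: "\<And>j. j < n \<Longrightarrow> j \<noteq> i \<Longrightarrow> j \<noteq> k \<Longrightarrow> rr i j v = (if j \<in> T then - v else v)"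
    using T by (auto simp: RS_def)
  show "rr a b v \<noteq> 0" using rr_inj [of a b v] v a b by blast
  fix j assume j: "j < n" "j \<noteq> i \<and> j \<noteq> k"
  show "rr i j (rr a b v) = (if j \<in> (if a \<in> T then T - {a} else insert a T) then - rr a b v else rr a b v)"
  proof (cases "j = a")
    case True
    have "rr a b (rr i a v) = rr i a (rr a b (rr i b v))" using ik a b by (intro rr_rr) auto
    then have "rr a b (rr i a v) = - rr i a (rr a b v)" using sgn [of b] b T(2) by (simp add: rr_lin)
    then have "rr i a (rr a b v) = - rr a b (rr i a v)" by simp
    then show ?thesis using True sgn [of a] a by (auto simp: rr_lin)
  next
    case False
    have "rr i j (rr a b v) = rr a b (rr i j v)" using ik a b j False by (intro rr_comm) auto
    then show ?thesis using False sgn [of j] j by (auto simp: rr_lin)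
  qed
qed

text \<open>Toggling signs connects all nonempty patterns: each step reduces the symmetric
  difference to \<open>S\<close>.\<close>

lemma RS_all:
  assumes ik: "i < n" "k < n" "i \<noteq> k"
    and "RS i k T v" "T \<subseteq> {..<n} - {i, k}" "T \<noteq> {}" "S \<subseteq> {..<n} - {i, k}" "S \<noteq> {}"
  shows "\<exists>v. RS i k S v"
  using assms(4-6)
proof (induction "card ((T - S) \<union> (S - T))" arbitrary: T v rule: less_induct)
  case less
  let ?D = "(T - S) \<union> (S - T)"
  have finD: "finite ?D" by (rule finite_subset [of _ "{..<n} - {i, k}"]) (use less.prems(2) assms(7) in auto)
  show ?case
  proof (cases "T = S")
    case True
    then show ?thesis using less.prems(1) by blast
  next
    case False
    \<comment> \<open>Toggling at \<open>a\<close> needs another element \<open>b\<close> of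
      \<open>T\<close>. If \<open>T\<close> consisted of \<open>a\<close> alone, then
      \<open>a\<close> would be missing from \<open>S\<close>, and any element of \<open>S\<close>
      could be toggled instead.\<close>
    have "\<exists>a\<in>?D. \<exists>b\<in>T. b \<noteq> a"
    proof (rule ccontr)
      assume none: "\<not> ?thesis"
      obtain a where a: "a \<in> ?D" using False by blast
      have "\<forall>b\<in>T. b = a" using none a by blast
      then have Ta: "T = {a}" using less.prems(3) by auto
      obtain s where s: "s \<in> S" using assms(8) by blast
      have "a \<notin> S" using a Ta by blast
      then have "s \<in> ?D \<and> a \<noteq> s" using s Ta by blast
      then show False using none Ta by blast
    qed
    then obtain a b where ab: "a \<in> ?D" "b \<in> T" "b \<noteq> a" by blast
    let ?T = "if a \<in> T then T - {a} else insert a T"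
    have idx: "a < n" "a \<noteq> i" "a \<noteq> k" "b < n" "b \<noteq> i" "b \<noteq> k"
      using subsetD [OF less.prems(2), of a] subsetD [OF less.prems(2), of b] subsetD [OF assms(7), of a] ab by auto
    have "RS i k ?T (rr a b v)" by (rule RS_toggle [OF ik idx ab(3) less.prems(1) ab(2)])
    moreover have "(?T - S) \<union> (S - ?T) = ?D - {a}" using ab(1) by (cases "a \<in> T") auto
    then have "card ((?T - S) \<union> (S - ?T)) < card ?D" by (simp only: card_Diff1_less [OF finD ab(1)])
    moreover have "?T \<subseteq> {..<n} - {i, k}" using less.prems(2) idx(1-3) by auto
    moreover have "b \<in> ?T" using ab(2,3) by simp
    then have "?T \<noteq> {}" by (simp only: ex_in_conv [symmetric]) (rule exI)
    ultimately show ?thesis by (intro less.hyps [of ?T "rr a b v"])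
  qed
qed

text \<open>Otherwise all 2^(n-2) - 1 nonempty patterns would occur, giving more independent vectors
  than the dimension allows.\<close>

lemma RS_none:
  assumes ik: "i < n" "k < n" "i \<noteq> k" and T: "RS i k T v" "T \<subseteq> {..<n} - {i, k}" "T \<noteq> {}"
  shows False
proof -
  let ?J = "{..<n} - {i, k}"
  define I where "I = Pow ?J - {{}}"
  have "\<exists>v. RS i k S v" if "S \<in> I" for S using RS_all [OF ik T, of S] that by (auto simp: I_def)
  then obtain w where w: "\<And>S. S \<in> I \<Longrightarrow> RS i k S (w S)" by metis
  have "card I \<le> m"
  proof (rule sign_independent [where A = ?J and L = "rr i" and \<chi> = "\<lambda>S x. x \<in> S" and v = w])
    show "finite I" by (simp add: I_def)
    show "linear (rr i x)" for x by (simp add: rr_def linear_act)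
    show "w S \<noteq> 0" if "S \<in> I" for S using w [OF that] by (simp add: RS_def)
    show sgn: "rr i x (w S) = (if x \<in> S then - w S else w S)" if "S \<in> I" "x \<in> ?J" for S x
      using w [OF that(1)] that(2) by (simp add: RS_def)
    show "w S l = 0" if S: "S \<in> I" "l \<ge> m" for S l
    proof -
      obtain x where x: "x \<in> S" "x \<in> ?J" using S(1) by (auto simp: I_def)
      have "rr i x (w S) l = - w S l" using sgn [OF S(1) x(2)] x(1) by (simp add: fun_simps)
      then show ?thesis using e_rr_outside(2) [OF S(2)] by simp
    qed
    show "\<exists>x\<in>?J. (x \<in> S) \<noteq> (x \<in> S')" if "S \<in> I" "S' \<in> I" "S \<noteq> S'" for S S' using that by (auto simp: I_def)
  qed
  moreover have "card ?J = n - 2" using ik by (simp add: card_Diff_subset)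
  then have "card I = 2 ^ (n - 2) - 1" unfolding I_def by (simp add: card_Diff_subset card_Pow)
  ultimately show False using card_patterns [OF n6] m by linarith
qed

text \<open>If \<open>rr i j\<close> moves \<open>u\<close>, the difference
  \<open>u - rr i j u\<close> is negated by it. Splitting this vector successively by the other
  commuting involutions yields a simultaneous eigenvector in \<open>U\<close> with a nonempty
  pattern, against \<open>RS_none\<close>.\<close>

lemma no_signs:
  assumes ik: "i < n" "k < n" "i \<noteq> k" and u: "U u" and j: "j < n" "j \<noteq> i" "j \<noteq> k"
    and inv: "\<And>u j. U u \<Longrightarrow> j < n \<Longrightarrow> j \<noteq> i \<Longrightarrow> j \<noteq> k \<Longrightarrow> U (rr i j u) \<and> rr i j (rr i j u) = u"
    and comm: "\<And>u j l. U u \<Longrightarrow> j < n \<Longrightarrow> j \<noteq> i \<Longrightarrow> j \<noteq> k \<Longrightarrow> l < n \<Longrightarrow> l \<noteq> i \<Longrightarrow> l \<noteq> k \<Longrightarrow> rr i j (rr i l u) = rr i l (rr i j u)"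
    and U: "\<And>u v. U u \<Longrightarrow> U v \<Longrightarrow> U (u + v) \<and> U (u - v)"
  shows "rr i j u = u"
proof (rule ccontr)
  assume neq: "rr i j u \<noteq> u"
  let ?J = "{..<n} - {i, k}"
  have "\<exists>w T. U w \<and> w \<noteq> 0 \<and> rr i j w = - w \<and> (\<forall>a\<in>A. rr i a w = (if a \<in> T then - w else w))" if "finite A" "A \<subseteq> ?J" for A
    using that
  proof (induction A rule: finite_induct)
    case empty
    have "U (u - rr i j u) \<and> u - rr i j u \<noteq> 0 \<and> rr i j (u - rr i j u) = - (u - rr i j u)"
      using U [OF u] inv [OF u j] neq by (simp add: rr_lin)
    then show ?case by (intro exI [of _ "u - rr i j u"]) simp
  next
    case (insert a A)
    have "A \<subseteq> ?J" using insert.prems by simp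
    from insert.IH [OF this]
    obtain w T where W: "U w \<and> w \<noteq> 0 \<and> rr i j w = - w \<and> (\<forall>b\<in>A. rr i b w = (if b \<in> T then - w else w))"
      by (elim exE) (rule that)
    have w: "U w" "w \<noteq> 0" "rr i j w = - w" "\<And>b. b \<in> A \<Longrightarrow> rr i b w = (if b \<in> T then - w else w)"
      using W by simp_all
    have a: "a < n" "a \<noteq> i" "a \<noteq> k" using insert.prems by auto
    show ?case
    proof (cases "w + rr i a w = 0")
      case True
      then have "rr i a w = - w" by (simp add: eq_neg_iff_add_eq_0 add.commute)
      then have "\<forall>b\<in>insert a A. rr i b w = (if b \<in> insert a T then - w else w)" using w(4) insert.hyps(2) by auto
      then show ?thesis using w(1-3) by (intro exI [of _ w] exI [of _ "insert a T"]) simp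
    next
      case False
      let ?w = "w + rr i a w"
      have 1: "rr i b ?w = (if b \<in> T then - ?w else ?w)" if "b \<in> A" for b
      proof -
        have b: "b < n" "b \<noteq> i" "b \<noteq> k" using that insert.prems by auto
        show ?thesis using w(4) [OF that] comm [OF w(1) b a] by (simp add: rr_lin)
      qed
      have 2: "rr i a ?w = ?w" using inv [OF w(1) a] by (simp add: rr_lin add.commute)
      have 3: "rr i j ?w = - ?w" using w(3) comm [OF w(1) j a] by (simp add: rr_lin)
      have 4: "U ?w" by (rule conjunct1 [OF U [OF w(1) conjunct1 [OF inv [OF w(1) a]]]])
      have "\<forall>b\<in>insert a A. rr i b ?w = (if b \<in> T - {a} then - ?w else ?w)" using 1 2 insert.hyps(2) by auto
      then show ?thesis using 3 4 False by (intro exI [of _ ?w] exI [of _ "T - {a}"] conjI)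
    qed
  qed
  from this [of ?J] obtain w T where w: "w \<noteq> 0" "rr i j w = - w" "\<forall>a\<in>?J. rr i a w = (if a \<in> T then - w else w)" by auto
  have "RS i k (T \<inter> ?J) w" using w(1,3) by (simp add: RS_def)
  moreover have "j \<in> T"
  proof (rule ccontr)
    assume "j \<notin> T"
    then have "w = - w" using bspec [OF w(3), of j] w(2) j by simp
    then have "w = 0" by (rule eq_neg_zero)
    with w(1) show False by (rule notE)
  qed
  then have "j \<in> T \<inter> ?J" using j by simp
  ultimately show False using RS_none [OF ik, of "T \<inter> ?J" w] by blast
qed

section \<open>Verification of the assumptions of \<open>transvections\<close>\<close>

lemma om_even:
  assumes "\<forall>i\<in>set l. i < n"
  shows "foldr ee l v = (om ^^ length l) (foldr e l v)"
proof -
  have step: "ee i ((om ^^ k) u) = (om ^^ Suc k) (e i u)" if "i < n" for i k u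
    by (induction k) (simp_all add: ee_def e_om [OF that])
  show ?thesis using assms
  proof (induction l)
    case (Cons i l)
    then have "foldr ee (i # l) v = ee i ((om ^^ length l) (foldr e l v))" by simp
    also have "\<dots> = (om ^^ Suc (length l)) (e i (foldr e l v))" using Cons.prems by (intro step) simp
    finally show ?case by simp
  qed simp
qed

lemma ee_lin: "ee i (u + v) = ee i u + ee i v" "ee i (u - v) = ee i u - ee i v" "ee i (- v) = - ee i v" "ee i (r *\<^sub>R v) = r *\<^sub>R ee i v" "ee i 0 = 0"
  by (simp_all only: ee_def e_lin om_lin)

lemma ee_outer:
  assumes k: "k < n"
  shows "foldr ee [0..<n] (foldr (\<lambda>j. rr j k) (filter (\<lambda>j. j \<noteq> k) [0..<n]) v)
      = foldr (\<lambda>j. rr j k) (filter (\<lambda>j. j \<noteq> k) [0..<n]) (foldr ee [0..<n] v)"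
proof -
  have 1: "foldr (\<lambda>j. rr j k) l (om u) = om (foldr (\<lambda>j. rr j k) l u)" if "\<forall>j\<in>set l. j < n \<and> j \<noteq> k" for l u
    using that k by (induction l) (auto simp: rr_om)
  have 2: "foldr (\<lambda>j. rr j k) l ((om ^^ q) u) = (om ^^ q) (foldr (\<lambda>j. rr j k) l u)" if "\<forall>j\<in>set l. j < n \<and> j \<noteq> k" for l u q
    using 1 [OF that] by (induction q) auto
  show ?thesis using outer_rel [OF k, of v] by (simp add: om_even 2)
qed

lemma transvections: "transvections n ee rr"
  apply (rule transvections.intro)
  subgoal by (rule n6)
  subgoal for i by (rule linearI) (simp_all only: ee_lin)
  subgoal for i j by (simp only: rr_def linear_act)
  subgoal for i v by (simp add: ee_def e_om om_om e_e)
  subgoal for i j v by (rule ee_rank)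
  subgoal for i j k v by (simp only: ee_def e_rr rr_om simp_thms)
  subgoal for i j v by (simp add: ee_def e_om rr_om om_om rr_inv)
  subgoal for i j k v by (rule rr_rr)
  subgoal for i j k l v by (rule rr_comm)
  subgoal for i j k v using ll_comm [of i j k v] by (simp only: ee_def e_om rr_om om_om simp_thms)
  subgoal for i j T v using tt_e_i [of i j v] by (simp add: ee_def e_om rr_om om_om)
  subgoal for i j T v using tt_e_j [of i j v] by (simp add: ee_def e_om rr_om om_om)
  subgoal for k v by (rule ee_outer)
  by (rule_tac U = U and k = k in no_signs; (assumption | blast))

sublocale tv: transvections n ee rr by (rule transvections)

end

section \<open>Commuting elements of order 3 and 4\<close>

context transvections begin

text \<open>The operator of the rotation x_i \<mapsto> x_j, x_j \<mapsto> x_i^-1, written in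
  inversions and transvections.\<close>

definition th :: "nat \<Rightarrow> nat \<Rightarrow> 'v \<Rightarrow> 'v" where
  "th i j v = E i (E j (R i j (E j (E i (E j (R j i (E j (R i j v))))))))"

lemma th_lin: assumes "ix [i, j]"
  shows "th i j (u + v) = th i j u + th i j v" "th i j (u - v) = th i j u - th i j v" "th i j (- v) = - th i j v" "th i j 0 = 0"
  using assms by (simp_all add: th_def E_lin R_lin)

lemma th_val: assumes "ix [i, j]"
  shows "W i v \<Longrightarrow> th i j v = c i j v - d j i v" "W j v \<Longrightarrow> th i j v = d i j v - c j i v"
  unfolding th_def using theta_W(3) [OF assms] theta_Wj [OF assms] by auto

lemma th_W:
  assumes ij: "ix [i, j]" and v: "W i v"
  shows "th i j v = c i j v - d j i v" "W j (th i j v)" "th i j (th i j v) = - v"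
proof -
  have ji: "ix [j, i]" using ij by auto
  show 1: "th i j v = c i j v - d j i v" by (rule th_val(1) [OF ij v])
  show 2: "W j (th i j v)" unfolding 1 by (rule W_closed(2)) (use ij c_W [OF ij v] d_W [OF ji] in auto)
  have "th i j (th i j v) = d i j (c i j v - d j i v) - c j i (c i j v - d j i v)"
    using th_val(2) [OF ij 2] by (simp only: 1)
  also have "\<dots> = - (c j i (c i j v) + d i j (d j i v))"
    using d_c [OF ij v] c_d [OF ji v] by (simp add: d_lin [OF ij] c_lin [OF ji])
  finally show "th i j (th i j v) = - v" unfolding theta_W(1) [OF ij v] .
qed

lemma th_Wj:
  assumes ij: "ix [i, j]" and u: "W j u"
  shows "th i j u = d i j u - c j i u" "W i (th i j u)" "th i j (th i j u) = - u"
proof -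
  have ji: "ix [j, i]" using ij by auto
  show 1: "th i j u = d i j u - c j i u" by (rule th_val(2) [OF ij u])
  show 2: "W i (th i j u)" unfolding 1 by (rule W_closed(2)) (use ij c_W [OF ji u] d_W [OF ij] in auto)
  have "th i j (th i j u) = c i j (d i j u - c j i u) - d j i (d i j u - c j i u)"
    using th_val(1) [OF ij 2] by (simp only: 1)
  also have "\<dots> = - (c i j (c j i u) + d j i (d i j u))"
    using d_c [OF ji u] c_d [OF ij u] by (simp add: d_lin [OF ji] c_lin [OF ij])
  finally show "th i j (th i j u) = - u" unfolding theta_W(1) [OF ji u] .
qed

lemma th_fix: assumes "ix [i, j]" shows "W0 v \<Longrightarrow> th i j v = v" "k < n \<Longrightarrow> k \<noteq> i \<Longrightarrow> k \<noteq> j \<Longrightarrow> W k v \<Longrightarrow> th i j v = v"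
proof -
  have n: "i < n" "j < n" "i \<noteq> j" and ji: "ix [j, i]" using assms by auto
  show "th i j v = v" if "W0 v" using that assms ji n by (simp add: th_def R_W0 W0_E)
  show "th i j v = v" if "k < n" "k \<noteq> i" "k \<noteq> j" "W k v"
    using that n R_fix [of i j k v] R_fix [of j i k v] W_other [of k v i] W_other [of k v j] by (simp add: th_def)
qed

text \<open>The conjugate on the left is the left transvection. It acts like the right one, as is
  seen from the matrix entries on each part.\<close>

lemma lam_eq: assumes ij: "ix [i, j]" shows "E i (E j (R i j (E j (E i v)))) = R i j v"
proof (induction v rule: W_induct)
  case (W0 v)
  then show ?case using ij by (simp add: R_W0 W0_E)
next
  case (W k v)
  have n: "i < n" "j < n" "i \<noteq> j" and ji: "ix [j, i]" using ij by auto
  consider "k = i" | "k = j" | "k \<noteq> i" "k \<noteq> j" by blast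
  then show ?case
  proof cases
    case 1
    then have v: "W i v" using W by simp
    have "E i (c i j v) = c i j v" by (rule W_other [OF c_W [OF ij v]]) (use n in auto)
    then show ?thesis using v W_E [OF c_W [OF ij v]] W_other [OF v n(1,2,3)] n by (simp add: R_c E_lin c_lin [OF ij] W_E)
  next
    case 2
    then have v: "W j v" using W by simp
    have "E j (d i j v) = d i j v" by (rule W_other [OF d_W [OF ij]]) (use n in auto)
    then show ?thesis using v W_E [OF d_W [OF ij]] W_other [OF v, of i] n by (simp add: R_Wj [OF ij] E_lin R_lin W_E)
  next
    case 3
    then show ?thesis using n W R_fix [of i j k v] W_other [of k v i] W_other [of k v j] by simp
  qed
next
  case (add u v)
  then show ?case using ij by (simp add: E_lin R_lin)
qed

text \<open>The operator of the partial conjugation of x_i by x_j, the quotient of a left by a right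
  transvection.\<close>

lemma twist_trivial: assumes ij: "ix [i, j]" shows "E j (R i j (E j (E i (E j (R i j (E j (E i v))))))) = v"
  unfolding lam_eq [OF ij] by (rule R_inv) (use ij in auto)

text \<open>A rotation composed with a transvection: on two coordinates this is an element of order
  3 of GL_2(\<int>).\<close>

definition sgm :: "nat \<Rightarrow> nat \<Rightarrow> 'v \<Rightarrow> 'v" where "sgm i j v = th i j (R i j v)"

context
  fixes i j
  assumes ij: "ix [i, j]"
begin

lemma ji: "ix [j, i]" and neq: "i < n" "j < n" "i \<noteq> j" "j \<noteq> i"
  using ij by auto

lemma sg_lin: "sgm i j (u + v) = sgm i j u + sgm i j v" "sgm i j (u - v) = sgm i j u - sgm i j v" "sgm i j (- v) = - sgm i j v"
  using neq by (simp_all add: sgm_def R_lin th_lin [OF ij])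

lemma sg_Wi:
  assumes v: "W i v"
  shows "sgm i j v = (c i j v - d j i v) - c j i (c i j v)"
proof -
  have "sgm i j v = th i j v + th i j (c i j v)" by (simp add: sgm_def R_c [of i j v] th_lin [OF ij])
  also have "\<dots> = (c i j v - d j i v) + (d i j (c i j v) - c j i (c i j v))"
    by (simp add: th_W [OF ij v] th_Wj [OF ij c_W [OF ij v]])
  finally show ?thesis by (simp add: d_c [OF ij v])
qed

lemma sg_Wj:
  assumes u: "W j u"
  shows "sgm i j u = (d i j u - c j i u) - d j i (d i j u)"
proof -
  have "sgm i j u = th i j u + th i j (d i j u)" by (simp only: sgm_def R_Wj [OF ij u] th_lin [OF ij])
  also have "\<dots> = (d i j u - c j i u) + (c i j (d i j u) - d j i (d i j u))"
    by (simp only: th_Wj(1) [OF ij u] th_W(1) [OF ij d_W [OF ij]])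
  finally show ?thesis by (simp only: c_d [OF ij u]) simp
qed

lemma sg_order:
  assumes "W i v \<or> W j v"
  shows "v + sgm i j v + sgm i j (sgm i j v) = 0"
proof -
  note l = c_lin [OF ij] c_lin [OF ji] d_lin [OF ij] d_lin [OF ji]
  note n01 = neq
  from assms show ?thesis
  proof
    assume v: "W i v"
    let ?u = "c i j v - d j i v" and ?w = "c j i (c i j v)"
    have cv: "W j (c i j v)" by (rule c_W [OF ij v])
    have dv: "W j (d j i v)" by (rule d_W [OF ji])
    have u: "W j ?u" by (rule W_closed(2)) (use n01 cv dv in auto)
    have w: "W i ?w" by (rule c_W [OF ji cv])
    have q: "d i j (d j i v) = v - ?w" using theta_W(1) [OF ij v] by (simp add: algebra_simps)
    have "c i j v - c i j ?w = 0" using c_d [OF ij dv] by (simp only: q l)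
    then have cc: "c i j ?w = c i j v" by (simp only: right_minus_eq)
    have d1w: "d j i ?w = 0" by (rule d_c [OF ji cv])
    have du: "d i j ?u = ?w - v" by (simp only: l d_c [OF ij v] q) simp
    have cu: "c j i ?u = ?w" by (simp only: l c_d [OF ji v] diff_zero)
    have "sgm i j ?u = - v - (- d j i v)" unfolding sg_Wj [OF u] du cu by (simp only: l d1w) simp
    moreover have "sgm i j ?w = c i j v - ?w" by (simp only: sg_Wi [OF w] cc d1w diff_zero)
    ultimately have "sgm i j (sgm i j v) = (- v - (- d j i v)) - (c i j v - ?w)" by (simp only: sg_Wi [OF v] sg_lin)
    then show ?thesis unfolding sg_Wi [OF v] by simp
  next
    assume u: "W j v"
    let ?w = "d i j v - c j i v" and ?y = "d j i (d i j v)"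
    have dv: "W i (d i j v)" by (rule d_W [OF ij])
    have cv: "W i (c j i v)" by (rule c_W [OF ji u])
    have w: "W i ?w" by (rule W_closed(2)) (use n01 cv dv in auto)
    have y: "W j ?y" by (rule d_W [OF ji])
    have q: "c i j (c j i v) = v - ?y" using theta_W(1) [OF ji u] by (simp add: algebra_simps)
    have "d i j v - d i j ?y = 0" using d_c [OF ij cv] by (simp only: q l)
    then have dy: "d i j ?y = d i j v" by (simp only: right_minus_eq)
    have c1y: "c j i ?y = 0" by (rule c_d [OF ji dv])
    have cw: "c i j ?w = ?y - v" by (simp only: l c_d [OF ij u] q) simp
    have dw: "d j i ?w = ?y" by (simp only: l d_c [OF ji u] diff_zero)
    have "sgm i j ?w = - v + c j i v" unfolding sg_Wi [OF w] cw dw by (simp only: l c1y) simp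
    moreover have "sgm i j ?y = d i j v - ?y" by (simp only: sg_Wj [OF y] dy c1y diff_zero)
    ultimately have "sgm i j (sgm i j v) = (- v + c j i v) - (d i j v - ?y)" by (simp only: sg_Wj [OF u] sg_lin)
    then show ?thesis unfolding sg_Wj [OF u] by simp
  qed
qed

text \<open>The two off-diagonal entries are mutually inverse up to sign. This later shows that the
  element of order 3 moves every functional of \<open>W i\<close> that is nonzero modulo 3.\<close>

lemma sg_cross: assumes v: "W i v" shows "p i (sgm i j (p j (sgm i j v))) = - v"
proof -
  note l = c_lin [OF ij] c_lin [OF ji] d_lin [OF ij] d_lin [OF ji]
  note n01 = neq
  let ?u = "c i j v - d j i v" and ?w = "c j i (c i j v)"
  have cv: "W j (c i j v)" by (rule c_W [OF ij v])
  have dv: "W j (d j i v)" by (rule d_W [OF ji])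
  have u: "W j ?u" by (rule W_closed(2)) (use n01 cv dv in auto)
  have w: "W i ?w" by (rule c_W [OF ji cv])
  have "p j (sgm i j v) = ?u" unfolding sg_Wi [OF v] using n01 by (simp only: p_lin p_on(1) [OF u] p_simps(2) [OF w neq(2,1,4)]) simp
  moreover have "W i (d i j ?u - c j i ?u)" by (rule W_closed(2)) (use n01 d_W [OF ij] c_W [OF ji u] in auto)
  then have "p i (sgm i j ?u) = d i j ?u - c j i ?u"
    unfolding sg_Wj [OF u] using n01 p_simps(2) [OF d_W [OF ji], of i] by (simp only: p_lin p_on(1)) simp
  moreover have "d i j ?u - c j i ?u = - (c j i (c i j v) + d i j (d j i v))"
    by (simp only: l d_c [OF ij v] c_d [OF ji v]) simp
  ultimately show ?thesis by (simp only: theta_W(1) [OF ij v])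
qed

end

section \<open>The linear action of the elements of order 4 and 3\<close>

definition sg :: "'v \<Rightarrow> 'v" where "sg = sgm 0 1"

lemma ix01: "ix [0, 1]"
  using n by auto

lemmas sg_linear = sg_lin [OF ix01, folded sg_def]

lemma sg_fix: "W0 v \<Longrightarrow> sg v = v" "2 \<le> k \<Longrightarrow> k < n \<Longrightarrow> W k v \<Longrightarrow> sg v = v"
proof -
  show "sg v = v" if "W0 v" using that ix01 R_W0 [OF ix01 that] th_fix(1) [OF ix01 that] by (simp add: sg_def sgm_def)
  show "sg v = v" if "2 \<le> k" "k < n" "W k v"
    using that n R_fix [of 0 1 k v] th_fix(2) [OF ix01, of k v] by (simp add: sg_def sgm_def)
qed

text \<open>\<open>dl\<close> and \<open>pe\<close> describe the linear action of two commuting outer automorphisms of order 4 and 3.\<close>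

definition N :: nat where "N = (if even n then n else n - 3)"
definition rot :: "nat \<Rightarrow> 'v \<Rightarrow> 'v" where "rot q = foldr (\<lambda>q. th (2 * q) (2 * q + 1)) [1..<q]"
definition dl :: "'v \<Rightarrow> 'v" where "dl v = E 0 (E 1 (rot (N div 2) v))"
definition pe :: "'v \<Rightarrow> 'v" where "pe v = sg (if even n then v else th N (N + 1) (th (N + 1) (N + 2) v))"

text \<open>Below \<open>N\<close> the generators from 2 on are rotated in pairs by
  \<open>dl\<close>, so their number must be even. For odd \<open>n\<close> the last three
  generators are set aside; \<open>pe\<close> permutes them cyclically up to signs and
  \<open>dl\<close> fixes them.\<close>

lemma N: "even N" "N \<le> n" "odd n \<Longrightarrow> n = N + 3" "even n \<Longrightarrow> n = N" "2 \<le> N"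
  using n by (auto simp: N_def)

lemma pair_ix: "1 \<le> q \<Longrightarrow> q < N div 2 \<Longrightarrow> ix [2 * q, 2 * q + 1]"
  using N(1,2) by (auto elim!: evenE)

lemma foldr_lin:
  fixes f :: "nat \<Rightarrow> 'v \<Rightarrow> 'v"
  assumes "\<And>q u v. q \<in> set l \<Longrightarrow> f q (u + v) = f q u + f q v"
  shows "foldr f l (u + v) = foldr f l u + foldr f l v"
  using assms by (induction l) auto

lemma rot_fix:
  assumes "Q \<le> N div 2"
  shows "W0 v \<Longrightarrow> rot Q v = v" "k < n \<Longrightarrow> k < 2 \<or> 2 * Q \<le> k \<Longrightarrow> W k v \<Longrightarrow> rot Q v = v"
proof -
  have "foldr (\<lambda>q. th (2 * q) (2 * q + 1)) l v = v" if "set l \<subseteq> {1..<Q}" "W0 v" for l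
    using that
  proof (induction l)
    case (Cons q l)
    then have "ix [2 * q, 2 * q + 1]" using assms by (intro pair_ix) auto
    then show ?case using Cons th_fix(1) by simp
  qed simp
  then show "W0 v \<Longrightarrow> rot Q v = v" by (simp add: rot_def)
  have "foldr (\<lambda>q. th (2 * q) (2 * q + 1)) l v = v" if "set l \<subseteq> {1..<Q}" "k < n" "k < 2 \<or> 2 * Q \<le> k" "W k v" for l
    using that
  proof (induction l)
    case (Cons q l)
    then have q: "ix [2 * q, 2 * q + 1]" using assms by (intro pair_ix) auto
    have "k \<noteq> 2 * q" "k \<noteq> 2 * q + 1" using Cons.prems by auto
    then show ?case using Cons th_fix(2) [OF q, of k v] by simp
  qed simp
  then show "k < n \<Longrightarrow> k < 2 \<or> 2 * Q \<le> k \<Longrightarrow> W k v \<Longrightarrow> rot Q v = v" by (simp add: rot_def)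
qed

lemma rot_W:
  assumes "Q \<le> N div 2" "2 \<le> k" "k < 2 * Q" "W k v"
  shows "\<exists>k'. 2 \<le> k' \<and> k' < 2 * Q \<and> W k' (rot Q v) \<and> rot Q (rot Q v) = - v"
  using assms
proof (induction Q)
  case (Suc Q)
  have Q: "1 \<le> Q" using Suc.prems by auto
  have step: "rot (Suc Q) u = rot Q (th (2 * Q) (2 * Q + 1) u)" for u using Q by (simp add: rot_def)
  have ixQ: "ix [2 * Q, 2 * Q + 1]" using Suc.prems Q by (intro pair_ix) auto
  have Qn: "2 * Q < n" "2 * Q + 1 < n" using ixQ by auto
  have fix': "rot Q u = u" if "W (2 * Q) u \<or> W (2 * Q + 1) u" for u
    using that rot_fix(2) [of Q "2 * Q" u] rot_fix(2) [of Q "2 * Q + 1" u] Qn Suc.prems(1) by auto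
  have pass: "th (2 * Q) (2 * Q + 1) u = u" if "2 \<le> l" "l < 2 * Q" "W l u" for l u
    using that th_fix(2) [OF ixQ, of l u] Qn by auto
  have "k < 2 * Q + 2" using Suc.prems(3) by simp
  then consider "k = 2 * Q" | "k = 2 * Q + 1" | "k < 2 * Q" by linarith
  then show ?case
  proof cases
    case 1
    then have v: "W (2 * Q) v" using Suc.prems by simp
    note t = th_W [OF ixQ v]
    show ?thesis unfolding step using fix' t(2,3) v Q fix' [of "- v"] W_closed(3) [OF Qn(1) v] by (intro exI [of _ "2 * Q + 1"]) auto
  next
    case 2
    then have v: "W (2 * Q + 1) v" using Suc.prems by simp
    note t = th_Wj [OF ixQ v]
    show ?thesis unfolding step using fix' t(2,3) v Q fix' [of "- v"] W_closed(3) [OF Qn(2) v] by (intro exI [of _ "2 * Q"]) auto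
  next
    case 3
    then obtain k' where k': "2 \<le> k'" "k' < 2 * Q" "W k' (rot Q v)" "rot Q (rot Q v) = - v"
      using Suc.IH Suc.prems by auto
    show ?thesis unfolding step using pass [OF Suc.prems(2) 3 Suc.prems(4)] pass [OF k'(1-3)] k' by (intro exI [of _ k']) auto
  qed
qed simp

lemma rot_lin: "rot (N div 2) (u + v) = rot (N div 2) u + rot (N div 2) v"
  unfolding rot_def by (rule foldr_lin) (use pair_ix in \<open>auto simp: th_lin\<close>)

lemma dl_lin: "dl (u + v) = dl u + dl v"
  using n by (simp add: dl_def rot_lin E_lin)

lemma dl_neg: "dl (- v) = - dl v" "dl 0 = 0" "dl (u - v) = dl u - dl v"
proof -
  have "dl 0 + dl 0 = dl 0" using dl_lin [of 0 0] by simp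
  then show 0: "dl 0 = 0" by simp
  have *: "dl (- v) = - dl v" for v using dl_lin [of v "- v"] 0 by (simp add: eq_neg_iff_add_eq_0 add.commute)
  show "dl (- v) = - dl v" by (rule *)
  show "dl (u - v) = dl u - dl v" using dl_lin [of u "- v"] * by simp
qed

lemma dl_W0: "W0 v \<Longrightarrow> dl v = v"
  using n by (simp add: dl_def rot_fix W0_E)

lemma dl_01: "k < 2 \<Longrightarrow> W k v \<Longrightarrow> dl v = - v"
  using n rot_fix(2) [of "N div 2" k v] W_other [of k v 0] W_other [of k v 1]
  by (cases "k = 0") (auto simp: dl_def W_E E_lin less_2_cases_iff)

lemma dl_rot: assumes "2 \<le> k" "k < N" "W k v" shows "\<exists>k'. 2 \<le> k' \<and> k' < N \<and> W k' (dl v) \<and> dl (dl v) = - v"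
proof -
  have e: "dl u = rot (N div 2) u" if "2 \<le> k" "k < N" "W k (rot (N div 2) u)" for k u
    using that W_other [of k _ 0] W_other [of k _ 1] N(2) by (simp add: dl_def)
  have 2: "2 * (N div 2) = N" using N(1) by simp
  obtain k' where k': "2 \<le> k'" "k' < N" "W k' (rot (N div 2) v)" "rot (N div 2) (rot (N div 2) v) = - v"
    using rot_W [OF order_refl, of k v] assms 2 by auto
  have "k < n" using assms N(2) by simp
  then have "dl (rot (N div 2) v) = - v" using e [of k "rot (N div 2) v"] k'(4) assms W_closed(3) [of k v] by auto
  then show ?thesis using k' e [OF k'(1-3)] by (intro exI [of _ k']) auto
qed

lemma dl_cyc: "N \<le> k \<Longrightarrow> k < n \<Longrightarrow> W k v \<Longrightarrow> dl v = v"
  using n N rot_fix(2) [of "N div 2" k v] W_other [of k v 0] W_other [of k v 1] by (auto simp: dl_def)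

lemma cyc_ix: "odd n \<Longrightarrow> ix [N, N + 1] \<and> ix [N + 1, N + 2]"
  using N(3) by auto

lemma pe_lin: "pe (u + v) = pe u + pe v" "pe (u - v) = pe u - pe v" "pe (- v) = - pe v"
  using cyc_ix by (auto simp: pe_def th_lin sg_linear)

lemma pe_W0: "W0 v \<Longrightarrow> pe v = v"
  using cyc_ix by (auto simp: pe_def th_fix sg_fix)

lemma pe_low: "k < N \<Longrightarrow> W k v \<Longrightarrow> pe v = sg v"
  using cyc_ix N th_fix(2) [of N "N + 1" k v] th_fix(2) [of "N + 1" "N + 2" k v] by (auto simp: pe_def)

lemma pe_rot: "2 \<le> k \<Longrightarrow> k < N \<Longrightarrow> W k v \<Longrightarrow> pe v = v"
  using pe_low [of k v] sg_fix(2) [of k v] N(2) by simp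

lemma pe_cyc: assumes k: "N \<le> k" "k < n" "W k v" shows "W (if k = N + 2 then N else k + 1) (pe v)"
proof -
  have odd: "odd n" using k N(4) by auto
  have n3: "n = N + 3" by (rule N(3) [OF odd])
  have c: "ix [N, N + 1]" "ix [N + 1, N + 2]" using cyc_ix [OF odd] by auto
  have pe: "pe u = sg (th N (N + 1) (th (N + 1) (N + 2) u))" for u using odd by (simp add: pe_def)
  have fix': "sg u = u" if "W l u" "N \<le> l" "l < n" for l u using sg_fix(2) [of l u] that N(5) by simp
  consider "k = N" | "k = N + 1" | "k = N + 2" using k n3 by linarith
  then show ?thesis
  proof cases
    case 1
    then have "th (N + 1) (N + 2) v = v" using th_fix(2) [OF c(2), of N v] k n3 by simp
    then show ?thesis using 1 k th_W(2) [OF c(1), of v] fix' [of "N + 1" "th N (N + 1) v"] n3 by (simp add: pe)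
  next
    case 2
    then have 3: "W (N + 2) (th (N + 1) (N + 2) v)" using k th_W(2) [OF c(2), of v] by simp
    then have "th N (N + 1) (th (N + 1) (N + 2) v) = th (N + 1) (N + 2) v" using th_fix(2) [OF c(1), of "N + 2"] n3 by simp
    then show ?thesis using 2 3 fix' [of "N + 2"] n3 by (simp add: pe)
  next
    case 3
    then have "W (N + 1) (th (N + 1) (N + 2) v)" using k th_Wj(2) [OF c(2), of v] by simp
    then have "W N (th N (N + 1) (th (N + 1) (N + 2) v))" using th_Wj(2) [OF c(1)] by simp
    then show ?thesis using 3 fix' [of N] n3 by (simp add: pe)
  qed
qed

definition ka :: "'v \<Rightarrow> 'v" where "ka v = v - (\<Sum>i<n. p i v)"

lemma ka_lin: "ka (u + v) = ka u + ka v"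
  by (simp add: ka_def p_lin sum.distrib)

lemma ka_W0: "W0 v \<Longrightarrow> ka v = v" "W0 (ka v)"
  by (simp_all add: ka_def p_simps W0_rest)

lemma ka_W: assumes "k < n" "W k v" shows "ka v = 0"
proof -
  have "(\<Sum>i<n. p i v) = (\<Sum>i<n. if i = k then v else 0)"
    by (rule sum.cong) (use assms in \<open>auto simp: p_on p_simps\<close>)
  then show ?thesis using assms by (simp add: ka_def)
qed

lemma ka_sg: assumes "k < 2" "W k v" shows "ka (sg v) = 0"
proof (cases "k = 0")
  case True
  have c: "W 1 (c 0 1 v - d 1 0 v)" "W 0 (c 1 0 (c 0 1 v))"
    using assms True W_closed(2) [OF _ c_W [OF ix01, of v] d_W [OF ji [OF ix01], of v]] c_W [OF ji [OF ix01] c_W [OF ix01, of v]] n by auto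
  have "ka (sg v + c 1 0 (c 0 1 v)) = 0"
    unfolding sg_def sg_Wi [OF ix01 assms(2) [unfolded True]] using ka_W [OF _ c(1)] n by simp
  then show ?thesis unfolding ka_lin using ka_W [OF _ c(2)] n by simp
next
  case False
  then have v: "W 1 v" using assms by (simp add: less_2_cases_iff)
  have c: "W 0 (d 0 1 v - c 1 0 v)" "W 1 (d 1 0 (d 0 1 v))"
    using v W_closed(2) [OF _ d_W [OF ix01, of v] c_W [OF ji [OF ix01], of v]] d_W [OF ji [OF ix01], of "d 0 1 v"] n by auto
  have "ka (sg v + d 1 0 (d 0 1 v)) = 0"
    unfolding sg_def sg_Wj [OF ix01 v] using ka_W [OF _ c(1)] n by simp
  then show ?thesis unfolding ka_lin using ka_W [OF _ c(2)] n by simp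
qed

lemma ka_dl_pe: "ka (dl v) = ka v" "dl (ka v) = ka v" "ka (pe v) = ka v" "pe (ka v) = ka v"
proof -
  show "dl (ka v) = ka v" "pe (ka v) = ka v" by (simp_all add: dl_W0 pe_W0 ka_W0)
  show "ka (dl v) = ka v"
  proof (induction v rule: W_induct)
    case (W k v)
    consider "k < 2" | "2 \<le> k" "k < N" | "N \<le> k" by linarith
    then show ?case
    proof cases
      case 1
      then show ?thesis using W W_closed(3) [of k v] by (simp add: dl_01 ka_W)
    next
      case 2
      then obtain k' where "k' < N" "W k' (dl v)" using dl_rot [of k v] W by blast
      then show ?thesis using ka_W [OF W] ka_W [of k' "dl v"] N(2) by simp
    qed (use W dl_cyc in simp)
  qed (simp_all add: dl_W0 dl_lin ka_lin)
  show "ka (pe v) = ka v"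
  proof (induction v rule: W_induct)
    case (W k v)
    consider "k < 2" | "2 \<le> k" "k < N" | "N \<le> k" by linarith
    then show ?case
    proof cases
      case 1
      then show ?thesis using W N(5) ka_sg [of k v] pe_low [of k v] ka_W [OF W] by simp
    next
      case 2
      then show ?thesis using W pe_rot by simp
    next
      case 3
      have "(if k = N + 2 then N else k + 1) < n" using 3 W(1) N(3,4) by (cases "odd n") auto
      then show ?thesis using ka_W [OF _ pe_cyc [OF 3 W]] ka_W [OF W] by simp
    qed
  qed (simp_all add: pe_W0 pe_lin ka_lin)
qed

text \<open>The alternating sum over the powers of \<open>dl\<close> is 4 times the projection to
  its eigenvalue -1. This eigenspace is \<open>W 0\<close> plus \<open>W 1\<close>, where
  \<open>pe\<close> acts as \<open>sg\<close>. The statement is phrased as an identity of operators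
  so that it carries over to other coefficients.\<close>

lemma odd_sum: "(let y = v + pe v + pe (pe v) in y - dl y + dl (dl y) - dl (dl (dl y))) = 0"
proof (induction v rule: W_induct)
  case (W0 v)
  then show ?case by (simp add: pe_W0 dl_W0 dl_lin)
next
  case (W k v)
  consider "k < 2" | "2 \<le> k" "k < N" | "N \<le> k" by linarith
  then show ?case
  proof cases
    case 1
    then have v: "W 0 v \<or> W 1 v" using W by (auto simp: less_2_cases_iff)
    have pe: "pe v = sg v" using W pe_low [of k v] N(5) 1 by simp
    have "pe (sg v) = sg (sg v)"
    proof (cases "k = 0")
      case True
      have "pe u = sg u" if "W 0 u \<or> W 1 u" for u using that pe_low [of 0 u] pe_low [of 1 u] N(5) by auto
      then have *: "pe (u - w) = sg (u - w)" if "W 1 u" "W 0 w" for u w using that by (simp add: pe_lin sg_linear)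
      have "W 0 v" using W True by simp
      then have c: "W 1 (c 0 1 v - d 1 0 v)" "W 0 (c 1 0 (c 0 1 v))"
        using W_closed(2) [OF _ c_W [OF ix01, of v] d_W [OF ji [OF ix01], of v]] c_W [OF ji [OF ix01] c_W [OF ix01, of v]] n by auto
      show ?thesis using * [OF c] unfolding sg_def sg_Wi [OF ix01 \<open>W 0 v\<close>] .
    next
      case False
      have "pe u = sg u" if "W 0 u \<or> W 1 u" for u using that pe_low [of 0 u] pe_low [of 1 u] N(5) by auto
      then have *: "pe (u - w) = sg (u - w)" if "W 0 u" "W 1 w" for u w using that by (simp add: pe_lin sg_linear)
      have "W 1 v" using W 1 False by (simp add: less_2_cases_iff)
      then have c: "W 0 (d 0 1 v - c 1 0 v)" "W 1 (d 1 0 (d 0 1 v))"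
        using W_closed(2) [OF _ d_W [OF ix01, of v] c_W [OF ji [OF ix01], of v]] d_W [OF ji [OF ix01], of "d 0 1 v"] n by auto
      show ?thesis using * [OF c] unfolding sg_def sg_Wj [OF ix01 \<open>W 1 v\<close>] .
    qed
    moreover have "v + sg v + sg (sg v) = 0" using sg_order [OF ix01 v] by (simp only: sg_def)
    ultimately have "v + pe v + pe (pe v) = 0" by (simp only: pe)
    then show ?thesis by (simp add: dl_neg)
  next
    case 2
    then obtain k' where "dl (dl v) = - v" using dl_rot [of k v] W by blast
    then show ?thesis using pe_rot [OF 2 W(2)] by (simp add: dl_lin dl_neg)
  next
    case 3
    have k': "(if k = N + 2 then N else k + 1) < n" "N \<le> (if k = N + 2 then N else k + 1)" using 3 W(1) N(3,4) by (cases "odd n"; auto)+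
    have "dl (pe v) = pe v" by (rule dl_cyc [OF k'(2,1) pe_cyc [OF 3 W]])
    moreover have "dl v = v" by (rule dl_cyc [OF 3 W])
    moreover have k'': "(if (if k = N + 2 then N else k + 1) = N + 2 then N else (if k = N + 2 then N else k + 1) + 1) < n"
      using 3 W(1) N(3,4) by (cases "odd n") auto
    have "dl (pe (pe v)) = pe (pe v)" by (rule dl_cyc [OF _ k'' pe_cyc [OF k'(2,1) pe_cyc [OF 3 W]]]) (use 3 in auto)
    ultimately show ?thesis by (simp add: dl_lin)
  qed
next
  case (add u v)
  have "(let y = (u + v) + pe (u + v) + pe (pe (u + v)) in y - dl y + dl (dl y) - dl (dl (dl y)))
    = (let y = u + pe u + pe (pe u) in y - dl y + dl (dl y) - dl (dl (dl y)))
    + (let y = v + pe v + pe (pe v) in y - dl y + dl (dl y) - dl (dl (dl y)))"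
    by (simp add: Let_def pe_lin dl_lin algebra_simps)
  then show ?case using add by simp
qed

lemma even_sum_W:
  assumes pe3: "\<And>v. pe (pe (pe v)) = v" and k: "N \<le> k" "k < n" "W k x"
  shows "p N x + pe (p N (pe (pe x))) + pe (pe (p N (pe x))) = x"
proof -
  have n3: "n = N + 3" using k N(3,4) by (cases "odd n") auto
  have pN: "p N y = (if l = N then y else 0)" if "W l y" "l < n" for l y using that n3 by (auto simp: p_on p_simps)
  note w1 = pe_cyc [OF k]
  have n1: "N \<le> (if k = N + 2 then N else k + 1)" "(if k = N + 2 then N else k + 1) < n" using k n3 by auto
  note w2 = pe_cyc [OF n1 w1]
  have pe0: "pe 0 = 0" using pe_lin(2) [of 0 0] by simp
  consider "k = N" | "k = N + 1" | "k = N + 2" using k n3 by linarith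
  then show ?thesis
    by cases (use w1 w2 k n3 pN [of _ x] pN [of _ "pe x"] pN [of _ "pe (pe x)"] in \<open>simp_all add: pe3 pe0\<close>)
qed

text \<open>The sum over the powers of \<open>dl\<close> is 4 times the projection to its fixed
  vectors. Outside \<open>W0\<close> these are zero for even \<open>n\<close>. For odd
  \<open>n\<close> they form three parts permuted cyclically by \<open>pe\<close>, so the conjugates
  of \<open>p N\<close> by the powers of \<open>pe\<close> add up to the identity there.\<close>

lemma even_sum:
  assumes pe3: "\<And>v. pe (pe (pe v)) = v"
  shows "(let u = v + dl v + dl (dl v) + dl (dl (dl v)) in
      (\<Sum>i<n. p i u) - (if even n then 0 else p N u + pe (p N (pe (pe u))) + pe (pe (p N (pe u))))) = 0"
proof (induction v rule: W_induct)
  case (W0 v)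
  then have x: "W0 (v + v + v + v)" by (intro W0_closed)
  have pe0: "pe 0 = 0" using pe_lin(2) [of 0 0] by simp
  have "odd n \<Longrightarrow> p N (v + v + v + v) = 0" using p_simps(1) [OF x, of N] N(3) by simp
  then show ?case using dl_W0 [OF W0] by (simp add: p_simps(1) [OF x] pe_W0 [OF x] pe0 Let_def)
next
  case (W k v)
  have pe0: "pe 0 = 0" using pe_lin(2) [of 0 0] by simp
  have p0: "p i 0 = 0" if "i < n" for i using p_lin that by simp
  have zero: ?case if "v + dl v + dl (dl v) + dl (dl (dl v)) = 0"
    using that N(3) by (auto simp: Let_def pe0 p0)
  consider "k < 2" | "2 \<le> k" "k < N" | "N \<le> k" by linarith
  then show ?case
  proof cases
    case 1
    then show ?thesis using W dl_01 [of k v] by (intro zero) (simp add: dl_neg)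
  next
    case 2
    then obtain k' where "dl (dl v) = - v" using dl_rot [of k v] W by blast
    then show ?thesis by (intro zero) (simp add: dl_neg)
  next
    case 3
    have x: "W k (v + v + v + v)" by (intro W_closed W)
    have odd: "odd n" using 3 W N(4) by auto
    have "(\<Sum>i<n. p i (v + v + v + v)) = v + v + v + v" using ka_W [OF W(1) x] by (simp add: ka_def)
    then show ?thesis using dl_cyc [OF 3 W] even_sum_W [OF pe3 3 W(1) x] odd by (simp add: Let_def)
  qed
next
  case (add u v)
  have "odd n \<Longrightarrow> N < n" using N(3) by simp
  then have "(let x = (u + v) + dl (u + v) + dl (dl (u + v)) + dl (dl (dl (u + v))) in
      (\<Sum>i<n. p i x) - (if even n then 0 else p N x + pe (p N (pe (pe x))) + pe (pe (p N (pe x)))))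
    = (let x = u + dl u + dl (dl u) + dl (dl (dl u)) in
      (\<Sum>i<n. p i x) - (if even n then 0 else p N x + pe (p N (pe (pe x))) + pe (pe (p N (pe x)))))
    + (let x = v + dl v + dl (dl v) + dl (dl (dl v)) in
      (\<Sum>i<n. p i x) - (if even n then 0 else p N x + pe (p N (pe (pe x))) + pe (pe (p N (pe x)))))"
    by (simp add: Let_def pe_lin dl_lin p_lin sum.distrib algebra_simps)
  then show ?case using add by simp
qed

lemma dl_p0: "dl (p 0 v) = - p 0 v"
  using dl_01 [of 0 "p 0 v"] p_W [of 0 v] n by simp

lemma pe_cross: "p 0 (pe (p 1 (pe (p 0 v)))) = - p 0 v"
proof -
  have "pe u = sg u" if "W 0 u \<or> W 1 u" for u using that pe_low [of 0 u] pe_low [of 1 u] N(5) by auto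
  then have "p 0 (pe (p 1 (pe (p 0 v)))) = p 0 (sg (p 1 (sg (p 0 v))))" using p_W [of 0 v] p_W [of 1] n by simp
  also have "\<dots> = - p 0 v" using sg_cross [OF ix01 p_W, of v] n by (simp add: sg_def)
  finally show ?thesis .
qed

lemma p_p: "i < n \<Longrightarrow> p i (p i v) = p i v" "i < n \<Longrightarrow> j < n \<Longrightarrow> i \<noteq> j \<Longrightarrow> p i (p j v) = 0"
  using p_on(1) [OF p_W, of i v] p_simps(2) [OF p_W, of j i v] by auto

lemma p_th: assumes ij: "ix [i, j]" shows "p j (th i j v) = th i j (p i v)" "th i j (th i j (th i j (th i j v))) = v"
proof -
  have n: "i < n" "j < n" "i \<noteq> j" using ij by auto
  show "p j (th i j v) = th i j (p i v)"
  proof (induction v rule: W_induct)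
    case (W0 v)
    then show ?case using n by (simp add: th_fix [OF ij] p_simps th_lin [OF ij])
  next
    case (W k v)
    consider "k = i" | "k = j" | "k \<noteq> i" "k \<noteq> j" by blast
    then show ?case
    proof cases
      case 1
      then show ?thesis using W th_W(2) [OF ij, of v] by (simp add: p_on)
    next
      case 2
      then show ?thesis using W th_Wj(2) [OF ij, of v] n by (simp add: p_simps(2) [of i _ j] p_simps(2) [of j _ i] th_lin [OF ij])
    next
      case 3
      then show ?thesis using W n by (simp add: th_fix(2) [OF ij] p_simps(2) [of k] th_lin [OF ij])
    qed
  qed (use n in \<open>simp add: th_lin [OF ij] p_lin\<close>)
  show "th i j (th i j (th i j (th i j v))) = v"
  proof (induction v rule: W_induct)
    case (W k v)
    then show ?case using th_W(3) [OF ij, of v] th_Wj(3) [OF ij, of v] th_fix(2) [OF ij, of k v]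
      n by (cases "k = i"; cases "k = j"; simp add: th_lin [OF ij])
  qed (simp_all add: th_fix [OF ij] th_lin [OF ij])
qed

end

section \<open>Change of the coefficient ring\<close>

text \<open>Integral combinations of products of operators: an identity between such operators that holds
  over the reals holds over every commutative ring.\<close>

datatype opr = Ac "fg \<Rightarrow> fg" | One | Plus opr opr | Minus opr opr | Comp opr opr

context out_hom begin

primrec ev :: "opr \<Rightarrow> (nat \<Rightarrow> 'r::ab_group_add) \<Rightarrow> nat \<Rightarrow> 'r" where
  "ev (Ac f) v = act f v"
| "ev One v = v"
| "ev (Plus a b) v = ev a v + ev b v"
| "ev (Minus a b) v = ev a v - ev b v"
| "ev (Comp a b) v = ev a (ev b v)"

lemma ext_map: assumes h: "additive_map h" shows "ext (h \<circ> v) x = h (ext v x)"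
proof -
  have "ext (h \<circ> v) = h \<circ> ext v"
    by (rule additive_map_eqI) (use h in \<open>auto intro: additive_map_comp additive_ext\<close>)
  then show ?thesis by (simp add: fun_eq_iff)
qed

text \<open>Integral combinations of the operators commute with every change of
  coefficients.\<close>

lemma ev_map:
  fixes h :: "'r::ab_group_add \<Rightarrow> 's::ab_group_add"
  assumes h: "additive_map h"
  shows "ev a (h \<circ> v) = h \<circ> ev a v"
proof (induction a arbitrary: v)
  case (Ac f)
  show ?case
  proof
    fix i show "ev (Ac f) (h \<circ> v) i = (h \<circ> ev (Ac f) v) i" by (simp add: act_def ext_map [OF h])
  qed
next
  case (Plus a b)
  then show ?case by (simp add: fun_eq_iff fun_simps additive_map_add [OF h])
next
  case (Minus a b)
  have "h (x - y) = h x - h y" for x y using additive_map_add [OF h, of "x - y" y] by (simp add: algebra_simps)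
  then show ?case using Minus by (simp add: fun_eq_iff fun_simps)
qed (simp_all only: ev.simps)

lemma ev_lin: "ev a (u + v) = ev a u + ev a v" "ev a (u - v) = ev a u - ev a v" "ev a (- v) = - ev a v" "ev a 0 = 0"
proof -
  show add: "ev a (u + v) = ev a u + ev a v" for u v
    by (induction a arbitrary: u v) (simp_all add: act_lin algebra_simps)
  show 0: "ev a 0 = 0" using add [of 0 0] by simp
  show neg: "ev a (- v) = - ev a v" for v
  proof (rule minus_unique [symmetric])
    show "ev a v + ev a (- v) = 0" unfolding add [symmetric] by (simp only: add.right_inverse 0)
  qed
  show "ev a (u - v) = ev a u - ev a v" using add [of u "- v"] neg by simp
qed

lemma ev_sum: "ev a (\<Sum>i\<in>I. f i) = (\<Sum>i\<in>I. ev a (f i))"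
  by (induction I rule: infinite_finite_induct) (simp_all add: ev_lin)

definition supp :: "(nat \<Rightarrow> 'r::zero) \<Rightarrow> bool" where "supp v \<longleftrightarrow> (\<forall>k\<ge>m. v k = 0)"

lemma supp_ev: "supp v \<Longrightarrow> supp (ev a v)"
proof (induction a arbitrary: v)
  case (Ac f)
  then show ?case by (simp add: supp_def act_def)
qed (auto simp: supp_def fun_simps)

lemma ev_int: assumes "\<And>v :: nat \<Rightarrow> real. ev a v = ev b v" shows "ev a v = ev b (v :: nat \<Rightarrow> int)"
proof -
  have h: "additive_map real_of_int" by (simp add: additive_map_def)
  have "real_of_int \<circ> ev a v = real_of_int \<circ> ev b v" using assms by (simp only: ev_map [OF h, symmetric])
  then show ?thesis by (simp add: fun_eq_iff)
qed

definition unit :: "nat \<Rightarrow> nat \<Rightarrow> int" where "unit i k = (if k = i then 1 else 0)"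

lemma supp_sum: fixes v :: "nat \<Rightarrow> 'r::comm_ring_1" assumes "supp v" shows "v = (\<Sum>i<m. (\<lambda>z. of_int z * v i) \<circ> unit i)"
proof
  fix k
  have "(\<Sum>i<m. (\<lambda>z. of_int z * v i) \<circ> unit i) k = (\<Sum>i<m. if i = k then v k else 0)"
    unfolding sum_fun_apply by (intro sum.cong refl) (simp add: unit_def)
  also have "\<dots> = v k" using assms by (auto simp: supp_def)
  finally show "v k = (\<Sum>i<m. (\<lambda>z. of_int z * v i) \<circ> unit i) k" by simp
qed

text \<open>An identity over the reals holds for the integral unit vectors, and every vector
  supported below \<open>m\<close> is a combination of their images in the coefficient ring.\<close>

lemma transfer:
  fixes v :: "nat \<Rightarrow> 'r::comm_ring_1"
  assumes eq: "\<And>v :: nat \<Rightarrow> real. ev a v = ev b v" and "supp v"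
  shows "ev a v = ev b v"
proof -
  have h: "additive_map (\<lambda>z. of_int z * v i)" for i by (simp add: additive_map_def algebra_simps)
  have "ev a (\<Sum>i<m. (\<lambda>z. of_int z * v i) \<circ> unit i) = ev b (\<Sum>i<m. (\<lambda>z. of_int z * v i) \<circ> unit i)"
    unfolding ev_sum ev_map [OF h] ev_int [OF eq] ..
  then show ?thesis by (simp only: supp_sum [OF assms(2), symmetric])
qed

section \<open>Words for the two commuting outer automorphisms\<close>

abbreviation N where "N \<equiv> tv.N"

text \<open>The factors \<open>kw\<close> act trivially on the abelianization, and make \<open>dw\<close> and \<open>pw\<close> commute up to
  conjugation by \<open>x\<^sub>0\<close>.\<close>

definition thw :: "nat \<Rightarrow> nat \<Rightarrow> (fg \<Rightarrow> fg) list" where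
  "thw i j = [eps n i, eps n j, rho n i j, eps n j, eps n i, eps n j, rho n j i, eps n j, rho n i j]"
definition kw :: "nat \<Rightarrow> nat \<Rightarrow> (fg \<Rightarrow> fg) list" where
  "kw i j = [eps n j, rho n i j, eps n j, eps n i, eps n j, rho n i j, eps n j, eps n i]"
definition dw :: "(fg \<Rightarrow> fg) list" where
  "dw = [eps n 0, eps n 1] @ (if even n then [] else kw N 0 @ kw (N + 1) 1) @
    concat (map (\<lambda>q. thw (2 * q) (2 * q + 1)) [1..<N div 2])"
definition pw :: "(fg \<Rightarrow> fg) list" where
  "pw = concat (map (\<lambda>q. kw (2 * q + 1) 0) [1..<N div 2]) @ thw 0 1 @ [rho n 0 1] @
    (if even n then [] else thw N (N + 1) @ thw (N + 1) (N + 2))"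

lemma act_thw: "i < n \<Longrightarrow> j < n \<Longrightarrow> i \<noteq> j \<Longrightarrow> foldr act (thw i j) v = tv.th i j v"
  by (simp add: thw_def tv.th_def ee_def e_om rr_om om_om) (simp add: e_def rr_def)

lemma act_kw: assumes "i < n" "j < n" "i \<noteq> j" shows "foldr act (kw i j) v = (v :: nat \<Rightarrow> real)"
proof -
  have "foldr act (kw i j) v = e j (rr i j (e j (e i (e j (rr i j (e j (e i v)))))))" by (simp add: kw_def e_def rr_def)
  also have "\<dots> = ee j (rr i j (ee j (ee i (ee j (rr i j (ee j (ee i v)))))))"
    using assms by (simp add: ee_def e_om rr_om om_om)
  also have "\<dots> = v" by (rule tv.twist_trivial) (use assms in simp)
  finally show ?thesis .
qed

lemma index_bounds: "0 < n" "Suc 0 < n" "\<not> even n \<Longrightarrow> Suc (Suc N) < n" "1 \<le> q \<Longrightarrow> q < N div 2 \<Longrightarrow> Suc (2 * q) < N" "N \<le> n" "2 \<le> N" "even N"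
  using n6 tv.N by auto

lemma foldr_concat: "foldr f (concat (map g l)) v = foldr (\<lambda>q. foldr f (g q)) l v"
  by (induction l) simp_all

lemma foldr_idle: "(\<And>q v. q \<in> set l \<Longrightarrow> f q v = v) \<Longrightarrow> foldr f l v = v"
  by (induction l) simp_all

lemma act_dw: "foldr act dw v = tv.dl v"
proof -
  have "foldr act (if even n then [] else kw N 0 @ kw (N + 1) 1) u = u" for u :: "nat \<Rightarrow> real"
    using index_bounds by (auto simp: act_kw)
  moreover have "foldr act (concat (map (\<lambda>q. thw (2 * q) (2 * q + 1)) [1..<N div 2])) v = tv.rot (N div 2) v"
    unfolding foldr_concat tv.rot_def
    by (rule foldr_cong [OF refl refl]) (use index_bounds(4,5) in \<open>fastforce simp: act_thw\<close>)
  ultimately have "foldr act dw v = e 0 (e 1 (tv.rot (N div 2) v))" by (simp add: dw_def e_def)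
  also have "\<dots> = tv.dl v" using index_bounds(1,2) by (simp add: tv.dl_def ee_def e_om om_om)
  finally show ?thesis .
qed

lemma act_pw: "foldr act pw v = tv.pe v"
proof -
  have 1: "foldr act (concat (map (\<lambda>q. kw (2 * q + 1) 0) [1..<N div 2])) u = u" for u :: "nat \<Rightarrow> real"
    unfolding foldr_concat by (rule foldr_idle) (use index_bounds(1,4,5) in \<open>fastforce simp: act_kw\<close>)
  have 2: "foldr act (if even n then [] else thw N (N + 1) @ thw (N + 1) (N + 2)) v = (if even n then v else tv.th N (N + 1) (tv.th (N + 1) (N + 2) v))"
    using index_bounds by (auto simp: act_thw)
  have "foldr act pw v = tv.th 0 1 (rr 0 1 (foldr act (if even n then [] else thw N (N + 1) @ thw (N + 1) (N + 2)) v))"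
    unfolding pw_def foldr_append 1 using index_bounds(1,2) by (simp add: act_thw rr_def)
  then show ?thesis by (simp only: 2 tv.pe_def tv.sg_def tv.sgm_def)
qed

lemma pair_bounds: "1 \<le> q \<Longrightarrow> q < N div 2 \<Longrightarrow> 2 * q < n \<and> 2 * q + 1 < n"
  using index_bounds(4) [of q] index_bounds(5) by simp

lemma aut_thw: "f \<in> set (thw i j) \<Longrightarrow> i < n \<Longrightarrow> j < n \<Longrightarrow> i \<noteq> j \<Longrightarrow> aut n f"
  by (auto simp: thw_def)

lemma aut_kw: "f \<in> set (kw i j) \<Longrightarrow> i < n \<Longrightarrow> j < n \<Longrightarrow> i \<noteq> j \<Longrightarrow> aut n f"
  by (auto simp: kw_def)

lemma aut_rot: assumes "Q \<le> N div 2" "f \<in> set (concat (map (\<lambda>q. thw (2 * q) (2 * q + 1)) [1..<Q]))" shows "aut n f"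
proof -
  obtain q where q: "1 \<le> q" "q < Q" "f \<in> set (thw (2 * q) (2 * q + 1))" using assms(2) by auto
  show ?thesis by (rule aut_thw [OF q(3)]) (use pair_bounds [of q] q assms(1) in auto)
qed

lemma aut_kws: assumes "Q \<le> N div 2" "f \<in> set (concat (map (\<lambda>q. kw (2 * q + 1) 0) [1..<Q]))" shows "aut n f"
proof -
  obtain q where q: "1 \<le> q" "q < Q" "f \<in> set (kw (2 * q + 1) 0)" using assms(2) by auto
  show ?thesis by (rule aut_kw [OF q(3)]) (use pair_bounds [of q] q assms(1) index_bounds(1) in auto)
qed

lemma aut_dw: assumes "f \<in> set dw" shows "aut n f"
proof -
  consider "f = eps n 0 \<or> f = eps n 1" | "odd n" "f \<in> set (kw N 0)" | "odd n" "f \<in> set (kw (N + 1) 1)"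
    | "f \<in> set (concat (map (\<lambda>q. thw (2 * q) (2 * q + 1)) [1..<N div 2]))"
    using assms unfolding dw_def by (auto split: if_splits)
  then show ?thesis
  proof cases
    case 2
    then show ?thesis using aut_kw [OF 2(2)] index_bounds by simp
  next
    case 3
    then show ?thesis using aut_kw [OF 3(2)] index_bounds by simp
  qed (use index_bounds(1,2) aut_rot [OF order_refl] in auto)
qed

lemma aut_pw: assumes "f \<in> set pw" shows "aut n f"
proof -
  consider "f \<in> set (concat (map (\<lambda>q. kw (2 * q + 1) 0) [1..<N div 2]))" | "f \<in> set (thw 0 1)" | "f = rho n 0 1"
    | "odd n" "f \<in> set (thw N (N + 1))" | "odd n" "f \<in> set (thw (N + 1) (N + 2))"
    using assms unfolding pw_def by (auto split: if_splits)
  then show ?thesis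
  proof cases
    case 1
    then show ?thesis by (rule aut_kws [OF order_refl])
  next
    case 2
    then show ?thesis using aut_thw [OF 2] index_bounds(1,2) by simp
  next
    case 3
    then show ?thesis using index_bounds(1,2) by simp
  next
    case 4
    then show ?thesis using aut_thw [OF 4(2)] index_bounds by simp
  next
    case 5
    then show ?thesis using aut_thw [OF 5(2)] index_bounds by simp
  qed
qed

lemma additive_eval: "(\<And>f. f \<in> set fs \<Longrightarrow> aut n f) \<Longrightarrow> additive_map (eval fs)"
proof (induction fs)
  case (Cons f fs)
  have "additive_map f" by (rule endo_additive [OF aut_endo [of n]]) (use Cons.prems in simp)
  then have "additive_map (f \<circ> eval fs)" using Cons by (intro additive_map_comp) auto
  then show ?case by (simp add: comp_def)
qed (simp add: additive_map_def)

lemma eval_thw: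
  assumes "i < n" "j < n" "i \<noteq> j" "k < n"
  shows "eval (thw i j) (gen k) = (if k = i then gen j else if k = j then - gen i else gen k)"
    "eval (kw i j) (gen k) = (if k = i then gen j + gen i - gen j else gen k)"
  using assms by (auto simp: thw_def kw_def group_norm simp del: add_uminus_conv_diff)

lemma eval_rot: assumes "Q \<le> N div 2" "k < n"
  shows "eval (concat (map (\<lambda>q. thw (2 * q) (2 * q + 1)) [1..<Q])) (gen k) =
    (if k < 2 \<or> 2 * Q \<le> k then gen k else if even k then gen (k + 1) else - gen (k - 1))"
  using assms
proof (induction Q arbitrary: k)
  case (Suc Q)
  show ?case
  proof (cases "Q = 0")
    case True
    then show ?thesis by (cases "k < 2") auto
  next
    case False
    define g where "g = eval (concat (map (\<lambda>q. thw (2 * q) (2 * q + 1)) [1..<Q]))"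
    have "additive_map g"
      unfolding g_def by (rule additive_eval, rule aut_rot [of Q]) (use Suc.prems(1) in auto)
    then have neg: "g (- x) = - g x" for x by (rule additive_map_neg)
    have b: "2 * Q < n" "2 * Q + 1 < n" using pair_bounds [of Q] Suc.prems False by auto
    have step: "eval (concat (map (\<lambda>q. thw (2 * q) (2 * q + 1)) [1..<Suc Q])) (gen k) = g (eval (thw (2 * Q) (2 * Q + 1)) (gen k))"
      using False by (simp add: g_def)
    have IH: "g (gen l) = (if l < 2 \<or> 2 * Q \<le> l then gen l else if even l then gen (l + 1) else - gen (l - 1))" if "l < n" for l
      using Suc.IH [of l] Suc.prems(1) that by (simp add: g_def)
    have th: "eval (thw (2 * Q) (2 * Q + 1)) (gen k) = (if k = 2 * Q then gen (2 * Q + 1) else if k = 2 * Q + 1 then - gen (2 * Q) else gen k)"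
      by (rule eval_thw(1)) (use b Suc.prems(2) in auto)
    show ?thesis
      unfolding step th using b Suc.prems(2) False by (cases "k < 2 * Q") (auto simp: IH neg)
  qed
qed simp

lemma eval_kws: assumes "Q \<le> N div 2" "k < n"
  shows "eval (concat (map (\<lambda>q. kw (2 * q + 1) 0) [1..<Q])) (gen k) =
    (if 2 \<le> k \<and> k < 2 * Q \<and> odd k then gen 0 + gen k - gen 0 else gen k)"
  using assms
proof (induction Q arbitrary: k)
  case (Suc Q)
  show ?case
  proof (cases "Q = 0")
    case True
    then show ?thesis by auto
  next
    case False
    define g where "g = eval (concat (map (\<lambda>q. kw (2 * q + 1) 0) [1..<Q]))"
    have "additive_map g"
      unfolding g_def by (rule additive_eval, rule aut_kws [of Q]) (use Suc.prems(1) in auto)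
    then have add: "g (x + y) = g x + g y" "g (x - y) = g x - g y" for x y by (rule additive_map_add, rule additive_map_diff)
    have b: "2 * Q < n" "2 * Q + 1 < n" using pair_bounds [of Q] Suc.prems False by auto
    have step: "eval (concat (map (\<lambda>q. kw (2 * q + 1) 0) [1..<Suc Q])) (gen k) = g (eval (kw (2 * Q + 1) 0) (gen k))"
      using False by (simp add: g_def)
    have IH: "g (gen l) = (if 2 \<le> l \<and> l < 2 * Q \<and> odd l then gen 0 + gen l - gen 0 else gen l)" if "l < n" for l
      using Suc.IH [of l] Suc.prems(1) that by (simp add: g_def)
    have kw: "eval (kw (2 * Q + 1) 0) (gen k) = (if k = 2 * Q + 1 then gen 0 + gen (2 * Q + 1) - gen 0 else gen k)"
      using eval_thw(2) [of "2 * Q + 1" 0 k] b Suc.prems(2) index_bounds(1) by simp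
    show ?thesis
      unfolding step kw using b Suc.prems(2) False index_bounds(1) by (cases "k = 2 * Q"; cases "k < 2 * Q") (auto simp: IH add)
  qed
qed simp

lemma eval_dw: assumes "k < n"
  shows "eval dw (gen k) = (if k < 2 then - gen k else if k < N then (if even k then gen (k + 1) else - gen (k - 1))
    else if k = N then - gen 0 + gen N + gen 0 else if k = N + 1 then - gen 1 + gen (N + 1) + gen 1 else gen k)"
proof -
  define g where "g = eval (if even n then [] else kw N 0 @ kw (N + 1) 1)"
  have "additive_map g"
    unfolding g_def by (rule additive_eval) (use index_bounds aut_kw [of _ N 0] aut_kw [of _ "N + 1" 1] in \<open>auto split: if_splits\<close>)
  then have neg: "g (- x) = - g x" for x by (rule additive_map_neg)
  have k: "g (gen l) = (if l = N then gen 0 + gen N - gen 0 else if l = N + 1 then gen 1 + gen (N + 1) - gen 1 else gen l)"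
    if "l < n" for l
    using that index_bounds tv.N(4) eval_thw(2) [of "N + 1" 1 l] eval_thw(2) [of N 0 l] eval_thw(2) [of N 0 1] eval_thw(2) [of N 0 "N + 1"]
      additive_map_add [OF additive_eval, of "kw N 0"] additive_map_diff [OF additive_eval, of "kw N 0"] aut_kw [of _ N 0]
    unfolding g_def by (cases "even n") auto
  define e2 where "e2 = eval [eps n 0, eps n 1]"
  have e: "e2 (gen l) = (if l < 2 then - gen l else gen l)" if "l < n" for l
    using that index_bounds by (auto simp: e2_def less_2_cases_iff)
  have "additive_map e2" unfolding e2_def by (rule additive_eval) (use index_bounds in auto)
  note add = additive_map_simps [OF this]
  have r: "eval (concat (map (\<lambda>q. thw (2 * q) (2 * q + 1)) [1..<N div 2])) (gen k) =
    (if k < 2 \<or> N \<le> k then gen k else if even k then gen (k + 1) else - gen (k - 1))"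
    using eval_rot [OF order_refl assms] index_bounds(7) by simp
  have "Suc k < n" if "k < N" "even k"
  proof -
    have "Suc k \<noteq> N"
    proof
      assume "Suc k = N"
      then have "even (Suc k)" using index_bounds(7) by (simp only:)
      then show False using that(2) by simp
    qed
    then show ?thesis using that index_bounds(5) by simp
  qed
  moreover have N2: "k < N \<Longrightarrow> even k \<Longrightarrow> Suc k < N" using index_bounds(7) by (metis Suc_lessI even_Suc)
  moreover have "eval dw (gen k) = e2 (g (eval (concat (map (\<lambda>q. thw (2 * q) (2 * q + 1)) [1..<N div 2])) (gen k)))"
    by (simp add: dw_def e2_def g_def)
  moreover have "odd k \<Longrightarrow> \<not> k < 2 \<Longrightarrow> \<not> k - Suc 0 < 2" by (cases "k = 2") auto
  ultimately show ?thesis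
    unfolding r using assms index_bounds(1,2,5,6) tv.N(3) by (auto simp: k e neg add group_norm simp del: add_uminus_conv_diff)
qed

lemma eval_pw: assumes "k < n"
  shows "eval pw (gen k) = (if k = 0 then gen 1 - gen 0 else if k = 1 then - gen 0
    else if k < N then (if even k then gen k else gen 0 + gen k - gen 0)
    else if k = N + 2 then gen N else gen (k + 1))"
proof -
  let ?c = "if even n then [] else thw N (N + 1) @ thw (N + 1) (N + 2)"
  have c: "eval ?c (gen k) = (if k < N then gen k else if k = N + 2 then gen N else gen (k + 1))"
    using assms index_bounds tv.N(3,4) eval_thw(1) [of "N + 1" "N + 2" k] eval_thw(1) [of N "N + 1" k] eval_thw(1) [of N "N + 1" "N + 2"]
      eval_thw(1) [of N "N + 1" "N + 1"] additive_map_neg [OF additive_eval, of "thw N (N + 1)"] aut_thw [of _ N "N + 1"]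
    by (cases "even n") (auto simp: not_less)
  define g where "g = eval (thw 0 1 @ [rho n 0 1])"
  have t: "g (gen l) = (if l = 0 then gen 1 - gen 0 else if l = 1 then - gen 0 else gen l)" if "l < n" for l
    using that index_bounds eval_thw(1) [of 0 1 l] eval_thw(1) [of 0 1 0] eval_thw(1) [of 0 1 1]
      additive_map_add [OF additive_eval, of "thw 0 1"] aut_thw [of _ 0 1] by (auto simp: g_def)
  define f where "f = eval (concat (map (\<lambda>q. kw (2 * q + 1) 0) [1..<N div 2]))"
  have "additive_map f"
    unfolding f_def by (rule additive_eval, rule aut_kws [OF order_refl])
  note add = additive_map_simps [OF this]
  have r: "f (gen l) =
    (if 2 \<le> l \<and> l < N \<and> odd l then gen 0 + gen l - gen 0 else gen l)" if "l < n" for l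
    using eval_kws [OF order_refl that] index_bounds(7) by (simp add: f_def)
  have "eval pw (gen k) = f (g (eval ?c (gen k)))"
    by (simp add: pw_def f_def g_def)
  then show ?thesis
    unfolding c using assms index_bounds(1,2,5,6) tv.N(3,4) by (cases "even n") (auto simp: t r add not_less)
qed

end

text \<open>Commutation with \<open>gen i\<close> makes the expansion commute with
  \<open>X i\<close>, so all its nonempty monomials begin with \<open>i\<close>; they cannot begin
  with both 0 and 1.\<close>

lemma central_trivial:
  assumes "w + gen 0 = gen 0 + w" "w + gen 1 = gen 1 + w"
  shows "w = 0"
proof -
  have X: "mu w * X i = X i * mu w" if "w + gen i = gen i + w" for i
    using arg_cong [OF that, of mu] by (simp add: mu_add mu_gen algebra_simps)
  have "cf (mu w) v = 0" if v: "v \<noteq> []" for v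
  proof -
    obtain a t where at: "v = a # t" using v by (cases v) auto
    have "a = i \<or> cf (mu w) v = 0" if "w + gen i = gen i + w" for i
    proof -
      have "cf (mu w) v = cf (mu w * X i) (v @ [i])" by (simp only: cf_mult_X_snoc if_True simp_thms)
      also have "\<dots> = cf (X i * mu w) (a # t @ [i])" by (simp only: X [OF that] at append_Cons)
      finally show ?thesis by (auto simp: cf_X_mult_Cons)
    qed
    from this [OF assms(1)] this [OF assms(2)] show ?thesis by auto
  qed
  then have "mu w = 1" by (intro ser_eqI) (auto simp: cf_one)
  then show ?thesis by (rule mu_eq_1)
qed

context out_hom begin

section \<open>The automorphisms of order 4 and 3 and their lifts\<close>

lemma eval_pr:
  assumes "\<And>f. f \<in> set fs \<Longrightarrow> aut n f"
  shows "aut n (eval fs \<circ> pr n) \<and> act (eval fs \<circ> pr n) v = foldr act fs v"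
  using assms
proof (induction fs)
  case Nil
  have eq: "eval [] \<circ> pr n = pr n" by (simp add: fun_eq_iff)
  show ?case unfolding eq using aut_pr act_pr [of v] by simp
next
  case (Cons f fs)
  have f: "aut n f" by (rule Cons.prems) simp
  have fs: "aut n (eval fs \<circ> pr n) \<and> act (eval fs \<circ> pr n) v = foldr act fs v"
    by (rule Cons.IH, rule Cons.prems) simp
  have eq: "eval (f # fs) \<circ> pr n = f \<circ> (eval fs \<circ> pr n)" by (simp add: fun_eq_iff)
  show ?case
    unfolding eq act_comp [OF f conjunct1 [OF fs]] conjunct2 [OF fs] by (intro conjI aut_comp f conjunct1 [OF fs]) simp
qed

definition del :: "fg \<Rightarrow> fg" where "del = eval dw \<circ> pr n"
definition pie :: "fg \<Rightarrow> fg" where "pie = eval pw \<circ> pr n"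

lemma aut_del: "aut n del" and aut_pie: "aut n pie"
  unfolding del_def pie_def by (rule conjunct1 [OF eval_pr]; rule aut_dw aut_pw; assumption)+

lemma act_del: "act del v = foldr act dw v" and act_pie: "act pie v = foldr act pw v"
  unfolding del_def pie_def by (rule conjunct2 [OF eval_pr]; rule aut_dw aut_pw; assumption)+

lemma del_gen: "k < n \<Longrightarrow> del (gen k) = (if k < 2 then - gen k else if k < N then (if even k then gen (k + 1) else - gen (k - 1))
    else if k = N then - gen 0 + gen N + gen 0 else if k = N + 1 then - gen 1 + gen (N + 1) + gen 1 else gen k)"
  using eval_dw [of k] by (simp add: del_def)

lemma pie_gen: "k < n \<Longrightarrow> pie (gen k) = (if k = 0 then gen 1 - gen 0 else if k = 1 then - gen 0
    else if k < N then (if even k then gen k else gen 0 + gen k - gen 0)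
    else if k = N + 2 then gen N else gen (k + 1))"
  using eval_pw [of k] by (simp add: pie_def)

lemmas del_add = additive_map_simps [OF endo_additive [OF aut_endo [OF aut_del]]]
lemmas pie_add = additive_map_simps [OF endo_additive [OF aut_endo [OF aut_pie]]]

lemma even_next: assumes "k < N" shows "even k \<Longrightarrow> k + 1 < N" "odd k \<Longrightarrow> \<not> k < 2 \<Longrightarrow> 2 \<le> k - 1" "odd k \<Longrightarrow> k - 1 + 1 = k"
proof -
  show "k + 1 < N" if "even k"
  proof (rule ccontr)
    assume "\<not> k + 1 < N"
    then have "N = Suc k" using assms by simp
    then have "odd N" using that by simp
    then show False using index_bounds(7) by simp
  qed
  show "2 \<le> k - 1" if "odd k" "\<not> k < 2" using that by (cases "k = 2") auto
  show "k - 1 + 1 = k" if "odd k" using that by (cases k) auto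
qed

lemma index_cases:
  assumes "k < n"
  obtains "k = 0" | "k = 1" | "2 \<le> k" "k < N" "even k" "k + 1 < N" "k + 1 < n" | j where "2 \<le> j" "k = j + 1" "even j" "j < N" "k < N" "j < n"
    | "k = N" "n = N + 3" | "k = N + 1" "n = N + 3" | "k = N + 2" "n = N + 3"
proof -
  consider "k = 0" | "k = 1" | "2 \<le> k" "k < N" "even k" | "2 \<le> k" "k < N" "odd k" | "N \<le> k" by linarith
  then show thesis
  proof cases
    case 3
    then show thesis using even_next(1) [of k] index_bounds(5) that(3) by simp
  next
    case 4
    then show thesis using even_next(2,3) [of k] index_bounds(5) by (intro that(4) [of "k - 1"]) auto
  next
    case 5
    then have "n = N + 3" using assms tv.N(3,4) by (cases "odd n") auto
    then consider "k = N" | "k = N + 1" | "k = N + 2" using 5 assms by linarith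
    then show thesis using that(5-7) \<open>n = N + 3\<close> by cases auto
  qed (rule that; assumption)+
qed

lemma del_4: "del \<circ> del \<circ> del \<circ> del = pr n"
proof (rule endo_eqI [of n])
  show "endo n (del \<circ> del \<circ> del \<circ> del)" by (intro endo_comp aut_endo aut_del)
  fix k assume k: "k < n"
  then show "(del \<circ> del \<circ> del \<circ> del) (gen k) = pr n (gen k)"
    using index_bounds(1,2,5,6)
    by (cases rule: index_cases) (auto simp: del_gen del_add group_norm simp del: add_uminus_conv_diff)
qed (simp add: endo_pr)

lemma pie_3: "pie \<circ> pie \<circ> pie = pr n"
proof (rule endo_eqI [of n])
  show "endo n (pie \<circ> pie \<circ> pie)" by (intro endo_comp aut_endo aut_pie)
  fix k assume k: "k < n"
  then show "(pie \<circ> pie \<circ> pie) (gen k) = pr n (gen k)"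
    using index_bounds(1,2,5,6)
    by (cases rule: index_cases) (auto simp: pie_gen pie_add group_norm simp del: add_uminus_conv_diff)
qed (simp add: endo_pr)

lemma del_pie: "del \<circ> pie = inn (- gen 0) (pie \<circ> del)"
proof (rule endo_eqI [of n])
  show "endo n (del \<circ> pie)" by (intro endo_comp aut_endo aut_pie aut_del)
  show "endo n (inn (- gen 0) (pie \<circ> del))" using index_bounds(1) by (intro endo_inn endo_comp aut_endo aut_pie aut_del) simp
  fix k assume k: "k < n"
  then show "(del \<circ> pie) (gen k) = inn (- gen 0) (pie \<circ> del) (gen k)"
    using index_bounds(1,2,5,6)
    by (cases rule: index_cases) (auto simp: inn_def pie_gen del_gen del_add pie_add group_norm simp del: add_uminus_conv_diff)
qed

abbreviation dlv :: "(nat \<Rightarrow> 'r::ab_group_add) \<Rightarrow> nat \<Rightarrow> 'r" where "dlv \<equiv> act del"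
abbreviation pev :: "(nat \<Rightarrow> 'r::ab_group_add) \<Rightarrow> nat \<Rightarrow> 'r" where "pev \<equiv> act pie"

lemma dlv_4: "dlv (dlv (dlv (dlv v))) = v"
proof -
  have "act (del \<circ> del \<circ> del \<circ> del) v = v" by (simp only: del_4 act_pr)
  then show ?thesis by (simp only: act_comp aut_comp aut_del)
qed

lemma pev_3: "pev (pev (pev v)) = v"
proof -
  have "act (pie \<circ> pie \<circ> pie) v = v" by (simp only: pie_3 act_pr)
  then show ?thesis by (simp only: act_comp aut_comp aut_pie)
qed

lemma dlv_pev: "dlv (pev v) = pev (dlv v)"
proof -
  have "act (del \<circ> pie) v = act (pie \<circ> del) v"
    unfolding del_pie by (simp add: act_inn aut_comp aut_del aut_pie index_bounds(1))
  then show ?thesis by (simp only: act_comp aut_del aut_pie)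
qed

text \<open>Lifts chosen separately for the two elements would commute only up to conjugation,
  whereas powers of one automorphism commute exactly.\<close>

definition r :: "fg \<Rightarrow> fg" where "r = lift (del \<circ> pie)"

lemma aut_r: "aut m r"
  unfolding r_def by (intro lift(1) aut_comp aut_del aut_pie)

lemma aut_pow: "aut m f \<Longrightarrow> aut m (f ^^ Suc k)"
  by (induction k) (simp_all add: aut_comp)

lemma cls_pow: assumes "aut m f" shows "cls m (f ^^ Suc k) = cls m f [^]\<^bsub>Out (F m)\<^esub> Suc k"
proof (induction k)
  case 0
  then show ?case using assms cls_in_Out by simp
next
  case (Suc k)
  have "cls m (f ^^ Suc (Suc k)) = cls m (f ^^ Suc k \<circ> f)" by (simp only: funpow_Suc_right)
  also have "\<dots> = cls m (f ^^ Suc k) \<otimes>\<^bsub>Out (F m)\<^esub> cls m f" by (rule cls_mult) (rule aut_pow assms)+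
  finally show ?case by (simp only: Suc M.nat_pow_Suc)
qed

lemma order_12: "(cls n del \<otimes>\<^bsub>Out (F n)\<^esub> cls n pie) [^]\<^bsub>Out (F n)\<^esub> (12::nat) = \<one>\<^bsub>Out (F n)\<^esub>"
proof -
  let ?D = "cls n del" and ?P = "cls n pie"
  have c: "?D \<in> carrier (Out (F n))" "?P \<in> carrier (Out (F n))" by (intro cls_in_Out aut_del aut_pie)+
  have "cls n (pie \<circ> del) = cls n (del \<circ> pie)"
    unfolding cls_eq_iff [OF aut_comp [OF aut_pie aut_del] aut_comp [OF aut_del aut_pie]]
    by (rule exI [of _ "- gen 0"]) (use del_pie index_bounds(1) in simp)
  then have comm: "?D \<otimes>\<^bsub>Out (F n)\<^esub> ?P = ?P \<otimes>\<^bsub>Out (F n)\<^esub> ?D" by (simp add: cls_mult aut_del aut_pie)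
  have d4: "?D [^]\<^bsub>Out (F n)\<^esub> (4::nat) = \<one>\<^bsub>Out (F n)\<^esub>"
  proof -
    have "cls n (del \<circ> del \<circ> del \<circ> del) = \<one>\<^bsub>Out (F n)\<^esub>" by (simp only: del_4 cls_one)
    then show ?thesis using c by (simp add: cls_mult aut_del aut_comp numeral_eq_Suc)
  qed
  have p3: "?P [^]\<^bsub>Out (F n)\<^esub> (3::nat) = \<one>\<^bsub>Out (F n)\<^esub>"
  proof -
    have "cls n (pie \<circ> pie \<circ> pie) = \<one>\<^bsub>Out (F n)\<^esub>" by (simp only: pie_3 cls_one)
    then show ?thesis using c by (simp add: cls_mult aut_pie aut_comp numeral_eq_Suc)
  qed
  have "(?D \<otimes>\<^bsub>Out (F n)\<^esub> ?P) [^]\<^bsub>Out (F n)\<^esub> (12::nat) = ?D [^]\<^bsub>Out (F n)\<^esub> (4 * 3::nat) \<otimes>\<^bsub>Out (F n)\<^esub> ?P [^]\<^bsub>Out (F n)\<^esub> (3 * 4::nat)"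
    using G.pow_mult_distrib [OF comm c, of 12] by simp
  also have "\<dots> = \<one>\<^bsub>Out (F n)\<^esub>" unfolding G.nat_pow_pow [OF c(1), symmetric] G.nat_pow_pow [OF c(2), symmetric] d4 p3 by simp
  finally show ?thesis .
qed

lemma r_12: "\<exists>g. pr m g = g \<and> r ^^ 12 = inn g (pr m)"
proof -
  have c: "cls n (del \<circ> pie) \<in> carrier (Out (F n))" by (intro cls_in_Out aut_comp aut_del aut_pie)
  have "cls m (r ^^ 12) = cls m r [^]\<^bsub>Out (F m)\<^esub> (12::nat)" using cls_pow [OF aut_r, of 11] by simp
  also have "cls m r = inv\<^bsub>Out (F m)\<^esub> \<phi> (cls n (del \<circ> pie))" unfolding r_def by (intro lift(2) aut_comp aut_del aut_pie)
  also have "(inv\<^bsub>Out (F m)\<^esub> \<phi> (cls n (del \<circ> pie))) [^]\<^bsub>Out (F m)\<^esub> (12::nat) = inv\<^bsub>Out (F m)\<^esub> \<phi> (cls n (del \<circ> pie) [^]\<^bsub>Out (F n)\<^esub> (12::nat))"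
    using c by (simp only: M.nat_pow_inv h.hom_closed h.hom_nat_pow)
  also have "\<dots> = cls m (pr m)" using order_12 by (simp add: cls_mult aut_del aut_pie cls_one)
  finally have "cls m (pr m) = cls m (r ^^ 12)" by simp
  moreover have "aut m (r ^^ 12)" using aut_pow [OF aut_r, of 11] by simp
  ultimately show ?thesis using cls_eq_iff [OF aut_pr] by blast
qed

lemma ext_pr: "supp v \<Longrightarrow> ext v (pr m x) = ext v x"
proof -
  assume v: "supp v"
  have "ext v \<circ> pr m = ext v"
    by (rule additive_map_eqI)
       (use v additive_map_zero [OF additive_ext, of v] in \<open>auto simp: supp_def intro: additive_map_comp additive_ext additive_pr\<close>)
  then show ?thesis by (simp add: fun_eq_iff)
qed

lemma supp_act: "supp v \<Longrightarrow> supp (act f v)"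
  by (simp add: supp_def act_def)

lemma ext_lift: assumes "supp v" "aut n f" shows "ext v (lift f x) = ext (act f v) x"
proof -
  have "lift f (pr m x) = lift f x" using endo_pr_simps(1) [OF aut_endo [OF lift(1) [OF assms(2)]]] by (simp add: fun_eq_iff)
  then show ?thesis using ext_act [OF assms(2), of "pr m x" v] ext_pr [OF supp_act [OF assms(1)], of f x] by simp
qed

lemma ext_r: "supp v \<Longrightarrow> ext v (r x) = ext (dlv (pev v)) x"
  unfolding r_def by (simp add: ext_lift aut_comp aut_del aut_pie act_comp)

lemma ext_r_pow: "supp v \<Longrightarrow> ext v ((r ^^ k) x) = ext ((dlv ^^ k) ((pev ^^ k) v)) x"
proof (induction k arbitrary: v)
  case (Suc k)
  have c: "(pev ^^ k) (dlv u) = dlv ((pev ^^ k) u)" for k :: nat and u :: "nat \<Rightarrow> 'a" by (induction k) (simp_all add: dlv_pev)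
  have "supp (dlv (pev v))" using Suc.prems by (intro supp_act)
  from Suc.IH [OF this] show ?case
    by (simp only: funpow.simps(2) [of k r] o_apply ext_r [OF Suc.prems] funpow_Suc_right [of k dlv] funpow_Suc_right [of k pev] c)
qed simp

lemma pow_reduce: "(dlv ^^ 81) v = dlv v" "(pev ^^ 81) v = v" "(dlv ^^ 4) v = v" "(pev ^^ 4) v = pev v"
proof -
  have d: "dlv ^^ 4 = id" by (simp add: fun_eq_iff numeral_eq_Suc dlv_4)
  have p: "pev ^^ 3 = id" by (simp add: fun_eq_iff numeral_eq_Suc pev_3)
  have "dlv ^^ (1 + 4 * 20) = (dlv :: (nat \<Rightarrow> 'a) \<Rightarrow> _)" unfolding funpow_add funpow_mult [symmetric] d by simp
  then show "(dlv ^^ 81) v = dlv v" by simp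
  have "pev ^^ (3 * 27) = (id :: (nat \<Rightarrow> 'a) \<Rightarrow> _)" unfolding funpow_mult [symmetric] p by simp
  then show "(pev ^^ 81) v = v" by simp
  show "(dlv ^^ 4) v = v" "(pev ^^ 4) v = pev v" by (simp_all add: numeral_eq_Suc dlv_4 pev_3)
qed

text \<open>The exponents separate the two factors: 4 is 0 modulo 4 and 1 modulo 3, while 81 is 1
  modulo 4 and 0 modulo 3. The exponent 81 has the further property that the fourth power of
  \<open>d\<close> is the 27th power of \<open>r ^^ 12\<close>, hence conjugation by a multiple of
  \<open>g\<close> on which functionals modulo 9 vanish. It is the least with these
  properties.\<close>

definition s :: "fg \<Rightarrow> fg" where "s = r ^^ 4"
definition d :: "fg \<Rightarrow> fg" where "d = r ^^ 81"

lemma ext_s: "supp v \<Longrightarrow> ext v (s x) = ext (pev v) x" and ext_d: "supp v \<Longrightarrow> ext v (d x) = ext (dlv v) x"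
  unfolding s_def d_def by (simp_all only: ext_r_pow pow_reduce)

lemma endo_s: "endo m s" and endo_d: "endo m d"
  unfolding s_def d_def using aut_pow [OF aut_r, of 3] aut_pow [OF aut_r, of 80] by (simp_all add: aut_endo)

lemma s_d: "s (d x) = d (s x)"
proof -
  have "s \<circ> d = d \<circ> s" unfolding s_def d_def funpow_add [symmetric] by simp
  then show ?thesis by (simp add: fun_eq_iff)
qed

text \<open>\<open>r\<close> commutes with its own power, which is conjugation by \<open>g\<close>.
  Hence \<open>r g\<close> and \<open>g\<close> induce the same conjugation, and the centre is
  trivial in rank at least 2.\<close>

lemma r_fixes: assumes "m \<ge> 2" "pr m g = g" "r ^^ 12 = inn g (pr m)" shows "r g = g"
proof -
  have r: "r \<circ> pr m = r" "pr m \<circ> r = r" by (rule endo_pr_simps [OF aut_endo [OF aut_r]])+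
  have "r \<circ> r ^^ 12 = r ^^ 12 \<circ> r" by (simp only: fun_eq_iff o_apply funpow_swap1 simp_thms)
  then have "inn (r g) r = inn g r"
    unfolding assms(3) comp_inn [OF endo_additive [OF aut_endo [OF aut_r]]] inn_comp_right r .
  moreover obtain q where q: "r \<circ> q = pr m" using aut_r by (auto simp: aut_def)
  ultimately have "inn (r g) (pr m) = inn g (pr m)" by (metis inn_comp_right)
  then have i: "r g + gen k - r g = g + gen k - g" if "k < m" for k
    using that by (metis inn_def pr_gen)
  have c: "(- g + r g) + gen k = gen k + (- g + r g)" if "k < m" for k
  proof -
    have "- g + (r g + gen k - r g) + r g = - g + (g + gen k - g) + r g" by (simp only: i [OF that])
    then show ?thesis by (simp add: group_norm del: add_uminus_conv_diff)
  qed
  have "- g + r g = 0" by (rule central_trivial) (rule c; use assms(1) in simp)+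
  then show ?thesis by (metis add.inverse_inverse minus_unique)
qed

lemma dl_real: "tv.dl v = dlv v" and pe_real: "tv.pe v = pev v"
  by (simp_all only: act_del act_dw act_pie act_pw)

section \<open>Integral multiples of the projections\<close>

lemma act_scale: "act f (a *\<^sub>R v) = a *\<^sub>R act f (v :: nat \<Rightarrow> real)"
  by (rule linear_scale [OF linear_act])

lemma p_scale: "tv.p i (a *\<^sub>R v) = a *\<^sub>R tv.p i v"
  by (simp add: tv.p_def ee_lin scaleR_right_diff_distrib)

text \<open>Over the reals \<open>Gop i\<close> and \<open>Kop\<close> are 4 times the projections to \<open>W i\<close> and \<open>W0\<close>; the factor clears the denominators.\<close>

definition Gop :: "nat \<Rightarrow> opr" where
  "Gop i = Minus (Plus One One) (Comp (Minus (Plus (Plus (Ac (eps n 0)) (Ac (eps n 1))) (Ac (eps n 2)))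
    (Comp (Ac (eps n 0)) (Comp (Ac (eps n 1)) (Ac (eps n 2))))) (Ac (eps n i)))"
definition Kop :: opr where
  "Kop = Minus (Plus (Plus One One) (Plus One One)) (foldr (\<lambda>i. Plus (Gop i)) [0..<n] (Minus One One))"
definition tau :: "nat \<Rightarrow> nat \<Rightarrow> fg \<Rightarrow> fg" where "tau i j = eval (thw i j) \<circ> pr n"

definition dbl :: "opr \<Rightarrow> opr" where "dbl a = Plus a a"

lemma G_real: "ev (Gop i) v = 4 *\<^sub>R tv.p i v"
proof -
  have om: "e 0 u + e 1 u + e 2 u - e 0 (e 1 (e 2 u)) = 2 *\<^sub>R om u" for u by (simp add: om_def om3_def)
  have "ev (Gop i) v = v + v - 2 *\<^sub>R ee i v" unfolding Gop_def ee_def om [symmetric] by (simp add: e_def)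
  then show ?thesis by (simp add: tv.p_def scaleR_right_diff_distrib fun_eq_iff fun_simps)
qed

lemma K_real: "ev Kop v = 4 *\<^sub>R tv.ka v"
proof -
  have "ev (foldr (\<lambda>i. Plus (Gop i)) l (Minus One One)) v = (\<Sum>i\<leftarrow>l. 4 *\<^sub>R tv.p i v)" for l
    by (induction l) (simp_all add: G_real)
  from this [of "[0..<n]"] show ?thesis
    by (simp add: Kop_def tv.ka_def interv_sum_list_conv_sum_set_nat scaleR_right_diff_distrib scaleR_sum_right [symmetric] atLeast0LessThan)
       (simp add: fun_eq_iff fun_simps)
qed

lemma tau_real: "i < n \<Longrightarrow> j < n \<Longrightarrow> i \<noteq> j \<Longrightarrow> act (tau i j) v = tv.th i j v"
  unfolding tau_def using eval_pr [of "thw i j" v] by (simp add: aut_thw act_thw)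

lemma K_sum: "ev Kop v = v + v + (v + v) - (\<Sum>i<n. ev (Gop i) v)"
proof -
  have "ev (foldr (\<lambda>i. Plus (Gop i)) l (Minus One One)) v = (\<Sum>i\<leftarrow>l. ev (Gop i) v)" for l
    by (induction l) simp_all
  from this [of "[0..<n]"] show ?thesis
    by (simp add: Kop_def interv_sum_list_conv_sum_set_nat atLeast0LessThan)
qed

context
  fixes v :: "nat \<Rightarrow> 'r::comm_ring_1"
  assumes v: "supp v"
begin

lemma G_G: "i < n \<Longrightarrow> ev (Gop i) (ev (Gop i) v) = ev (dbl (dbl (Gop i))) v"
  using transfer [of "Comp (Gop i) (Gop i)" "dbl (dbl (Gop i))", OF _ v]
  by (simp add: dbl_def G_real p_scale tv.p_p scaleR_left_distrib [symmetric])

lemma G_G_other: "i < n \<Longrightarrow> j < n \<Longrightarrow> i \<noteq> j \<Longrightarrow> ev (Gop i) (ev (Gop j) v) = 0"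
  using transfer [of "Comp (Gop i) (Gop j)" "Minus One One", OF _ v]
  by (simp add: G_real p_scale tv.p_p)

lemma K_dlv: "ev Kop (dlv v) = ev Kop v" "dlv (ev Kop v) = ev Kop v"
  using transfer [of "Comp Kop (Ac del)" Kop, OF _ v] transfer [of "Comp (Ac del) Kop" Kop, OF _ v]
  by (simp_all add: K_real act_scale tv.ka_dl_pe [unfolded dl_real pe_real])

lemma K_pev: "ev Kop (pev v) = ev Kop v" "pev (ev Kop v) = ev Kop v"
  using transfer [of "Comp Kop (Ac pie)" Kop, OF _ v] transfer [of "Comp (Ac pie) Kop" Kop, OF _ v]
  by (simp_all add: K_real act_scale tv.ka_dl_pe [unfolded dl_real pe_real])

lemma odd_identity: "v + pev v + pev (pev v) - dlv (v + pev v + pev (pev v)) + dlv (dlv (v + pev v + pev (pev v)))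
    - dlv (dlv (dlv (v + pev v + pev (pev v)))) = 0"
proof -
  let ?y = "Plus (Plus One (Ac pie)) (Comp (Ac pie) (Ac pie))"
  show ?thesis
    using transfer [of "Minus (Plus (Minus ?y (Comp (Ac del) ?y)) (Comp (Ac del) (Comp (Ac del) ?y))) (Comp (Ac del) (Comp (Ac del) (Comp (Ac del) ?y)))"
       "Minus One One", OF _ v] tv.odd_sum [unfolded dl_real pe_real Let_def]
    by simp
qed

lemma even_identity:
  assumes u: "u = v + dlv v + dlv (dlv v) + dlv (dlv (dlv v))"
  shows "(\<Sum>i<n. ev (Gop i) u) = (if even n then 0 else ev (Gop N) u + pev (ev (Gop N) (pev (pev u))) + pev (pev (ev (Gop N) (pev u))))"
proof -
  let ?u = "Plus (Plus (Plus One (Ac del)) (Comp (Ac del) (Ac del))) (Comp (Ac del) (Comp (Ac del) (Ac del)))"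
  let ?R = "if even n then Minus One One else Plus (Plus (Gop N) (Comp (Ac pie) (Comp (Gop N) (Comp (Ac pie) (Ac pie)))))
      (Comp (Ac pie) (Comp (Ac pie) (Comp (Gop N) (Ac pie))))"
  let ?L = "Minus (Plus (Plus One One) (Plus One One)) Kop"
  have "ev (Comp ?L ?u) v = ev (Comp ?R ?u) v"
  proof (rule transfer [OF _ v])
    fix v :: "nat \<Rightarrow> real"
    let ?w = "v + dlv v + dlv (dlv v) + dlv (dlv (dlv v))"
    have w: "ev ?u v = ?w" by simp
    have L: "ev ?L ?w = 4 *\<^sub>R (\<Sum>i<n. tv.p i ?w)"
      by (simp only: ev.simps K_real tv.ka_def) (simp add: fun_eq_iff fun_simps)
    have R: "ev ?R ?w = 4 *\<^sub>R (if even n then 0 else tv.p N ?w + pev (tv.p N (pev (pev ?w))) + pev (pev (tv.p N (pev ?w))))"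
      by (cases "even n") (simp_all only: if_True if_False ev.simps G_real p_scale act_scale scaleR_right_distrib simp_thms diff_self scaleR_zero_right)
    have "(\<Sum>i<n. tv.p i ?w) = (if even n then 0 else tv.p N ?w + pev (tv.p N (pev (pev ?w))) + pev (pev (tv.p N (pev ?w))))"
      using tv.even_sum [unfolded dl_real pe_real Let_def, OF pev_3, of v] by (simp only: right_minus_eq)
    then show "ev (Comp ?L ?u) v = ev (Comp ?R ?u) v" by (simp only: ev.simps(5) w L R)
  qed
  then have "ev ?L u = ev ?R u" by (simp only: ev.simps u)
  moreover have "ev ?L u = (\<Sum>i<n. ev (Gop i) u)" by (simp only: ev.simps K_sum) simp
  ultimately show ?thesis by (cases "even n") simp_all
qed

lemma G0_dlv: "dlv (ev (Gop 0) v) = - ev (Gop 0) v"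
  using transfer [of "Comp (Ac del) (Gop 0)" "Minus (Minus One One) (Gop 0)", OF _ v]
  by (simp add: G_real act_scale tv.dl_p0 [unfolded dl_real])

text \<open>The three projections on the left carry a factor 4 each and the one on the right a
  single one, which leaves 16 and thus four doublings.\<close>

lemma G_cross: "ev (Gop 0) (pev (ev (Gop 1) (pev (ev (Gop 0) v)))) = - ev (dbl (dbl (dbl (dbl (Gop 0))))) v"
proof -
  have "ev (Comp (Gop 0) (Comp (Ac pie) (Comp (Gop 1) (Comp (Ac pie) (Gop 0))))) v
      = ev (Minus (Minus One One) (dbl (dbl (dbl (dbl (Gop 0)))))) v"
  proof (rule transfer [OF _ v])
    fix v :: "nat \<Rightarrow> real"
    have "ev (Comp (Gop 0) (Comp (Ac pie) (Comp (Gop 1) (Comp (Ac pie) (Gop 0))))) v = 64 *\<^sub>R tv.p 0 (pev (tv.p 1 (pev (tv.p 0 v))))"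
      by (simp only: ev.simps G_real p_scale act_scale scaleR_scaleR) simp
    also have "\<dots> = - (64 *\<^sub>R tv.p 0 v)" unfolding tv.pe_cross [unfolded pe_real] by simp
    also have "\<dots> = ev (Minus (Minus One One) (dbl (dbl (dbl (dbl (Gop 0)))))) v"
      by (simp add: dbl_def G_real fun_eq_iff fun_simps)
    finally show "ev (Comp (Gop 0) (Comp (Ac pie) (Comp (Gop 1) (Comp (Ac pie) (Gop 0))))) v
      = ev (Minus (Minus One One) (dbl (dbl (dbl (dbl (Gop 0)))))) v" .
  qed
  then show ?thesis by simp
qed

lemma G_tau:
  assumes "i < n" "j < n" "i \<noteq> j"
  shows "ev (Gop j) (act (tau i j) v) = act (tau i j) (ev (Gop i) v)"
    "act (tau i j) (act (tau i j) (act (tau i j) (act (tau i j) v))) = v"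
proof -
  note real = tv.p_th [of i j, folded tau_real [OF assms]]
  have ij: "tv.ix [i, j]" using assms by simp
  show "ev (Gop j) (act (tau i j) v) = act (tau i j) (ev (Gop i) v)"
    using transfer [of "Comp (Gop j) (Ac (tau i j))" "Comp (Ac (tau i j)) (Gop i)", OF _ v] real(1) [OF ij]
    by (simp add: G_real act_scale)
  show "act (tau i j) (act (tau i j) (act (tau i j) (act (tau i j) v))) = v"
    using transfer [of "Comp (Ac (tau i j)) (Comp (Ac (tau i j)) (Comp (Ac (tau i j)) (Ac (tau i j))))" One, OF _ v] real(2) [OF ij]
    by simp
qed

end

end

section \<open>Coefficients in the integers modulo 9\<close>

type_synonym z9 = 9

lemma z9_cases: "(x::z9) \<in> {0, 1, 2, 3, 4, 5, 6, 7, 8}"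
proof (cases x)
  case (of_int z)
  then have "z \<in> {0, 1, 2, 3, 4, 5, 6, 7, 8}" by auto
  then show ?thesis using of_int(1) by auto
qed

lemma z9_three: "3 * (x::z9) = 0 \<Longrightarrow> \<exists>y. x = 3 * y"
proof -
  assume x: "3 * x = 0"
  have "x = 3 * 0 \<or> x = 3 * 1 \<or> x = 3 * 2" using z9_cases [of x] x by auto
  then show ?thesis by blast
qed

text \<open>Modulo 9 the elements outside the multiples of 3 are units, and their squares 1, 4, 7
  are all 1 modulo 3.\<close>

lemma z9_unit: "3 * (x::z9) \<noteq> 0 \<Longrightarrow> 3 * x ^ 2 = 3" "3 * (x::z9) \<noteq> 0 \<Longrightarrow> \<exists>y. x * y = 1"
proof -
  assume x: "3 * x \<noteq> 0"
  then have x: "x = 1 \<or> x = 2 \<or> x = 4 \<or> x = 5 \<or> x = 7 \<or> x = 8" using z9_cases [of x] by auto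
  then show "3 * x ^ 2 = 3" by (elim disjE) simp_all
  have "x * 1 = 1 \<or> x * 5 = 1 \<or> x * 7 = 1 \<or> x * 2 = 1 \<or> x * 4 = 1 \<or> x * 8 = 1" using x by (elim disjE) simp_all
  then show "\<exists>y. x * y = 1" by blast
qed

lemma z9_nine: "(9::z9) = 0" and z9_3: "(3::z9) \<noteq> 0"
  by simp_all

lemma z9_red: "(28::z9) = 1" "(48::z9) = 3" "(196::z9) = 7" "(5488::z9) = 7" "(27::z9) = 0"
  by simp_all

lemma z9_range: "card (range (\<lambda>x::z9. 3 * x)) = 3"
proof -
  have "range (\<lambda>x::z9. 3 * x) = {0, 3, 6}"
  proof
    show "range (\<lambda>x::z9. 3 * x) \<subseteq> {0, 3, 6}"
    proof (rule image_subsetI)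
      fix x :: z9
      show "3 * x \<in> {0, 3, 6}" using z9_cases [of x] by auto
    qed
    have "0 = 3 * (0::z9)" "3 = 3 * (1::z9)" "6 = 3 * (2::z9)" by simp_all
    then show "{0, 3, 6} \<subseteq> range (\<lambda>x::z9. 3 * x)" by blast
  qed
  then show ?thesis by simp
qed

lemma z9_of_int: "3 * (of_int z :: z9) = 0 \<Longrightarrow> 3 dvd z"
proof -
  assume a: "3 * (of_int z :: z9) = 0"
  have "of_int z = (of_int (9 * (z div 9) + z mod 9) :: z9)" by simp
  also have "\<dots> = of_int (z mod 9)" by (simp only: of_int_add of_int_mult of_int_numeral z9_nine)  simp
  finally have b: "3 * (of_int (z mod 9) :: z9) = 0" using a by simp
  have "z mod 9 \<in> {0, 1, 2, 3, 4, 5, 6, 7, 8}" using pos_mod_bound [of 9 z] pos_mod_sign [of 9 z] by (simp; arith)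
  then have "3 dvd z mod 9" using b by auto
  then show ?thesis by presburger
qed

context out_hom begin

definition sc :: "z9 \<Rightarrow> (nat \<Rightarrow> z9) \<Rightarrow> nat \<Rightarrow> z9" where "sc c v = (\<lambda>x. c * x) \<circ> v"

lemma sc_simps: "sc c v k = c * v k" "sc a (sc b v) = sc (a * b) v" "sc c (u + v) = sc c u + sc c v" "sc c (u - v) = sc c u - sc c v"
    "sc c (- v) = - sc c v" "sc c 0 = 0" "sc 1 v = v" "sc 0 v = 0" "sc (a + b) v = sc a v + sc b v"
  by (simp_all add: sc_def fun_eq_iff fun_simps algebra_simps)

lemma ev_sc: "ev a (sc c v) = sc c (ev a v)"
  unfolding sc_def by (rule ev_map) (simp add: additive_map_def algebra_simps)

lemma act_sc: "act f (sc c v) = sc c (act f v)"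
  using ev_sc [of "Ac f" c v] by simp

lemma supp_sc: "supp v \<Longrightarrow> supp (sc c v)"
  by (simp add: supp_def sc_simps)

lemma supp_lin: "supp u \<Longrightarrow> supp v \<Longrightarrow> supp (u + v)" "supp u \<Longrightarrow> supp v \<Longrightarrow> supp (u - v)" "supp v \<Longrightarrow> supp (- v)" "supp (0 :: nat \<Rightarrow> z9)"
  for u v :: "nat \<Rightarrow> z9"
  by (simp_all add: supp_def fun_simps)

text \<open>For an odd vector the terms of \<open>odd_identity\<close> coincide, so it reads 4y = 0,
  and 7 is the inverse of 4.\<close>

lemma odd_vec:
  fixes v :: "nat \<Rightarrow> z9"
  assumes v: "supp v" and odd: "dlv v = - v"
  shows "v + pev v + pev (pev v) = 0"
proof -
  define y where "y = v + pev v + pev (pev v)"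
  have y: "dlv y = - y" using odd by (simp add: y_def act_lin dlv_pev)
  have "y - dlv y + dlv (dlv y) - dlv (dlv (dlv y)) = 0" unfolding y_def by (rule odd_identity [OF v])
  then have "y + y + y + y = 0" by (simp only: y act_lin(3) minus_minus diff_minus_eq_add)
  then have "4 * y k = 0" for k unfolding fun_eq_iff by (simp add: fun_simps)
  then have "7 * (4 * y k) = 0" for k by simp
  moreover have "7 * (4 * y k) = y k" for k by (simp only: mult.assoc [symmetric]) (simp add: z9_red)
  ultimately have "y = 0" by (intro HOL.ext) (simp add: fun_simps)
  then show ?thesis by (simp only: y_def)
qed

text \<open>The sum over the powers of \<open>dlv\<close> at an even vector is 4 times the vector,
  whence \<open>u\<close>. As \<open>ev Kop\<close> is invariant under \<open>pev\<close>, the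
  hypothesis \<open>cyc\<close> makes 3 annihilate the part of \<open>u\<close> in
  \<open>W0\<close>. The rest is given by \<open>even_identity\<close>, for odd \<open>n\<close> as
  a sum of translates of a component, which is a coboundary.\<close>

lemma even_vec:
  fixes v :: "nat \<Rightarrow> z9"
  assumes v: "supp v" and even: "dlv v = v" and cyc: "v + pev v + pev (pev v) = 0"
  shows "\<exists>w. supp w \<and> sc 3 v = sc 3 (pev w - w)"
proof -
  define u where "u = v + v + v + v"
  have u: "u = sc 4 v" by (simp add: u_def sc_simps fun_eq_iff fun_simps)
  have su: "supp u" unfolding u by (rule supp_sc [OF v])
  have cu: "u + pev u + pev (pev u) = 0" unfolding u act_sc sc_simps(3) [symmetric] cyc by (simp add: sc_simps)
  have "ev Kop u + ev Kop (pev u) + ev Kop (pev (pev u)) = 0" unfolding ev_lin(1) [symmetric] cu by (simp add: ev_lin)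
  then have "ev Kop u + ev Kop u + ev Kop u = 0" by (simp only: K_pev su supp_act)
  then have K: "sc 3 (ev Kop u) = 0" by (simp add: fun_eq_iff fun_simps sc_simps)
  let ?S = "if even n then 0 else ev (Gop N) u + pev (ev (Gop N) (pev (pev u))) + pev (pev (ev (Gop N) (pev u)))"
  have "ev Kop u = sc 4 u - ?S"
    unfolding K_sum even_identity [OF v, of u, unfolded even, OF u_def] by (simp add: sc_simps fun_eq_iff fun_simps)
  then have S: "sc 3 ?S = sc 12 u" using K by (simp add: sc_simps)
  have v48: "sc 12 u = sc 3 v" unfolding u sc_simps(2) by (simp add: z9_red)
  show ?thesis
  proof (cases "even n")
    case True
    then have "sc 3 v = sc 3 (pev 0 - 0)" using S v48 by (simp add: act_lin sc_simps)
    then show ?thesis using supp_lin(4) by blast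
  next
    case False
    define a b c where "a = ev (Gop N) u" and "b = ev (Gop N) (pev u)" and "c = ev (Gop N) (pev (pev u))"
    have "a + b + c = 0" unfolding a_def b_def c_def ev_lin(1) [symmetric] cu by (rule ev_lin)
    then have a: "a = - b - c" by (simp add: eq_neg_iff_add_eq_0 algebra_simps)
    have "sc 3 v = sc 3 (a + pev c + pev (pev b))" using S v48 False by (simp add: a_def b_def c_def)
    \<comment> \<open>With \<open>a = - b - c\<close> the terms regroup into the coboundary of
      \<open>c + pev b + b\<close>.\<close>
    also have "a + pev c + pev (pev b) = pev (c + pev b + b) - (c + pev b + b)" unfolding a by (simp add: act_lin algebra_simps)
    finally have "sc 3 v = sc 3 (pev (c + pev b + b) - (c + pev b + b))" .
    moreover have "supp (c + pev b + b)" unfolding b_def c_def by (intro supp_lin supp_act supp_ev su)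
    ultimately show ?thesis by blast
  qed
qed

lemma fn_vec: assumes "fn m (h :: fg \<Rightarrow> z9)" shows "\<exists>v. supp v \<and> h = ext v"
proof -
  define v where "v i = (if i < m then h (gen i) else 0)" for i
  have "h = ext v"
  proof (rule additive_map_eqI)
    show "additive_map h" using assms by (simp add: fn_def)
    fix i
    have "h (pr m (gen i)) = h (gen i)" using assms by (simp add: fn_def del: pr_gen)
    then show "h (gen i) = ext v (gen i)" using additive_map_zero [of h] assms by (auto simp: v_def fn_def split: if_splits)
  qed (rule additive_ext)
  moreover have "supp v" by (simp add: supp_def v_def)
  ultimately show ?thesis by blast
qed

lemma vec_fn: "supp v \<Longrightarrow> fn m (ext v)"
  by (simp add: fn_def additive_ext ext_pr)

lemma ext_inj: "(\<And>x. ext u x = ext v x) \<Longrightarrow> u = v"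
proof
  fix i assume "\<And>x. ext u x = ext v x"
  from this [of "gen i"] show "u i = v i" by simp
qed

definition mul :: "nat \<Rightarrow> fg \<Rightarrow> fg" where "mul k g = ((+) g ^^ k) 0"

lemma mul_simps: "mul 0 g = 0" "mul (Suc k) g = g + mul k g"
  by (simp_all add: mul_def)

lemma pow_inn: assumes "pr m g = g" shows "((inn g (pr m)) ^^ Suc k) x = mul (Suc k) g + pr m x - mul (Suc k) g"
proof (induction k)
  case 0
  then show ?case by (simp add: inn_def mul_simps)
next
  case (Suc k)
  have p: "pr m (mul k g) = mul k g" for k using assms by (induction k) (simp_all add: mul_simps additive_map_simps [OF additive_pr])
  have "((inn g (pr m)) ^^ Suc (Suc k)) x = inn g (pr m) (mul (Suc k) g + pr m x - mul (Suc k) g)" using Suc by simp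
  also have "\<dots> = g + (mul (Suc k) g + pr m x - mul (Suc k) g) - g" by (simp add: inn_def additive_map_simps [OF additive_pr] p)
  finally show ?case by (simp add: mul_simps(2) [of "Suc k"] group_norm del: add_uminus_conv_diff)
qed

lemma hom_mul: "fn m h \<Longrightarrow> h (mul k g) = of_nat k * (h g :: z9)"
  by (induction k) (simp_all add: mul_simps fn_add additive_map_zero [of h, OF conjunct1 [OF iffD1 [OF fn_def]]] algebra_simps)

lemma commuting_lift_exists:
  assumes "m \<ge> 2"
  shows "\<exists>Z Z'. commuting_lift TYPE(z9) m s d Z Z'"
proof -
  obtain g where g: "pr m g = g" "r ^^ 12 = inn g (pr m)" using r_12 by blast
  have rg: "r g = g" by (rule r_fixes [OF assms g])
  \<comment> \<open>The third power of \<open>s\<close> is \<open>r ^^ 12\<close> itself and the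
    fourth power of \<open>d\<close> is its 27th power, so both conjugators are multiples of
    \<open>g\<close>.\<close>
  have "commuting_lift TYPE(z9) m s d g (mul 27 g)"
  proof
    show "(9::z9) = 0" by (rule z9_nine)
    show "\<exists>y. x = 3 * y" if "3 * x = 0" for x :: z9 by (rule z9_three [OF that])
    show "endo m s" "endo m d" by (rule endo_s endo_d)+
    show "s (d x) = d (s x)" for x by (rule s_d)
    have s3: "s \<circ> s \<circ> s = r ^^ 12" unfolding s_def funpow_add [symmetric] by simp
    show "s (s (s x)) = g + pr m x - g" for x using fun_cong [OF s3, of x] by (simp add: g(2) inn_def)
    have d4: "d \<circ> d \<circ> d \<circ> d = (r ^^ 12) ^^ Suc 26" unfolding d_def funpow_add [symmetric] funpow_mult by simp
    show "d (d (d (d x))) = mul 27 g + pr m x - mul 27 g" for x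
      using fun_cong [OF d4, of x] pow_inn [OF g(1), of 26 x] unfolding g(2) by simp
    have "(r ^^ k) g = g" for k by (induction k) (simp_all add: rg)
    then show "d g = g" by (simp add: d_def)
    show "h (mul 27 g) = 0" if "fn m h" for h :: "fg \<Rightarrow> z9" using hom_mul [OF that, of 27 g] by (simp add: z9_red)
    show "h x + h (s x) + h (s (s x)) = 0" if h: "fn m h" "\<And>x. h (d x) = - h x" for h :: "fg \<Rightarrow> z9" and x
    proof -
      obtain v where v: "supp v" "h = ext v" using fn_vec [OF h(1)] by blast
      have "dlv v = - v" by (rule ext_inj) (use h(2) v in \<open>simp add: ext_d ext_lin\<close>)
      then have "ext (v + pev v + pev (pev v)) x = 0" by (simp add: odd_vec [OF v(1)] ext_lin)
      then show ?thesis using v by (simp add: ext_lin ext_s supp_act)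
    qed
    show "\<exists>\<nu>. fn m \<nu> \<and> (\<forall>x. 3 * h x = 3 * (\<nu> (s x) - \<nu> x))"
      if h: "fn m h" "\<And>x. h (d x) = h x" "\<And>x. h x + h (s x) + h (s (s x)) = 0" for h :: "fg \<Rightarrow> z9"
    proof -
      obtain v where v: "supp v" "h = ext v" using fn_vec [OF h(1)] by blast
      have e: "dlv v = v" by (rule ext_inj) (use h(2) v in \<open>simp add: ext_d\<close>)
      have "v + pev v + pev (pev v) = 0"
        by (rule ext_inj) (use h(3) v in \<open>simp add: ext_lin ext_s supp_act\<close>)
      then obtain w where w: "supp w" "sc 3 v = sc 3 (pev w - w)" using even_vec [OF v(1) e] by blast
      have es: "ext (sc 3 u) x = 3 * ext u x" for u x
        unfolding sc_def by (rule ext_map) (simp add: additive_map_def algebra_simps)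
      have "3 * h x = 3 * (ext w (s x) - ext w x)" for x
        using arg_cong [OF w(2), of "\<lambda>u. ext u x"] v(2) w(1) by (simp add: es ext_lin ext_s)
      then show ?thesis using vec_fn [OF w(1)] by blast
    qed
  qed
  then show ?thesis by blast
qed

section \<open>Projections modulo 9 and the comparison of ranks\<close>

definition Fv :: "nat \<Rightarrow> (nat \<Rightarrow> z9) \<Rightarrow> nat \<Rightarrow> z9" where "Fv i v = sc 7 (ev (Gop i) v)"

lemma Fv_lin: "Fv i (u + v) = Fv i u + Fv i v" "Fv i (u - v) = Fv i u - Fv i v" "Fv i 0 = 0" "Fv i (sc c v) = sc c (Fv i v)"
  by (simp_all add: Fv_def ev_lin sc_simps ev_sc mult.commute)

lemma supp_Fv: "supp v \<Longrightarrow> supp (Fv i v)"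
  by (simp add: Fv_def supp_sc supp_ev)

lemma Fv_Fv: "supp v \<Longrightarrow> i < n \<Longrightarrow> Fv i (Fv i v) = Fv i v" "supp v \<Longrightarrow> i < n \<Longrightarrow> j < n \<Longrightarrow> i \<noteq> j \<Longrightarrow> Fv i (Fv j v) = 0"
proof -
  assume v: "supp v" and i: "i < n"
  have d: "ev (dbl (dbl a)) v = sc 4 (ev a v)" for a by (simp add: dbl_def sc_simps fun_eq_iff fun_simps)
  show "Fv i (Fv i v) = Fv i v" by (simp add: Fv_def ev_sc G_G [OF v i] d sc_simps z9_red)
  show "Fv i (Fv j v) = 0" if "j < n" "i \<noteq> j" by (simp add: Fv_def ev_sc G_G_other [OF v i that] sc_simps)
qed

lemma Fv_sum: "v = sc 7 (ev Kop v) + (\<Sum>i<n. Fv i v)"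
proof -
  have "(\<Sum>i<n. Fv i v) = sc 7 (\<Sum>i<n. ev (Gop i) v)" unfolding Fv_def
    by (induction "{..<n}" rule: infinite_finite_induct) (simp_all add: sc_simps fun_eq_iff sum_fun_apply fun_simps sum_distrib_left)
  moreover have "sc 7 (ev Kop v) = v - sc 7 (\<Sum>i<n. ev (Gop i) v)"
  proof -
    have "ev Kop v = sc 4 v - (\<Sum>i<n. ev (Gop i) v)" unfolding K_sum by (simp add: sc_simps fun_eq_iff fun_simps)
    then show ?thesis by (simp add: sc_simps z9_red)
  qed
  ultimately show ?thesis by simp
qed

definition inF :: "nat \<Rightarrow> (nat \<Rightarrow> z9) \<Rightarrow> bool" where "inF i v \<longleftrightarrow> supp v \<and> Fv i v = v"

lemma inF_closed: "inF i u \<Longrightarrow> inF i v \<Longrightarrow> inF i (u + v)" "inF i u \<Longrightarrow> inF i v \<Longrightarrow> inF i (u - v)" "inF i v \<Longrightarrow> inF i (sc c v)"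
  by (simp_all add: inF_def Fv_lin supp_lin supp_sc)

lemma inF_0_odd: assumes "inF 0 v" shows "dlv v = - v"
proof -
  have v: "supp v" "Fv 0 v = v" using assms by (auto simp: inF_def)
  have "dlv (Fv 0 v) = - Fv 0 v" unfolding Fv_def act_sc G0_dlv [OF v(1)] sc_simps ..
  then show ?thesis by (simp only: v(2))
qed

text \<open>If \<open>pev\<close> fixed \<open>v\<close> modulo 3, the component of
  \<open>pev v\<close> in the part of index 1 would vanish modulo 3, but \<open>G_cross\<close>
  recovers \<open>- v\<close> from this component.\<close>

lemma inF_0_moved: assumes "inF 0 v" "sc 3 v \<noteq> 0" shows "sc 3 (pev v - v) \<noteq> 0"
proof
  have v: "supp v" "Fv 0 v = v" using assms by (auto simp: inF_def)
  assume "sc 3 (pev v - v) = 0"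
  then have eq: "sc 3 (pev v) = sc 3 v" by (simp add: sc_simps)
  have d: "ev (dbl (dbl a)) u = sc 4 (ev a u)" for a u by (simp add: dbl_def sc_simps fun_eq_iff fun_simps)
  have "Fv 0 (pev (Fv 1 (pev (Fv 0 v)))) = - Fv 0 v"
    by (simp add: Fv_def ev_sc act_sc G_cross [OF v(1), unfolded One_nat_def] d sc_simps z9_red)
  then have cross: "Fv 0 (pev (Fv 1 (pev v))) = - v" by (simp only: v(2))
  have "Fv 1 (Fv 0 v) = 0" by (rule Fv_Fv(2) [OF v(1)]) (use index_bounds in auto)
  then have "sc 3 (Fv 1 (pev v)) = 0" unfolding Fv_lin(4) [symmetric] eq by (simp add: Fv_lin v(2) sc_simps)
  then have "sc 3 (- v) = 0" unfolding cross [symmetric] by (simp add: Fv_lin(4) [symmetric] act_sc [symmetric] act_lin Fv_lin)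
  then show False using assms(2) by (simp add: sc_simps)
qed

lemma inF_0_unit: assumes "inF 0 v" "sc 3 v \<noteq> 0" shows "\<exists>x. 3 * (ext v (s x) - ext v x) ^ 2 = 3"
proof -
  have v: "supp v" using assms by (simp add: inF_def)
  obtain k where "sc 3 (pev v - v) k \<noteq> 0" using inF_0_moved [OF assms] by (auto simp: fun_eq_iff fun_simps)
  then have "3 * (pev v k - v k) \<noteq> 0" by (simp add: sc_simps fun_simps)
  then have "3 * (ext v (s (gen k)) - ext v (gen k)) \<noteq> 0" by (simp add: ext_s [OF v])
  then show ?thesis using z9_unit(1) by blast
qed

text \<open>If \<open>w\<close> differs from \<open>v\<close> and \<open>- v\<close> modulo 3, then
  \<open>v\<close>, \<open>w\<close>, \<open>v + w\<close> and \<open>v - w\<close> are all nonzero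
  modulo 3. By \<open>inF_0_unit\<close> they provide the four units demanded by
  \<open>odd_rank_le_1\<close>.\<close>

lemma dimension_le_1:
  assumes m: "m \<ge> 2" and v: "inF 0 v" "sc 3 v \<noteq> 0" and w: "inF 0 w" "sc 3 w \<noteq> 0"
  shows "sc 3 w = sc 3 v \<or> sc 3 w = - sc 3 v"
proof (rule ccontr)
  assume neq: "\<not> ?thesis"
  obtain Z Z' where "commuting_lift TYPE(z9) m s d Z Z'" using commuting_lift_exists [OF m] by blast
  then interpret cl: commuting_lift m s d Z Z' "TYPE(z9)" .
  have odd: "cl.is_odd (ext u)" if "inF 0 u" for u
    using that inF_0_odd [OF that] by (simp add: cl.is_odd_def vec_fn inF_def ext_d ext_lin)
  have p: "inF 0 (v + w)" "inF 0 (v - w)" by (intro inF_closed v w)+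
  have "sc 3 (v + w) \<noteq> 0" "sc 3 (v - w) \<noteq> 0"
    using neq by (auto simp: sc_simps eq_neg_iff_add_eq_0 add.commute)
  note u = inF_0_unit [OF v] inF_0_unit [OF w] inF_0_unit [OF p(1) this(1)] inF_0_unit [OF p(2) this(2)]
  have "(3::z9) = 0"
    by (rule cl.odd_rank_le_1 [OF odd [OF v(1)] odd [OF w(1)]]) (use u in \<open>simp_all only: cl.dif_def ext_lin\<close>)
  then show False using z9_3 by simp
qed

text \<open>The transpose of an operator, realized by words: it turns the coordinate of an image
  into evaluation of the original functional. This supplies the word \<open>t\<close> for
  \<open>no_fixed_part\<close>.\<close>

lemma dual_word: "pr m x = x \<Longrightarrow> \<exists>t. pr m t = t \<and> (\<forall>v :: nat \<Rightarrow> z9. supp v \<longrightarrow> ext v t = ext (ev a v) x)"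
proof (induction a arbitrary: x)
  case (Ac f)
  define t where "t = ext (\<lambda>i. if i < m then lift f (gen i) else 0)"
  have "ext v (pr m (t x)) = ext (act f v) x" if v: "supp v" for v :: "nat \<Rightarrow> z9"
  proof -
    have "ext v \<circ> t = ext (act f v)"
    proof (rule additive_map_eqI)
      fix i show "(ext v \<circ> t) (gen i) = ext (act f v) (gen i)"
        using v additive_map_zero [OF additive_ext, of v] by (simp add: t_def act_def supp_def)
    qed (unfold t_def, intro additive_map_comp additive_ext, rule additive_ext)
    then show ?thesis using ext_pr [OF v] by (simp add: fun_eq_iff)
  qed
  then show ?case by (intro exI [of _ "pr m (t x)"]) simp
next
  case One
  then show ?case by (intro exI [of _ x]) simp
next
  case (Plus a b)
  obtain t where t: "pr m t = t" "\<forall>v :: nat \<Rightarrow> z9. supp v \<longrightarrow> ext v t = ext (ev a v) x" using Plus.IH(1) [OF Plus.prems] by blast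
  obtain u where u: "pr m u = u" "\<forall>v :: nat \<Rightarrow> z9. supp v \<longrightarrow> ext v u = ext (ev b v) x" using Plus.IH(2) [OF Plus.prems] by blast
  show ?case using t u by (intro exI [of _ "t + u"]) (simp add: ext_lin additive_map_simps [OF additive_pr] additive_map_simps [OF additive_ext])
next
  case (Minus a b)
  obtain t where t: "pr m t = t" "\<forall>v :: nat \<Rightarrow> z9. supp v \<longrightarrow> ext v t = ext (ev a v) x" using Minus.IH(1) [OF Minus.prems] by blast
  obtain u where u: "pr m u = u" "\<forall>v :: nat \<Rightarrow> z9. supp v \<longrightarrow> ext v u = ext (ev b v) x" using Minus.IH(2) [OF Minus.prems] by blast
  have "ext (ev (Minus a b) v) x = ext (ev a v) x - ext (ev b v) x" for v :: "nat \<Rightarrow> z9" by (simp only: ev.simps ext_lin)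
  then show ?case using t u
    by (intro exI [of _ "t - u"]) (simp add: additive_map_simps [OF additive_pr] additive_map_simps [OF additive_ext] del: ev.simps)
next
  case (Comp a b)
  obtain t where t: "pr m t = t" "\<forall>v :: nat \<Rightarrow> z9. supp v \<longrightarrow> ext v t = ext (ev a v) x" using Comp.IH(1) [OF Comp.prems] by blast
  obtain u where u: "pr m u = u" "\<forall>v :: nat \<Rightarrow> z9. supp v \<longrightarrow> ext v u = ext (ev b v) t" using Comp.IH(2) [OF t(1)] by blast
  have "ext v u = ext (ev (Comp a b) v) x" if "supp v" for v :: "nat \<Rightarrow> z9"
    using u(2) [rule_format, OF that] t(2) [rule_format, OF supp_ev [OF that, of b]] by (simp only: ev.simps)
  then show ?case using u(1) by (intro exI [of _ u] conjI allI impI)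
qed

lemma K_K: assumes "supp (v :: nat \<Rightarrow> z9)" shows "ev Kop (ev Kop v) = sc 4 (ev Kop v)"
proof -
  have "tv.ka (a *\<^sub>R v) = a *\<^sub>R tv.ka v" for a v by (simp add: tv.ka_def p_scale scaleR_right_diff_distrib scaleR_sum_right)
  then have "ev Kop (ev Kop v) = ev (dbl (dbl Kop)) v"
    using transfer [of "Comp Kop Kop" "dbl (dbl Kop)", OF _ assms]
    by (simp add: dbl_def K_real tv.ka_W0 scaleR_left_distrib [symmetric])
  then show ?thesis by (simp add: dbl_def sc_simps fun_eq_iff fun_simps)
qed

text \<open>A vector of \<open>W0\<close> that is nonzero modulo 3 gives a functional invariant
  under \<open>s\<close> and \<open>d\<close>, and the transpose of \<open>Kop\<close> at a
  coordinate word gives a word whose class is invariant.\<close>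

lemma no_fixed_vectors:
  assumes m: "m \<ge> 2" and v: "inF 0 v" "sc 3 v \<noteq> 0" and w: "supp w"
  shows "sc 3 (ev Kop w) = 0"
proof (rule ccontr)
  assume "sc 3 (ev Kop w) \<noteq> 0"
  then obtain i where i: "3 * ev Kop w i \<noteq> 0" by (auto simp: fun_eq_iff fun_simps sc_simps)
  then have im: "i < m" using supp_ev [OF w, of Kop] by (intro ccontr [of "i < m"]) (simp add: supp_def)
  obtain z where z: "ev Kop w i * z = 1" using z9_unit(2) [OF i] by blast
  \<comment> \<open>Applying \<open>Kop\<close> twice multiplies by 4, so the factor 7 and the
    inverse \<open>z\<close> of a coordinate normalize the value at \<open>t\<close> to 1.\<close>
  define w' where "w' = sc (7 * z) w"
  have w': "supp w'" by (simp add: w'_def supp_sc w)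
  obtain t where t: "pr m t = t" "\<And>u :: nat \<Rightarrow> z9. supp u \<Longrightarrow> ext u t = ev Kop u i"
    using dual_word [of "gen i" Kop] im by auto
  obtain Z Z' where "commuting_lift TYPE(z9) m s d Z Z'" using commuting_lift_exists [OF m] by blast
  then interpret cl: commuting_lift m s d Z Z' "TYPE(z9)" .
  have "cl.is_odd (ext v)"
    using v inF_0_odd [OF v(1)] by (simp add: cl.is_odd_def vec_fn inF_def ext_d ext_lin)
  moreover obtain y where "3 * cl.dif (ext v) y ^ 2 = 3" using inF_0_unit [OF v] by (auto simp: cl.dif_def)
  moreover have sK: "supp (ev Kop w')" by (rule supp_ev [OF w'])
  moreover have "ext (ev Kop w') (d x) = ext (ev Kop w') x" "ext (ev Kop w') (s x) = ext (ev Kop w') x" for x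
    by (simp_all add: ext_d ext_s sK K_dlv K_pev w')
  moreover have "ext (ev Kop w') t = 1"
  proof -
    have "ext (ev Kop w') t = 28 * (z * ev Kop w i)" unfolding t(2) [OF sK] K_K [OF w'] by (simp add: w'_def ev_sc sc_simps)
    then show ?thesis using z by (simp add: mult.commute)
  qed
  moreover have "g (s t) = g t" "g (d t) = g t" if g: "fn m g" for g :: "fg \<Rightarrow> z9"
  proof -
    obtain u where u: "supp u" "g = ext u" using fn_vec [OF g] by blast
    show "g (s t) = g t" "g (d t) = g t"
      by (simp_all add: u ext_s ext_d t(2) supp_act K_pev K_dlv)
  qed
  ultimately have "(3::z9) = 0" by (intro cl.no_fixed_part [OF _ _ vec_fn _ _ t(1)])
  then show False using z9_3 by simp
qed

text \<open>Multiplication by 3 has the multiples of 3 as its kernel, so this set is a copy of the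
  reduction modulo 3 of the \<open>i\<close>-th part. Ranks can then be compared by
  counting.\<close>

definition triples :: "nat \<Rightarrow> (nat \<Rightarrow> z9) set" where "triples i = sc 3 ` {v. inF i v}"

lemma tau_inF:
  assumes j: "j < n" "j \<noteq> 0"
  shows "bij_betw (act (tau 0 j)) (triples 0) (triples j)"
proof -
  let ?t = "act (tau 0 j) :: (nat \<Rightarrow> z9) \<Rightarrow> _"
  have jj: "0 < n" "j < n" "0 \<noteq> j" using j by auto
  have F: "Fv j (?t v) = ?t (Fv 0 v)" if "supp v" for v
    by (simp add: Fv_def act_sc G_tau(1) [OF that jj])
  have t4: "?t (?t (?t (?t v))) = v" if "supp v" for v by (rule G_tau(2) [OF that jj])
  have inj: "u = v" if "supp u" "supp v" "?t u = ?t v" for u v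
  proof -
    have "u = ?t (?t (?t (?t u)))" by (rule t4 [OF that(1), symmetric])
    also have "\<dots> = v" unfolding that(3) by (rule t4 [OF that(2)])
    finally show ?thesis .
  qed
  have s: "supp v" if v: "v \<in> triples i" for v i
  proof -
    obtain w where w: "inF i w" "v = sc 3 w" using v unfolding triples_def by (elim imageE CollectE) (rule that)
    show ?thesis unfolding w(2) by (rule supp_sc [OF conjunct1 [OF w(1) [unfolded inF_def]]])
  qed
  show ?thesis
  proof (rule bij_betw_imageI)
    show "inj_on ?t (triples 0)"
    proof (rule inj_onI)
      fix u v assume uv: "u \<in> triples 0" "v \<in> triples 0" "?t u = ?t v"
      show "u = v" by (rule inj [OF s [OF uv(1)] s [OF uv(2)] uv(3)])
    qed
    have a: "?t (sc 3 v) \<in> triples j" if "inF 0 v" for v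
    proof -
      have v: "supp v" "Fv 0 v = v" using that by (simp_all add: inF_def)
      have "inF j (?t v)" unfolding inF_def F [OF v(1)] v(2) by (intro conjI supp_act v(1) refl)
      then show ?thesis unfolding triples_def act_sc by (intro imageI CollectI)
    qed
    have b: "sc 3 w \<in> ?t ` triples 0" if w: "inF j w" for w
    proof -
      let ?v = "?t (?t (?t w))"
      have sw: "supp w" by (rule conjunct1 [OF w [unfolded inF_def]])
      have sv: "supp ?v" by (intro supp_act sw)
      have "?t (Fv 0 ?v) = Fv j (?t ?v)" by (rule F [OF sv, symmetric])
      also have "\<dots> = Fv j w" by (rule arg_cong [OF t4 [OF sw]])
      also have "\<dots> = w" by (rule conjunct2 [OF w [unfolded inF_def]])
      also have "\<dots> = ?t ?v" by (rule t4 [OF sw, symmetric])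
      finally have "Fv 0 ?v = ?v" by (rule inj [OF supp_Fv [OF sv] sv])
      then have "inF 0 ?v" unfolding inF_def by (intro conjI sv)
      then have mem: "sc 3 ?v \<in> triples 0" unfolding triples_def by (intro imageI CollectI)
      have "sc 3 w = sc 3 (?t ?v)" by (rule arg_cong [OF t4 [OF sw, symmetric]])
      then have "sc 3 w = ?t (sc 3 ?v)" unfolding act_sc .
      then show ?thesis by (rule image_eqI [where f = ?t, OF _ mem])
    qed
    show "?t ` triples 0 = triples j"
    proof (rule equalityI)
      show "?t ` triples 0 \<subseteq> triples j"
      proof (rule image_subsetI)
        fix x assume "x \<in> triples 0"
        then obtain v where v: "inF 0 v" "x = sc 3 v" unfolding triples_def by (elim imageE CollectE) (rule that)
        show "?t x \<in> triples j" unfolding v(2) by (rule a [OF v(1)])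
      qed
      show "triples j \<subseteq> ?t ` triples 0"
        unfolding triples_def [of j] by (rule image_subsetI) (elim CollectE, rule b)
    qed
  qed
qed

lemma supp_sum_z9: "(\<And>i. i \<in> I \<Longrightarrow> supp (f i)) \<Longrightarrow> supp (\<Sum>i\<in>I. f i :: nat \<Rightarrow> z9)"
  by (simp add: supp_def sum_fun_apply)

lemma sc_sum: "sc c (\<Sum>i\<in>I. f i) = (\<Sum>i\<in>I. sc c (f i))"
  by (simp add: fun_eq_iff sc_simps sum_fun_apply sum_distrib_left)

lemma Fv_sum_lin: "Fv j (\<Sum>i\<in>I. f i) = (\<Sum>i\<in>I. Fv j (f i))"
  by (simp add: Fv_def ev_sum sc_sum)

text \<open>Both counts concern the multiples by 3 of all vectors modulo 9: by coordinates there are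
  3^m, and by components 3^n, since the part \<open>W0\<close> contributes nothing and each of the
  \<open>n\<close> parts contributes exactly three elements.\<close>

lemma rank_eq:
  assumes m: "m \<ge> 2" and v: "inF 0 v" "sc 3 v \<noteq> 0"
  shows "m = n"
proof -
  let ?S = "sc 3 ` {w. supp w}"
  have c0: "card (triples 0) = 3"
  proof -
    have "sc 3 w \<in> {0, sc 3 v, - sc 3 v}" if "inF 0 w" for w
      using dimension_le_1 [OF m v that] by auto
    then have sub: "triples 0 \<subseteq> {0, sc 3 v, - sc 3 v}" unfolding triples_def by (intro image_subsetI) simp
    have z: "inF 0 0" using inF_closed(3) [OF v(1), of 0] by (simp add: sc_simps)
    have v': "inF 0 (- v)" using inF_closed(2) [OF z v(1)] by simp
    have "0 \<in> triples 0" unfolding triples_def by (rule image_eqI [of _ _ 0]) (simp_all add: sc_simps z)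
    moreover have "sc 3 v \<in> triples 0" unfolding triples_def by (intro imageI CollectI v(1))
    moreover have "- sc 3 v \<in> triples 0" unfolding triples_def sc_simps(5) [symmetric] by (intro imageI CollectI v')
    ultimately have eq: "triples 0 = {0, sc 3 v, - sc 3 v}" by (intro equalityI [OF sub]) (simp only: insert_subset empty_subsetI simp_thms)
    have "sc 3 v \<noteq> - sc 3 v"
    proof
      assume "sc 3 v = - sc 3 v"
      then have "sc 3 v + sc 3 v = 0" by (simp only: eq_neg_iff_add_eq_0)
      then have "sc 6 v = 0" unfolding sc_simps(9) [symmetric] by simp
      then have "sc 5 (sc 6 v) = 0" by (simp only: sc_simps)
      then have "sc (5 * 6) v = 0" by (simp only: sc_simps)
      moreover have "(5 * 6::z9) = 3" by simp
      ultimately show False using v(2) by (simp only:)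
    qed
    then show ?thesis unfolding eq using v(2) not_sym [OF v(2)] by (subst card_insert_disjoint; simp)+
  qed
  have ci: "card (triples i) = 3" if "i < n" for i
    using bij_betw_same_card [OF tau_inF [OF that]] c0 by (cases "i = 0") auto
  have img: "(\<lambda>f. \<Sum>i<n. f i) ` PiE {..<n} triples = ?S"
  proof
    show "(\<lambda>f. \<Sum>i<n. f i) ` PiE {..<n} triples \<subseteq> ?S"
    proof (rule image_subsetI)
      fix f assume "f \<in> PiE {..<n} triples"
      then have "\<forall>i\<in>{..<n}. \<exists>w. inF i w \<and> f i = sc 3 w" by (auto simp: PiE_def Pi_def triples_def)
      from bchoice [OF this] obtain w where w: "\<And>i. i < n \<Longrightarrow> inF i (w i) \<and> f i = sc 3 (w i)" by auto
      then have "(\<Sum>i<n. f i) = sc 3 (\<Sum>i<n. w i)" by (simp add: sc_sum)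
      moreover have "supp (\<Sum>i<n. w i)" by (rule supp_sum_z9) (use w in \<open>simp add: inF_def\<close>)
      ultimately show "(\<Sum>i<n. f i) \<in> ?S" by (intro image_eqI CollectI)
    qed
    show "?S \<subseteq> (\<lambda>f. \<Sum>i<n. f i) ` PiE {..<n} triples"
    proof (rule image_subsetI)
      fix w :: "nat \<Rightarrow> z9" assume "w \<in> {w. supp w}"
      then have w: "supp w" by simp
      have "sc 3 w = sc 7 (sc 3 (ev Kop w)) + (\<Sum>i<n. sc 3 (Fv i w))"
        using arg_cong [OF Fv_sum [of w], of "sc 3"] by (simp add: sc_sum sc_simps)
      also have "\<dots> = (\<Sum>i<n. restrict (\<lambda>i. sc 3 (Fv i w)) {..<n} i)" by (simp add: no_fixed_vectors [OF m v w] sc_simps)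
      finally have "sc 3 w = (\<Sum>i<n. restrict (\<lambda>i. sc 3 (Fv i w)) {..<n} i)" .
      moreover have "restrict (\<lambda>i. sc 3 (Fv i w)) {..<n} \<in> PiE {..<n} triples"
        using w Fv_Fv(1) [OF w] by (auto simp: triples_def inF_def supp_Fv)
      ultimately show "sc 3 w \<in> (\<lambda>f. \<Sum>i<n. f i) ` PiE {..<n} triples" by (rule image_eqI)
    qed
  qed
  have comp: "Fv j (\<Sum>i<n. f i) = f j" if f: "f \<in> PiE {..<n} triples" and j: "j < n" for f j
  proof -
    have fi: "supp (f i)" "Fv i (f i) = f i" if "i < n" for i
      using f that by (auto simp: PiE_def Pi_def triples_def inF_def supp_sc Fv_lin)
    have "Fv j (f i) = (if i = j then f j else 0)" if "i < n" for i
      using fi [OF that] Fv_Fv(2) [OF fi(1) [OF that] j that] by (cases "i = j") auto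
    then have "(\<Sum>i<n. Fv j (f i)) = (\<Sum>i<n. if i = j then f j else 0)" by (intro sum.cong) auto
    then show ?thesis using j by (simp add: Fv_sum_lin)
  qed
  have "inj_on (\<lambda>f. \<Sum>i<n. f i) (PiE {..<n} triples)"
  proof (rule inj_onI)
    fix f g assume fg: "f \<in> PiE {..<n} triples" "g \<in> PiE {..<n} triples" "(\<Sum>i<n. f i) = (\<Sum>i<n. g i)"
    show "f = g"
    proof (rule PiE_ext [OF fg(1,2)])
      fix j assume "j \<in> {..<n}"
      then show "f j = g j" using comp [OF fg(1), of j] comp [OF fg(2), of j] fg(3) by simp
    qed
  qed
  then have "card ?S = card (PiE {..<n} triples)" unfolding img [symmetric] by (rule card_image)
  also have "\<dots> = 3 ^ n" by (simp add: card_PiE ci)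
  finally have S1: "card ?S = 3 ^ n" .
  let ?R = "range (\<lambda>x::z9. 3 * x)"
  have "bij_betw (\<lambda>f k. if k < m then f k else 0) (PiE {..<m} (\<lambda>_. ?R)) ?S"
  proof (rule bij_betw_imageI)
    show "inj_on (\<lambda>f k. if k < m then f k else 0) (PiE {..<m} (\<lambda>_. ?R))"
    proof (rule inj_onI)
      fix f g :: "nat \<Rightarrow> z9"
      assume fg: "f \<in> PiE {..<m} (\<lambda>_. ?R)" "g \<in> PiE {..<m} (\<lambda>_. ?R)"
        "(\<lambda>k. if k < m then f k else 0) = (\<lambda>k. if k < m then g k else 0)"
      show "f = g"
      proof (rule PiE_ext [OF fg(1,2)])
        fix j assume "j \<in> {..<m}"
        then show "f j = g j" using fun_cong [OF fg(3), of j] by simp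
      qed
    qed
    show "(\<lambda>f k. if k < m then f k else 0) ` PiE {..<m} (\<lambda>_. ?R) = ?S"
    proof (intro equalityI image_subsetI)
      fix f :: "nat \<Rightarrow> z9" assume "f \<in> PiE {..<m} (\<lambda>_. ?R)"
      then have "\<forall>k\<in>{..<m}. \<exists>x. f k = 3 * x" by (auto simp: PiE_def Pi_def)
      from bchoice [OF this] obtain x where x: "\<And>k. k < m \<Longrightarrow> f k = 3 * x k" by auto
      have "(\<lambda>k. if k < m then f k else 0) = sc 3 (\<lambda>k. if k < m then x k else 0)" by (auto simp: x sc_simps fun_eq_iff)
      moreover have "supp (\<lambda>k. if k < m then x k else 0)" by (simp add: supp_def)
      ultimately show "(\<lambda>k. if k < m then f k else 0) \<in> ?S" by (intro image_eqI CollectI)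
    next
      fix w assume "w \<in> {w :: nat \<Rightarrow> z9. supp w}"
      then have "sc 3 w = (\<lambda>k. if k < m then restrict (\<lambda>k. 3 * w k) {..<m} k else 0)"
        by (auto simp: fun_eq_iff sc_simps supp_def)
      moreover have "restrict (\<lambda>k. 3 * w k) {..<m} \<in> PiE {..<m} (\<lambda>_. ?R)" by auto
      ultimately show "sc 3 w \<in> (\<lambda>f k. if k < m then f k else 0) ` PiE {..<m} (\<lambda>_. ?R)" by (rule image_eqI)
    qed
  qed
  then have "card ?S = card (PiE {..<m} (\<lambda>_. ?R))" by (rule bij_betw_same_card [symmetric])
  also have "\<dots> = 3 ^ m" by (simp add: card_PiE z9_range)
  finally show ?thesis using S1 by simp
qed

section \<open>Triviality of the transvections\<close>

lemma om_outside: "k \<ge> m \<Longrightarrow> om v k = v k"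
  by (simp add: om_def om3_def fun_simps e_rr_outside)

text \<open>Rotations carry a nonzero vector of \<open>W 0\<close> into each \<open>W i\<close>,
  giving \<open>n\<close> independent vectors in a space of smaller dimension.\<close>

lemma p0_few: assumes "m < n" shows "tv.p 0 v = 0"
proof (rule ccontr)
  assume v: "tv.p 0 v \<noteq> 0"
  define w where "w i = (if i = 0 then tv.p 0 v else tv.th 0 i (tv.p 0 v))" for i
  have W0: "tv.W 0 (tv.p 0 v)" by (rule tv.p_W) (use index_bounds(1) in simp)
  have ix: "tv.ix [0, i]" if "i < n" "i \<noteq> 0" for i using that by simp
  have W: "tv.W i (w i)" if "i < n" for i
    using W0 tv.th_W(2) [OF ix [OF that] W0] by (simp add: w_def)
  have nz: "w i \<noteq> 0" if "i < n" for i
  proof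
    assume w0: "w i = 0"
    show False
    proof (cases "i = 0")
      case False
      then have "tv.th 0 i 0 = - tv.p 0 v" using w0 tv.th_W(3) [OF ix [OF that False] W0] by (simp add: w_def)
      then show False using v tv.th_lin(4) [OF ix [OF that False]] by simp
    qed (use w0 v in \<open>simp add: w_def\<close>)
  qed
  have "card {..<n} \<le> m"
  proof (rule sign_independent [where A = "{..<n}" and L = ee and \<chi> = "\<lambda>i x. x = i" and v = w])
    show "linear (ee x)" for x by (rule linearI) (simp_all only: ee_lin)
    show "w i k = 0" if "i \<in> {..<n}" "k \<ge> m" for i k
    proof -
      have "ee i (w i) k = w i k" using that(2) by (simp add: ee_def om_outside e_rr_outside)
      then show ?thesis using W [of i] that(1) by (simp add: tv.W_def fun_simps)
    qed
    show "ee x (w i) = (if x = i then - w i else w i)" if "i \<in> {..<n}" "x \<in> {..<n}" for i x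
      using tv.W_other [OF W, of i x] W [of i] that by (auto simp: tv.W_def)
  qed (use nz in auto)
  then show False using assms by simp
qed

text \<open>As \<open>Gop 0\<close> is 4 times a projection, its square is 4 times itself. Applying
  it to a quotient of \<open>ev (Gop 0) v\<close> by a power of 3 gains a further factor 3, since 4
  is prime to 3; so the values are divisible by all powers of 3.\<close>

lemma int_descent:
  assumes three: "\<And>v :: nat \<Rightarrow> int. supp v \<Longrightarrow> (\<forall>k. 3 dvd ev (Gop 0) v k)" and v: "supp (v :: nat \<Rightarrow> int)"
  shows "ev (Gop 0) v = 0"
proof -
  have "\<forall>k. (3::int) ^ t dvd ev (Gop 0) v k" if "supp v" for t and v :: "nat \<Rightarrow> int"
    using that
  proof (induction t)
    case (Suc t)
    define u where "u k = ev (Gop 0) v k div 3 ^ t" for k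
    have eq: "ev (Gop 0) v = (\<lambda>z. 3 ^ t * z) \<circ> u" using Suc by (auto simp: u_def fun_eq_iff)
    have su: "supp u" using supp_ev [OF Suc.prems, of "Gop 0"] by (simp add: supp_def u_def)
    have "ev (dbl (dbl (Gop 0))) v = (\<lambda>z. 3 ^ t * z) \<circ> ev (Gop 0) u"
      unfolding G_G [OF Suc.prems index_bounds(1), symmetric] unfolding eq by (rule ev_map) (simp add: additive_map_def algebra_simps)
    then have 4: "4 * ev (Gop 0) v k = 3 ^ t * ev (Gop 0) u k" for k by (simp add: dbl_def fun_eq_iff fun_simps)
    show ?case
    proof
      fix k
      have "3 ^ t * 3 dvd 3 ^ t * ev (Gop 0) u k" by (rule mult_dvd_mono [OF dvd_refl]) (use three [OF su] in blast)
      then have "3 ^ Suc t dvd 4 * ev (Gop 0) v k" by (simp only: 4 power_Suc2)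
      moreover have "coprime (3 ^ Suc t :: int) 4"
      proof -
        have "coprime (3::int) 4" using coprime_add_one_right [of "3::int"] by simp
        then show ?thesis by (simp only: coprime_power_left_iff) simp
      qed
      ultimately show "3 ^ Suc t dvd ev (Gop 0) v k" by (simp only: coprime_dvd_mult_right_iff)
    qed
  qed simp
  note div = this [OF v]
  show ?thesis
  proof
    fix k
    have "ev (Gop 0) v k = 0"
    proof (rule ccontr)
      assume nz: "ev (Gop 0) v k \<noteq> 0"
      \<comment> \<open>A power 3^t exceeds t, so the absolute value itself serves as an impossible
        exponent.\<close>
      let ?t = "nat \<bar>ev (Gop 0) v k\<bar>"
      have "3 ^ ?t \<le> \<bar>ev (Gop 0) v k\<bar>" using dvd_imp_le_int [OF nz spec [OF div [of ?t], of k]] by simp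
      moreover have "?t < 3 ^ ?t" by (rule less_exp [THEN less_le_trans]) (simp add: power_mono)
      then have "int ?t < int (3 ^ ?t)" by (simp only: of_nat_less_iff)
      then have "\<bar>ev (Gop 0) v k\<bar> < 3 ^ ?t" by simp
      ultimately show False by simp
    qed
    then show "ev (Gop 0) v k = 0 k" by (simp add: zero_fun_def)
  qed
qed

text \<open>For m > n the projection vanishes modulo 3 on all integral vectors by
  \<open>rank_eq\<close>. The descent makes it vanish on integral vectors and, by combination of
  unit vectors, over the reals.\<close>

lemma p0_zero:
  assumes "m \<noteq> n" and v: "supp (v :: nat \<Rightarrow> real)"
  shows "tv.p 0 v = 0"
proof (cases "m < n")
  case False
  have m: "m \<ge> 2" using False n6 by simp
  have z: "sc 3 (Fv 0 w) = 0" if w: "supp w" for w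
  proof (rule ccontr)
    assume "sc 3 (Fv 0 w) \<noteq> 0"
    moreover have "inF 0 (Fv 0 w)" unfolding inF_def using w by (intro conjI supp_Fv Fv_Fv index_bounds)
    ultimately show False using rank_eq [OF m] assms(1) by blast
  qed
  have "3 dvd ev (Gop 0) w k" if w: "supp w" for w :: "nat \<Rightarrow> int" and k
  proof (rule z9_of_int)
    let ?w = "of_int \<circ> w :: nat \<Rightarrow> z9"
    have h: "additive_map (of_int :: int \<Rightarrow> z9)" by (simp add: additive_map_def)
    have "supp ?w" using w by (simp add: supp_def)
    from z [OF this] have "sc 4 (sc 3 (sc 7 (of_int \<circ> ev (Gop 0) w))) k = 0"
      unfolding Fv_def ev_map [OF h] by (simp add: sc_simps fun_simps)
    then have "(84::z9) * of_int (ev (Gop 0) w k) = 0" by (simp add: sc_simps mult.assoc [symmetric])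
    moreover have "(84::z9) = 3" by simp
    ultimately show "3 * (of_int (ev (Gop 0) w k) :: z9) = 0" by (simp only:)
  qed
  then have int: "ev (Gop 0) w = 0" if "supp w" for w :: "nat \<Rightarrow> int" by (intro int_descent that) blast
  have h: "additive_map (\<lambda>z. of_int z * v i)" for i by (simp add: additive_map_def algebra_simps)
  have "ev (Gop 0) (\<Sum>i<m. (\<lambda>z. of_int z * v i) \<circ> unit i) = 0"
    unfolding ev_sum ev_map [OF h]
  proof (rule sum.neutral, rule ballI)
    fix i assume "i \<in> {..<m}"
    then have "ev (Gop 0) (unit i) = 0" by (intro int) (simp add: supp_def unit_def)
    then show "(\<lambda>z. of_int z * v i) \<circ> ev (Gop 0) (unit i) = 0" by (simp add: fun_eq_iff fun_simps)
  qed
  then have "ev (Gop 0) v = 0" by (simp only: supp_sum [OF v, symmetric])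
  then show ?thesis by (simp add: G_real)
qed (rule p0_few)

text \<open>All projections are conjugate to the one of index 0 by rotations, so every vector lies
  in \<open>W0\<close>.\<close>

lemma rr_trivial:
  assumes "m \<noteq> n" and v: "supp (v :: nat \<Rightarrow> real)" and ij: "i < n" "j < n" "i \<noteq> j"
  shows "rr i j v = v"
proof -
  have "tv.p k v = 0" if "k < n" for k
  proof (cases "k = 0")
    case False
    then have ix: "tv.ix [0, k]" using that by simp
    let ?t = "tv.th 0 k"
    have t: "?t u = act (tau 0 k) u" for u using tau_real [of 0 k u] False that by simp
    have "tv.p 0 (?t (?t (?t v))) = 0" unfolding t by (intro p0_zero assms(1) supp_act v)
    then have "tv.p k (?t (?t (?t (?t v)))) = 0" unfolding tv.p_th(1) [OF ix] by (simp only: tv.th_lin(4) [OF ix])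
    then show ?thesis unfolding tv.p_th(2) [OF ix] .
  qed (use p0_zero [OF assms(1) v] in simp)
  then have "tv.ka v = v" by (simp add: tv.ka_def)
  then show ?thesis using tv.R_W0 [of i j v] tv.ka_W0(2) [of v] ij by simp
qed

lemma near_1:
  assumes "m \<noteq> n" and ij: "i < n" "j < n" "i \<noteq> j"
  shows "near m 1 (lift (rho n i j))"
  unfolding near_def deep_def
proof (intro allI impI)
  fix k w assume k: "k < m" and w: "length (w :: nat list) < Suc 1"
  let ?f = "lift (rho n i j)"
  have aut: "aut n (rho n i j)" using ij by simp
  have cf: "cf (mu x) [l] = ext (unit l) x" for x l
  proof -
    have "(\<lambda>x. cf (mu x) [l]) = ext (unit l)"
      by (rule additive_map_eqI) (auto simp: additive_map_def cf_mu_singleton_add mu_gen cf_one cf_X unit_def additive_ext [unfolded additive_map_def])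
    then show ?thesis by (simp add: fun_eq_iff)
  qed
  have real: "real_of_int (ext u x) = ext (real_of_int \<circ> u) x" for u x by (rule ext_map [symmetric]) (simp add: additive_map_def)
  have "ext (unit l) (?f (gen k)) = unit l k" for l
  proof (cases "l < m")
    case True
    then have "supp (real_of_int \<circ> unit l)" by (simp add: supp_def unit_def)
    from fun_cong [OF rr_trivial [OF assms(1) this ij], of k] k
    have "real_of_int (ext (unit l) (?f (gen k))) = real_of_int (unit l k)" by (simp add: rr_def act_def real)
    then show ?thesis by simp
  next
    case False
    have "ext (unit l) \<circ> pr m = (\<lambda>_. 0)"
      by (rule additive_map_eqI)
         (use False additive_map_zero [OF additive_ext, of "unit l"] in \<open>auto simp: unit_def additive_map_def additive_map_simps [OF additive_pr] additive_map_simps [OF additive_ext]\<close>)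
    moreover have "pr m (?f (gen k)) = ?f (gen k)" using aut_endo [OF lift(1) [OF aut]] by (simp add: endo_def)
    ultimately have "ext (unit l) (?f (gen k)) = 0" by (metis comp_apply)
    then show ?thesis using False k by (simp add: unit_def)
  qed
  moreover have "w = [] \<or> (\<exists>l. w = [l])" using w by (cases w) auto
  ultimately show "cf (mu (?f (gen k)) - mu (gen k)) w = 0" by (auto simp: cf cf_simps unit_def mu_gen cf_one cf_X split: if_splits)
qed

lemma commutator_inv:
  assumes "group G" "a \<in> carrier G" "b \<in> carrier G" "c \<in> carrier G" "b \<otimes>\<^bsub>G\<^esub> a = a \<otimes>\<^bsub>G\<^esub> b \<otimes>\<^bsub>G\<^esub> c"
  shows "inv\<^bsub>G\<^esub> c = inv\<^bsub>G\<^esub> a \<otimes>\<^bsub>G\<^esub> inv\<^bsub>G\<^esub> b \<otimes>\<^bsub>G\<^esub> a \<otimes>\<^bsub>G\<^esub> b"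
proof -
  interpret group G by fact
  have "c = inv\<^bsub>G\<^esub> (a \<otimes>\<^bsub>G\<^esub> b) \<otimes>\<^bsub>G\<^esub> (b \<otimes>\<^bsub>G\<^esub> a)"
    unfolding assms(5) by (rule inv_cancel_left(1) [OF m_closed [OF assms(2,3)] assms(4), symmetric])
  then show ?thesis using assms(2-4) by (simp add: inv_mult_group m_assoc)
qed

text \<open>Each step expresses the class of a transvection as a commutator of two others, so the
  induction must run over all pairs of indices. The representative \<open>a\<close> may differ from
  the chosen lift by an inner automorphism that changes with \<open>k\<close>.\<close>

lemma near_all:
  assumes "m \<noteq> n" "i < n" "j < n" "i \<noteq> j"
  shows "\<exists>a. aut m a \<and> cls m a = cls m (lift (rho n i j)) \<and> near m (Suc k) a"
  using assms(2-4)
proof (induction k arbitrary: i j)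
  case 0
  then show ?case using near_1 [OF assms(1) 0] lift(1) [of "rho n i j"] by auto
next
  case (Suc k)
  obtain l where l: "l < n" "l \<noteq> i" "l \<noteq> j" using tv.third [of i j] by blast
  have aut: "aut n (rho n i l)" "aut n (rho n l j)" "aut n (rho n i j)" using l Suc.prems by auto
  obtain a b where a: "aut m a" "cls m a = cls m (lift (rho n i l))" "near m (Suc k) a"
    and b: "aut m b" "cls m b = cls m (lift (rho n l j))" "near m (Suc k) b"
    using Suc.IH [of i l] Suc.IH [of l j] l Suc.prems by metis
  obtain a' where a': "endo m a'" "a \<circ> a' = pr m" "a' \<circ> a = pr m" using a(1) by (auto simp: aut_def)
  obtain b' where b': "endo m b'" "b \<circ> b' = pr m" "b' \<circ> b = pr m" using b(1) by (auto simp: aut_def)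
  have auts: "aut m a'" "aut m b'" using autI [OF a'(1) aut_endo [OF a(1)] a'(3,2)] autI [OF b'(1) aut_endo [OF b(1)] b'(3,2)] by auto
  let ?A = "cls m a" and ?B = "cls m b"
  have "near m (Suc (Suc k)) (a \<circ> b \<circ> a' \<circ> b')"
    by (rule near_commutator)
       (use a b a' b' near_inverse [OF aut_endo [OF a(1)] a'(1,3) a(3)] near_inverse [OF aut_endo [OF b(1)] b'(1,3) b(3)] aut_endo in auto)
  moreover have aut4: "aut m (a \<circ> b \<circ> a' \<circ> b')" by (intro aut_comp a(1) b(1) auts)
  moreover have "cls m (a \<circ> b \<circ> a' \<circ> b') = cls m (lift (rho n i j))"
  proof -
    have c: "\<phi> (cls n (rho n i l)) \<in> carrier (Out (F m))" "\<phi> (cls n (rho n l j)) \<in> carrier (Out (F m))" "\<phi> (cls n (rho n i j)) \<in> carrier (Out (F m))"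
      by (intro h.hom_closed cls_in_Out aut)+
    have A: "?A \<in> carrier (Out (F m))" "?B \<in> carrier (Out (F m))" by (intro cls_in_Out a b)+
    have inv: "cls m a' = inv\<^bsub>Out (F m)\<^esub> ?A" "cls m b' = inv\<^bsub>Out (F m)\<^esub> ?B"
      using a'(3) b'(3) by (intro M.inv_equality [symmetric]; simp add: cls_mult [symmetric] a(1) b(1) auts cls_one cls_in_Out)+
    have "rho n l j \<circ> rho n i l = rho n i l \<circ> rho n l j \<circ> rho n i j"
      by (rule endo_eqI [of n]) (use l Suc.prems in \<open>auto intro!: endo_comp simp: group_norm simp del: add_uminus_conv_diff\<close>)
    from arg_cong [OF this, of "\<lambda>f. \<phi> (cls n f)"]
    have rel: "\<phi> (cls n (rho n l j)) \<otimes>\<^bsub>Out (F m)\<^esub> \<phi> (cls n (rho n i l))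
        = \<phi> (cls n (rho n i l)) \<otimes>\<^bsub>Out (F m)\<^esub> \<phi> (cls n (rho n l j)) \<otimes>\<^bsub>Out (F m)\<^esub> \<phi> (cls n (rho n i j))"
      by (simp add: cls_mult aut aut_comp cls_in_Out)
    have "cls m (lift (rho n i j)) = inv\<^bsub>Out (F m)\<^esub> \<phi> (cls n (rho n i j))" by (rule lift(2) [OF aut(3)])
    also have "\<dots> = ?A \<otimes>\<^bsub>Out (F m)\<^esub> ?B \<otimes>\<^bsub>Out (F m)\<^esub> inv\<^bsub>Out (F m)\<^esub> ?A \<otimes>\<^bsub>Out (F m)\<^esub> inv\<^bsub>Out (F m)\<^esub> ?B"
      unfolding commutator_inv [OF M.is_group c(1,2,3) rel] a(2) b(2) lift(2) [OF aut(1)] lift(2) [OF aut(2)] using c by simp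
    also have "\<dots> = cls m (a \<circ> b \<circ> a' \<circ> b')" by (simp add: cls_mult a(1) b(1) auts aut_comp inv)
    finally show ?thesis by simp
  qed
  ultimately show ?case by (intro exI [of _ "a \<circ> b \<circ> a' \<circ> b'"] conjI)
qed

lemma phi_rho:
  assumes "m \<noteq> n" and ij: "i < n" "j < n" "i \<noteq> j"
  shows "\<phi> (cls n (rho n i j)) = \<one>\<^bsub>Out (F m)\<^esub>"
proof -
  let ?b = "lift (rho n i j)"
  have aut: "aut n (rho n i j)" using ij by simp
  have b: "aut m ?b" by (rule lift(1) [OF aut])
  have "\<exists>u. \<forall>l<m. deep (Suc k) (mu (?b (gen l)) - mu (u + gen l - u))" for k
  proof -
    obtain a where a: "aut m a" "cls m ?b = cls m a" "near m (Suc k) a" using near_all [OF assms, of k] by metis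
    then obtain u where u: "a = inn u ?b" using cls_eq_iff [OF b a(1)] by auto
    have "deep (Suc k) (mu (?b (gen l)) - mu (- u + gen l - - u))" if "l < m" for l
    proof -
      have "mu (?b (gen l)) - mu (- u + gen l - - u) = mu (- u) * (mu (a (gen l)) - mu (gen l)) * mu u"
      proof -
        have "?b (gen l) = - u + a (gen l) - - u" by (simp add: u inn_def group_norm del: add_uminus_conv_diff)
        then show ?thesis by (simp only: mu_conj minus_minus right_diff_distrib left_diff_distrib)
      qed
      moreover have "deep (Suc k) (mu (a (gen l)) - mu (gen l))" using a(3) that by (auto simp: near_def intro: deep_mono)
      ultimately show ?thesis by (simp add: deep_mult_left deep_mult_right)
    qed
    then show ?thesis by blast
  qed
  then obtain h where h: "pr m h = h" "?b = inn h (pr m)" using inner_of_near [OF b] by blast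
  then have "cls m (pr m) = cls m ?b" using cls_eq_iff [OF aut_pr b] by blast
  then have "inv\<^bsub>Out (F m)\<^esub> \<phi> (cls n (rho n i j)) = \<one>\<^bsub>Out (F m)\<^esub>" by (simp only: lift(2) [OF aut] cls_one)
  then show ?thesis using M.inv_eq_1_iff [of "\<phi> (cls n (rho n i j))"] cls_in_Out [OF aut] by simp
qed

text \<open>Once the transvections are killed, the rotation written in generators makes the image of
  \<open>swp n i j\<close> equal to that of \<open>eps n j\<close>. As \<open>swp\<close> is
  symmetric in its indices, all inversions have the same image \<open>E\<close>, and Nielsen's
  theorem leaves only 1 and \<open>E\<close>.\<close>

lemma image_two:
  assumes "m \<noteq> n"
  defines "E \<equiv> \<phi> (cls n (eps n 0))"
  shows "E \<otimes>\<^bsub>Out (F m)\<^esub> E = \<one>\<^bsub>Out (F m)\<^esub>" "\<phi> ` carrier (Out (F n)) \<subseteq> {\<one>\<^bsub>Out (F m)\<^esub>, E}"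
proof -
  let ?e = "\<lambda>i. \<phi> (cls n (eps n i))" and ?p = "\<lambda>i j. \<phi> (cls n (swp n i j))"
  have c: "?e i \<in> carrier (Out (F m))" for i by (intro h.hom_closed cls_in_Out) simp
  have mult: "\<phi> (cls n (f \<circ> g)) = \<phi> (cls n f) \<otimes>\<^bsub>Out (F m)\<^esub> \<phi> (cls n g)" if "aut n f" "aut n g" for f g
    using that by (simp add: cls_mult cls_in_Out)
  have one: "\<phi> (cls n (pr n)) = \<one>\<^bsub>Out (F m)\<^esub>" by (simp only: cls_one h.hom_one)
  have sq: "?e i \<otimes>\<^bsub>Out (F m)\<^esub> ?e i = \<one>\<^bsub>Out (F m)\<^esub>" for i
    using mult [of "eps n i" "eps n i"] by (simp add: eps_eps one)
  show "E \<otimes>\<^bsub>Out (F m)\<^esub> E = \<one>\<^bsub>Out (F m)\<^esub>" unfolding E_def by (rule sq)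
  have sq': "?e i \<otimes>\<^bsub>Out (F m)\<^esub> (?e i \<otimes>\<^bsub>Out (F m)\<^esub> x) = x" if "x \<in> carrier (Out (F m))" for i x
    using M.m_assoc [OF c c that, of i i, symmetric] that by (simp add: sq)
  have swp: "?p i j = ?e j" if ij: "i < n" "j < n" "i \<noteq> j" for i j
  proof -
    have auts: "aut n (rho n i j)" "aut n (rho n j i)" "aut n (eps n i)" "aut n (eps n j)" "aut n (swp n i j)" using ij by auto
    \<comment> \<open>When the factors \<open>rho\<close> are dropped, the inversions on the right
      cancel completely.\<close>
    have "swp n i j \<circ> eps n j = eps n i \<circ> (eps n j \<circ> (rho n i j \<circ> (eps n j \<circ> (eps n i \<circ> (eps n j \<circ> (rho n j i \<circ> (eps n j \<circ> rho n i j)))))))"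
      by (rule endo_eqI [of n]) (use ij in \<open>auto intro!: endo_comp simp: group_norm simp del: add_uminus_conv_diff\<close>)
    from arg_cong [OF this, of "\<lambda>f. \<phi> (cls n f)"]
    have pe: "?p i j \<otimes>\<^bsub>Out (F m)\<^esub> ?e j = \<one>\<^bsub>Out (F m)\<^esub>"
      using ij c by (simp add: mult aut_comp auts phi_rho [OF assms(1)] sq sq')
    have p: "?p i j \<in> carrier (Out (F m))" by (intro h.hom_closed cls_in_Out auts)
    have "?p i j = ?p i j \<otimes>\<^bsub>Out (F m)\<^esub> ?e j \<otimes>\<^bsub>Out (F m)\<^esub> ?e j" by (simp only: M.m_assoc [OF p c c] sq M.r_one [OF p])
    also have "\<dots> = ?e j" unfolding pe by (rule M.l_one [OF c])
    finally show ?thesis .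
  qed
  have e0: "?e i = E" if "i < n" for i
  proof (cases "i = 0")
    case False
    have "swp n 0 i = swp n i 0" by (rule endo_eqI [of n]) (use that index_bounds(1) in auto)
    then have "?p 0 i = ?p i 0" by (simp only:)
    moreover have "?p 0 i = ?e i" by (rule swp) (use that False index_bounds(1) in auto)
    moreover have "?p i 0 = ?e 0" by (rule swp) (use that False index_bounds(1) in auto)
    ultimately show ?thesis by (simp only: E_def)
  qed (simp add: E_def)
  have p0: "?p i j \<in> {\<one>\<^bsub>Out (F m)\<^esub>, E}" if "i < n" "j < n" for i j
  proof (cases "i = j")
    case True
    then have "swp n i j = pr n" by (intro endo_eqI [of n]) (use that in \<open>auto simp: endo_pr\<close>)
    then show ?thesis by (simp add: one)
  qed (use swp e0 that in simp)
  have E: "E \<in> carrier (Out (F m))" unfolding E_def by (rule c)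
  have closed: "x \<otimes>\<^bsub>Out (F m)\<^esub> y \<in> {\<one>\<^bsub>Out (F m)\<^esub>, E}" if "x \<in> {\<one>\<^bsub>Out (F m)\<^esub>, E}" "y \<in> {\<one>\<^bsub>Out (F m)\<^esub>, E}" for x y
  proof -
    have "E \<otimes>\<^bsub>Out (F m)\<^esub> E = \<one>\<^bsub>Out (F m)\<^esub>" unfolding E_def by (rule sq)
    then show ?thesis using that E by (elim insertE emptyE) simp_all
  qed
  have all: "aut n f \<and> \<phi> (cls n f) \<in> {\<one>\<^bsub>Out (F m)\<^esub>, E}" if "f \<in> Nie n" for f
    using that
  proof induction
    case Nie_pr
    then show ?case by (simp add: one aut_pr)
  next
    case (Nie_rho f i j)
    have r: "aut n (rho n i j)" using Nie_rho.hyps by simp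
    have "\<phi> (cls n (f \<circ> rho n i j)) \<in> {\<one>\<^bsub>Out (F m)\<^esub>, E}"
      unfolding mult [OF conjunct1 [OF Nie_rho.IH] r] phi_rho [OF assms(1) Nie_rho.hyps(3,4,2)]
      by (rule closed [OF conjunct2 [OF Nie_rho.IH]]) simp
    then show ?case by (intro conjI aut_comp conjunct1 [OF Nie_rho.IH] r)
  next
    case (Nie_eps f i)
    have r: "aut n (eps n i)" by simp
    have "\<phi> (cls n (f \<circ> eps n i)) \<in> {\<one>\<^bsub>Out (F m)\<^esub>, E}"
      unfolding mult [OF conjunct1 [OF Nie_eps.IH] r] e0 [OF Nie_eps.hyps(2)]
      by (rule closed [OF conjunct2 [OF Nie_eps.IH]]) simp
    then show ?case by (intro conjI aut_comp conjunct1 [OF Nie_eps.IH] r)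
  next
    case (Nie_swp f i j)
    have r: "aut n (swp n i j)" using Nie_swp.hyps by simp
    have "\<phi> (cls n (f \<circ> swp n i j)) \<in> {\<one>\<^bsub>Out (F m)\<^esub>, E}"
      unfolding mult [OF conjunct1 [OF Nie_swp.IH] r]
      by (rule closed [OF conjunct2 [OF Nie_swp.IH] p0 [OF Nie_swp.hyps(2,3)]])
    then show ?case by (intro conjI aut_comp conjunct1 [OF Nie_swp.IH] r)
  qed
  show "\<phi> ` carrier (Out (F n)) \<subseteq> {\<one>\<^bsub>Out (F m)\<^esub>, E}"
  proof (rule image_subsetI)
    fix x assume "x \<in> carrier (Out (F n))"
    then obtain f where f: "aut n f" "x = cls n f" using cls_surj by blast
    show "\<phi> x \<in> {\<one>\<^bsub>Out (F m)\<^esub>, E}" unfolding f(2) using all [OF Nielsen [OF f(1)]] by (rule conjunct2)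
  qed
qed

end

section \<open>Conclusion: the subgroup generated by an involution\<close>

lemma (in group) involution_subgroup:
  assumes x: "x \<in> carrier G" "x \<noteq> \<one>" "x \<otimes> x = \<one>"
  shows "subgroup {\<one>, x} G" "G\<lparr>carrier := {\<one>, x}\<rparr> \<cong> integer_mod_group 2"
proof -
  have "inv x = x" using x by (intro inv_equality) auto
  then show "subgroup {\<one>, x} G" using x by (intro subgroupI) auto
  let ?h = "\<lambda>y. if y = \<one> then 0 else 1::int"
  have "?h \<in> iso (G\<lparr>carrier := {\<one>, x}\<rparr>) (integer_mod_group 2)"
  proof (rule isoI)
    show "?h \<in> hom (G\<lparr>carrier := {\<one>, x}\<rparr>) (integer_mod_group 2)"
      using x by (auto intro!: homI simp: integer_mod_group_def)
    have "{0..<2} = {0, 1::int}" by auto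
    then show "bij_betw ?h (carrier (G\<lparr>carrier := {\<one>, x}\<rparr>)) (carrier (integer_mod_group 2))"
      using x(2) by (auto simp: bij_betw_def inj_on_def integer_mod_group_def)
  qed
  then show "G\<lparr>carrier := {\<one>, x}\<rparr> \<cong> integer_mod_group 2" by (auto simp: is_iso_def)
qed

theorem theorem6p8:
  fixes n m :: nat
    and \<phi> :: "(word \<Rightarrow> word) set \<Rightarrow> (word \<Rightarrow> word) set"
  assumes "n \<noteq> m" and "n \<ge> 6" and "m < n choose 2"
    and "\<phi> \<in> hom (Out (free_group n)) (Out (free_group m))"
  shows "\<phi> ` carrier (Out (free_group n)) = {\<one>\<^bsub>Out (free_group m)\<^esub>} \<or>
    (\<exists>H. subgroup H (Out (free_group m)) \<and>
         (Out (free_group m))\<lparr>carrier := H\<rparr> \<cong> integer_mod_group 2 \<and>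
         \<phi> ` carrier (Out (free_group n)) \<subseteq> H)"
proof -
  interpret out_hom n m \<phi>
    using assms by unfold_locales auto
  let ?E = "\<phi> (cls n (eps n 0))"
  note mn = assms(1) [symmetric]
  note im = image_two [OF mn]
  have E: "?E \<in> carrier (Out (F m))" by (intro h.hom_closed cls_in_Out) simp
  have one: "\<one>\<^bsub>Out (F m)\<^esub> \<in> \<phi> ` carrier (Out (F n))" using h.hom_one G.one_closed by force
  show ?thesis
  proof (cases "?E = \<one>\<^bsub>Out (F m)\<^esub>")
    case True
    then show ?thesis using im(2) one by auto
  next
    case False
    show ?thesis using M.involution_subgroup [OF E False im(1)] im(2) by blast
  qed
qed

end
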